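(* The $\mathcal{L}_{RV}^{\dagger}$-theory $\mathrm{ACVF}^{\dagger}$ admits quantifier elimination.
   Context: The language $\mathcal{L}_{RV}$ is two-sorted. The VF-sort carries the ring language $\{0,1,+,-,\times\}$. The RV-sort carries $\{1,\times\}$, constants $0,\infty$, a unary predicate $\mathrm{K}^\times$, a binary function $+:\mathrm{K}^2\to\mathrm{K}$ and a unary function $-:\mathrm{K}\to\mathrm{K}$ where $\mathrm{K}=\mathrm{K}^\times\cup\{0\}$, and a binary relation $\le$; there is a function symbol $\mathrm{rv}$ from VF to RV. Write $\mathrm{RV}$ for the RV-sort without $0$, $\mathrm{RV}^\times=\mathrm{RV}\setminus\{\infty\}$, $\mathrm{RV}_0=\mathrm{RV}\cup\{0\}$. The theory $\mathrm{ACVF}$ states: VF is an algebraically closed field; $(\mathrm{RV}^\times,1,\times)$ is a divisible abelian group (with $t\times0=0$ for $t\in\mathrm K$, $t\times\infty=\infty$ for $t\in\mathrm{RV}_0$); $(\mathrm{K},0,1,+,-,\times)$ is an algebraically closed field; $\le$ is a preorder on RV with top element $\infty$ and $\mathrm{K}^\times$ the class of $1$; $\mathrm{RV}/\mathrm{K}^\times=\Gamma\cup\{\infty\}$ is a divisible ordered abelian group with top element (order and operation induced by $\le,\times$), with quotient map $\mathrm{vrv}$; $\mathrm{rv}:\mathrm{VF}^\times\to\mathrm{RV}^\times$ is a surjective group homomorphism with $\mathrm{rv}(0)=\infty$ such that $v=\mathrm{vrv}\circ\mathrm{rv}$ is a valuation with valuation ring $\mathcal O=\mathrm{rv}^{-1}(\{x:1\le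 x\})$ and maximal ideal $\mathcal M=\mathrm{rv}^{-1}(\{x:1<x\})$. The language $\mathcal{L}_{RV}^{\dagger}$ expands $\mathcal{L}_{RV}$ by a function symbol $\mathrm{sn}:\mathrm{RV}\to\mathrm{VF}$. A section of $\mathrm{RV}$ is a function $\mathrm{sn}:\mathrm{RV}\to\mathrm{VF}$ such that $\mathrm{sn}\restriction\mathrm{RV}^\times$ is a homomorphism of multiplicative groups, $\mathrm{sn}(\infty)=0$, $\mathrm{rv}(\mathrm{sn}(t))=t$ for every $t\in\mathrm{RV}$, and $\mathrm{sn}(\mathrm{K}^\times)\cup\{0\}$ is a subfield of $\mathcal{O}$. The theory $\mathrm{ACVF}^{\dagger}$ consists of the axioms of $\mathrm{ACVF}$ together with the statement that $\mathrm{sn}$ is a section of $\mathrm{RV}$.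
   Formalization: Two axioms are added to ACVF†: the value group Γ is nontrivial, and the residue map from O to K induced by rv is additive (K is the residue field O/M). Without either, quantifier elimination fails. Undefined values of +, −, ×, sn and ≤ on RV are fixed by convention. *)

theory Defs
  imports "HOL-Algebra.Algebraic_Closure" "HOL-Library.Countable_Set"
begin

section \<open>The language\<close>

text \<open>Terms of the two sorts of \<open>L\<^sub>R\<^sub>V\<^sup>\<dagger>\<close>. Each sort has its own supply of variables, indexed by the
  natural numbers. The RV-sort contains the constants \<open>0\<close> and \<open>\<infinity>\<close>.\<close>

datatype vterm =
    VVar nat | VZero | VOne | VAdd vterm vterm | VNeg vterm | VMul vterm vterm | Sn rterm
and rterm =
    RVar nat | RZero | ROne | RInf | RAdd rterm rterm | RNeg rterm | RMul rterm rterm | Rv vterm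

instantiation vterm :: "{zero, one, plus, uminus, times}"
begin
definition zero_vterm_def [simp]: "0 = VZero"
definition one_vterm_def [simp]: "1 = VOne"
definition plus_vterm_def [simp]: "s + t = VAdd s t"
definition uminus_vterm_def [simp]: "- t = VNeg t"
definition times_vterm_def [simp]: "s * t = VMul s t"
instance ..
end

instance vterm :: power ..

instantiation rterm :: "{zero, one, plus, uminus, times}"
begin
definition zero_rterm_def [simp]: "0 = RZero"
definition one_rterm_def [simp]: "1 = ROne"
definition plus_rterm_def [simp]: "s + t = RAdd s t"
definition uminus_rterm_def [simp]: "- t = RNeg t"
definition times_rterm_def [simp]: "s * t = RMul s t"
instance ..
end

instance rterm :: power ..

datatype form =
    VEq vterm vterm  (infix \<open>\<doteq>\<^sub>v\<close> 50)
  | REq rterm rterm  (infix \<open>\<doteq>\<^sub>r\<close> 50)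
  | InKx rterm
  | RLe rterm rterm  (infix \<open>\<preceq>\<^sub>r\<close> 50)
  | FNot form        (\<open>\<^bold>\<not> _\<close> [40] 40)
  | FAnd form form   (infixr \<open>\<^bold>\<and>\<close> 35)
  | VEx nat form
  | REx nat form

abbreviation FOr :: "form \<Rightarrow> form \<Rightarrow> form"  (infixr \<open>\<^bold>\<or>\<close> 30)
  where "\<phi> \<^bold>\<or> \<psi> \<equiv> \<^bold>\<not> (\<^bold>\<not> \<phi> \<^bold>\<and> \<^bold>\<not> \<psi>)"

abbreviation FImp :: "form \<Rightarrow> form \<Rightarrow> form"  (infixr \<open>\<^bold>\<longrightarrow>\<close> 25)
  where "\<phi> \<^bold>\<longrightarrow> \<psi> \<equiv> \<^bold>\<not> (\<phi> \<^bold>\<and> \<^bold>\<not> \<psi>)"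

abbreviation FIff :: "form \<Rightarrow> form \<Rightarrow> form"  (infixr \<open>\<^bold>\<longleftrightarrow>\<close> 25)
  where "\<phi> \<^bold>\<longleftrightarrow> \<psi> \<equiv> (\<phi> \<^bold>\<longrightarrow> \<psi>) \<^bold>\<and> (\<psi> \<^bold>\<longrightarrow> \<phi>)"

abbreviation VAll :: "nat \<Rightarrow> form \<Rightarrow> form"
  where "VAll n \<phi> \<equiv> \<^bold>\<not> VEx n (\<^bold>\<not> \<phi>)"

abbreviation RAll :: "nat \<Rightarrow> form \<Rightarrow> form"
  where "RAll n \<phi> \<equiv> \<^bold>\<not> REx n (\<^bold>\<not> \<phi>)"

primrec qfree :: "form \<Rightarrow> bool" where
  "qfree (s \<doteq>\<^sub>v t) = True"
| "qfree (s \<doteq>\<^sub>r t) = True"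
| "qfree (InKx t) = True"
| "qfree (s \<preceq>\<^sub>r t) = True"
| "qfree (\<^bold>\<not> \<phi>) = qfree \<phi>"
| "qfree (\<phi> \<^bold>\<and> \<psi>) = (qfree \<phi> \<and> qfree \<psi>)"
| "qfree (VEx n \<phi>) = False"
| "qfree (REx n \<phi>) = False"

text \<open>\<open>vvars\<close> and \<open>rvars\<close>: the VF-variables and the RV-variables of a term; \<open>fvV\<close> and \<open>fvR\<close>: the
  free VF-variables and RV-variables of a formula.\<close>

primrec vvars_v :: "vterm \<Rightarrow> nat set" and vvars_r :: "rterm \<Rightarrow> nat set" where
  "vvars_v (VVar n) = {n}"
| "vvars_v VZero = {}"
| "vvars_v VOne = {}"
| "vvars_v (VAdd s t) = vvars_v s \<union> vvars_v t"
| "vvars_v (VNeg t) = vvars_v t"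
| "vvars_v (VMul s t) = vvars_v s \<union> vvars_v t"
| "vvars_v (Sn t) = vvars_r t"
| "vvars_r (RVar n) = {}"
| "vvars_r RZero = {}"
| "vvars_r ROne = {}"
| "vvars_r RInf = {}"
| "vvars_r (RAdd s t) = vvars_r s \<union> vvars_r t"
| "vvars_r (RNeg t) = vvars_r t"
| "vvars_r (RMul s t) = vvars_r s \<union> vvars_r t"
| "vvars_r (Rv t) = vvars_v t"

primrec rvars_v :: "vterm \<Rightarrow> nat set" and rvars_r :: "rterm \<Rightarrow> nat set" where
  "rvars_v (VVar n) = {}"
| "rvars_v VZero = {}"
| "rvars_v VOne = {}"
| "rvars_v (VAdd s t) = rvars_v s \<union> rvars_v t"
| "rvars_v (VNeg t) = rvars_v t"
| "rvars_v (VMul s t) = rvars_v s \<union> rvars_v t"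
| "rvars_v (Sn t) = rvars_r t"
| "rvars_r (RVar n) = {n}"
| "rvars_r RZero = {}"
| "rvars_r ROne = {}"
| "rvars_r RInf = {}"
| "rvars_r (RAdd s t) = rvars_r s \<union> rvars_r t"
| "rvars_r (RNeg t) = rvars_r t"
| "rvars_r (RMul s t) = rvars_r s \<union> rvars_r t"
| "rvars_r (Rv t) = rvars_v t"

primrec fvV :: "form \<Rightarrow> nat set" where
  "fvV (s \<doteq>\<^sub>v t) = vvars_v s \<union> vvars_v t"
| "fvV (s \<doteq>\<^sub>r t) = vvars_r s \<union> vvars_r t"
| "fvV (InKx t) = vvars_r t"
| "fvV (s \<preceq>\<^sub>r t) = vvars_r s \<union> vvars_r t"
| "fvV (\<^bold>\<not> \<phi>) = fvV \<phi>"
| "fvV (\<phi> \<^bold>\<and> \<psi>) = fvV \<phi> \<union> fvV \<psi>"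
| "fvV (VEx n \<phi>) = fvV \<phi> - {n}"
| "fvV (REx n \<phi>) = fvV \<phi>"

primrec fvR :: "form \<Rightarrow> nat set" where
  "fvR (s \<doteq>\<^sub>v t) = rvars_v s \<union> rvars_v t"
| "fvR (s \<doteq>\<^sub>r t) = rvars_r s \<union> rvars_r t"
| "fvR (InKx t) = rvars_r t"
| "fvR (s \<preceq>\<^sub>r t) = rvars_r s \<union> rvars_r t"
| "fvR (\<^bold>\<not> \<phi>) = fvR \<phi>"
| "fvR (\<phi> \<^bold>\<and> \<psi>) = fvR \<phi> \<union> fvR \<psi>"
| "fvR (VEx n \<phi>) = fvR \<phi>"
| "fvR (REx n \<phi>) = fvR \<phi> - {n}"


section \<open>Structures and satisfaction\<close>

record ('v, 'r) struct =
  VF :: "'v set"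
  v_zero :: 'v
  v_one :: 'v
  v_add :: "'v \<Rightarrow> 'v \<Rightarrow> 'v"
  v_neg :: "'v \<Rightarrow> 'v"
  v_mul :: "'v \<Rightarrow> 'v \<Rightarrow> 'v"
  RV0 :: "'r set"
  r_zero :: 'r
  r_one :: 'r
  r_inf :: 'r
  r_add :: "'r \<Rightarrow> 'r \<Rightarrow> 'r"
  r_neg :: "'r \<Rightarrow> 'r"
  r_mul :: "'r \<Rightarrow> 'r \<Rightarrow> 'r"
  r_Kx :: "'r \<Rightarrow> bool"
  r_le :: "'r \<Rightarrow> 'r \<Rightarrow> bool"
  s_rv :: "'v \<Rightarrow> 'r"
  s_sn :: "'r \<Rightarrow> 'v"

definition is_structure :: "('v, 'r) struct \<Rightarrow> bool" where
  "is_structure M \<longleftrightarrow>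
     v_zero M \<in> VF M \<and> v_one M \<in> VF M \<and>
     (\<forall>x\<in>VF M. \<forall>y\<in>VF M. v_add M x y \<in> VF M) \<and>
     (\<forall>x\<in>VF M. v_neg M x \<in> VF M) \<and>
     (\<forall>x\<in>VF M. \<forall>y\<in>VF M. v_mul M x y \<in> VF M) \<and>
     r_zero M \<in> RV0 M \<and> r_one M \<in> RV0 M \<and> r_inf M \<in> RV0 M \<and>
     (\<forall>s\<in>RV0 M. \<forall>t\<in>RV0 M. r_add M s t \<in> RV0 M) \<and>
     (\<forall>t\<in>RV0 M. r_neg M t \<in> RV0 M) \<and>
     (\<forall>s\<in>RV0 M. \<forall>t\<in>RV0 M. r_mul M s t \<in> RV0 M) \<and>
     (\<forall>x\<in>VF M. s_rv M x \<in> RV0 M) \<and>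
     (\<forall>t\<in>RV0 M. s_sn M t \<in> VF M)"

primrec veval :: "('v, 'r) struct \<Rightarrow> (nat \<Rightarrow> 'v) \<Rightarrow> (nat \<Rightarrow> 'r) \<Rightarrow> vterm \<Rightarrow> 'v"
  and reval :: "('v, 'r) struct \<Rightarrow> (nat \<Rightarrow> 'v) \<Rightarrow> (nat \<Rightarrow> 'r) \<Rightarrow> rterm \<Rightarrow> 'r" where
  "veval M e f (VVar n) = e n"
| "veval M e f VZero = v_zero M"
| "veval M e f VOne = v_one M"
| "veval M e f (VAdd s t) = v_add M (veval M e f s) (veval M e f t)"
| "veval M e f (VNeg t) = v_neg M (veval M e f t)"
| "veval M e f (VMul s t) = v_mul M (veval M e f s) (veval M e f t)"
| "veval M e f (Sn t) = s_sn M (reval M e f t)"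
| "reval M e f (RVar n) = f n"
| "reval M e f RZero = r_zero M"
| "reval M e f ROne = r_one M"
| "reval M e f RInf = r_inf M"
| "reval M e f (RAdd s t) = r_add M (reval M e f s) (reval M e f t)"
| "reval M e f (RNeg t) = r_neg M (reval M e f t)"
| "reval M e f (RMul s t) = r_mul M (reval M e f s) (reval M e f t)"
| "reval M e f (Rv t) = s_rv M (veval M e f t)"

primrec sat :: "('v, 'r) struct \<Rightarrow> (nat \<Rightarrow> 'v) \<Rightarrow> (nat \<Rightarrow> 'r) \<Rightarrow> form \<Rightarrow> bool" where
  "sat M e f (s \<doteq>\<^sub>v t) = (veval M e f s = veval M e f t)"
| "sat M e f (s \<doteq>\<^sub>r t) = (reval M e f s = reval M e f t)"
| "sat M e f (InKx t) = r_Kx M (reval M e f t)"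
| "sat M e f (s \<preceq>\<^sub>r t) = r_le M (reval M e f s) (reval M e f t)"
| "sat M e f (\<^bold>\<not> \<phi>) = (\<not> sat M e f \<phi>)"
| "sat M e f (\<phi> \<^bold>\<and> \<psi>) = (sat M e f \<phi> \<and> sat M e f \<psi>)"
| "sat M e f (VEx n \<phi>) = (\<exists>a\<in>VF M. sat M (e(n := a)) f \<phi>)"
| "sat M e f (REx n \<phi>) = (\<exists>b\<in>RV0 M. sat M e (f(n := b)) \<phi>)"

text \<open>A formula with free variables holds in \<open>M\<close> if its universal closure does.\<close>

definition holds :: "('v, 'r) struct \<Rightarrow> form \<Rightarrow> bool" where
  "holds M \<phi> \<longleftrightarrow> (\<forall>e f. range e \<subseteq> VF M \<longrightarrow> range f \<subseteq> RV0 M \<longrightarrow> sat M e f \<phi>)"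

definition is_model :: "('v, 'r) struct \<Rightarrow> form set \<Rightarrow> bool" where
  "is_model M T \<longleftrightarrow> is_structure M \<and> (\<forall>\<sigma>\<in>T. holds M \<sigma>)"

text \<open>Logical consequence must not depend on a choice of types for the models. As the language is
  countable, it is enough to consider the models whose sorts are subsets of the natural numbers:
  \<open>entails_model\<close> below (downward Loewenheim-Skolem) shows that \<open>T \<TTurnstile> \<phi>\<close> as defined here implies
  that \<open>\<phi>\<close> holds in all models of \<open>T\<close>, of any cardinality and over any types.\<close>

definition entails :: "form set \<Rightarrow> form \<Rightarrow> bool"  (infix \<open>\<TTurnstile>\<close> 50) where
  "T \<TTurnstile> \<phi> \<longleftrightarrow> (\<forall>M :: (nat, nat) struct. is_model M T \<longrightarrow> holds M \<phi>)"

definition admits_QE :: "form set \<Rightarrow> bool" where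
  "admits_QE T \<longleftrightarrow>
     (\<forall>\<phi>. \<exists>\<psi>. qfree \<psi> \<and> fvV \<psi> \<subseteq> fvV \<phi> \<and> fvR \<psi> \<subseteq> fvR \<phi> \<and> T \<TTurnstile> (\<phi> \<^bold>\<longleftrightarrow> \<psi>))"


section \<open>The theory ACVF with a section\<close>

abbreviation VAlls :: "nat list \<Rightarrow> form \<Rightarrow> form"
  where "VAlls ns \<phi> \<equiv> foldr (\<lambda>n \<psi>. VAll n \<psi>) ns \<phi>"

abbreviation RAlls_in :: "(rterm \<Rightarrow> form) \<Rightarrow> nat list \<Rightarrow> form \<Rightarrow> form"
  where "RAlls_in P ns \<phi> \<equiv> foldr (\<lambda>n \<psi>. RAll n (P (RVar n) \<^bold>\<longrightarrow> \<psi>)) ns \<phi>"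

abbreviation REx_in :: "(rterm \<Rightarrow> form) \<Rightarrow> nat \<Rightarrow> form \<Rightarrow> form"
  where "REx_in P n \<phi> \<equiv> REx n (P (RVar n) \<^bold>\<and> \<phi>)"

text \<open>Membership in \<open>RV\<^sub>0\<close> (the whole RV-sort), \<open>RV\<close>, \<open>RV\<^sup>\<times>\<close> and \<open>K\<close>, and the strict part of \<open>\<le>\<close>.\<close>

definition inRV0 :: "rterm \<Rightarrow> form" where [simp]: "inRV0 t = (t \<doteq>\<^sub>r t)"
definition inRV :: "rterm \<Rightarrow> form" where [simp]: "inRV t = (\<^bold>\<not> t \<doteq>\<^sub>r 0)"
definition inRVx :: "rterm \<Rightarrow> form" where [simp]: "inRVx t = (\<^bold>\<not> t \<doteq>\<^sub>r 0 \<^bold>\<and> \<^bold>\<not> t \<doteq>\<^sub>r RInf)"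
definition inK :: "rterm \<Rightarrow> form" where [simp]: "inK t = (InKx t \<^bold>\<or> t \<doteq>\<^sub>r 0)"
definition RLess :: "rterm \<Rightarrow> rterm \<Rightarrow> form"  (infix \<open>\<prec>\<^sub>r\<close> 50)
  where [simp]: "s \<prec>\<^sub>r t = (s \<preceq>\<^sub>r t \<^bold>\<and> \<^bold>\<not> t \<preceq>\<^sub>r s)"

text \<open>\<open>monic x c n\<close> is the monic polynomial \<open>x\<^sup>n + c\<^sub>0 x\<^sup>n\<^sup>-\<^sup>1 + \<dots> + c\<^sub>n\<^sub>-\<^sub>1\<close> in Horner form.\<close>

primrec monic :: "'t \<Rightarrow> (nat \<Rightarrow> 't) \<Rightarrow> nat \<Rightarrow> 't::{one, plus, times}" where
  "monic x c 0 = 1"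
| "monic x c (Suc k) = monic x c k * x + c k"

definition VF_axioms :: "form set" where
  "VF_axioms = (let x = VVar 0; y = VVar 1; z = VVar 2 in
     {VAlls [0, 1, 2] ((x + y) + z \<doteq>\<^sub>v x + (y + z)),
      VAlls [0, 1] (x + y \<doteq>\<^sub>v y + x),
      VAlls [0] (0 + x \<doteq>\<^sub>v x),
      VAlls [0] (- x + x \<doteq>\<^sub>v 0),
      VAlls [0, 1, 2] ((x * y) * z \<doteq>\<^sub>v x * (y * z)),
      VAlls [0, 1] (x * y \<doteq>\<^sub>v y * x),
      VAlls [0] (1 * x \<doteq>\<^sub>v x),
      VAlls [0, 1, 2] ((x + y) * z \<doteq>\<^sub>v x * z + y * z),
      \<^bold>\<not> 0 \<doteq>\<^sub>v 1,
      VAlls [0] (\<^bold>\<not> x \<doteq>\<^sub>v 0 \<^bold>\<longrightarrow> VEx 1 (x * y \<doteq>\<^sub>v 1))} \<union>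
     {VAlls [0..<n] (VEx n (monic (VVar n) VVar n \<doteq>\<^sub>v 0)) | n. n \<ge> 1})"

definition RVx_axioms :: "form set" where
  "RVx_axioms = (let r = RVar 0; s = RVar 1; t = RVar 2 in
     {\<^bold>\<not> 0 \<doteq>\<^sub>r RInf,
      inRVx 1,
      RAlls_in inRVx [0, 1] (inRVx (r * s)),
      RAlls_in inRVx [0, 1, 2] ((r * s) * t \<doteq>\<^sub>r r * (s * t)),
      RAlls_in inRVx [0, 1] (r * s \<doteq>\<^sub>r s * r),
      RAlls_in inRVx [0] (1 * r \<doteq>\<^sub>r r),
      RAlls_in inRVx [0] (REx_in inRVx 1 (s * r \<doteq>\<^sub>r 1)),
      RAlls_in inK [0] (r * 0 \<doteq>\<^sub>r 0 \<^bold>\<and> 0 * r \<doteq>\<^sub>r 0),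
      RAlls_in inRV0 [0] (r * RInf \<doteq>\<^sub>r RInf \<^bold>\<and> RInf * r \<doteq>\<^sub>r RInf)} \<union>
     {RAlls_in inRVx [0] (REx_in inRVx 1 (s ^ n \<doteq>\<^sub>r r)) | n. n \<ge> 1})"

definition K_axioms :: "form set" where
  "K_axioms = (let r = RVar 0; s = RVar 1; t = RVar 2 in
     {inK 1,
      RAlls_in inK [0, 1] (inK (r + s)),
      RAlls_in inK [0] (inK (- r)),
      RAlls_in inK [0, 1] (inK (r * s)),
      RAlls_in inK [0, 1, 2] ((r + s) + t \<doteq>\<^sub>r r + (s + t)),
      RAlls_in inK [0, 1] (r + s \<doteq>\<^sub>r s + r),
      RAlls_in inK [0] (0 + r \<doteq>\<^sub>r r),
      RAlls_in inK [0] (- r + r \<doteq>\<^sub>r 0),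
      RAlls_in inK [0, 1, 2] ((r * s) * t \<doteq>\<^sub>r r * (s * t)),
      RAlls_in inK [0, 1] (r * s \<doteq>\<^sub>r s * r),
      RAlls_in inK [0] (1 * r \<doteq>\<^sub>r r),
      RAlls_in inK [0, 1, 2] ((r + s) * t \<doteq>\<^sub>r r * t + s * t),
      \<^bold>\<not> 0 \<doteq>\<^sub>r 1,
      RAlls_in inK [0] (\<^bold>\<not> r \<doteq>\<^sub>r 0 \<^bold>\<longrightarrow> REx_in inK 1 (r * s \<doteq>\<^sub>r 1))} \<union>
     {RAlls_in inK [0..<n] (REx_in inK n (monic (RVar n) RVar n \<doteq>\<^sub>r 0)) | n. n \<ge> 1})"

text \<open>The preorder and the value group. For \<open>s, t \<in> RV\<close>, the images in \<open>RV / K\<^sup>\<times> = \<Gamma> \<union> {\<infinity>}\<close> are equal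
  iff \<open>s = k t\<close> for some \<open>k \<in> K\<^sup>\<times>\<close>; that the induced relation is antisymmetric is the fifth axiom.
  Divisibility of \<open>\<Gamma>\<close> follows from that of \<open>RV\<^sup>\<times>\<close>. As always for divisible ordered abelian groups
  in this context, \<open>\<Gamma>\<close> is nontrivial, which is the last axiom: trivially valued fields and nontrivially
  valued ones with the same residue field satisfy the same quantifier-free sentences, so that
  quantifiers could not be eliminated from that very axiom if both kinds were allowed.\<close>

definition order_axioms :: "form set" where
  "order_axioms = (let r = RVar 0; s = RVar 1; t = RVar 2 in
     {RAlls_in inRV [0] (r \<preceq>\<^sub>r r),
      RAlls_in inRV [0, 1, 2] (r \<preceq>\<^sub>r s \<^bold>\<and> s \<preceq>\<^sub>r t \<^bold>\<longrightarrow> r \<preceq>\<^sub>r t),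
      RAlls_in inRV [0] (r \<preceq>\<^sub>r RInf),
      RAlls_in inRV0 [0] (InKx r \<^bold>\<longleftrightarrow> inRV r \<^bold>\<and> r \<preceq>\<^sub>r 1 \<^bold>\<and> 1 \<preceq>\<^sub>r r),
      RAlls_in inRV [0, 1] (r \<preceq>\<^sub>r s \<^bold>\<and> s \<preceq>\<^sub>r r \<^bold>\<longrightarrow> REx_in InKx 2 (r \<doteq>\<^sub>r t * s)),
      RAlls_in inRV [0, 1] (r \<preceq>\<^sub>r s \<^bold>\<or> s \<preceq>\<^sub>r r),
      RAlls_in inRVx [0, 1, 2] (r \<preceq>\<^sub>r s \<^bold>\<longrightarrow> r * t \<preceq>\<^sub>r s * t),
      REx_in inRVx 0 (\<^bold>\<not> InKx r)})"

text \<open>\<open>isRes x t\<close> says that \<open>x \<in> \<O>\<close> and that \<open>t \<in> K\<close> is its residue, namely \<open>rv x\<close> if \<open>x\<close> is a unit of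
  \<open>\<O>\<close> and \<open>0\<close> if \<open>x \<in> \<M>\<close>. The last axiom below makes the residue map \<open>\<O> \<rightarrow> K\<close> additive, i.e. \<open>K\<close> with
  its field structure is the residue field \<open>\<O>/\<M>\<close>, and the kernel of \<open>rv\<close> is \<open>1 + \<M>\<close>.\<close>

definition isRes :: "vterm \<Rightarrow> rterm \<Rightarrow> form" where
  [simp]: "isRes x t = ((InKx (Rv x) \<^bold>\<and> t \<doteq>\<^sub>r Rv x) \<^bold>\<or> (1 \<prec>\<^sub>r Rv x \<^bold>\<and> t \<doteq>\<^sub>r 0))"

definition rv_axioms :: "form set" where
  "rv_axioms = (let x = VVar 0; y = VVar 1; r = RVar 0; s = RVar 1; t = RVar 2 in
     {Rv 0 \<doteq>\<^sub>r RInf,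
      VAlls [0] (\<^bold>\<not> x \<doteq>\<^sub>v 0 \<^bold>\<longrightarrow> inRVx (Rv x)),
      VAlls [0, 1] (\<^bold>\<not> x \<doteq>\<^sub>v 0 \<^bold>\<and> \<^bold>\<not> y \<doteq>\<^sub>v 0 \<^bold>\<longrightarrow> Rv (x * y) \<doteq>\<^sub>r Rv x * Rv y),
      RAlls_in inRVx [0] (VEx 0 (\<^bold>\<not> x \<doteq>\<^sub>v 0 \<^bold>\<and> Rv x \<doteq>\<^sub>r r)),
      VAlls [0, 1] (Rv x \<preceq>\<^sub>r Rv (x + y) \<^bold>\<or> Rv y \<preceq>\<^sub>r Rv (x + y)),
      VAlls [0, 1] (RAlls_in inK [0, 1, 2]
        (isRes x r \<^bold>\<and> isRes y s \<^bold>\<and> isRes (x + y) t \<^bold>\<longrightarrow> t \<doteq>\<^sub>r r + s))})"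

text \<open>Function symbols denote total functions. Outside their intended domain (\<open>+\<close> and \<open>-\<close> outside \<open>K\<close>,
  and \<open>t \<times> 0\<close> for \<open>t \<in> RV\<^sup>\<times> - K\<^sup>\<times>\<close>) they are given the value \<open>0\<close>, and \<open>\<le>\<close> is a relation on \<open>RV\<close> only.\<close>

definition default_axioms :: "form set" where
  "default_axioms = (let r = RVar 0; s = RVar 1 in
     {RAlls_in inRV0 [0, 1] (\<^bold>\<not> (inK r \<^bold>\<and> inK s) \<^bold>\<longrightarrow> r + s \<doteq>\<^sub>r 0),
      RAlls_in inRV0 [0] (\<^bold>\<not> inK r \<^bold>\<longrightarrow> - r \<doteq>\<^sub>r 0),
      RAlls_in inRVx [0] (\<^bold>\<not> inK r \<^bold>\<longrightarrow> r * 0 \<doteq>\<^sub>r 0 \<^bold>\<and> 0 * r \<doteq>\<^sub>r 0),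
      RAlls_in inRV0 [0] (\<^bold>\<not> r \<preceq>\<^sub>r 0 \<^bold>\<and> \<^bold>\<not> 0 \<preceq>\<^sub>r r)})"

definition ACVF :: "form set" where
  "ACVF = VF_axioms \<union> RVx_axioms \<union> K_axioms \<union> order_axioms \<union> rv_axioms \<union> default_axioms"

text \<open>\<open>sn\<close> is a section of \<open>RV\<close>. Given the other axioms, \<open>sn(K\<^sup>\<times>) \<union> {0}\<close> is contained in \<open>\<O>\<close>, contains \<open>0\<close> and
  \<open>1\<close>, and is closed under products and inverses of nonzero elements, so that it is a subfield of \<open>\<O>\<close>
  iff it is closed under sums and negatives. The last axiom is the convention that fixes the value
  of \<open>sn\<close> at \<open>0\<close>, which does not belong to \<open>RV\<close>; by it, \<open>sn(K\<^sup>\<times>) \<union> {0} = sn(K)\<close>.\<close>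

definition section_axioms :: "form set" where
  "section_axioms = (let r = RVar 0; s = RVar 1; t = RVar 2 in
     {RAlls_in inRVx [0] (\<^bold>\<not> Sn r \<doteq>\<^sub>v 0),
      RAlls_in inRVx [0, 1] (Sn (r * s) \<doteq>\<^sub>v Sn r * Sn s),
      Sn RInf \<doteq>\<^sub>v 0,
      RAlls_in inRV [0] (Rv (Sn r) \<doteq>\<^sub>r r),
      RAlls_in inK [0, 1] (REx_in inK 2 (Sn r + Sn s \<doteq>\<^sub>v Sn t)),
      RAlls_in inK [0] (REx_in inK 1 (- Sn r \<doteq>\<^sub>v Sn s)),
      Sn 0 \<doteq>\<^sub>v 0})"

definition ACVF_dag :: "form set" where
  "ACVF_dag = ACVF \<union> section_axioms"


section \<open>Logical consequence does not depend on the types of the models\<close>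

instance vterm :: countable by countable_datatype
instance rterm :: countable by countable_datatype
instance form :: countable by countable_datatype

lemma finite_vvars: "finite (vvars_v t)" "finite (vvars_r u)"
  by (induction t and u) auto

lemma finite_rvars: "finite (rvars_v t)" "finite (rvars_r u)"
  by (induction t and u) auto

lemma finite_fv: "finite (fvV \<phi>)" "finite (fvR \<phi>)"
  by (induction \<phi>) (auto simp: finite_vvars finite_rvars)

lemma eval_cong:
  "(\<And>i. i \<in> vvars_v t \<Longrightarrow> e i = e' i) \<Longrightarrow> (\<And>i. i \<in> rvars_v t \<Longrightarrow> f i = f' i)
     \<Longrightarrow> veval M e f t = veval M e' f' t"
  "(\<And>i. i \<in> vvars_r u \<Longrightarrow> e i = e' i) \<Longrightarrow> (\<And>i. i \<in> rvars_r u \<Longrightarrow> f i = f' i)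
     \<Longrightarrow> reval M e f u = reval M e' f' u"
  by (induction t and u) auto

lemma sat_cong:
  assumes "\<And>i. i \<in> fvV \<phi> \<Longrightarrow> e i = e' i" "\<And>i. i \<in> fvR \<phi> \<Longrightarrow> f i = f' i"
  shows "sat M e f \<phi> = sat M e' f' \<phi>"
  using assms
proof (induction \<phi> arbitrary: e e' f f')
  case (VEq s t)
  then show ?case
    using eval_cong(1)[of s e e' f f' M] eval_cong(1)[of t e e' f f' M] by simp
next
  case (REq s t)
  then show ?case
    using eval_cong(2)[of s e e' f f' M] eval_cong(2)[of t e e' f f' M] by simp
next
  case (InKx t)
  then show ?case
    using eval_cong(2)[of t e e' f f' M] by simp
next
  case (RLe s t)
  then show ?case
    using eval_cong(2)[of s e e' f f' M] eval_cong(2)[of t e e' f f' M] by simp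
next
  case (FNot \<phi>)
  have "sat M e f \<phi> = sat M e' f' \<phi>" by (rule FNot.IH) (use FNot.prems in auto)
  then show ?case by simp
next
  case (FAnd \<phi> \<psi>)
  have "sat M e f \<phi> = sat M e' f' \<phi>" by (rule FAnd.IH) (use FAnd.prems in auto)
  moreover have "sat M e f \<psi> = sat M e' f' \<psi>" by (rule FAnd.IH) (use FAnd.prems in auto)
  ultimately show ?case by simp
next
  case (VEx n \<phi>)
  have "sat M (e(n := a)) f \<phi> = sat M (e'(n := a)) f' \<phi>" for a
    by (rule VEx.IH) (use VEx.prems in auto)
  then show ?case by simp
next
  case (REx n \<phi>)
  have "sat M e (f(n := a)) \<phi> = sat M e' (f'(n := a)) \<phi>" for a
    by (rule REx.IH) (use REx.prems in auto)
  then show ?case by simp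
qed

lemma eval_in:
  assumes "is_structure M" "range e \<subseteq> VF M" "range f \<subseteq> RV0 M"
  shows "veval M e f t \<in> VF M" "reval M e f u \<in> RV0 M"
  using assms by (induction t and u) (auto simp: is_structure_def)

definition list_asg :: "'a \<Rightarrow> 'a list \<Rightarrow> nat \<Rightarrow> 'a" where
  "list_asg d xs i = (if i < length xs then xs ! i else d)"

lemma range_list_asg: "range (list_asg d xs) \<subseteq> insert d (set xs)"
  by (auto simp: list_asg_def)

definition v_wit :: "('v, 'r) struct \<Rightarrow> form \<times> nat \<times> 'v list \<times> 'r list \<Rightarrow> 'v" where
  "v_wit M = (\<lambda>(\<phi>, n, xs, ts).
     let P = (\<lambda>a. a \<in> VF M \<and> sat M ((list_asg (v_zero M) xs)(n := a)) (list_asg (r_zero M) ts) \<phi>)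
     in if \<exists>a. P a then SOME a. P a else v_zero M)"

definition r_wit :: "('v, 'r) struct \<Rightarrow> form \<times> nat \<times> 'v list \<times> 'r list \<Rightarrow> 'r" where
  "r_wit M = (\<lambda>(\<phi>, n, xs, ts).
     let P = (\<lambda>b. b \<in> RV0 M \<and> sat M (list_asg (v_zero M) xs) ((list_asg (r_zero M) ts)(n := b)) \<phi>)
     in if \<exists>b. P b then SOME b. P b else r_zero M)"

primrec sk_hull :: "('v, 'r) struct \<Rightarrow> 'v set \<Rightarrow> 'r set \<Rightarrow> nat \<Rightarrow> 'v set \<times> 'r set" where
  "sk_hull M A B 0 = (A, B)"
| "sk_hull M A B (Suc k) = (let (A', B') = sk_hull M A B k; W = UNIV \<times> UNIV \<times> lists A' \<times> lists B'
     in (A' \<union> v_wit M ` W, B' \<union> r_wit M ` W))"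

lemma some_or_default: "d \<in> S \<Longrightarrow> (if \<exists>a. a \<in> S \<and> P a then SOME a. a \<in> S \<and> P a else d) \<in> S"
  using someI_ex[of "\<lambda>a. a \<in> S \<and> P a"] by presburger

lemma v_wit_in: "is_structure M \<Longrightarrow> v_wit M w \<in> VF M"
  unfolding v_wit_def Let_def split_beta by (rule some_or_default) (simp add: is_structure_def)

lemma r_wit_in: "is_structure M \<Longrightarrow> r_wit M w \<in> RV0 M"
  unfolding r_wit_def Let_def split_beta by (rule some_or_default) (simp add: is_structure_def)

lemma sk_hull_Suc:
  "fst (sk_hull M A B (Suc k)) = fst (sk_hull M A B k) \<union>
     v_wit M ` (UNIV \<times> UNIV \<times> lists (fst (sk_hull M A B k)) \<times> lists (snd (sk_hull M A B k)))"
  "snd (sk_hull M A B (Suc k)) = snd (sk_hull M A B k) \<union>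
     r_wit M ` (UNIV \<times> UNIV \<times> lists (fst (sk_hull M A B k)) \<times> lists (snd (sk_hull M A B k)))"
  by (simp_all add: Let_def split_beta)

declare sk_hull.simps(2) [simp del]

lemma hull_sub:
  assumes M: "is_structure M" and "A \<subseteq> VF M" "B \<subseteq> RV0 M"
  shows "fst (sk_hull M A B k) \<subseteq> VF M \<and> snd (sk_hull M A B k) \<subseteq> RV0 M"
proof (induction k)
  case (Suc k)
  then show ?case
    unfolding sk_hull_Suc using v_wit_in[OF M] r_wit_in[OF M] by (simp add: image_subset_iff)
qed (use assms in simp)

lemma hull_countable:
  assumes "countable A" "countable B"
  shows "countable (fst (sk_hull M A B k)) \<and> countable (snd (sk_hull M A B k))"
proof (induction k)
  case (Suc k)
  then have "countable ((UNIV :: form set) \<times> (UNIV :: nat set) \<times>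
      lists (fst (sk_hull M A B k)) \<times> lists (snd (sk_hull M A B k)))"
    by (intro countable_SIGMA countable_lists countableI_type) simp_all
  then show ?case unfolding sk_hull_Suc using Suc by simp
qed (use assms in simp)

lemma hull_mono:
  assumes "j \<le> k"
  shows "fst (sk_hull M A B j) \<subseteq> fst (sk_hull M A B k)" "snd (sk_hull M A B j) \<subseteq> snd (sk_hull M A B k)"
  by (rule lift_Suc_mono_le[OF _ assms]; simp add: sk_hull_Suc)+

lemma list_in_chain:
  assumes "set xs \<subseteq> (\<Union>k. S k)" "\<And>j k. j \<le> k \<Longrightarrow> S j \<subseteq> S (k :: nat)"
  shows "\<exists>k. set xs \<subseteq> S k"
  using assms(1)
proof (induction xs)
  case (Cons x xs)
  then obtain k j where "set xs \<subseteq> S k" "x \<in> S j" by auto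
  then have "set (x # xs) \<subseteq> S (max j k)"
    using assms(2)[of j "max j k"] assms(2)[of k "max j k"] by auto
  then show ?case ..
qed simp

lemma countable_elementary_substructure:
  fixes M :: "('v, 'r) struct"
  assumes M: "is_structure M" and A0: "A0 \<subseteq> VF M" "countable A0" and B0: "B0 \<subseteq> RV0 M" "countable B0"
  obtains A B where "A0 \<subseteq> A" "B0 \<subseteq> B" "countable A" "countable B"
    "A \<subseteq> VF M" "B \<subseteq> RV0 M" "is_structure (M\<lparr>VF := A, RV0 := B\<rparr>)"
    "\<And>e f \<phi>. range e \<subseteq> A \<Longrightarrow> range f \<subseteq> B \<Longrightarrow> sat (M\<lparr>VF := A, RV0 := B\<rparr>) e f \<phi> = sat M e f \<phi>"
proof -
  define A where "A = (\<Union>k. fst (sk_hull M A0 B0 k))"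
  define B where "B = (\<Union>k. snd (sk_hull M A0 B0 k))"
  have sub: "A \<subseteq> VF M" "B \<subseteq> RV0 M"
    using hull_sub[OF M A0(1) B0(1)] by (auto simp: A_def B_def)
  have cnt: "countable A" "countable B"
    using hull_countable[OF A0(2) B0(2)] by (auto simp: A_def B_def)
  have ext: "A0 \<subseteq> A" "B0 \<subseteq> B"
    using UN_upper[of 0 UNIV "\<lambda>k. fst (sk_hull M A0 B0 k)"]
      UN_upper[of 0 UNIV "\<lambda>k. snd (sk_hull M A0 B0 k)"] by (simp_all add: A_def B_def)
  have wit: "v_wit M (\<phi>, n, xs, ts) \<in> A \<and> r_wit M (\<phi>, n, xs, ts) \<in> B"
    if xs: "set xs \<subseteq> A" and ts: "set ts \<subseteq> B" for \<phi> n xs ts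
  proof -
    obtain i where i: "set xs \<subseteq> fst (sk_hull M A0 B0 i)"
      using list_in_chain[of xs "\<lambda>k. fst (sk_hull M A0 B0 k)"] xs hull_mono(1) unfolding A_def by metis
    obtain j where j: "set ts \<subseteq> snd (sk_hull M A0 B0 j)"
      using list_in_chain[of ts "\<lambda>k. snd (sk_hull M A0 B0 k)"] ts hull_mono(2) unfolding B_def by metis
    define k where "k = max i j"
    have "xs \<in> lists (fst (sk_hull M A0 B0 k))" "ts \<in> lists (snd (sk_hull M A0 B0 k))"
      using i j hull_mono[of i k M A0 B0] hull_mono[of j k M A0 B0] by (auto simp: k_def)
    then have "v_wit M (\<phi>, n, xs, ts) \<in> fst (sk_hull M A0 B0 (Suc k))"
      "r_wit M (\<phi>, n, xs, ts) \<in> snd (sk_hull M A0 B0 (Suc k))"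
      by (simp_all add: sk_hull_Suc)
    then show ?thesis unfolding A_def B_def by blast
  qed
  have TV: "(\<exists>a\<in>VF M. sat M (e(n := a)) f \<phi>) \<longrightarrow> (\<exists>a\<in>A. sat M (e(n := a)) f \<phi>)"
           "(\<exists>b\<in>RV0 M. sat M e (f(n := b)) \<phi>) \<longrightarrow> (\<exists>b\<in>B. sat M e (f(n := b)) \<phi>)"
    if e: "range e \<subseteq> A" and f: "range f \<subseteq> B" for e f n \<phi>
  proof -
    have "finite (fvV \<phi> \<union> fvR \<phi>)" by (simp add: finite_fv)
    then obtain N where N: "\<And>i. i \<in> fvV \<phi> \<union> fvR \<phi> \<Longrightarrow> i < N"
      using finite_nat_set_iff_bounded by auto
    define xs where "xs = map e [0..<N]"
    define ts where "ts = map f [0..<N]"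
    define e' where "e' = list_asg (v_zero M) xs"
    define f' where "f' = list_asg (r_zero M) ts"
    have in_AB: "set xs \<subseteq> A" "set ts \<subseteq> B" using e f by (auto simp: xs_def ts_def)
    have eq: "e i = e' i \<and> f i = f' i" if "i \<in> fvV \<phi> \<union> fvR \<phi>" for i
      using N[OF that] by (simp add: e'_def f'_def xs_def ts_def list_asg_def)
    have eqV: "sat M (e(n := a)) f \<phi> = sat M (e'(n := a)) f' \<phi>" for a
      by (rule sat_cong) (use eq in auto)
    have eqR: "sat M e (f(n := a)) \<phi> = sat M e' (f'(n := a)) \<phi>" for a
      by (rule sat_cong) (use eq in auto)
    show "(\<exists>a\<in>VF M. sat M (e(n := a)) f \<phi>) \<longrightarrow> (\<exists>a\<in>A. sat M (e(n := a)) f \<phi>)"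
    proof
      assume "\<exists>a\<in>VF M. sat M (e(n := a)) f \<phi>"
      then have ex: "\<exists>a. a \<in> VF M \<and> sat M (e'(n := a)) f' \<phi>" using eqV by auto
      then have "sat M (e'(n := v_wit M (\<phi>, n, xs, ts))) f' \<phi>"
        using someI_ex[OF ex] by (simp add: v_wit_def Let_def e'_def f'_def)
      then show "\<exists>a\<in>A. sat M (e(n := a)) f \<phi>" using eqV wit[OF in_AB] by blast
    qed
    show "(\<exists>b\<in>RV0 M. sat M e (f(n := b)) \<phi>) \<longrightarrow> (\<exists>b\<in>B. sat M e (f(n := b)) \<phi>)"
    proof
      assume "\<exists>b\<in>RV0 M. sat M e (f(n := b)) \<phi>"
      then have ex: "\<exists>b. b \<in> RV0 M \<and> sat M e' (f'(n := b)) \<phi>" using eqR by auto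
      then have "sat M e' (f'(n := r_wit M (\<phi>, n, xs, ts))) \<phi>"
        using someI_ex[OF ex] by (simp add: r_wit_def Let_def e'_def f'_def)
      then show "\<exists>b\<in>B. sat M e (f(n := b)) \<phi>" using eqR wit[OF in_AB] by blast
    qed
  qed
  have ne: "v_wit M (VEx 0 (VVar 0 \<doteq>\<^sub>v VVar 0), 0, [], []) \<in> A"
    "r_wit M (VEx 0 (VVar 0 \<doteq>\<^sub>v VVar 0), 0, [], []) \<in> B"
    using wit[of "[]" "[]"] by auto
  then obtain a0 b0 where a0: "a0 \<in> A" and b0: "b0 \<in> B" by blast
  have clV: "veval M e f t \<in> A" if e: "range e \<subseteq> A" and f: "range f \<subseteq> B" for e f t
  proof -
    obtain n where n: "n \<notin> vvars_v t"
      using finite_vvars(1) ex_new_if_finite infinite_UNIV_nat by blast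
    have eq: "veval M (e(n := a)) f t = veval M e f t" for a
      by (rule eval_cong) (use n in auto)
    have "veval M e f t \<in> VF M" by (rule eval_in) (use M e f sub in auto)
    then have "\<exists>a\<in>VF M. sat M (e(n := a)) f (VVar n \<doteq>\<^sub>v t)" by (simp add: eq)
    then have "\<exists>a\<in>A. sat M (e(n := a)) f (VVar n \<doteq>\<^sub>v t)" using TV(1)[OF e f] by blast
    then show ?thesis by (simp add: eq)
  qed
  have clR: "reval M e f t \<in> B" if e: "range e \<subseteq> A" and f: "range f \<subseteq> B" for e f t
  proof -
    obtain n where n: "n \<notin> rvars_r t"
      using finite_rvars(2) ex_new_if_finite infinite_UNIV_nat by blast
    have eq: "reval M e (f(n := a)) t = reval M e f t" for a
      by (rule eval_cong) (use n in auto)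
    have "reval M e f t \<in> RV0 M" by (rule eval_in) (use M e f sub in auto)
    then have "\<exists>a\<in>RV0 M. sat M e (f(n := a)) (RVar n \<doteq>\<^sub>r t)" by (simp add: eq)
    then have "\<exists>a\<in>B. sat M e (f(n := a)) (RVar n \<doteq>\<^sub>r t)" using TV(2)[OF e f] by blast
    then show ?thesis by (simp add: eq)
  qed
  let ?M = "M\<lparr>VF := A, RV0 := B\<rparr>"
  have clV': "veval M (list_asg a0 xs) (list_asg b0 ts) t \<in> A"
    and clR': "reval M (list_asg a0 xs) (list_asg b0 ts) u \<in> B"
    if "set xs \<subseteq> A" "set ts \<subseteq> B" for xs ts t u
  proof -
    have "range (list_asg a0 xs) \<subseteq> A" "range (list_asg b0 ts) \<subseteq> B"
      using that a0 b0 range_list_asg[of a0 xs] range_list_asg[of b0 ts] by auto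
    then show "veval M (list_asg a0 xs) (list_asg b0 ts) t \<in> A"
      "reval M (list_asg a0 xs) (list_asg b0 ts) u \<in> B"
      by (auto intro: clV clR)
  qed
  have struct: "is_structure ?M"
  proof -
    have "v_zero M \<in> A" "v_one M \<in> A" "r_zero M \<in> B" "r_one M \<in> B" "r_inf M \<in> B"
      using clV'[of "[]" "[]" VZero] clV'[of "[]" "[]" VOne]
        clR'[of "[]" "[]" RZero] clR'[of "[]" "[]" ROne] clR'[of "[]" "[]" RInf] by simp_all
    moreover have "v_add M x y \<in> A" "v_mul M x y \<in> A" if "x \<in> A" "y \<in> A" for x y
      using that clV'[of "[x, y]" "[]" "VAdd (VVar 0) (VVar 1)"]
        clV'[of "[x, y]" "[]" "VMul (VVar 0) (VVar 1)"] by (simp_all add: list_asg_def)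
    moreover have "v_neg M x \<in> A" "s_rv M x \<in> B" if "x \<in> A" for x
      using that clV'[of "[x]" "[]" "VNeg (VVar 0)"] clR'[of "[x]" "[]" "Rv (VVar 0)"]
      by (simp_all add: list_asg_def)
    moreover have "r_add M x y \<in> B" "r_mul M x y \<in> B" if "x \<in> B" "y \<in> B" for x y
      using that clR'[of "[]" "[x, y]" "RAdd (RVar 0) (RVar 1)"]
        clR'[of "[]" "[x, y]" "RMul (RVar 0) (RVar 1)"] by (simp_all add: list_asg_def)
    moreover have "r_neg M x \<in> B" "s_sn M x \<in> A" if "x \<in> B" for x
      using that clR'[of "[]" "[x]" "RNeg (RVar 0)"] clV'[of "[]" "[x]" "Sn (RVar 0)"]
      by (simp_all add: list_asg_def)
    ultimately show ?thesis by (simp add: is_structure_def)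
  qed
  have ev: "veval ?M e f t = veval M e f t" "reval ?M e f u = reval M e f u" for e f t u
    by (induction t and u) auto
  have elem: "sat ?M e f \<phi> = sat M e f \<phi>" if "range e \<subseteq> A" "range f \<subseteq> B" for e f \<phi>
    using that
  proof (induction \<phi> arbitrary: e f)
    case (VEx n \<phi>)
    have "sat ?M (e(n := a)) f \<phi> = sat M (e(n := a)) f \<phi>" if "a \<in> A" for a
      by (rule VEx.IH) (use VEx.prems that in auto)
    then show ?case using TV(1)[OF VEx.prems, of n \<phi>] sub by auto
  next
    case (REx n \<phi>)
    have "sat ?M e (f(n := a)) \<phi> = sat M e (f(n := a)) \<phi>" if "a \<in> B" for a
      by (rule REx.IH) (use REx.prems that in auto)
    then show ?case using TV(2)[OF REx.prems, of n \<phi>] sub by auto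
  qed (simp_all add: ev)
  show thesis by (rule that[OF ext cnt sub struct elem])
qed

definition transport :: "('v \<Rightarrow> 'w) \<Rightarrow> ('r \<Rightarrow> 's) \<Rightarrow> ('v, 'r) struct \<Rightarrow> ('w, 's) struct" where
  "transport g h M =
    (let g' = inv_into (VF M) g; h' = inv_into (RV0 M) h in
     \<lparr>VF = g ` VF M, v_zero = g (v_zero M), v_one = g (v_one M),
      v_add = (\<lambda>x y. g (v_add M (g' x) (g' y))), v_neg = (\<lambda>x. g (v_neg M (g' x))),
      v_mul = (\<lambda>x y. g (v_mul M (g' x) (g' y))),
      RV0 = h ` RV0 M, r_zero = h (r_zero M), r_one = h (r_one M), r_inf = h (r_inf M),
      r_add = (\<lambda>x y. h (r_add M (h' x) (h' y))), r_neg = (\<lambda>x. h (r_neg M (h' x))),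
      r_mul = (\<lambda>x y. h (r_mul M (h' x) (h' y))),
      r_Kx = (\<lambda>x. r_Kx M (h' x)), r_le = (\<lambda>x y. r_le M (h' x) (h' y)),
      s_rv = (\<lambda>x. h (s_rv M (g' x))), s_sn = (\<lambda>x. g (s_sn M (h' x)))\<rparr>)"

context
  fixes M :: "('v, 'r) struct" and g :: "'v \<Rightarrow> 'w" and h :: "'r \<Rightarrow> 's"
  assumes M: "is_structure M" and g: "inj_on g (VF M)" and h: "inj_on h (RV0 M)"
begin

lemma transport_structure: "is_structure (transport g h M)"
  using M by (simp add: is_structure_def transport_def Let_def g h)

lemma transport_eval:
  assumes "range e \<subseteq> VF M" "range f \<subseteq> RV0 M"
  shows "veval (transport g h M) (g \<circ> e) (h \<circ> f) t = g (veval M e f t)"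
    "reval (transport g h M) (g \<circ> e) (h \<circ> f) u = h (reval M e f u)"
  by (induction t and u)
    (auto simp: transport_def Let_def g h eval_in[OF M assms])

lemma transport_sat:
  assumes "range e \<subseteq> VF M" "range f \<subseteq> RV0 M"
  shows "sat (transport g h M) (g \<circ> e) (h \<circ> f) \<phi> = sat M e f \<phi>"
  using assms
proof (induction \<phi> arbitrary: e f)
  case (VEq s t)
  then show ?case
    by (simp only: sat.simps transport_eval inj_on_eq_iff[OF g] eval_in[OF M])
next
  case (REq s t)
  then show ?case
    by (simp only: sat.simps transport_eval inj_on_eq_iff[OF h] eval_in[OF M])
next
  case (InKx t)
  then show ?case
    by (simp only: sat.simps transport_eval)
       (simp add: transport_def Let_def h eval_in[OF M])
next
  case (RLe s t)
  then show ?case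
    by (simp only: sat.simps transport_eval)
       (simp add: transport_def Let_def h eval_in[OF M])
next
  case (VEx n \<phi>)
  have "sat (transport g h M) ((g \<circ> e)(n := g a)) (h \<circ> f) \<phi> = sat M (e(n := a)) f \<phi>"
    if "a \<in> VF M" for a
  proof -
    have "(g \<circ> e)(n := g a) = g \<circ> e(n := a)" by auto
    moreover have "range (e(n := a)) \<subseteq> VF M" using VEx.prems that by auto
    ultimately show ?thesis using VEx.IH[of "e(n := a)" f] VEx.prems by (simp only:)
  qed
  moreover have "VF (transport g h M) = g ` VF M" by (simp add: transport_def Let_def)
  ultimately show ?case by (simp only: sat.simps bex_simps cong: bex_cong)
next
  case (REx n \<phi>)
  have "sat (transport g h M) (g \<circ> e) ((h \<circ> f)(n := h a)) \<phi> = sat M e (f(n := a)) \<phi>"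
    if "a \<in> RV0 M" for a
  proof -
    have "(h \<circ> f)(n := h a) = h \<circ> f(n := a)" by auto
    moreover have "range (f(n := a)) \<subseteq> RV0 M" using REx.prems that by auto
    ultimately show ?thesis using REx.IH[of e "f(n := a)"] REx.prems by (simp only:)
  qed
  moreover have "RV0 (transport g h M) = h ` RV0 M" by (simp add: transport_def Let_def)
  ultimately show ?case by (simp only: sat.simps bex_simps cong: bex_cong)
qed simp_all

lemma transport_holds: "holds (transport g h M) \<phi> \<longleftrightarrow> holds M \<phi>"
proof
  assume N: "holds (transport g h M) \<phi>"
  show "holds M \<phi>"
    unfolding holds_def
  proof (intro allI impI)
    fix e :: "nat \<Rightarrow> 'v" and f :: "nat \<Rightarrow> 'r"
    assume ef: "range e \<subseteq> VF M" "range f \<subseteq> RV0 M"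
    then have "range (g \<circ> e) \<subseteq> VF (transport g h M)" "range (h \<circ> f) \<subseteq> RV0 (transport g h M)"
      by (auto simp: transport_def Let_def)
    then show "sat M e f \<phi>" using N transport_sat[OF ef] unfolding holds_def by blast
  qed
next
  assume N: "holds M \<phi>"
  show "holds (transport g h M) \<phi>"
    unfolding holds_def
  proof (intro allI impI)
    fix e :: "nat \<Rightarrow> 'w" and f :: "nat \<Rightarrow> 's"
    assume ef: "range e \<subseteq> VF (transport g h M)" "range f \<subseteq> RV0 (transport g h M)"
    define e' where "e' = inv_into (VF M) g \<circ> e"
    define f' where "f' = inv_into (RV0 M) h \<circ> f"
    have in_im: "e i \<in> g ` VF M" "f i \<in> h ` RV0 M" for i
      using ef by (auto simp: transport_def Let_def)
    have eq: "e = g \<circ> e'" "f = h \<circ> f'"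
      using in_im by (auto simp: e'_def f'_def f_inv_into_f)
    have "range e' \<subseteq> VF M" "range f' \<subseteq> RV0 M"
      using in_im by (auto simp: e'_def f'_def inv_into_into)
    then show "sat (transport g h M) e f \<phi>"
      using N transport_sat[of e' f' \<phi>] unfolding eq holds_def by blast
  qed
qed

end

theorem entails_model:
  fixes M :: "('v, 'r) struct"
  assumes T: "T \<TTurnstile> \<phi>" and M: "is_model M T"
  shows "holds M \<phi>"
  unfolding holds_def
proof (intro allI impI)
  fix e :: "nat \<Rightarrow> 'v" and f :: "nat \<Rightarrow> 'r"
  assume ef: "range e \<subseteq> VF M" "range f \<subseteq> RV0 M"
  have str: "is_structure M" using M by (simp add: is_model_def)
  have cnt: "countable (range e)" "countable (range f)" by simp_all
  obtain A B where AB: "range e \<subseteq> A" "range f \<subseteq> B" "countable A" "countable B"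
    and sub: "A \<subseteq> VF M" "B \<subseteq> RV0 M" and strAB: "is_structure (M\<lparr>VF := A, RV0 := B\<rparr>)"
    and el: "\<And>e f \<phi>. range e \<subseteq> A \<Longrightarrow> range f \<subseteq> B \<Longrightarrow> sat (M\<lparr>VF := A, RV0 := B\<rparr>) e f \<phi> = sat M e f \<phi>"
    by (rule countable_elementary_substructure[OF str ef(1) cnt(1) ef(2) cnt(2)]) (rule that)
  let ?M = "M\<lparr>VF := A, RV0 := B\<rparr>"
  let ?N = "transport (to_nat_on A) (to_nat_on B) ?M"
  have inj: "inj_on (to_nat_on A) (VF ?M)" "inj_on (to_nat_on B) (RV0 ?M)"
    using AB by auto
  have "holds ?M \<sigma>" if "\<sigma> \<in> T" for \<sigma>
    unfolding holds_def
  proof (intro allI impI)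
    fix e' :: "nat \<Rightarrow> 'v" and f' :: "nat \<Rightarrow> 'r"
    assume "range e' \<subseteq> VF ?M" "range f' \<subseteq> RV0 ?M"
    then have *: "range e' \<subseteq> A" "range f' \<subseteq> B" by simp_all
    moreover have "range e' \<subseteq> VF M" "range f' \<subseteq> RV0 M"
      using subset_trans[OF *(1) sub(1)] subset_trans[OF *(2) sub(2)] .
    ultimately have "sat M e' f' \<sigma>" using M that by (simp only: is_model_def holds_def)
    then show "sat ?M e' f' \<sigma>" using el[OF *] by simp
  qed
  then have "is_model ?N T"
    using transport_structure[OF strAB inj] transport_holds[OF strAB inj] by (simp add: is_model_def)
  then have "holds ?N \<phi>" using T unfolding entails_def by blast
  then have "holds ?M \<phi>" using transport_holds[OF strAB inj] by simp
  then have "sat ?M e f \<phi>" using AB(1,2) unfolding holds_def by simp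
  then show "sat M e f \<phi>" using el[OF AB(1,2)] by simp
qed

section \<open>The models of the theory in terms of HOL-Algebra\<close>

text \<open>\<open>is_model_ACVF_dag_iff\<close> below: the models of \<open>ACVF_dag\<close> are exactly the structures that satisfy
  \<open>is_ACVF\<close> and \<open>is_section\<close>, which express the axioms through the notions of HOL-Algebra.\<close>

definition RV :: "('v, 'r) struct \<Rightarrow> 'r set" where
  "RV M = RV0 M - {r_zero M}"

definition RVx :: "('v, 'r) struct \<Rightarrow> 'r set" where
  "RVx M = RV0 M - {r_zero M, r_inf M}"

definition Kx :: "('v, 'r) struct \<Rightarrow> 'r set" where
  "Kx M = {t \<in> RV0 M. r_Kx M t}"

definition VF_ring :: "('v, 'r) struct \<Rightarrow> 'v ring" where
  "VF_ring M = \<lparr>carrier = VF M, monoid.mult = v_mul M, one = v_one M, zero = v_zero M, add = v_add M\<rparr>"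

definition VFx_group :: "('v, 'r) struct \<Rightarrow> 'v monoid" where
  "VFx_group M = \<lparr>carrier = VF M - {v_zero M}, monoid.mult = v_mul M, one = v_one M\<rparr>"

definition K_ring :: "('v, 'r) struct \<Rightarrow> 'r ring" where
  "K_ring M = \<lparr>carrier = insert (r_zero M) (Kx M), monoid.mult = r_mul M, one = r_one M,
     zero = r_zero M, add = r_add M\<rparr>"

definition RVx_group :: "('v, 'r) struct \<Rightarrow> 'r monoid" where
  "RVx_group M = \<lparr>carrier = RVx M, monoid.mult = r_mul M, one = r_one M\<rparr>"

definition val_ring :: "('v, 'r) struct \<Rightarrow> 'v set" where
  "val_ring M = {x \<in> VF M. r_le M (r_one M) (s_rv M x)}"

definition residue :: "('v, 'r) struct \<Rightarrow> 'v \<Rightarrow> 'r" where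
  "residue M x = (if r_Kx M (s_rv M x) then s_rv M x else r_zero M)"

definition is_ACVF :: "('v, 'r) struct \<Rightarrow> bool" where
  "is_ACVF M \<longleftrightarrow>
     (algebraically_closed (VF_ring M) \<and> (\<forall>x\<in>VF M. v_neg M x = \<ominus>\<^bsub>VF_ring M\<^esub> x)) \<and>
     (comm_group (RVx_group M) \<and>
      (\<forall>n\<ge>1. \<forall>t\<in>RVx M. \<exists>s\<in>RVx M. s [^]\<^bsub>RVx_group M\<^esub> (n :: nat) = t) \<and>
      r_zero M \<noteq> r_inf M \<and>
      (\<forall>t\<in>carrier (K_ring M). r_mul M t (r_zero M) = r_zero M \<and> r_mul M (r_zero M) t = r_zero M) \<and>
      (\<forall>t\<in>RV0 M. r_mul M t (r_inf M) = r_inf M \<and> r_mul M (r_inf M) t = r_inf M)) \<and>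
     (algebraically_closed (K_ring M) \<and>
      (\<forall>t\<in>carrier (K_ring M). r_neg M t = \<ominus>\<^bsub>K_ring M\<^esub> t)) \<and>
     ((\<forall>t\<in>RV M. r_le M t t \<and> r_le M t (r_inf M)) \<and>
      (\<forall>r\<in>RV M. \<forall>s\<in>RV M. \<forall>t\<in>RV M. r_le M r s \<longrightarrow> r_le M s t \<longrightarrow> r_le M r t) \<and>
      Kx M = {t \<in> RV M. r_le M t (r_one M) \<and> r_le M (r_one M) t} \<and>
      (\<forall>s\<in>RV M. \<forall>t\<in>RV M. r_le M s t \<longrightarrow> r_le M t s \<longrightarrow> (\<exists>k\<in>Kx M. s = r_mul M k t)) \<and>
      (\<forall>s\<in>RV M. \<forall>t\<in>RV M. r_le M s t \<or> r_le M t s) \<and>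
      (\<forall>r\<in>RVx M. \<forall>s\<in>RVx M. \<forall>t\<in>RVx M. r_le M r s \<longrightarrow> r_le M (r_mul M r t) (r_mul M s t)) \<and>
      (\<exists>t\<in>RVx M. t \<notin> Kx M)) \<and>
     ((\<forall>s\<in>RV0 M. \<forall>t\<in>RV0 M. \<not> (s \<in> carrier (K_ring M) \<and> t \<in> carrier (K_ring M))
         \<longrightarrow> r_add M s t = r_zero M) \<and>
      (\<forall>t\<in>RV0 M - carrier (K_ring M). r_neg M t = r_zero M) \<and>
      (\<forall>t\<in>RVx M - Kx M. r_mul M t (r_zero M) = r_zero M \<and> r_mul M (r_zero M) t = r_zero M) \<and>
      (\<forall>t\<in>RV0 M. \<not> r_le M t (r_zero M) \<and> \<not> r_le M (r_zero M) t)) \<and>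
     (s_rv M (v_zero M) = r_inf M \<and>
      s_rv M \<in> hom (VFx_group M) (RVx_group M) \<and> s_rv M ` (VF M - {v_zero M}) = RVx M \<and>
      (\<forall>x\<in>VF M. \<forall>y\<in>VF M. r_le M (s_rv M x) (s_rv M (v_add M x y)) \<or>
         r_le M (s_rv M y) (s_rv M (v_add M x y)))) \<and>
     residue M \<in> ring_hom ((VF_ring M)\<lparr>carrier := val_ring M\<rparr>) (K_ring M)"

definition is_section :: "('v, 'r) struct \<Rightarrow> bool" where
  "is_section M \<longleftrightarrow>
     s_sn M \<in> hom (RVx_group M) (VFx_group M) \<and>
     s_sn M (r_inf M) = v_zero M \<and>
     (\<forall>t\<in>RV M. s_rv M (s_sn M t) = t) \<and>
     insert (v_zero M) (s_sn M ` Kx M) \<subseteq> val_ring M \<and>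
     subfield (insert (v_zero M) (s_sn M ` Kx M)) (VF_ring M) \<and>
     s_sn M (r_zero M) = v_zero M"

lemma ACVF_dag_sentences:
  assumes "\<sigma> \<in> ACVF_dag"
  shows "fvV \<sigma> = {}" "fvR \<sigma> = {}"
proof -
  have monic_v: "vvars_v (monic (VVar m) VVar n) \<subseteq> insert m {0..<n}"
    "rvars_v (monic (VVar m) VVar n) = {}" for m n
    by (induction n) auto
  have monic_r: "rvars_r (monic (RVar m) RVar n) \<subseteq> insert m {0..<n}"
    "vvars_r (monic (RVar m) RVar n) = {}" for m n
    by (induction n) auto
  have monic_v': "x \<in> vvars_v (monic (VVar n) VVar n) \<Longrightarrow> x = n \<or> x < n"
    and monic_r': "x \<in> rvars_r (monic (RVar n) RVar n) \<Longrightarrow> x = n \<or> x < n" for n x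
    using monic_v(1)[of n n] monic_r(1)[of n n] by auto
  have pow: "rvars_r (RVar m ^ n) \<subseteq> {m}" "vvars_r (RVar m ^ n) = {}" for m n
    by (induction n) auto
  have VAlls_fv: "fvV (VAlls ns \<phi>) = fvV \<phi> - set ns" "fvR (VAlls ns \<phi>) = fvR \<phi>" for ns \<phi>
    by (induction ns) auto
  have RAlls_fv: "fvR (RAlls_in inK ns \<phi>) = fvR \<phi> - set ns" "fvV (RAlls_in inK ns \<phi>) = fvV \<phi>" for ns \<phi>
    by (induction ns) auto
  have "\<forall>\<sigma>\<in>VF_axioms. fvV \<sigma> = {} \<and> fvR \<sigma> = {}"
    using monic_v(2) by (auto simp: VF_axioms_def Let_def VAlls_fv dest: monic_v')
  moreover have "\<forall>\<sigma>\<in>RVx_axioms. fvV \<sigma> = {} \<and> fvR \<sigma> = {}"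
    using pow(2) subsetD[OF pow(1)] by (auto simp: RVx_axioms_def Let_def)
  moreover have "\<forall>\<sigma>\<in>K_axioms. fvV \<sigma> = {} \<and> fvR \<sigma> = {}"
    using monic_r(2) by (auto simp: K_axioms_def Let_def RAlls_fv[simplified] dest: monic_r')
  moreover have "\<forall>\<sigma>\<in>order_axioms \<union> rv_axioms \<union> default_axioms \<union> section_axioms. fvV \<sigma> = {} \<and> fvR \<sigma> = {}"
    by (auto simp: order_axioms_def rv_axioms_def default_axioms_def section_axioms_def Let_def)
  ultimately show "fvV \<sigma> = {}" "fvR \<sigma> = {}"
    using assms unfolding ACVF_dag_def ACVF_def by blast+
qed

lemma holds_sentence:
  assumes M: "is_structure M" and "fvV \<sigma> = {}" "fvR \<sigma> = {}"
  shows "holds M \<sigma> \<longleftrightarrow> sat M (\<lambda>_. v_zero M) (\<lambda>_. r_zero M) \<sigma>"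
proof -
  have "sat M e f \<sigma> = sat M (\<lambda>_. v_zero M) (\<lambda>_. r_zero M) \<sigma>" for e f
    by (rule sat_cong) (simp_all add: assms)
  moreover have "range (\<lambda>_. v_zero M) \<subseteq> VF M" "range (\<lambda>_. r_zero M) \<subseteq> RV0 M"
    using M by (auto simp: is_structure_def)
  ultimately show ?thesis unfolding holds_def by blast
qed

primrec horner :: "('a, 'b) ring_scheme \<Rightarrow> 'a \<Rightarrow> 'a \<Rightarrow> (nat \<Rightarrow> 'a) \<Rightarrow> nat \<Rightarrow> 'a" where
  "horner R a x c 0 = a"
| "horner R a x c (Suc k) = add R (monoid.mult R (horner R a x c k) x) (c k)"

lemma horner_cong: "(\<And>i. i < n \<Longrightarrow> c i = c' i) \<Longrightarrow> horner R a x c n = horner R a x c' n"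
  by (induction n) simp_all

context field
begin

lemma horner_closed:
  assumes "a \<in> carrier R" "x \<in> carrier R" "\<And>i. c i \<in> carrier R"
  shows "horner R a x c n \<in> carrier R"
  by (induction n) (simp_all add: assms)

lemma horner_scale:
  assumes "b \<in> carrier R" "a \<in> carrier R" "x \<in> carrier R" "\<And>i. c i \<in> carrier R"
  shows "b \<otimes> horner R a x c n = horner R (b \<otimes> a) x (\<lambda>i. b \<otimes> c i) n"
proof (induction n)
  case (Suc n)
  have "b \<otimes> (horner R a x c n \<otimes> x \<oplus> c n) = b \<otimes> horner R a x c n \<otimes> x \<oplus> b \<otimes> c n"
    using assms horner_closed[of a x c n] by (simp add: r_distr m_assoc)
  then show ?case by (simp add: Suc)
qed simp

lemma horner_eval:
  assumes "a \<in> carrier R" "x \<in> carrier R" "\<And>i. c i \<in> carrier R"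
  shows "horner R a x c n = eval (a # map c [0..<n]) x"
proof (induction n)
  case 0
  show ?case using assms by simp
next
  case (Suc n)
  have "eval ((a # map c [0..<n]) @ [c n]) x = eval (a # map c [0..<n]) x \<otimes> x \<oplus> c n"
    by (rule eval_append_aux) (use assms in auto)
  then show ?case by (simp add: Suc)
qed

lemma algebraically_closed_iff_horner:
  "algebraically_closed R \<longleftrightarrow>
     (\<forall>n\<ge>1. \<forall>c. (\<forall>i. c i \<in> carrier R) \<longrightarrow> (\<exists>x\<in>carrier R. horner R \<one> x c n = \<zero>))"
proof
  assume "algebraically_closed R"
  then interpret algebraically_closed R .
  show "\<forall>n\<ge>1. \<forall>c. (\<forall>i. c i \<in> carrier R) \<longrightarrow> (\<exists>x\<in>carrier R. horner R \<one> x c n = \<zero>)"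
  proof (intro allI impI)
    fix n :: nat and c :: "nat \<Rightarrow> 'a" assume n: "n \<ge> 1" and c: "\<forall>i. c i \<in> carrier R"
    let ?p = "\<one> # map c [0..<n]"
    have p: "?p \<in> carrier (poly_ring R)"
      using c by (auto simp: sym[OF univ_poly_carrier] polynomial_def)
    have "size (roots ?p) = n" using roots_over_carrier[OF p] by (simp add: splitted_def)
    then have "roots ?p \<noteq> {#}" using n by auto
    then obtain x where "x \<in># roots ?p" by blast
    then have "x \<in> carrier R" "eval ?p x = \<zero>"
      using roots_mem_iff_is_root[OF p, of x] by (simp_all only: is_root_def)
    moreover from this have "horner R \<one> x c n = \<zero>" using horner_eval[of \<one> x c n] c by (simp only: one_closed)
    ultimately show "\<exists>x\<in>carrier R. horner R \<one> x c n = \<zero>" by blast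
  qed
next
  assume *: "\<forall>n\<ge>1. \<forall>c. (\<forall>i. c i \<in> carrier R) \<longrightarrow> (\<exists>x\<in>carrier R. horner R \<one> x c n = \<zero>)"
  show "algebraically_closed R"
  proof (rule algebraically_closedI)
    fix p assume p: "p \<in> carrier (poly_ring R)" "degree p > 1"
    then obtain a q where aq: "p = a # q" by (cases p) auto
    have a: "a \<in> carrier R" "a \<noteq> \<zero>" and q: "set q \<subseteq> carrier R"
      using p unfolding aq sym[OF univ_poly_carrier] polynomial_def by auto
    define c where "c = (\<lambda>i. if i < length q then q ! i else \<zero>)"
    have c: "c i \<in> carrier R" for i using q by (auto simp: c_def)
    have map_c: "map c [0..<length q] = q"
      by (rule nth_equalityI) (auto simp: c_def)
    have inv_a: "inv a \<in> carrier R" "a \<otimes> inv a = \<one>" using a field_Units by auto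
    have "inv a \<otimes> c i \<in> carrier R" for i using inv_a c by simp
    then obtain x where x: "x \<in> carrier R" "horner R \<one> x (\<lambda>i. inv a \<otimes> c i) (length q) = \<zero>"
      using *[rule_format, of "length q" "\<lambda>i. inv a \<otimes> c i"] p(2) aq by auto
    have "a \<otimes> horner R \<one> x (\<lambda>i. inv a \<otimes> c i) (length q) =
        horner R (a \<otimes> \<one>) x (\<lambda>i. a \<otimes> (inv a \<otimes> c i)) (length q)"
      by (rule horner_scale) (use a inv_a c x in auto)
    also have "\<dots> = horner R a x c (length q)"
      using a inv_a(2) m_assoc[OF a(1) inv_a(1) c, symmetric] c by simp
    also have "\<dots> = eval p x" using horner_eval[of a x c "length q", OF a(1) x(1) c] by (simp only: map_c aq)
    finally have "eval p x = \<zero>" using x(2) a(1) by simp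
    then show "\<exists>x\<in>carrier R. eval p x = \<zero>" using x(1) by blast
  qed
qed

end

lemma algebraically_closed_iff:
  fixes R :: "'a ring" (structure)
  assumes zero: "\<zero> \<in> carrier R"
  shows "algebraically_closed R \<and> (\<forall>x\<in>carrier R. nu x = \<ominus> x) \<longleftrightarrow>
     \<one> \<in> carrier R \<and>
     (\<forall>x\<in>carrier R. \<forall>y\<in>carrier R. x \<oplus> y \<in> carrier R) \<and>
     (\<forall>x\<in>carrier R. nu x \<in> carrier R) \<and>
     (\<forall>x\<in>carrier R. \<forall>y\<in>carrier R. x \<otimes> y \<in> carrier R) \<and>
     (\<forall>x\<in>carrier R. \<forall>y\<in>carrier R. \<forall>z\<in>carrier R. (x \<oplus> y) \<oplus> z = x \<oplus> (y \<oplus> z)) \<and>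
     (\<forall>x\<in>carrier R. \<forall>y\<in>carrier R. x \<oplus> y = y \<oplus> x) \<and>
     (\<forall>x\<in>carrier R. \<zero> \<oplus> x = x) \<and>
     (\<forall>x\<in>carrier R. nu x \<oplus> x = \<zero>) \<and>
     (\<forall>x\<in>carrier R. \<forall>y\<in>carrier R. \<forall>z\<in>carrier R. (x \<otimes> y) \<otimes> z = x \<otimes> (y \<otimes> z)) \<and>
     (\<forall>x\<in>carrier R. \<forall>y\<in>carrier R. x \<otimes> y = y \<otimes> x) \<and>
     (\<forall>x\<in>carrier R. \<one> \<otimes> x = x) \<and>
     (\<forall>x\<in>carrier R. \<forall>y\<in>carrier R. \<forall>z\<in>carrier R. (x \<oplus> y) \<otimes> z = x \<otimes> z \<oplus> y \<otimes> z) \<and>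
     \<zero> \<noteq> \<one> \<and>
     (\<forall>x\<in>carrier R. x \<noteq> \<zero> \<longrightarrow> (\<exists>y\<in>carrier R. x \<otimes> y = \<one>)) \<and>
     (\<forall>n\<ge>1. \<forall>c. (\<forall>i. c i \<in> carrier R) \<longrightarrow> (\<exists>x\<in>carrier R. horner R \<one> x c n = \<zero>))"
    (is "?L \<longleftrightarrow> ?R")
proof
  assume L: ?L
  then interpret algebraically_closed R by blast
  have "algebraically_closed R" using L by blast
  moreover have "\<exists>y\<in>carrier R. x \<otimes> y = \<one>" if "x \<in> carrier R" "x \<noteq> \<zero>" for x
    using that field_Units unfolding Units_def by blast
  ultimately show ?R
    using L by (simp add: a_assoc m_assoc l_distr l_neg algebraically_closed_iff_horner)
      (simp add: a_comm m_comm)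
next
  assume R: ?R
  from R have cl: "\<one> \<in> carrier R" "\<forall>x\<in>carrier R. \<forall>y\<in>carrier R. x \<oplus> y \<in> carrier R"
      "\<forall>x\<in>carrier R. nu x \<in> carrier R" "\<forall>x\<in>carrier R. \<forall>y\<in>carrier R. x \<otimes> y \<in> carrier R"
    and ad: "\<forall>x\<in>carrier R. \<forall>y\<in>carrier R. \<forall>z\<in>carrier R. (x \<oplus> y) \<oplus> z = x \<oplus> (y \<oplus> z)"
      "\<forall>x\<in>carrier R. \<forall>y\<in>carrier R. x \<oplus> y = y \<oplus> x"
      "\<forall>x\<in>carrier R. \<zero> \<oplus> x = x" "\<forall>x\<in>carrier R. nu x \<oplus> x = \<zero>"
    and mu: "\<forall>x\<in>carrier R. \<forall>y\<in>carrier R. \<forall>z\<in>carrier R. (x \<otimes> y) \<otimes> z = x \<otimes> (y \<otimes> z)"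
      "\<forall>x\<in>carrier R. \<forall>y\<in>carrier R. x \<otimes> y = y \<otimes> x" "\<forall>x\<in>carrier R. \<one> \<otimes> x = x"
      "\<forall>x\<in>carrier R. \<forall>y\<in>carrier R. \<forall>z\<in>carrier R. (x \<oplus> y) \<otimes> z = x \<otimes> z \<oplus> y \<otimes> z"
    and fi: "\<zero> \<noteq> \<one>" "\<forall>x\<in>carrier R. x \<noteq> \<zero> \<longrightarrow> (\<exists>y\<in>carrier R. x \<otimes> y = \<one>)"
    and ro: "\<forall>n\<ge>1. \<forall>c. (\<forall>i. c i \<in> carrier R) \<longrightarrow> (\<exists>x\<in>carrier R. horner R \<one> x c n = \<zero>)"
    by - (elim conjE, assumption)+
  have "abelian_group R"
    by (rule abelian_groupI) (use cl ad zero in blast)+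
  moreover have "Group.comm_monoid R"
    by (rule comm_monoidI) (use cl mu in blast)+
  ultimately interpret cring R
    by (rule cringI) (use mu in blast)
  interpret field R by (rule cring_fieldI2) (use fi in blast)+
  have "nu x = \<ominus> x" if "x \<in> carrier R" for x
    using cl(3) ad(4) that minus_equality[of "nu x" x] by simp
  moreover have "algebraically_closed R"
    unfolding algebraically_closed_iff_horner by (rule ro)
  ultimately show ?L by blast
qed


lemma veval_monic:
  "veval M e f (monic (VVar m) VVar n) = horner (VF_ring M) (v_one M) (e m) e n"
  by (induction n) (simp_all add: VF_ring_def)

lemma reval_monic:
  "reval M e f (monic (RVar m) RVar n) = horner (K_ring M) (r_one M) (f m) f n"
  by (induction n) (simp_all add: K_ring_def)

lemma sat_VAlls:
  "sat M e f (VAlls ns \<phi>) \<longleftrightarrow>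
     (\<forall>c. (\<forall>i\<in>set ns. c i \<in> VF M) \<longrightarrow> sat M (\<lambda>i. if i \<in> set ns then c i else e i) f \<phi>)"
proof (induction ns arbitrary: e)
  case (Cons n ns)
  have "sat M e f (VAlls (n # ns) \<phi>) \<longleftrightarrow> (\<forall>a\<in>VF M. sat M (e(n := a)) f (VAlls ns \<phi>))" by simp
  also have "\<dots> \<longleftrightarrow> (\<forall>a\<in>VF M. \<forall>c. (\<forall>i\<in>set ns. c i \<in> VF M) \<longrightarrow>
      sat M (\<lambda>i. if i \<in> set ns then c i else (e(n := a)) i) f \<phi>)"
    by (simp only: Cons.IH)
  also have "\<dots> \<longleftrightarrow> (\<forall>c. (\<forall>i\<in>set (n # ns). c i \<in> VF M) \<longrightarrow>
      sat M (\<lambda>i. if i \<in> set (n # ns) then c i else e i) f \<phi>)"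
  proof (intro iffI allI ballI impI)
    fix c assume *: "\<forall>a\<in>VF M. \<forall>c. (\<forall>i\<in>set ns. c i \<in> VF M) \<longrightarrow>
      sat M (\<lambda>i. if i \<in> set ns then c i else (e(n := a)) i) f \<phi>"
      and c: "\<forall>i\<in>set (n # ns). c i \<in> VF M"
    have "(\<lambda>i. if i \<in> set (n # ns) then c i else e i) =
      (\<lambda>i. if i \<in> set ns then c i else (e(n := c n)) i)" by auto
    then show "sat M (\<lambda>i. if i \<in> set (n # ns) then c i else e i) f \<phi>" using * c by simp
  next
    fix a c assume *: "\<forall>c. (\<forall>i\<in>set (n # ns). c i \<in> VF M) \<longrightarrow>
      sat M (\<lambda>i. if i \<in> set (n # ns) then c i else e i) f \<phi>"
      and a: "a \<in> VF M" and c: "\<forall>i\<in>set ns. c i \<in> VF M"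
    define d where "d = (\<lambda>i. if i \<in> set ns then c i else a)"
    have "(\<lambda>i. if i \<in> set ns then c i else (e(n := a)) i) =
      (\<lambda>i. if i \<in> set (n # ns) then d i else e i)" by (auto simp: d_def)
    moreover have "\<forall>i\<in>set (n # ns). d i \<in> VF M" using a c by (simp add: d_def)
    ultimately show "sat M (\<lambda>i. if i \<in> set ns then c i else (e(n := a)) i) f \<phi>"
      using * by metis
  qed
  finally show ?case .
qed simp

lemma sat_RAlls_inK:
  "sat M e f (RAlls_in inK ns \<phi>) \<longleftrightarrow>
     (\<forall>c. (\<forall>i\<in>set ns. c i \<in> RV0 M \<and> sat M e c (inK (RVar i))) \<longrightarrow>
       sat M e (\<lambda>i. if i \<in> set ns then c i else f i) \<phi>)"
proof (induction ns arbitrary: f)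
  case (Cons n ns)
  let ?P = "\<lambda>a. a \<in> RV0 M \<and> (r_Kx M a \<or> a = r_zero M)"
  have P: "c i \<in> RV0 M \<and> sat M e c (inK (RVar i)) \<longleftrightarrow> ?P (c i)" for c i by auto
  have "sat M e f (RAlls_in inK (n # ns) \<phi>) \<longleftrightarrow> (\<forall>a. ?P a \<longrightarrow> sat M e (f(n := a)) (RAlls_in inK ns \<phi>))"
    by auto
  also have "\<dots> \<longleftrightarrow> (\<forall>a. ?P a \<longrightarrow> (\<forall>c. (\<forall>i\<in>set ns. ?P (c i)) \<longrightarrow>
      sat M e (\<lambda>i. if i \<in> set ns then c i else (f(n := a)) i) \<phi>))"
    by (simp only: Cons.IH P)
  also have "\<dots> \<longleftrightarrow> (\<forall>c. (\<forall>i\<in>set (n # ns). ?P (c i)) \<longrightarrow>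
      sat M e (\<lambda>i. if i \<in> set (n # ns) then c i else f i) \<phi>)"
  proof (intro iffI allI impI)
    fix c assume *: "\<forall>a. ?P a \<longrightarrow> (\<forall>c. (\<forall>i\<in>set ns. ?P (c i)) \<longrightarrow>
      sat M e (\<lambda>i. if i \<in> set ns then c i else (f(n := a)) i) \<phi>)"
      and c: "\<forall>i\<in>set (n # ns). ?P (c i)"
    have "(\<lambda>i. if i \<in> set (n # ns) then c i else f i) =
      (\<lambda>i. if i \<in> set ns then c i else (f(n := c n)) i)" by auto
    then show "sat M e (\<lambda>i. if i \<in> set (n # ns) then c i else f i) \<phi>"
      using *[rule_format, of "c n" c] c by simp
  next
    fix a c assume *: "\<forall>c. (\<forall>i\<in>set (n # ns). ?P (c i)) \<longrightarrow>
      sat M e (\<lambda>i. if i \<in> set (n # ns) then c i else f i) \<phi>"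
      and a: "?P a" and c: "\<forall>i\<in>set ns. ?P (c i)"
    define d where "d = (\<lambda>i. if i \<in> set ns then c i else a)"
    have "(\<lambda>i. if i \<in> set ns then c i else (f(n := a)) i) =
      (\<lambda>i. if i \<in> set (n # ns) then d i else f i)" by (auto simp: d_def)
    moreover have "\<forall>i\<in>set (n # ns). ?P (d i)" using a c by (simp add: d_def)
    ultimately show "sat M e (\<lambda>i. if i \<in> set ns then c i else (f(n := a)) i) \<phi>"
      using * by metis
  qed
  finally show ?case by (simp only: P)
qed simp

lemma horner_schema:
  assumes "z \<in> S"
  shows "(\<forall>c. (\<forall>i\<in>{0..<n}. c i \<in> S) \<longrightarrow>
      (\<exists>x\<in>S. horner R a x ((\<lambda>i. if i \<in> {0..<n} then c i else e i)(n := x)) n = z)) \<longleftrightarrow>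
    (\<forall>c. (\<forall>i. c i \<in> S) \<longrightarrow> (\<exists>x\<in>S. horner R a x c n = z))"
proof -
  have *: "horner R a x ((\<lambda>i. if i \<in> {0..<n} then c i else e i)(n := x)) n = horner R a x c n" for x c
    by (rule horner_cong) simp
  have "\<exists>x\<in>S. horner R a x c n = z"
    if H: "\<forall>c. (\<forall>i. c i \<in> S) \<longrightarrow> (\<exists>x\<in>S. horner R a x c n = z)" and c: "\<forall>i\<in>{0..<n}. c i \<in> S" for c
  proof -
    have "horner R a x c n = horner R a x (\<lambda>i. if i < n then c i else z) n" for x
      by (rule horner_cong) simp
    then show ?thesis using H[rule_format, of "\<lambda>i. if i < n then c i else z"] c assms by simp
  qed
  then show ?thesis unfolding * by blast
qed

lemma VF_axioms_iff:
  assumes "is_structure M"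
  shows "(\<forall>\<sigma>\<in>VF_axioms. sat M e f \<sigma>) \<longleftrightarrow>
    algebraically_closed (VF_ring M) \<and> (\<forall>x\<in>VF M. v_neg M x = \<ominus>\<^bsub>VF_ring M\<^esub> x)"
proof -
  have z: "v_zero M \<in> VF M" using assms by (simp add: is_structure_def)
  have "sat M e f (VAlls [0..<n] (VEx n (monic (VVar n) VVar n \<doteq>\<^sub>v 0))) \<longleftrightarrow>
      (\<forall>c. (\<forall>i. c i \<in> VF M) \<longrightarrow> (\<exists>x\<in>VF M. horner (VF_ring M) (v_one M) x c n = v_zero M))" for n
    using horner_schema[OF z, of n "VF_ring M" "v_one M" e] by (simp add: sat_VAlls veval_monic)
  then have ac: "(\<forall>\<sigma>\<in>{VAlls [0..<n] (VEx n (monic (VVar n) VVar n \<doteq>\<^sub>v 0)) | n. n \<ge> 1}. sat M e f \<sigma>) \<longleftrightarrow>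
      (\<forall>n\<ge>1. \<forall>c. (\<forall>i. c i \<in> VF M) \<longrightarrow> (\<exists>x\<in>VF M. horner (VF_ring M) (v_one M) x c n = v_zero M))"
    by blast
  have R: "carrier (VF_ring M) = VF M" "zero (VF_ring M) = v_zero M" "one (VF_ring M) = v_one M"
    "add (VF_ring M) = v_add M" "monoid.mult (VF_ring M) = v_mul M"
    by (simp_all add: VF_ring_def)
  have cl: "v_one M \<in> VF M" "\<forall>x\<in>VF M. \<forall>y\<in>VF M. v_add M x y \<in> VF M"
    "\<forall>x\<in>VF M. v_neg M x \<in> VF M" "\<forall>x\<in>VF M. \<forall>y\<in>VF M. v_mul M x y \<in> VF M"
    using assms by (simp_all add: is_structure_def)
  show ?thesis
    using algebraically_closed_iff[of "VF_ring M" "v_neg M"] z cl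
    unfolding VF_axioms_def Let_def ball_Un ac R
    by (simp add: disj_imp)
qed

lemma K_axioms_iff:
  assumes "is_structure M"
  shows "(\<forall>\<sigma>\<in>K_axioms. sat M e f \<sigma>) \<longleftrightarrow>
    algebraically_closed (K_ring M) \<and> (\<forall>x\<in>carrier (K_ring M). r_neg M x = \<ominus>\<^bsub>K_ring M\<^esub> x)"
proof -
  let ?K = "carrier (K_ring M)"
  have M: "r_zero M \<in> RV0 M" "r_one M \<in> RV0 M" "\<forall>x\<in>RV0 M. \<forall>y\<in>RV0 M. r_add M x y \<in> RV0 M"
    "\<forall>x\<in>RV0 M. r_neg M x \<in> RV0 M" "\<forall>x\<in>RV0 M. \<forall>y\<in>RV0 M. r_mul M x y \<in> RV0 M"
    using assms by (simp_all add: is_structure_def)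
  then have K: "x \<in> ?K \<longleftrightarrow> x \<in> RV0 M \<and> (r_Kx M x \<or> x = r_zero M)" for x
    by (auto simp: K_ring_def Kx_def)
  have z: "r_zero M \<in> ?K" by (simp add: K_ring_def)
  have "sat M e f (RAlls_in inK [0..<n] (REx_in inK n (monic (RVar n) RVar n \<doteq>\<^sub>r 0))) \<longleftrightarrow>
      (\<forall>c. (\<forall>i\<in>{0..<n}. c i \<in> ?K) \<longrightarrow>
      (\<exists>x\<in>?K. horner (K_ring M) (r_one M) x ((\<lambda>i. if i \<in> {0..<n} then c i else f i)(n := x)) n = r_zero M))" for n
    unfolding sat_RAlls_inK by (auto simp: reval_monic K Bex_def)
  then have "sat M e f (RAlls_in inK [0..<n] (REx_in inK n (monic (RVar n) RVar n \<doteq>\<^sub>r 0))) \<longleftrightarrow>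
      (\<forall>c. (\<forall>i. c i \<in> ?K) \<longrightarrow> (\<exists>x\<in>?K. horner (K_ring M) (r_one M) x c n = r_zero M))" for n
    by (simp only: horner_schema[OF z])
  then have ac: "(\<forall>\<sigma>\<in>{RAlls_in inK [0..<n] (REx_in inK n (monic (RVar n) RVar n \<doteq>\<^sub>r 0)) | n. n \<ge> 1}. sat M e f \<sigma>) \<longleftrightarrow>
      (\<forall>n\<ge>1. \<forall>c. (\<forall>i. c i \<in> ?K) \<longrightarrow> (\<exists>x\<in>?K. horner (K_ring M) (r_one M) x c n = r_zero M))"
    by blast
  have R: "zero (K_ring M) = r_zero M" "one (K_ring M) = r_one M"
    "add (K_ring M) = r_add M" "monoid.mult (K_ring M) = r_mul M"
    by (simp_all add: K_ring_def)
  have K': "(\<forall>x\<in>?K. P x) \<longleftrightarrow> (\<forall>x\<in>RV0 M. (\<not> r_Kx M x \<longrightarrow> x = r_zero M) \<longrightarrow> P x)"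
    "(\<exists>x\<in>?K. P x) \<longleftrightarrow> (\<exists>x\<in>RV0 M. (\<not> r_Kx M x \<longrightarrow> x = r_zero M) \<and> P x)" for P
    using K by blast+
  have cl: "r_one M \<in> ?K \<longleftrightarrow> (\<not> r_Kx M (r_one M) \<longrightarrow> r_one M = r_zero M)"
    "(\<forall>x\<in>?K. \<forall>y\<in>?K. r_add M x y \<in> ?K) \<longleftrightarrow>
       (\<forall>x\<in>?K. \<forall>y\<in>?K. \<not> r_Kx M (r_add M x y) \<longrightarrow> r_add M x y = r_zero M)"
    "(\<forall>x\<in>?K. \<forall>y\<in>?K. r_mul M x y \<in> ?K) \<longleftrightarrow>
       (\<forall>x\<in>?K. \<forall>y\<in>?K. \<not> r_Kx M (r_mul M x y) \<longrightarrow> r_mul M x y = r_zero M)"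
    "(\<forall>x\<in>?K. r_neg M x \<in> ?K) \<longleftrightarrow> (\<forall>x\<in>?K. \<not> r_Kx M (r_neg M x) \<longrightarrow> r_neg M x = r_zero M)"
    using M K by blast+
  let ?AC = "\<forall>n\<ge>1. \<forall>c. (\<forall>i. c i \<in> ?K) \<longrightarrow> (\<exists>x\<in>?K. horner (K_ring M) (r_one M) x c n = r_zero M)"
  define AC where "AC = ?AC"
  show ?thesis
    using algebraically_closed_iff[of "K_ring M" "r_neg M"] z
    unfolding K_axioms_def Let_def ball_Un ac R
    unfolding cl AC_def[symmetric]
    unfolding K'
    by (simp add: disj_imp)
qed


lemma comm_group_iff:
  fixes G (structure)
  shows "comm_group G \<longleftrightarrow> \<one> \<in> carrier G \<and>
    (\<forall>x\<in>carrier G. \<forall>y\<in>carrier G. x \<otimes> y \<in> carrier G) \<and>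
    (\<forall>x\<in>carrier G. \<forall>y\<in>carrier G. \<forall>z\<in>carrier G. (x \<otimes> y) \<otimes> z = x \<otimes> (y \<otimes> z)) \<and>
    (\<forall>x\<in>carrier G. \<forall>y\<in>carrier G. x \<otimes> y = y \<otimes> x) \<and>
    (\<forall>x\<in>carrier G. \<one> \<otimes> x = x) \<and>
    (\<forall>x\<in>carrier G. \<exists>y\<in>carrier G. y \<otimes> x = \<one>)" (is "?L \<longleftrightarrow> ?R")
proof
  assume ?L
  then interpret comm_group G .
  show ?R using l_inv_ex by (simp add: m_assoc) (simp add: m_comm)
next
  assume ?R
  then show ?L by (intro comm_groupI) blast+
qed

lemma RVx_axioms_iff:
  fixes M :: "('v, 'r) struct"
  assumes M: "is_structure M"
  shows "(\<forall>\<sigma>\<in>RVx_axioms. sat M e f \<sigma>) \<longleftrightarrow>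
     comm_group (RVx_group M) \<and>
     (\<forall>n\<ge>1. \<forall>t\<in>RVx M. \<exists>s\<in>RVx M. s [^]\<^bsub>RVx_group M\<^esub> (n :: nat) = t) \<and>
     r_zero M \<noteq> r_inf M \<and>
     (\<forall>t\<in>carrier (K_ring M). r_mul M t (r_zero M) = r_zero M \<and> r_mul M (r_zero M) t = r_zero M) \<and>
     (\<forall>t\<in>RV0 M. r_mul M t (r_inf M) = r_inf M \<and> r_mul M (r_inf M) t = r_inf M)"
proof -
  let ?D = "{RAlls_in inRVx [0] (REx_in inRVx 1 (RVar 1 ^ n \<doteq>\<^sub>r RVar 0)) | n. n \<ge> 1}"
  have Ball: "(\<forall>x\<in>RVx M. P x) \<longleftrightarrow> (\<forall>x\<in>RV0 M. \<not> x = r_zero M \<longrightarrow> \<not> x = r_inf M \<longrightarrow> P x)"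
    "(\<exists>x\<in>RVx M. P x) \<longleftrightarrow> (\<exists>x\<in>RV0 M. (x \<noteq> r_zero M \<and> x \<noteq> r_inf M) \<and> P x)" for P
    unfolding RVx_def by blast+
  have BallK: "(\<forall>x\<in>carrier (K_ring M). P x) \<longleftrightarrow>
      (\<forall>x\<in>RV0 M. (\<not> r_Kx M x \<longrightarrow> x = r_zero M) \<longrightarrow> P x)" for P
    using M by (auto simp: K_ring_def Kx_def is_structure_def)
  have G: "carrier (RVx_group M) = RVx M" "one (RVx_group M) = r_one M"
    "monoid.mult (RVx_group M) = r_mul M" by (simp_all add: RVx_group_def)
  have cl: "r_one M \<in> RVx M \<longleftrightarrow> r_one M \<noteq> r_zero M \<and> r_one M \<noteq> r_inf M"
    "(\<forall>x\<in>RVx M. \<forall>y\<in>RVx M. r_mul M x y \<in> RVx M) \<longleftrightarrow>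
       (\<forall>x\<in>RVx M. \<forall>y\<in>RVx M. r_mul M x y \<noteq> r_zero M \<and> r_mul M x y \<noteq> r_inf M)"
    using M unfolding is_structure_def RVx_def by blast+
  have fin: "(\<forall>\<sigma>\<in>RVx_axioms. sat M e f \<sigma>) \<longleftrightarrow>
     comm_group (RVx_group M) \<and> (\<forall>\<sigma>\<in>?D. sat M e f \<sigma>) \<and>
     r_zero M \<noteq> r_inf M \<and>
     (\<forall>t\<in>carrier (K_ring M). r_mul M t (r_zero M) = r_zero M \<and> r_mul M (r_zero M) t = r_zero M) \<and>
     (\<forall>t\<in>RV0 M. r_mul M t (r_inf M) = r_inf M \<and> r_mul M (r_inf M) t = r_inf M)"
    unfolding RVx_axioms_def Let_def ball_Un comm_group_iff G
    unfolding cl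
    unfolding Ball BallK
    by (simp del: One_nat_def add: disj_imp) argo
  have "(\<forall>\<sigma>\<in>?D. sat M e f \<sigma>) \<longleftrightarrow>
     (\<forall>n\<ge>1. \<forall>t\<in>RVx M. \<exists>s\<in>RVx M. s [^]\<^bsub>RVx_group M\<^esub> (n :: nat) = t)"
    if "comm_group (RVx_group M)"
  proof -
    interpret comm_group "RVx_group M" by fact
    have pow: "reval M e f (RVar m ^ n) = f m [^]\<^bsub>RVx_group M\<^esub> n" if "f m \<in> RVx M" for e f m n
    proof (induction n)
      case (Suc n)
      have "f m [^]\<^bsub>RVx_group M\<^esub> Suc n = r_mul M (f m) (f m [^]\<^bsub>RVx_group M\<^esub> n)"
        using nat_pow_Suc2[of "f m" n] that by (simp add: G)
      then show ?case using Suc by simp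
    qed (simp add: G)
    have "sat M e f (RAlls_in inRVx [0] (REx_in inRVx 1 (RVar 1 ^ n \<doteq>\<^sub>r RVar 0))) \<longleftrightarrow>
        (\<forall>t\<in>RVx M. \<exists>s\<in>RVx M. s [^]\<^bsub>RVx_group M\<^esub> n = t)" for n
    proof -
      have "reval M e (f(0 := t, Suc 0 := s)) (RVar (Suc 0) ^ n) = s [^]\<^bsub>RVx_group M\<^esub> n"
        if "s \<in> RVx M" for s t
        using pow[of "f(0 := t, Suc 0 := s)" "Suc 0"] that by simp
      moreover have "sat M e f (RAlls_in inRVx [0] (REx_in inRVx 1 (RVar 1 ^ n \<doteq>\<^sub>r RVar 0))) \<longleftrightarrow>
          (\<forall>t\<in>RVx M. \<exists>s\<in>RVx M. reval M e (f(0 := t, Suc 0 := s)) (RVar (Suc 0) ^ n) = t)"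
        by (auto simp: RVx_def)
      ultimately show ?thesis by (simp only: cong: bex_cong)
    qed
    then show ?thesis by blast
  qed
  then show ?thesis using fin by blast
qed

lemma order_axioms_iff:
  assumes M: "is_structure M"
  shows "(\<forall>\<sigma>\<in>order_axioms. sat M e f \<sigma>) \<longleftrightarrow>
     (\<forall>t\<in>RV M. r_le M t t \<and> r_le M t (r_inf M)) \<and>
     (\<forall>r\<in>RV M. \<forall>s\<in>RV M. \<forall>t\<in>RV M. r_le M r s \<longrightarrow> r_le M s t \<longrightarrow> r_le M r t) \<and>
     Kx M = {t \<in> RV M. r_le M t (r_one M) \<and> r_le M (r_one M) t} \<and>
     (\<forall>s\<in>RV M. \<forall>t\<in>RV M. r_le M s t \<longrightarrow> r_le M t s \<longrightarrow> (\<exists>k\<in>Kx M. s = r_mul M k t)) \<and>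
     (\<forall>s\<in>RV M. \<forall>t\<in>RV M. r_le M s t \<or> r_le M t s) \<and>
     (\<forall>r\<in>RVx M. \<forall>s\<in>RVx M. \<forall>t\<in>RVx M. r_le M r s \<longrightarrow> r_le M (r_mul M r t) (r_mul M s t)) \<and>
     (\<exists>t\<in>RVx M. t \<notin> Kx M)"
proof -
  have Ball: "(\<forall>x\<in>RVx M. P x) \<longleftrightarrow> (\<forall>x\<in>RV0 M. \<not> x = r_zero M \<longrightarrow> \<not> x = r_inf M \<longrightarrow> P x)"
    "(\<forall>x\<in>RV M. P x) \<longleftrightarrow> (\<forall>x\<in>RV0 M. \<not> x = r_zero M \<longrightarrow> P x)" for P
    unfolding RVx_def RV_def by blast+
  have Bex: "(\<exists>x\<in>RVx M. P x) \<longleftrightarrow> (\<exists>x\<in>RV0 M. (x \<noteq> r_zero M \<and> x \<noteq> r_inf M) \<and> P x)"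
    "(\<exists>x\<in>Kx M. P x) \<longleftrightarrow> (\<exists>x\<in>RV0 M. r_Kx M x \<and> P x)" for P
    unfolding RVx_def Kx_def by blast+
  have K: "Kx M = {t \<in> RV M. P t \<and> Q t} \<longleftrightarrow>
      (\<forall>t\<in>RV0 M. r_Kx M t \<longrightarrow> t \<noteq> r_zero M \<and> P t \<and> Q t) \<and>
      (\<forall>t\<in>RV0 M. t \<noteq> r_zero M \<longrightarrow> P t \<longrightarrow> Q t \<longrightarrow> r_Kx M t)" for P Q
    unfolding Kx_def RV_def by blast
  have nK: "(\<exists>t\<in>RVx M. t \<notin> Kx M) \<longleftrightarrow> (\<exists>t\<in>RVx M. \<not> r_Kx M t)"
    unfolding Kx_def RVx_def by blast
  show ?thesis
    unfolding order_axioms_def Let_def K nK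
    unfolding ball_conj_distrib
    unfolding Ball Bex
    by (simp del: One_nat_def add: disj_imp ball_conj_distrib) argo
qed

lemma default_axioms_iff:
  assumes M: "is_structure M"
  shows "(\<forall>\<sigma>\<in>default_axioms. sat M e f \<sigma>) \<longleftrightarrow>
     (\<forall>s\<in>RV0 M. \<forall>t\<in>RV0 M. \<not> (s \<in> carrier (K_ring M) \<and> t \<in> carrier (K_ring M))
        \<longrightarrow> r_add M s t = r_zero M) \<and>
     (\<forall>t\<in>RV0 M - carrier (K_ring M). r_neg M t = r_zero M) \<and>
     (\<forall>t\<in>RVx M - Kx M. r_mul M t (r_zero M) = r_zero M \<and> r_mul M (r_zero M) t = r_zero M) \<and>
     (\<forall>t\<in>RV0 M. \<not> r_le M t (r_zero M) \<and> \<not> r_le M (r_zero M) t)"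
  unfolding default_axioms_def Let_def K_ring_def Kx_def RVx_def by auto


locale pre_ACVF =
  fixes M :: "('v, 'r) struct"
  assumes struct: "is_structure M"
    and VF: "algebraically_closed (VF_ring M)"
    and v_neg: "\<And>x. x \<in> VF M \<Longrightarrow> v_neg M x = \<ominus>\<^bsub>VF_ring M\<^esub> x"
    and RVx: "comm_group (RVx_group M)"
    and zero_inf: "r_zero M \<noteq> r_inf M"
    and inf_mult: "\<And>t. t \<in> RV0 M \<Longrightarrow> r_mul M t (r_inf M) = r_inf M"
    and K: "algebraically_closed (K_ring M)"
    and le_refl: "\<And>t. t \<in> RV M \<Longrightarrow> r_le M t t"
    and le_inf: "\<And>t. t \<in> RV M \<Longrightarrow> r_le M t (r_inf M)"
    and le_trans: "\<And>r s t. r \<in> RV M \<Longrightarrow> s \<in> RV M \<Longrightarrow> t \<in> RV M \<Longrightarrow>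
      r_le M r s \<Longrightarrow> r_le M s t \<Longrightarrow> r_le M r t"
    and Kx: "Kx M = {t \<in> RV M. r_le M t (r_one M) \<and> r_le M (r_one M) t}"
    and antisym: "\<And>s t. s \<in> RV M \<Longrightarrow> t \<in> RV M \<Longrightarrow> r_le M s t \<Longrightarrow> r_le M t s \<Longrightarrow>
      \<exists>k\<in>Kx M. s = r_mul M k t"
    and compat: "\<And>r s t. r \<in> RVx M \<Longrightarrow> s \<in> RVx M \<Longrightarrow> t \<in> RVx M \<Longrightarrow> r_le M r s \<Longrightarrow>
      r_le M (r_mul M r t) (r_mul M s t)"
    and rv_zero: "s_rv M (v_zero M) = r_inf M"
    and rv_hom: "s_rv M \<in> hom (VFx_group M) (RVx_group M)"
    and ultrametric: "\<And>x y. x \<in> VF M \<Longrightarrow> y \<in> VF M \<Longrightarrow>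
      r_le M (s_rv M x) (s_rv M (v_add M x y)) \<or> r_le M (s_rv M y) (s_rv M (v_add M x y))"
begin

sublocale VF: algebraically_closed "VF_ring M" by (rule VF)
sublocale K: algebraically_closed "K_ring M" by (rule K)
sublocale RVx: comm_group "RVx_group M" by (rule RVx)

lemma ops [simp]:
  "carrier (VF_ring M) = VF M" "\<zero>\<^bsub>VF_ring M\<^esub> = v_zero M" "\<one>\<^bsub>VF_ring M\<^esub> = v_one M"
  "x \<oplus>\<^bsub>VF_ring M\<^esub> y = v_add M x y" "x \<otimes>\<^bsub>VF_ring M\<^esub> y = v_mul M x y"
  "carrier (RVx_group M) = RVx M" "\<one>\<^bsub>RVx_group M\<^esub> = r_one M" "s \<otimes>\<^bsub>RVx_group M\<^esub> t = r_mul M s t"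
  "carrier (K_ring M) = insert (r_zero M) (Kx M)" "\<zero>\<^bsub>K_ring M\<^esub> = r_zero M" "\<one>\<^bsub>K_ring M\<^esub> = r_one M"
  "s \<oplus>\<^bsub>K_ring M\<^esub> t = r_add M s t" "s \<otimes>\<^bsub>K_ring M\<^esub> t = r_mul M s t"
  by (simp_all add: VF_ring_def RVx_group_def K_ring_def)

lemmas VF_facts = VF.zero_closed VF.one_closed VF.a_closed VF.m_closed VF.zero_not_one
  VF.l_null VF.r_null VF.integral VF.a_inv_closed
lemmas v_facts [simp] = VF_facts[simplified]

lemma Kx_RVx: "Kx M \<subseteq> RVx M"
proof -
  have "r_inf M \<notin> Kx M"
  proof
    assume inf: "r_inf M \<in> Kx M"
    then have "r_le M (r_inf M) (r_one M)" "r_le M (r_one M) (r_inf M)" using Kx by auto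
    moreover have "r_one M \<in> RV M" "r_inf M \<in> RV M"
      using RVx.one_closed inf Kx by (auto simp: RVx_def RV_def)
    ultimately obtain k where "k \<in> Kx M" "r_one M = r_mul M k (r_inf M)" using antisym by blast
    then have "r_one M = r_inf M" using inf_mult[of k] by (auto simp: Kx_def)
    then show False using RVx.one_closed by (simp add: RVx_def)
  qed
  then show ?thesis using Kx by (auto simp: RVx_def RV_def)
qed

lemma inf_notin: "\<not> r_Kx M (r_inf M)"
  using Kx_RVx struct by (auto simp: RVx_def Kx_def is_structure_def)

lemma RVx_RV: "t \<in> RVx M \<Longrightarrow> t \<in> RV M" by (simp add: RVx_def RV_def)

lemma one_Kx: "r_one M \<in> Kx M"
  using RVx.one_closed le_refl[of "r_one M"] Kx RVx_RV by simp

lemma Kx_mult: assumes "s \<in> Kx M" "t \<in> Kx M" shows "r_mul M s t \<in> Kx M"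
proof -
  have "s \<noteq> r_zero M" "t \<noteq> r_zero M" using assms Kx by (auto simp: RV_def)
  then show ?thesis using K.m_closed[of s t] K.integral[of s t] assms by auto
qed

lemma rv_RVx: "x \<in> VF M \<Longrightarrow> x \<noteq> v_zero M \<Longrightarrow> s_rv M x \<in> RVx M"
  using rv_hom by (auto simp: hom_def VFx_group_def)

lemma rv_mult: "x \<in> VF M \<Longrightarrow> x \<noteq> v_zero M \<Longrightarrow> y \<in> VF M \<Longrightarrow> y \<noteq> v_zero M \<Longrightarrow>
    s_rv M (v_mul M x y) = r_mul M (s_rv M x) (s_rv M y)"
  using rv_hom by (auto simp: hom_def VFx_group_def)

lemma inf_RV: "r_inf M \<in> RV M"
  using struct zero_inf by (auto simp: RV_def is_structure_def)

lemma rv_RV: "x \<in> VF M \<Longrightarrow> s_rv M x \<in> RV M"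
  using rv_RVx[of x] RVx_RV[of "s_rv M x"] rv_zero inf_RV by (cases "x = v_zero M") simp_all

lemma rv_one: "s_rv M (v_one M) = r_one M"
proof -
  have 1: "v_one M \<in> VF M" "v_one M \<noteq> v_zero M" using VF.one_closed VF.one_not_zero by simp_all
  have "r_mul M (s_rv M (v_one M)) (s_rv M (v_one M)) = s_rv M (v_one M)"
    using rv_mult[OF 1 1] VF.l_one[of "v_one M"] by simp
  then show ?thesis using RVx.l_cancel_one[of "s_rv M (v_one M)" "s_rv M (v_one M)"] rv_RVx[OF 1] by simp
qed

lemma le_one_RV: "r_one M \<in> RV M" using RVx.one_closed RVx_RV by simp

lemma residue_Kx: "x \<in> VF M \<Longrightarrow> r_Kx M (s_rv M x) \<Longrightarrow> s_rv M x \<in> Kx M"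
  using rv_RV by (auto simp: Kx_def RV_def)

lemma isRes_iff:
  assumes "x \<in> VF M"
  shows "(r_Kx M (s_rv M x) \<and> t = s_rv M x \<or>
      r_le M (r_one M) (s_rv M x) \<and> \<not> r_le M (s_rv M x) (r_one M) \<and> t = r_zero M) \<longleftrightarrow>
    x \<in> val_ring M \<and> t = residue M x"
proof -
  have "r_Kx M (s_rv M x) \<longleftrightarrow> r_le M (s_rv M x) (r_one M) \<and> r_le M (r_one M) (s_rv M x)"
    using Kx rv_RV[OF assms] by (auto simp: Kx_def RV_def)
  then show ?thesis using assms by (auto simp: val_ring_def residue_def)
qed

lemma residue_in_K: "x \<in> val_ring M \<Longrightarrow> residue M x \<in> insert (r_zero M) (Kx M)"
  using residue_Kx[of x] by (simp add: residue_def val_ring_def)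

lemma val_ring_add: "x \<in> val_ring M \<Longrightarrow> y \<in> val_ring M \<Longrightarrow> v_add M x y \<in> val_ring M"
  using ultrametric[of x y] le_trans[OF le_one_RV rv_RV[of x] rv_RV[of "v_add M x y"]]
    le_trans[OF le_one_RV rv_RV[of y] rv_RV[of "v_add M x y"]] v_facts(3)[of x y]
  unfolding val_ring_def by blast

lemma residue_mult:
  assumes x: "x \<in> val_ring M" and y: "y \<in> val_ring M"
  shows "residue M (v_mul M x y) = r_mul M (residue M x) (residue M y)"
proof -
  have VFs: "x \<in> VF M" "y \<in> VF M" using x y by (auto simp: val_ring_def)
  have le1: "r_le M (r_one M) (s_rv M x)" "r_le M (r_one M) (s_rv M y)"
    using x y by (auto simp: val_ring_def)
  have res0: "residue M (v_zero M) = r_zero M" using inf_notin rv_zero by (simp add: residue_def)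
  have null: "r_mul M (r_zero M) t = r_zero M" "r_mul M t (r_zero M) = r_zero M"
    if "t \<in> insert (r_zero M) (Kx M)" for t
    using K.l_null[of t] K.r_null[of t] that by simp_all
  show ?thesis
  proof (cases "x = v_zero M \<or> y = v_zero M")
    case True
    then show ?thesis
    proof
      assume "x = v_zero M"
      then show ?thesis using VFs res0 null(1)[OF residue_in_K[OF y]] by simp
    next
      assume "y = v_zero M"
      then show ?thesis using VFs res0 null(2)[OF residue_in_K[OF x]] by simp
    qed
  next
    case False
    then have xy: "s_rv M (v_mul M x y) = r_mul M (s_rv M x) (s_rv M y)"
      "s_rv M x \<in> RVx M" "s_rv M y \<in> RVx M"
      using rv_mult rv_RVx VFs by auto
    have key: "s \<in> Kx M"
      if st: "s \<in> RVx M" "t \<in> RVx M" and le: "r_le M (r_one M) s" "r_le M (r_one M) t"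
        and "r_mul M s t \<in> Kx M" for s t
    proof -
      have mem: "r_mul M s t \<in> RVx M" using RVx.m_closed st by simp
      have "r_le M (r_mul M (r_one M) s) (r_mul M t s)"
        using compat[of "r_one M" t s] st le RVx.one_closed by simp
      then have "r_le M s (r_mul M s t)"
        using RVx.l_one[of s] RVx.m_comm[of s t] st by simp
      moreover have "r_le M (r_mul M s t) (r_one M)" using that(5) Kx by blast
      ultimately have "r_le M s (r_one M)"
        using le_trans[of s "r_mul M s t" "r_one M"] st mem RVx_RV le_one_RV by blast
      then show ?thesis using Kx st le RVx_RV by blast
    qed
    have iff: "r_Kx M s \<longleftrightarrow> s \<in> Kx M" if "s \<in> RVx M" for s
      using that by (auto simp: Kx_def RVx_def)
    have mem: "r_mul M (s_rv M x) (s_rv M y) \<in> RVx M" using RVx.m_closed xy by simp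
    have comm: "r_mul M (s_rv M x) (s_rv M y) = r_mul M (s_rv M y) (s_rv M x)"
      using RVx.m_comm xy by simp
    show ?thesis
    proof (cases "s_rv M x \<in> Kx M \<and> s_rv M y \<in> Kx M")
      case True
      then show ?thesis using Kx_mult iff xy mem by (simp add: residue_def)
    next
      case False
      then have "r_mul M (s_rv M x) (s_rv M y) \<notin> Kx M"
        using key[of "s_rv M x" "s_rv M y"] key[of "s_rv M y" "s_rv M x"] xy le1 comm by auto
      then have "residue M (v_mul M x y) = r_zero M" using iff mem xy by (simp add: residue_def)
      moreover have "residue M x = r_zero M \<or> residue M y = r_zero M"
        using False iff xy by (auto simp: residue_def)
      ultimately show ?thesis using null(2)[OF residue_in_K[OF x]] null(1)[OF residue_in_K[OF y]] by auto
    qed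
  qed
qed

lemma residue_ring_hom_iff:
  "residue M \<in> ring_hom ((VF_ring M)\<lparr>carrier := val_ring M\<rparr>) (K_ring M) \<longleftrightarrow>
    (\<forall>x\<in>val_ring M. \<forall>y\<in>val_ring M. residue M (v_add M x y) = r_add M (residue M x) (residue M y))"
proof -
  have "residue M (v_one M) = r_one M" using one_Kx rv_one by (simp add: residue_def Kx_def)
  then show ?thesis using residue_in_K residue_mult by (auto simp: ring_hom_def)
qed

lemma residue_axiom_iff:
  "sat M e f (VAlls [0, 1] (RAlls_in inK [0, 1, 2]
      (isRes (VVar 0) (RVar 0) \<^bold>\<and> isRes (VVar 1) (RVar 1) \<^bold>\<and> isRes (VVar 0 + VVar 1) (RVar 2)
        \<^bold>\<longrightarrow> RVar 2 \<doteq>\<^sub>r RVar 0 + RVar 1))) \<longleftrightarrow>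
    residue M \<in> ring_hom ((VF_ring M)\<lparr>carrier := val_ring M\<rparr>) (K_ring M)"
proof -
  let ?R = "\<lambda>x t. r_Kx M (s_rv M x) \<and> t = s_rv M x \<or>
      r_le M (r_one M) (s_rv M x) \<and> \<not> r_le M (s_rv M x) (r_one M) \<and> t = r_zero M"
  let ?K = "insert (r_zero M) (Kx M)"
  have z: "r_zero M \<in> RV0 M" using struct by (simp add: is_structure_def)
  have K: "x \<in> ?K \<longleftrightarrow> x \<in> RV0 M \<and> (r_Kx M x \<or> x = r_zero M)" for x
    using z by (auto simp: Kx_def)
  have BallK: "(\<forall>x\<in>?K. P x) \<longleftrightarrow> (\<forall>x\<in>RV0 M. (\<not> r_Kx M x \<longrightarrow> x = r_zero M) \<longrightarrow> P x)" for P
    using K by blast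
  have "sat M e f (VAlls [0, 1] (RAlls_in inK [0, 1, 2]
      (isRes (VVar 0) (RVar 0) \<^bold>\<and> isRes (VVar 1) (RVar 1) \<^bold>\<and> isRes (VVar 0 + VVar 1) (RVar 2)
        \<^bold>\<longrightarrow> RVar 2 \<doteq>\<^sub>r RVar 0 + RVar 1))) \<longleftrightarrow>
    (\<forall>x\<in>VF M. \<forall>y\<in>VF M. \<forall>r\<in>?K. \<forall>s\<in>?K. \<forall>t\<in>?K.
      ?R x r \<and> ?R y s \<and> ?R (v_add M x y) t \<longrightarrow> t = r_add M r s)"
    unfolding BallK by (simp add: disj_imp imp_conjL)
  also have "\<dots> \<longleftrightarrow> (\<forall>x\<in>VF M. \<forall>y\<in>VF M. \<forall>r\<in>?K. \<forall>s\<in>?K. \<forall>t\<in>?K.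
      (x \<in> val_ring M \<and> r = residue M x) \<and> (y \<in> val_ring M \<and> s = residue M y) \<and>
      (v_add M x y \<in> val_ring M \<and> t = residue M (v_add M x y)) \<longrightarrow> t = r_add M r s)"
    by (simp add: isRes_iff)
  also have "\<dots> \<longleftrightarrow>
    (\<forall>x\<in>val_ring M. \<forall>y\<in>val_ring M. residue M (v_add M x y) = r_add M (residue M x) (residue M y))"
  proof -
    have sub: "x \<in> val_ring M \<Longrightarrow> x \<in> VF M" for x by (simp add: val_ring_def)
    show ?thesis
    proof (intro iffI ballI impI)
      fix x y assume *: "\<forall>x\<in>VF M. \<forall>y\<in>VF M. \<forall>r\<in>?K. \<forall>s\<in>?K. \<forall>t\<in>?K.
        (x \<in> val_ring M \<and> r = residue M x) \<and> (y \<in> val_ring M \<and> s = residue M y) \<and>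
        (v_add M x y \<in> val_ring M \<and> t = residue M (v_add M x y)) \<longrightarrow> t = r_add M r s"
        and xy: "x \<in> val_ring M" "y \<in> val_ring M"
      show "residue M (v_add M x y) = r_add M (residue M x) (residue M y)"
        by (rule *[rule_format, OF sub[OF xy(1)] sub[OF xy(2)]])
          (simp_all only: residue_in_K val_ring_add xy simp_thms)
    next
      fix x y r s t assume "\<forall>x\<in>val_ring M. \<forall>y\<in>val_ring M.
          residue M (v_add M x y) = r_add M (residue M x) (residue M y)"
        "(x \<in> val_ring M \<and> r = residue M x) \<and> (y \<in> val_ring M \<and> s = residue M y) \<and>
          (v_add M x y \<in> val_ring M \<and> t = residue M (v_add M x y))"
      then show "t = r_add M r s" by simp
    qed
  qed
  finally show ?thesis by (simp only: residue_ring_hom_iff)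
qed

lemma section_axioms_iff:
  "(\<forall>\<sigma>\<in>section_axioms. sat M e f \<sigma>) \<longleftrightarrow> is_section M"
proof -
  let ?K = "insert (r_zero M) (Kx M)"
  let ?S = "insert (v_zero M) (s_sn M ` Kx M)"
  have z: "r_zero M \<in> RV0 M" using struct by (simp add: is_structure_def)
  have K: "x \<in> ?K \<longleftrightarrow> x \<in> RV0 M \<and> (r_Kx M x \<or> x = r_zero M)" for x
    using z by (auto simp: Kx_def)
  have BallK: "(\<forall>x\<in>?K. P x) \<longleftrightarrow> (\<forall>x\<in>RV0 M. (\<not> r_Kx M x \<longrightarrow> x = r_zero M) \<longrightarrow> P x)"
    "(\<exists>x\<in>?K. P x) \<longleftrightarrow> (\<exists>x\<in>RV0 M. (\<not> r_Kx M x \<longrightarrow> x = r_zero M) \<and> P x)" for P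
    using K by blast+
  have Ball: "(\<forall>x\<in>RVx M. P x) \<longleftrightarrow> (\<forall>x\<in>RV0 M. \<not> x = r_zero M \<longrightarrow> \<not> x = r_inf M \<longrightarrow> P x)"
    "(\<forall>x\<in>RV M. P x) \<longleftrightarrow> (\<forall>x\<in>RV0 M. \<not> x = r_zero M \<longrightarrow> P x)" for P
    unfolding RVx_def RV_def by blast+
  have elem: "(\<forall>\<sigma>\<in>section_axioms. sat M e f \<sigma>) \<longleftrightarrow>
      (\<forall>t\<in>RVx M. s_sn M t \<noteq> v_zero M) \<and>
      (\<forall>s\<in>RVx M. \<forall>t\<in>RVx M. s_sn M (r_mul M s t) = v_mul M (s_sn M s) (s_sn M t)) \<and>
      s_sn M (r_inf M) = v_zero M \<and>
      (\<forall>t\<in>RV M. s_rv M (s_sn M t) = t) \<and>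
      (\<forall>s\<in>?K. \<forall>t\<in>?K. \<exists>u\<in>?K. v_add M (s_sn M s) (s_sn M t) = s_sn M u) \<and>
      (\<forall>t\<in>?K. \<exists>u\<in>?K. v_neg M (s_sn M t) = s_sn M u) \<and>
      s_sn M (r_zero M) = v_zero M"
    unfolding section_axioms_def Let_def BallK Ball
    by (simp del: One_nat_def add: disj_imp)
  have sn_VF: "s_sn M t \<in> VF M" if "t \<in> RV0 M" for t using struct that by (simp add: is_structure_def)
  have RVx_RV0: "t \<in> RVx M \<Longrightarrow> t \<in> RV0 M" for t by (simp add: RVx_def)
  have S: "?S = s_sn M ` ?K" if "s_sn M (r_zero M) = v_zero M" using that by simp
  show ?thesis
    unfolding elem
  proof
    assume A: "(\<forall>t\<in>RVx M. s_sn M t \<noteq> v_zero M) \<and>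
      (\<forall>s\<in>RVx M. \<forall>t\<in>RVx M. s_sn M (r_mul M s t) = v_mul M (s_sn M s) (s_sn M t)) \<and>
      s_sn M (r_inf M) = v_zero M \<and>
      (\<forall>t\<in>RV M. s_rv M (s_sn M t) = t) \<and>
      (\<forall>s\<in>?K. \<forall>t\<in>?K. \<exists>u\<in>?K. v_add M (s_sn M s) (s_sn M t) = s_sn M u) \<and>
      (\<forall>t\<in>?K. \<exists>u\<in>?K. v_neg M (s_sn M t) = s_sn M u) \<and>
      s_sn M (r_zero M) = v_zero M"
    then have nz: "\<And>t. t \<in> RVx M \<Longrightarrow> s_sn M t \<noteq> v_zero M"
      and mult: "\<And>s t. s \<in> RVx M \<Longrightarrow> t \<in> RVx M \<Longrightarrow> s_sn M (r_mul M s t) = v_mul M (s_sn M s) (s_sn M t)"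
      and inf: "s_sn M (r_inf M) = v_zero M"
      and rv_sn: "\<And>t. t \<in> RV M \<Longrightarrow> s_rv M (s_sn M t) = t"
      and sum: "\<And>s t. s \<in> ?K \<Longrightarrow> t \<in> ?K \<Longrightarrow> \<exists>u\<in>?K. v_add M (s_sn M s) (s_sn M t) = s_sn M u"
      and neg: "\<And>t. t \<in> ?K \<Longrightarrow> \<exists>u\<in>?K. v_neg M (s_sn M t) = s_sn M u"
      and sn0: "s_sn M (r_zero M) = v_zero M"
      by blast+
    have KxVF: "s_sn M t \<in> VF M" if "t \<in> Kx M" for t using that sn_VF by (simp add: Kx_def)
    have sub: "?S \<subseteq> VF M" using KxVF VF.zero_closed by auto
    have sn1: "s_sn M (r_one M) = v_one M"
    proof -
      let ?a = "s_sn M (r_one M)"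
      have one: "r_one M \<in> RVx M" using RVx.one_closed by simp
      have a: "?a \<in> VF M" "?a \<noteq> v_zero M" using nz[OF one] sn_VF RVx_RV0 one by auto
      have "v_mul M ?a ?a = v_mul M ?a (v_one M)"
        using mult[OF one one] RVx.l_one[of "r_one M"] one VF.r_one[of ?a] a by simp
      then show ?thesis using VF.m_lcancel[of ?a ?a "v_one M"] a VF.one_closed by simp
    qed
    have ring: "subring ?S (VF_ring M)"
    proof (rule VF.subringI)
      show "?S \<subseteq> carrier (VF_ring M)" using sub by simp
      show "\<one>\<^bsub>VF_ring M\<^esub> \<in> ?S" using sn1[symmetric] one_Kx by auto
    next
      fix h assume "h \<in> ?S"
      then obtain t where t: "t \<in> ?K" "h = s_sn M t" using S[OF sn0] by blast
      then have "h \<in> VF M" using sub S[OF sn0] by blast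
      then show "\<ominus>\<^bsub>VF_ring M\<^esub> h \<in> ?S" using neg[OF t(1)] t(2) v_neg[of h] S[OF sn0] by auto
    next
      fix h1 h2 assume "h1 \<in> ?S" "h2 \<in> ?S"
      then obtain s t where st: "s \<in> ?K" "h1 = s_sn M s" "t \<in> ?K" "h2 = s_sn M t" using S[OF sn0] by blast
      show "h1 \<oplus>\<^bsub>VF_ring M\<^esub> h2 \<in> ?S" using sum[OF st(1,3)] st(2,4) S[OF sn0] by auto
    next
      fix h1 h2 assume h: "h1 \<in> ?S" "h2 \<in> ?S"
      show "h1 \<otimes>\<^bsub>VF_ring M\<^esub> h2 \<in> ?S"
      proof (cases "h1 = v_zero M \<or> h2 = v_zero M")
        case True
        moreover have "h1 \<in> VF M" "h2 \<in> VF M" using h sub by blast+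
        ultimately have "v_mul M h1 h2 = v_zero M" using VF.l_null[of h2] VF.r_null[of h1] by auto
        then show ?thesis by simp
      next
        case False
        then obtain s t where st: "s \<in> Kx M" "h1 = s_sn M s" "t \<in> Kx M" "h2 = s_sn M t" using h by blast
        then have "v_mul M h1 h2 = s_sn M (r_mul M s t)" 
          using mult[of s t] subsetD[OF Kx_RVx] by simp
        then show ?thesis using Kx_mult[OF st(1,3)] by simp
      qed
    qed
    have "subfield ?S (VF_ring M)"
    proof (rule VF.subfieldI'[OF ring])
      fix k assume "k \<in> ?S - {\<zero>\<^bsub>VF_ring M\<^esub>}"
      then obtain t where t: "t \<in> Kx M" "k = s_sn M t" "k \<noteq> v_zero M" by auto
      have "t \<noteq> r_zero M" using t(1) Kx_RVx by (auto simp: RVx_def)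
      then obtain u where u: "u \<in> ?K" "r_mul M t u = r_one M"
        using K.field_Units t(1) unfolding Units_def by auto
      have "u \<noteq> r_zero M"
        using u(2) K.r_null[of t] t(1) K.zero_not_one by auto
      then have u': "u \<in> Kx M" using u(1) by simp
      have prod: "v_mul M k (s_sn M u) = v_one M"
        using mult[OF subsetD[OF Kx_RVx t(1)] subsetD[OF Kx_RVx u']] u(2) t(2) sn1 by simp
      have "k \<in> VF M" "s_sn M u \<in> VF M" using t u' KxVF by auto
      then have "inv\<^bsub>VF_ring M\<^esub> k = s_sn M u"
        using VF.comm_inv_char[of k "s_sn M u"] prod by simp
      then show "inv\<^bsub>VF_ring M\<^esub> k \<in> ?S" using u' by simp
    qed
    moreover have "?S \<subseteq> val_ring M"
    proof -
      have "v_zero M \<in> val_ring M"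
        using VF.zero_closed rv_zero le_inf[OF le_one_RV] by (simp add: val_ring_def)
      moreover have "s_sn M t \<in> val_ring M" if t: "t \<in> Kx M" for t
        using KxVF[OF t] rv_sn[of t] t Kx by (simp add: val_ring_def)
      ultimately show ?thesis by blast
    qed
    moreover have "s_sn M \<in> hom (RVx_group M) (VFx_group M)"
      using nz mult sn_VF RVx_RV0 by (auto simp: hom_def VFx_group_def)
    ultimately show "is_section M" using inf rv_sn sn0 by (simp add: is_section_def)
  next
    assume "is_section M"
    then have hom: "s_sn M \<in> hom (RVx_group M) (VFx_group M)" and sf: "subfield ?S (VF_ring M)"
      and inf: "s_sn M (r_inf M) = v_zero M" and sn0: "s_sn M (r_zero M) = v_zero M"
      and rv_sn: "\<forall>t\<in>RV M. s_rv M (s_sn M t) = t"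
      by (auto simp: is_section_def)
    have SK: "?S = s_sn M ` ?K" by (rule S[OF sn0])
    have ring: "subring ?S (VF_ring M)"
      by (intro subcring.axioms subdomain.axioms subfield.axioms sf)
    have sub: "?S \<subseteq> VF M" using subringE(1)[OF ring] by simp
    have "\<exists>u\<in>?K. v_add M (s_sn M s) (s_sn M t) = s_sn M u" if "s \<in> ?K" "t \<in> ?K" for s t
    proof -
      have "s_sn M s \<in> ?S" "s_sn M t \<in> ?S" using that SK by blast+
      then have "v_add M (s_sn M s) (s_sn M t) \<in> ?S" using subringE(7)[OF ring] by simp
      then show ?thesis unfolding SK by blast
    qed
    moreover have "\<exists>u\<in>?K. v_neg M (s_sn M t) = s_sn M u" if "t \<in> ?K" for t
    proof -
      have t: "s_sn M t \<in> ?S" using that SK by blast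
      then have "v_neg M (s_sn M t) \<in> ?S" using subringE(5)[OF ring t] v_neg[of "s_sn M t"] sub by auto
      then show ?thesis unfolding SK by blast
    qed
    moreover have "\<forall>t\<in>RVx M. s_sn M t \<noteq> v_zero M"
      "\<forall>s\<in>RVx M. \<forall>t\<in>RVx M. s_sn M (r_mul M s t) = v_mul M (s_sn M s) (s_sn M t)"
      using hom by (auto simp: hom_def VFx_group_def)
    ultimately show "(\<forall>t\<in>RVx M. s_sn M t \<noteq> v_zero M) \<and>
      (\<forall>s\<in>RVx M. \<forall>t\<in>RVx M. s_sn M (r_mul M s t) = v_mul M (s_sn M s) (s_sn M t)) \<and>
      s_sn M (r_inf M) = v_zero M \<and>
      (\<forall>t\<in>RV M. s_rv M (s_sn M t) = t) \<and>
      (\<forall>s\<in>?K. \<forall>t\<in>?K. \<exists>u\<in>?K. v_add M (s_sn M s) (s_sn M t) = s_sn M u) \<and>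
      (\<forall>t\<in>?K. \<exists>u\<in>?K. v_neg M (s_sn M t) = s_sn M u) \<and>
      s_sn M (r_zero M) = v_zero M"
      using inf rv_sn sn0 by blast
  qed
qed

end

lemma rv_axioms_iff:
  fixes M :: "('v, 'r) struct"
  assumes M: "is_structure M"
  shows "(\<forall>\<sigma>\<in>rv_axioms. sat M e f \<sigma>) \<longleftrightarrow>
     (s_rv M (v_zero M) = r_inf M \<and>
      s_rv M \<in> hom (VFx_group M) (RVx_group M) \<and> s_rv M ` (VF M - {v_zero M}) = RVx M \<and>
      (\<forall>x\<in>VF M. \<forall>y\<in>VF M. r_le M (s_rv M x) (s_rv M (v_add M x y)) \<or>
         r_le M (s_rv M y) (s_rv M (v_add M x y)))) \<and>
     sat M e f (VAlls [0, 1] (RAlls_in inK [0, 1, 2]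
      (isRes (VVar 0) (RVar 0) \<^bold>\<and> isRes (VVar 1) (RVar 1) \<^bold>\<and> isRes (VVar 0 + VVar 1) (RVar 2)
        \<^bold>\<longrightarrow> RVar 2 \<doteq>\<^sub>r RVar 0 + RVar 1)))"
    (is "_ \<longleftrightarrow> ?B \<and> sat M e f ?\<phi>")
proof -
  have rv_RV0: "s_rv M x \<in> RV0 M" if "x \<in> VF M" for x
    using M that by (simp add: is_structure_def)
  have B: "?B \<longleftrightarrow> s_rv M (v_zero M) = r_inf M \<and>
      (\<forall>x\<in>VF M. x \<noteq> v_zero M \<longrightarrow> s_rv M x \<noteq> r_zero M \<and> s_rv M x \<noteq> r_inf M) \<and>
      (\<forall>x\<in>VF M. \<forall>y\<in>VF M. x \<noteq> v_zero M \<longrightarrow> y \<noteq> v_zero M \<longrightarrow>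
        s_rv M (v_mul M x y) = r_mul M (s_rv M x) (s_rv M y)) \<and>
      (\<forall>t\<in>RV0 M. t \<noteq> r_zero M \<longrightarrow> t \<noteq> r_inf M \<longrightarrow> (\<exists>x\<in>VF M. x \<noteq> v_zero M \<and> s_rv M x = t)) \<and>
      (\<forall>x\<in>VF M. \<forall>y\<in>VF M. \<not> r_le M (s_rv M x) (s_rv M (v_add M x y)) \<longrightarrow>
         r_le M (s_rv M y) (s_rv M (v_add M x y)))"
    (is "_ \<longleftrightarrow> ?z \<and> ?c \<and> ?m \<and> ?s \<and> ?u")
  proof -
    have "s_rv M \<in> hom (VFx_group M) (RVx_group M) \<longleftrightarrow> ?c \<and> ?m"
      using rv_RV0 by (auto simp: hom_def VFx_group_def RVx_group_def RVx_def Pi_def)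
    moreover have "s_rv M ` (VF M - {v_zero M}) = RVx M \<longleftrightarrow> ?s" if ?c
    proof -
      have "s_rv M ` (VF M - {v_zero M}) \<subseteq> RVx M" using that rv_RV0 by (auto simp: RVx_def)
      then have "s_rv M ` (VF M - {v_zero M}) = RVx M \<longleftrightarrow> RVx M \<subseteq> s_rv M ` (VF M - {v_zero M})" by blast
      also have "\<dots> \<longleftrightarrow> ?s" unfolding RVx_def by blast
      finally show ?thesis .
    qed
    ultimately show ?thesis unfolding disj_imp by argo
  qed
  define \<phi> where "\<phi> = ?\<phi>"
  have S: "rv_axioms = insert \<phi> (let x = VVar 0; y = VVar 1; r = RVar 0; s = RVar 1; t = RVar 2 in
     {Rv 0 \<doteq>\<^sub>r RInf,
      VAlls [0] (\<^bold>\<not> x \<doteq>\<^sub>v 0 \<^bold>\<longrightarrow> inRVx (Rv x)),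
      VAlls [0, 1] (\<^bold>\<not> x \<doteq>\<^sub>v 0 \<^bold>\<and> \<^bold>\<not> y \<doteq>\<^sub>v 0 \<^bold>\<longrightarrow> Rv (x * y) \<doteq>\<^sub>r Rv x * Rv y),
      RAlls_in inRVx [0] (VEx 0 (\<^bold>\<not> x \<doteq>\<^sub>v 0 \<^bold>\<and> Rv x \<doteq>\<^sub>r r)),
      VAlls [0, 1] (Rv x \<preceq>\<^sub>r Rv (x + y) \<^bold>\<or> Rv y \<preceq>\<^sub>r Rv (x + y))})"
    unfolding rv_axioms_def \<phi>_def Let_def by blast
  show ?thesis
    unfolding B \<phi>_def[symmetric] S Let_def
    by (simp del: One_nat_def add: disj_imp) argo
qed

theorem is_model_ACVF_dag_iff:
  "is_model M ACVF_dag \<longleftrightarrow> is_structure M \<and> is_ACVF M \<and> is_section M"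
proof (cases "is_structure M")
  case False
  then show ?thesis by (simp add: is_model_def)
next
  case M: True
  let ?sat = "\<lambda>T. \<forall>\<sigma>\<in>T. sat M (\<lambda>_. v_zero M) (\<lambda>_. r_zero M) \<sigma>"
  have "is_model M ACVF_dag \<longleftrightarrow> ?sat ACVF_dag"
    using M holds_sentence[OF M ACVF_dag_sentences] by (simp add: is_model_def cong: ball_cong)
  also have "\<dots> \<longleftrightarrow> ?sat ACVF \<and> ?sat section_axioms" unfolding ACVF_dag_def by blast
  finally have 1: "is_model M ACVF_dag \<longleftrightarrow> ?sat ACVF \<and> ?sat section_axioms" .
  have 2: "?sat ACVF \<longleftrightarrow> ?sat VF_axioms \<and> ?sat RVx_axioms \<and> ?sat K_axioms \<and> ?sat order_axioms \<and>
      ?sat default_axioms \<and> ?sat rv_axioms"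
    unfolding ACVF_def by blast
  let ?\<phi> = "VAlls [0, 1] (RAlls_in inK [0, 1, 2]
      (isRes (VVar 0) (RVar 0) \<^bold>\<and> isRes (VVar 1) (RVar 1) \<^bold>\<and> isRes (VVar 0 + VVar 1) (RVar 2)
        \<^bold>\<longrightarrow> RVar 2 \<doteq>\<^sub>r RVar 0 + RVar 1))"
  define R where "R \<longleftrightarrow> sat M (\<lambda>_. v_zero M) (\<lambda>_. r_zero M) ?\<phi>"
  define H where "H \<longleftrightarrow> residue M \<in> ring_hom ((VF_ring M)\<lparr>carrier := val_ring M\<rparr>) (K_ring M)"
  define P where "P \<longleftrightarrow>
     (algebraically_closed (VF_ring M) \<and> (\<forall>x\<in>VF M. v_neg M x = \<ominus>\<^bsub>VF_ring M\<^esub> x)) \<and>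
     (comm_group (RVx_group M) \<and>
      (\<forall>n\<ge>1. \<forall>t\<in>RVx M. \<exists>s\<in>RVx M. s [^]\<^bsub>RVx_group M\<^esub> (n :: nat) = t) \<and>
      r_zero M \<noteq> r_inf M \<and>
      (\<forall>t\<in>carrier (K_ring M). r_mul M t (r_zero M) = r_zero M \<and> r_mul M (r_zero M) t = r_zero M) \<and>
      (\<forall>t\<in>RV0 M. r_mul M t (r_inf M) = r_inf M \<and> r_mul M (r_inf M) t = r_inf M)) \<and>
     (algebraically_closed (K_ring M) \<and>
      (\<forall>t\<in>carrier (K_ring M). r_neg M t = \<ominus>\<^bsub>K_ring M\<^esub> t)) \<and>
     ((\<forall>t\<in>RV M. r_le M t t \<and> r_le M t (r_inf M)) \<and>
      (\<forall>r\<in>RV M. \<forall>s\<in>RV M. \<forall>t\<in>RV M. r_le M r s \<longrightarrow> r_le M s t \<longrightarrow> r_le M r t) \<and>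
      Kx M = {t \<in> RV M. r_le M t (r_one M) \<and> r_le M (r_one M) t} \<and>
      (\<forall>s\<in>RV M. \<forall>t\<in>RV M. r_le M s t \<longrightarrow> r_le M t s \<longrightarrow> (\<exists>k\<in>Kx M. s = r_mul M k t)) \<and>
      (\<forall>s\<in>RV M. \<forall>t\<in>RV M. r_le M s t \<or> r_le M t s) \<and>
      (\<forall>r\<in>RVx M. \<forall>s\<in>RVx M. \<forall>t\<in>RVx M. r_le M r s \<longrightarrow> r_le M (r_mul M r t) (r_mul M s t)) \<and>
      (\<exists>t\<in>RVx M. t \<notin> Kx M)) \<and>
     ((\<forall>s\<in>RV0 M. \<forall>t\<in>RV0 M. \<not> (s \<in> carrier (K_ring M) \<and> t \<in> carrier (K_ring M))
         \<longrightarrow> r_add M s t = r_zero M) \<and>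
      (\<forall>t\<in>RV0 M - carrier (K_ring M). r_neg M t = r_zero M) \<and>
      (\<forall>t\<in>RVx M - Kx M. r_mul M t (r_zero M) = r_zero M \<and> r_mul M (r_zero M) t = r_zero M) \<and>
      (\<forall>t\<in>RV0 M. \<not> r_le M t (r_zero M) \<and> \<not> r_le M (r_zero M) t)) \<and>
     (s_rv M (v_zero M) = r_inf M \<and>
      s_rv M \<in> hom (VFx_group M) (RVx_group M) \<and> s_rv M ` (VF M - {v_zero M}) = RVx M \<and>
      (\<forall>x\<in>VF M. \<forall>y\<in>VF M. r_le M (s_rv M x) (s_rv M (v_add M x y)) \<or>
         r_le M (s_rv M y) (s_rv M (v_add M x y))))"
  have 3: "?sat ACVF \<longleftrightarrow> P \<and> R"
    unfolding 2 VF_axioms_iff[OF M] RVx_axioms_iff[OF M] K_axioms_iff[OF M] order_axioms_iff[OF M]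
      default_axioms_iff[OF M] rv_axioms_iff[OF M] R_def[symmetric] P_def
    by (simp only: conj_assoc)
  have 4: "is_ACVF M \<longleftrightarrow> P \<and> H"
    unfolding is_ACVF_def P_def H_def by (simp only: conj_assoc)
  have "(R \<longleftrightarrow> H) \<and> (?sat section_axioms \<longleftrightarrow> is_section M)" if P
  proof -
    note PP = that[unfolded P_def]
    have p1: "algebraically_closed (VF_ring M)"
      using PP by (elim conjE)
    have p2: "\<forall>x\<in>VF M. v_neg M x = \<ominus>\<^bsub>VF_ring M\<^esub> x"
      using PP by (elim conjE)
    have p3: "comm_group (RVx_group M)"
      using PP by (elim conjE)
    have p4: "r_zero M \<noteq> r_inf M"
      using PP by (elim conjE)
    have p5: "\<forall>t\<in>RV0 M. r_mul M t (r_inf M) = r_inf M \<and> r_mul M (r_inf M) t = r_inf M"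
      using PP by (elim conjE)
    have p6: "algebraically_closed (K_ring M)"
      using PP by (elim conjE)
    have p7: "\<forall>t\<in>RV M. r_le M t t \<and> r_le M t (r_inf M)"
      using PP by (elim conjE)
    have p8: "\<forall>r\<in>RV M. \<forall>s\<in>RV M. \<forall>t\<in>RV M. r_le M r s \<longrightarrow> r_le M s t \<longrightarrow> r_le M r t"
      using PP by (elim conjE)
    have p9: "Kx M = {t \<in> RV M. r_le M t (r_one M) \<and> r_le M (r_one M) t}"
      using PP by (elim conjE)
    have p10: "\<forall>s\<in>RV M. \<forall>t\<in>RV M. r_le M s t \<longrightarrow> r_le M t s \<longrightarrow> (\<exists>k\<in>Kx M. s = r_mul M k t)"
      using PP by (elim conjE)
    have p11: "\<forall>r\<in>RVx M. \<forall>s\<in>RVx M. \<forall>t\<in>RVx M. r_le M r s \<longrightarrow> r_le M (r_mul M r t) (r_mul M s t)"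
      using PP by (elim conjE)
    have p12: "s_rv M (v_zero M) = r_inf M"
      using PP by (elim conjE)
    have p13: "s_rv M \<in> hom (VFx_group M) (RVx_group M)"
      using PP by (elim conjE)
    have p14: "\<forall>x\<in>VF M. \<forall>y\<in>VF M. r_le M (s_rv M x) (s_rv M (v_add M x y)) \<or> r_le M (s_rv M y) (s_rv M (v_add M x y))"
      using PP by (elim conjE)
    interpret pre_ACVF M
    proof (rule pre_ACVF.intro)
      fix r s t x y
      show "is_structure M" "algebraically_closed (VF_ring M)" "comm_group (RVx_group M)"
        "r_zero M \<noteq> r_inf M" "algebraically_closed (K_ring M)"
        "Kx M = {t \<in> RV M. r_le M t (r_one M) \<and> r_le M (r_one M) t}"
        "s_rv M (v_zero M) = r_inf M" "s_rv M \<in> hom (VFx_group M) (RVx_group M)"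
        by (rule M p1 p3 p4 p6 p9 p12 p13)+
      show "v_neg M x = \<ominus>\<^bsub>VF_ring M\<^esub> x" if "x \<in> VF M" using p2 that by (rule bspec)
      show "r_mul M t (r_inf M) = r_inf M" if "t \<in> RV0 M" using p5 that by blast
      show "r_le M t t" "r_le M t (r_inf M)" if "t \<in> RV M" using p7 that by blast+
      show "r_le M r t" if "r \<in> RV M" "s \<in> RV M" "t \<in> RV M" "r_le M r s" "r_le M s t"
        using p8 that by blast
      show "\<exists>k\<in>Kx M. s = r_mul M k t" if "s \<in> RV M" "t \<in> RV M" "r_le M s t" "r_le M t s"
        using p10 that by blast
      show "r_le M (r_mul M r t) (r_mul M s t)"
        if "r \<in> RVx M" "s \<in> RVx M" "t \<in> RVx M" "r_le M r s" using p11 that by blast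
      show "r_le M (s_rv M x) (s_rv M (v_add M x y)) \<or> r_le M (s_rv M y) (s_rv M (v_add M x y))"
        if "x \<in> VF M" "y \<in> VF M" using p14 that by blast
    qed
    show ?thesis unfolding R_def H_def by (intro conjI residue_axiom_iff section_axioms_iff)
  qed
  then show ?thesis unfolding 1 3 4 using M by argo
qed

end

theory Submission
  imports Defs "HOL-Algebra.Chinese_Remainder"
begin

text \<open>Through \<open>sn\<close>, the RV-sort can be read off from VF with the relation \<open>v(x) \<le> v(y)\<close> and the map
  \<open>\<rho> = sn \<circ> rv\<close>. A partial isomorphism between two models is then a subring of the product of their
  VF-sorts that is closed under \<open>\<rho>\<close> and on which the two valuations agree.

  If \<open>\<phi>\<close> is not equivalent to a quantifier-free formula, then for each \<open>n\<close> two models with assignments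
  agree on the first \<open>n\<close> quantifier-free formulas in the free variables of \<open>\<phi>\<close>, but not on \<open>\<phi>\<close>. In the
  ultraproducts of these models, which are \<open>\<aleph>\<^sub>1\<close>-saturated, the assignments have the same quantifier-free
  type, so they differ on \<open>\<phi>\<close> only if the back-and-forth between countable partial isomorphisms breaks
  down. It does not: a partial isomorphism \<open>G\<close> from a countable model \<open>M\<close> to a saturated one extends to all of \<open>M\<close>.

  Let \<open>G\<close> be maximal. Its domain \<open>F\<close> is a field. If \<open>F \<noteq> M\<close>, take \<open>x\<close> outside \<open>F\<close> of least degree over \<open>F\<close>.
  All polynomials over \<open>F\<close> of smaller degree are products of linear factors, so that \<open>v\<close> and \<open>\<rho>\<close> on \<open>F[x]\<close> are
  known once they are known on the elements \<open>x - a\<close> with \<open>a\<close> in \<open>F\<close>. If \<open>x\<close> has no best approximation in \<open>F\<close>, then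
  \<open>\<rho>(x - a)\<close> is in \<open>F\<close>, and an element of the second model with the right values \<open>\<rho>(y - b)\<close> is found among the
  roots of the minimal polynomial of \<open>x\<close>, or by saturation if \<open>x\<close> is transcendental. If \<open>a\<close> is a best
  approximation, then \<open>r = \<rho>(x - a)\<close> is not in \<open>F\<close>; it is a root of the initial form of the minimal
  polynomial of \<open>x - a\<close>, and \<open>v\<close> and \<open>\<rho>\<close> on \<open>F[r]\<close> are determined by \<open>r = \<rho> r\<close> and by the cut of \<open>v(r)\<close> in \<open>v(F)\<close>.\<close>


text \<open>The delicate point is the image of an algebraic element. A valuation may extend in
  several ways to an algebraic extension, so a root of the image polynomial has to be selected: in
  the immediate case one whose linear terms have the prescribed \<rho>-values, and its existence is
  forced by comparing coefficients through G. Multiplicativity of \<rho> then settles all products.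
  Least degree matters because each element of F[x] is the value of a remainder modulo the minimal
  polynomial, hence a product of linear terms over F. If there is a best approximation, it is r that
  is adjoined and not x. This keeps F[r] closed under \<rho>, since \<rho>(r - a) is one of r,
  -\<rho>(a) and r - \<rho>(a). As G is maximal, any proper extension is a contradiction, so x
  itself never has to be reached. Saturation handles countably many conditions only, whereas an
  ultraproduct may be uncountable. Each step of the back-and-forth therefore extends G to a
  countable elementary substructure of one side.\<close>

section \<open>Polynomials as coefficient lists\<close>

text \<open>Coefficients are listed from the constant term upwards.\<close>

primrec peval :: "('a, 'm) ring_scheme \<Rightarrow> 'a list \<Rightarrow> 'a \<Rightarrow> 'a" where
  "peval R [] x = \<zero>\<^bsub>R\<^esub>"
| "peval R (c # p) x = c \<oplus>\<^bsub>R\<^esub> x \<otimes>\<^bsub>R\<^esub> peval R p x"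

text \<open>The quotient in the division of a polynomial by \<open>X - z\<close>.\<close>

fun synth :: "('a, 'm) ring_scheme \<Rightarrow> 'a \<Rightarrow> 'a list \<Rightarrow> 'a list" where
  "synth R z [] = []"
| "synth R z [c] = []"
| "synth R z (c # d # p) = peval R (d # p) z # synth R z (d # p)"

lemma length_synth [simp]: "length (synth R z p) = length p - 1"
  by (induction R z p rule: synth.induct) auto

context cring
begin

lemma peval_closed [simp]:
  "set p \<subseteq> carrier R \<Longrightarrow> x \<in> carrier R \<Longrightarrow> peval R p x \<in> carrier R"
  by (induction p) auto

lemma peval_append:
  "set p \<subseteq> carrier R \<Longrightarrow> c \<in> carrier R \<Longrightarrow> x \<in> carrier R \<Longrightarrow>
     peval R (p @ [c]) x = peval R p x \<oplus> c \<otimes> x [^] length p"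
proof (induction p)
  case (Cons a p)
  have "x \<otimes> (c \<otimes> x [^] length p) = c \<otimes> x [^] Suc (length p)"
    using Cons.prems by (simp add: m_ac)
  then show ?case using Cons by (simp add: r_distr a_assoc)
qed simp

lemma peval_replicate [simp]: "x \<in> carrier R \<Longrightarrow> peval R (replicate n \<zero>) x = \<zero>"
  by (induction n) auto

lemma peval_pad: "set p \<subseteq> carrier R \<Longrightarrow> x \<in> carrier R \<Longrightarrow>
    peval R (p @ replicate n \<zero>) x = peval R p x"
  by (induction p) auto

lemma peval_add:
  assumes "length p = length q" "set p \<subseteq> carrier R" "set q \<subseteq> carrier R" "x \<in> carrier R"
  shows "peval R (map2 (\<oplus>) p q) x = peval R p x \<oplus> peval R q x"
  using assms
proof (induction p q rule: list_induct2)
  case (Cons a p b q)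
  then show ?case by (simp add: r_distr a_ac)
qed simp

lemma peval_smult: "set p \<subseteq> carrier R \<Longrightarrow> x \<in> carrier R \<Longrightarrow> c \<in> carrier R \<Longrightarrow>
    peval R (map ((\<otimes>) c) p) x = c \<otimes> peval R p x"
  by (induction p) (auto simp: r_distr m_lcomm)

lemma subring_peval:
  assumes "subring G R" "set p \<subseteq> G" "z \<in> G"
  shows "peval R p z \<in> G"
  using assms(2) by (induction p) (auto intro: subringE(2,6,7)[OF assms(1)] assms(3))

lemma synth_in_lists:
  assumes "subring G R" "set p \<subseteq> G" "z \<in> G"
  shows "set (synth R z p) \<subseteq> G"
  using assms(2)
proof (induction p rule: induct_list012)
  case (3 c d p)
  then have "peval R (d # p) z \<in> G" by (intro subring_peval[OF assms(1) _ assms(3)]) simp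
  then show ?case using 3 by simp
qed auto

lemma carrier_synth: "set p \<subseteq> carrier R \<Longrightarrow> z \<in> carrier R \<Longrightarrow> set (synth R z p) \<subseteq> carrier R"
  using synth_in_lists[OF carrier_is_subring] by blast

lemma peval_synth:
  "set p \<subseteq> carrier R \<Longrightarrow> x \<in> carrier R \<Longrightarrow> z \<in> carrier R \<Longrightarrow>
     peval R p x = (x \<ominus> z) \<otimes> peval R (synth R z p) x \<oplus> peval R p z"
proof (induction p rule: induct_list012)
  case (3 c d p)
  define s where "s = peval R (synth R z (d # p)) x"
  define e where "e = peval R (d # p) z"
  have cl: "s \<in> carrier R" "e \<in> carrier R"
    using 3 carrier_synth[of "d # p" z] by (auto simp: s_def e_def simp del: peval.simps)
  have IH: "peval R (d # p) x = (x \<ominus> z) \<otimes> s \<oplus> e"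
    using 3 unfolding s_def e_def by simp
  have "peval R (c # d # p) x = c \<oplus> x \<otimes> ((x \<ominus> z) \<otimes> s \<oplus> e)"
    by (simp only: peval.simps(2)[of R c] IH)
  also have "\<dots> = (x \<ominus> z) \<otimes> (e \<oplus> x \<otimes> s) \<oplus> (c \<oplus> z \<otimes> e)"
    using 3 cl by (simp, algebra)
  finally show ?case unfolding s_def e_def by simp
qed auto

lemma set_map2_add:
  assumes "subring G R" "set p \<subseteq> G" "set q \<subseteq> G"
  shows "set (map2 (\<oplus>) p q) \<subseteq> G"
  using assms(2,3) by (force dest: set_zip_leftD set_zip_rightD intro!: subringE(7)[OF assms(1)])

lemma peval_shift:
  assumes G: "subring G R" and a: "a \<in> G" and p: "set p \<subseteq> G"
  obtains q where "set q \<subseteq> G" "length q = length p" "p \<noteq> [] \<Longrightarrow> last q = last p"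
    "\<And>x. x \<in> carrier R \<Longrightarrow> peval R q x = peval R p (x \<oplus> a)"
proof -
  note sub = subringE(1)[OF G]
  have "\<exists>q. set q \<subseteq> G \<and> length q = length p \<and> (p \<noteq> [] \<longrightarrow> last q = last p) \<and>
      (\<forall>x \<in> carrier R. peval R q x = peval R p (x \<oplus> a))"
    using p
  proof (induction p)
    case (Cons c p)
    then obtain q where q: "set q \<subseteq> G" "length q = length p" "p \<noteq> [] \<Longrightarrow> last q = last p"
      "\<And>x. x \<in> carrier R \<Longrightarrow> peval R q x = peval R p (x \<oplus> a)" by auto
    define q' where "q' = map2 (\<oplus>) (c # q) (map ((\<otimes>) a) q @ [\<zero>])"
    have cl: "set q \<subseteq> carrier R" "set p \<subseteq> carrier R" "c \<in> carrier R" "a \<in> carrier R"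
      using q(1) Cons.prems sub a by auto
    have aq: "set (map ((\<otimes>) a) q @ [\<zero>]) \<subseteq> G" "set (c # q) \<subseteq> G"
      using q(1) Cons.prems a by (auto intro: subringE(2,6)[OF G])
    then have aq': "set (map ((\<otimes>) a) q @ [\<zero>]) \<subseteq> carrier R" "set (c # q) \<subseteq> carrier R"
      using sub by auto
    have "set q' \<subseteq> G"
      using aq unfolding q'_def by (intro set_map2_add[OF G])
    moreover have "length q' = length (c # p)" by (simp add: q'_def q(2))
    moreover have "last q' = last (c # p)"
    proof (cases "p = []")
      case True
      then show ?thesis using q(2) cl by (simp add: q'_def)
    next
      case False
      then have "q \<noteq> []" using q(2) by auto
      then have "last (zip (c # q) (map ((\<otimes>) a) q @ [\<zero>])) = (last q, \<zero>)"
        by (subst last_zip) auto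
      moreover have "zip (c # q) (map ((\<otimes>) a) q @ [\<zero>]) \<noteq> []" by (cases q) auto
      moreover have "last q \<in> carrier R" using \<open>q \<noteq> []\<close> cl by auto
      ultimately show ?thesis using False q(3) unfolding q'_def by (simp add: last_map)
    qed
    moreover have "peval R q' x = peval R (c # p) (x \<oplus> a)" if "x \<in> carrier R" for x
    proof -
      have "peval R q' x = peval R (c # q) x \<oplus> peval R (map ((\<otimes>) a) q @ [\<zero>]) x"
        unfolding q'_def using aq' that by (intro peval_add) auto
      also have "peval R (map ((\<otimes>) a) q @ [\<zero>]) x = a \<otimes> peval R q x"
        using peval_pad[of "map ((\<otimes>) a) q" x 1] cl that by (auto simp: peval_smult)
      also have "peval R (c # q) x \<oplus> a \<otimes> peval R q x = c \<oplus> (x \<oplus> a) \<otimes> peval R q x"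
        using cl that by (simp add: l_distr a_assoc)
      finally show ?thesis using q(4) that by simp
    qed
    ultimately show ?case by blast
  qed auto
  then show thesis using that by blast
qed

end

section \<open>Subrings generated by one more element\<close>

definition adjoin :: "('a, 'm) ring_scheme \<Rightarrow> 'a set \<Rightarrow> 'a \<Rightarrow> 'a set" where
  "adjoin R G z = {peval R p z | p. set p \<subseteq> G}"

context cring
begin

context
  fixes G z
  assumes G: "subring G R" and z: "z \<in> carrier R"
begin

private lemma lists_carrier: "set p \<subseteq> G \<Longrightarrow> set p \<subseteq> carrier R"
  using subringE(1)[OF G] by auto

lemma adjoin_add: "u \<in> adjoin R G z \<Longrightarrow> w \<in> adjoin R G z \<Longrightarrow> u \<oplus> w \<in> adjoin R G z"
proof -
  assume "u \<in> adjoin R G z" "w \<in> adjoin R G z"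
  then obtain p q where p: "set p \<subseteq> G" "u = peval R p z" and q: "set q \<subseteq> G" "w = peval R q z"
    by (auto simp: adjoin_def)
  define p' where "p' = p @ replicate (length q) \<zero>"
  define q' where "q' = q @ replicate (length p) \<zero>"
  have pq: "set p' \<subseteq> G" "set q' \<subseteq> G" "length p' = length q'"
    using p q subringE(2)[OF G] by (auto simp: p'_def q'_def)
  have "u \<oplus> w = peval R (map2 (\<oplus>) p' q') z"
    using p q pq z by (simp add: peval_add lists_carrier peval_pad p'_def q'_def)
  moreover have "set (map2 (\<oplus>) p' q') \<subseteq> G"
    using pq by (intro set_map2_add[OF G])
  ultimately show ?thesis unfolding adjoin_def by blast
qed

lemma adjoin_smult: "u \<in> adjoin R G z \<Longrightarrow> c \<in> G \<Longrightarrow> c \<otimes> u \<in> adjoin R G z"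
proof -
  assume "u \<in> adjoin R G z" and c: "c \<in> G"
  then obtain p where p: "set p \<subseteq> G" "u = peval R p z" by (auto simp: adjoin_def)
  have "c \<otimes> u = peval R (map ((\<otimes>) c) p) z"
    using p c z subringE(1)[OF G] by (subst peval_smult) (auto dest: lists_carrier)
  moreover have "set (map ((\<otimes>) c) p) \<subseteq> G" using p c by (auto intro: subringE(6)[OF G])
  ultimately show ?thesis unfolding adjoin_def by blast
qed

lemma adjoin_shift: "u \<in> adjoin R G z \<Longrightarrow> z \<otimes> u \<in> adjoin R G z"
proof -
  assume "u \<in> adjoin R G z"
  then obtain p where p: "set p \<subseteq> G" "u = peval R p z" by (auto simp: adjoin_def)
  then have "z \<otimes> u = peval R (\<zero> # p) z" using z by (simp add: lists_carrier)
  moreover have "set (\<zero> # p) \<subseteq> G" using p subringE(2)[OF G] by auto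
  ultimately show ?thesis unfolding adjoin_def by blast
qed

lemma adjoin_incl: "G \<subseteq> adjoin R G z"
proof
  fix c assume c: "c \<in> G"
  then have "c = peval R [c] z" "set ([c]) \<subseteq> G" using z subringE(1)[OF G] by auto
  then show "c \<in> adjoin R G z" unfolding adjoin_def by blast
qed

lemma adjoin_subset: "adjoin R G z \<subseteq> carrier R"
  using z lists_carrier by (auto simp: adjoin_def)

lemma adjoin_mult: "u \<in> adjoin R G z \<Longrightarrow> w \<in> adjoin R G z \<Longrightarrow> u \<otimes> w \<in> adjoin R G z"
proof -
  assume "u \<in> adjoin R G z" and w: "w \<in> adjoin R G z"
  then obtain p where p: "set p \<subseteq> G" "u = peval R p z" by (auto simp: adjoin_def)
  have wc: "w \<in> carrier R" using w adjoin_subset by blast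
  have "peval R p z \<otimes> w \<in> adjoin R G z" using p(1)
  proof (induction p)
    case Nil
    then show ?case using adjoin_incl subringE(2)[OF G] wc by auto
  next
    case (Cons c p)
    have "c \<in> carrier R" "set p \<subseteq> carrier R" using Cons.prems subringE(1)[OF G] by auto
    then have "peval R (c # p) z \<otimes> w = c \<otimes> w \<oplus> z \<otimes> (peval R p z \<otimes> w)"
      using z wc by (simp add: l_distr m_assoc)
    then show ?case using Cons by (auto intro!: adjoin_add adjoin_smult adjoin_shift w)
  qed
  then show ?thesis using p by simp
qed

lemma adjoin_subring: "subring (adjoin R G z) R"
proof (rule subringI)
  show "adjoin R G z \<subseteq> carrier R" by (rule adjoin_subset)
  show "\<one> \<in> adjoin R G z" using adjoin_incl subringE(3)[OF G] by blast
  show "\<ominus> u \<in> adjoin R G z" if "u \<in> adjoin R G z" for u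
  proof -
    have "\<ominus> u = (\<ominus> \<one>) \<otimes> u" using that adjoin_subset by (auto simp: l_minus)
    then show ?thesis using adjoin_smult[OF that, of "\<ominus> \<one>"] subringE(3,5)[OF G] by simp
  qed
qed (auto intro: adjoin_add adjoin_mult)

lemma adjoin_mem: "z \<in> adjoin R G z"
  using adjoin_shift[of \<one>] adjoin_incl subringE(3)[OF G] z by auto

text \<open>Division with remainder by a monic polynomial, in Horner fashion. It is monic because
  the lemma serves in a product of two fields, where a nonzero leading coefficient need not be
  invertible.\<close>

lemma adjoin_algebraic:
  assumes P: "set P \<subseteq> G" "P \<noteq> []" "peval R (P @ [\<one>]) z = \<zero>" and u: "u \<in> adjoin R G z"
  shows "\<exists>q. set q \<subseteq> G \<and> length q = length P \<and> peval R q z = u"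
proof -
  have "\<exists>q. set q \<subseteq> G \<and> length q = length P \<and> peval R q z = peval R p z" if "set p \<subseteq> G" for p
    using that
  proof (induction p)
    case Nil
    show ?case using subringE(2)[OF G] z by (intro exI[of _ "replicate (length P) \<zero>"]) auto
  next
    case (Cons c p)
    then obtain q where q: "set q \<subseteq> G" "length q = length P" "peval R q z = peval R p z" by auto
    define l where "l = last q"
    have qne: "q \<noteq> []" using q(2) P(2) by auto
    then have ql: "q = butlast q @ [l]" by (simp add: l_def)
    have l: "l \<in> G" using qne q(1) by (auto simp: l_def)
    have bl: "set (butlast q) \<subseteq> G" using q(1) by (auto dest: in_set_butlastD)
    \<comment> \<open>Multiplying by z shifts \<open>q\<close> by one place. The overflowing top
      term \<open>l\<close> z^n, with n the length of \<open>P\<close>, is replaced by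
      -\<open>l\<close> P(z), so the number of coefficients stays n.\<close>
    define q1 where "q1 = c # butlast q"
    define q2 where "q2 = map ((\<otimes>) (\<ominus> l)) P"
    have cl: "c \<in> carrier R" "l \<in> carrier R" "set (butlast q) \<subseteq> carrier R" "set P \<subseteq> carrier R"
      using Cons.prems l bl P(1) subringE(1)[OF G] by auto
    have 12: "set q1 \<subseteq> G" "set q2 \<subseteq> G" "length q1 = length q2" "length q2 = length P"
      using Cons.prems bl q(2) qne P l
      by (auto simp: q1_def q2_def intro!: subringE(5,6)[OF G])
    have root: "z [^] length P = \<ominus> peval R P z"
      using P(3) cl z by (simp add: peval_append minus_equality[symmetric] a_comm)
    have "z \<otimes> peval R q z = z \<otimes> peval R (butlast q) z \<oplus> l \<otimes> z [^] length P"
    proof -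
      have "peval R q z = peval R (butlast q) z \<oplus> l \<otimes> z [^] (length P - 1)"
        using peval_append[of "butlast q" l z] cl z q(2) by (subst ql) simp
      moreover have "z [^] length P = z [^] (length P - 1) \<otimes> z"
        using P(2) nat_pow_Suc[of z "length P - 1"] by (simp del: nat_pow_Suc)
      ultimately show ?thesis using cl z by (simp add: r_distr m_ac)
    qed
    moreover have "peval R q2 z = l \<otimes> z [^] length P"
      unfolding q2_def root using cl z by (simp add: peval_smult l_minus r_minus)
    ultimately have "peval R (map2 (\<oplus>) q1 q2) z = peval R (c # p) z"
      using 12 cl z q(3) by (subst peval_add) (auto simp: lists_carrier q1_def a_assoc[symmetric])
    moreover have "set (map2 (\<oplus>) q1 q2) \<subseteq> G"
      using 12 by (intro set_map2_add[OF G])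
    ultimately show ?case using 12 by (intro exI[of _ "map2 (\<oplus>) q1 q2"]) auto
  qed
  then show ?thesis using u unfolding adjoin_def by blast
qed

end

end

section \<open>Coefficients of quotients, and finiteness of the set of roots\<close>

context cring
begin

lemma last_synth: "length p \<ge> 2 \<Longrightarrow> set p \<subseteq> carrier R \<Longrightarrow> z \<in> carrier R \<Longrightarrow> last (synth R z p) = last p"
proof (induction p rule: induct_list012)
  case (3 c d p)
  have "synth R z (d # p) = [] \<longleftrightarrow> p = []" by (cases p) auto
  then show ?case using 3 by (cases p) auto
qed auto

text \<open>Comparison of coefficients in p = (X - z) q + p(z). The \<open>if\<close> supplies the
  zero coefficient beyond the end of the quotient.\<close>

lemma nth_synth:
  assumes "set p \<subseteq> carrier R" "z \<in> carrier R" "j < length p - 1"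
  shows "p ! Suc j = synth R z p ! j \<ominus> (if Suc j < length p - 1 then z \<otimes> synth R z p ! Suc j else \<zero>)"
  using assms
proof (induction p arbitrary: j rule: induct_list012)
  case (3 c d p)
  define s where "s = synth R z (d # p)"
  have s0: "length p > 0 \<Longrightarrow> s ! 0 = peval R p z" by (cases p) (auto simp: s_def)
  show ?case
  proof (cases j)
    case 0
    show ?thesis
    proof (cases p)
      case Nil
      then show ?thesis using 3 0 by (simp add: minus_eq)
    next
      case (Cons e p')
      then have "d = (d \<oplus> z \<otimes> peval R p z) \<ominus> z \<otimes> peval R p z"
        using 3 by (simp add: minus_eq a_assoc r_neg del: peval.simps)
      then show ?thesis using 0 Cons s0 unfolding s_def by simp
    qed
  next
    case (Suc i)
    have "(d # p) ! Suc i = s ! i \<ominus> (if Suc i < length (d # p) - 1 then z \<otimes> s ! Suc i else \<zero>)"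
      unfolding s_def by (rule "3.IH") (use 3 Suc in auto)
    then show ?thesis using Suc by (simp add: s_def[symmetric])
  qed
qed auto

lemma hd_synth:
  assumes "set p \<subseteq> carrier R" "z \<in> carrier R" "length p \<ge> 2" "peval R p z = \<zero>"
  shows "p ! 0 = \<ominus> (z \<otimes> synth R z p ! 0)"
proof -
  obtain c d q where p: "p = c # d # q" using assms(3) by (cases p; cases "tl p") auto
  have "c \<oplus> z \<otimes> peval R (d # q) z = \<zero>" using assms(4) p by simp
  then have "c = \<ominus> (z \<otimes> peval R (d # q) z)"
    using assms(1,2) p by (intro minus_equality[symmetric]) auto
  then show ?thesis by (simp add: p)
qed

end

lemma (in domain) finite_roots_peval:
  assumes "set p \<subseteq> carrier R" "p \<noteq> []" "last p \<noteq> \<zero>"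
  shows "finite {x \<in> carrier R. peval R p x = \<zero>}"
  using assms
proof (induction "length p" arbitrary: p)
  case (Suc n)
  show ?case
  proof (cases "\<exists>z \<in> carrier R. peval R p z = \<zero>")
    case True
    then obtain z where z: "z \<in> carrier R" "peval R p z = \<zero>" by blast
    let ?q = "synth R z p"
    have len: "length p \<ge> 2"
    proof (rule ccontr)
      assume "\<not> ?thesis"
      then obtain c where "p = [c]" using Suc by (cases p) (auto simp: Suc_le_eq)
      then show False using z Suc by auto
    qed
    have q: "set ?q \<subseteq> carrier R" using Suc z by (intro carrier_synth)
    have "{x \<in> carrier R. peval R p x = \<zero>} \<subseteq> insert z {x \<in> carrier R. peval R ?q x = \<zero>}"
    proof
      fix x assume "x \<in> {x \<in> carrier R. peval R p x = \<zero>}"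
      then have x: "x \<in> carrier R" "peval R p x = \<zero>" by auto
      then have "(x \<ominus> z) \<otimes> peval R ?q x = \<zero>" using peval_synth[of p x z] Suc.prems z q by simp
      then have "x = z \<or> peval R ?q x = \<zero>"
        using integral[of "x \<ominus> z" "peval R ?q x"] x q z by simp
      then show "x \<in> insert z {x \<in> carrier R. peval R ?q x = \<zero>}" using x by auto
    qed
    moreover have "length ?q > 0" using len by simp
    then have "?q \<noteq> []" by (rule length_greater_0_conv[THEN iffD1])
    then have "finite {x \<in> carrier R. peval R ?q x = \<zero>}"
      by (intro Suc.hyps(1)) (use Suc.hyps(2) Suc.prems z len q last_synth[of p z] in auto)
    ultimately show ?thesis using finite_subset by blast
  next
    case False
    then have "{x \<in> carrier R. peval R p x = \<zero>} = {}" by blast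
    then show ?thesis by (simp only: finite.emptyI)
  qed
qed auto

section \<open>Valued fields with a section of RV\<close>

text \<open>In one sort: \<open>x \<unlhd> y\<close> stands for \<open>v(x) \<le> v(y)\<close> and \<open>\<rho>\<close> for \<open>sn \<circ> rv\<close>.\<close>

locale sectioned_field = field R for R (structure) +
  fixes le :: "'a \<Rightarrow> 'a \<Rightarrow> bool"  (infix \<open>\<unlhd>\<close> 50) and sec :: "'a \<Rightarrow> 'a"  (\<open>\<rho>\<close>)
  assumes val_total: "x \<in> carrier R \<Longrightarrow> y \<in> carrier R \<Longrightarrow> x \<unlhd> y \<or> y \<unlhd> x"
    and val_trans: "x \<unlhd> y \<Longrightarrow> y \<unlhd> z \<Longrightarrow> x \<in> carrier R \<Longrightarrow> y \<in> carrier R \<Longrightarrow> z \<in> carrier R \<Longrightarrow> x \<unlhd> z"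
    and val_mult: "x \<unlhd> y \<Longrightarrow> x \<in> carrier R \<Longrightarrow> y \<in> carrier R \<Longrightarrow> z \<in> carrier R \<Longrightarrow> x \<otimes> z \<unlhd> y \<otimes> z"
    and val_add: "z \<unlhd> x \<Longrightarrow> z \<unlhd> y \<Longrightarrow> x \<in> carrier R \<Longrightarrow> y \<in> carrier R \<Longrightarrow> z \<in> carrier R \<Longrightarrow> z \<unlhd> x \<oplus> y"
    and val_zero [simp]: "x \<in> carrier R \<Longrightarrow> x \<unlhd> \<zero>"
    and zero_val: "\<zero> \<unlhd> x \<Longrightarrow> x \<in> carrier R \<Longrightarrow> x = \<zero>"
    and sec_closed [simp]: "x \<in> carrier R \<Longrightarrow> \<rho> x \<in> carrier R"
    and sec_mult: "x \<in> carrier R \<Longrightarrow> y \<in> carrier R \<Longrightarrow> \<rho> (x \<otimes> y) = \<rho> x \<otimes> \<rho> y"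
    and sec_idem [simp]: "x \<in> carrier R \<Longrightarrow> \<rho> (\<rho> x) = \<rho> x"
    and sec_zero [simp]: "\<rho> \<zero> = \<zero>"
    and sec_eq_iff: "x \<in> carrier R \<Longrightarrow> y \<in> carrier R \<Longrightarrow> x \<noteq> \<zero> \<Longrightarrow> \<rho> x = \<rho> y \<longleftrightarrow> \<not> x \<ominus> y \<unlhd> x"
    and sec_add: "x \<in> carrier R \<Longrightarrow> y \<in> carrier R \<Longrightarrow> x \<unlhd> y \<Longrightarrow> y \<unlhd> x \<Longrightarrow>
      \<rho> x \<oplus> \<rho> y = \<zero> \<or> \<rho> (\<rho> x \<oplus> \<rho> y) = \<rho> x \<oplus> \<rho> y \<and> \<rho> x \<oplus> \<rho> y \<unlhd> x"
begin

lemma val_refl [simp]: "x \<in> carrier R \<Longrightarrow> x \<unlhd> x"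
  using val_total by blast

lemma val_zero_iff [simp]: "x \<in> carrier R \<Longrightarrow> \<zero> \<unlhd> x \<longleftrightarrow> x = \<zero>"
  using zero_val by auto

lemma val_minus_one: "\<one> \<unlhd> \<ominus> \<one>" "\<ominus> \<one> \<unlhd> \<one>"
proof -
  have "\<one> \<unlhd> \<ominus> \<one> \<longleftrightarrow> \<ominus> \<one> \<unlhd> \<one>"
    using val_mult[of "\<one>" "\<ominus> \<one>" "\<ominus> \<one>"] val_mult[of "\<ominus> \<one>" "\<one>" "\<ominus> \<one>"] by (auto simp: l_minus)
  then show "\<one> \<unlhd> \<ominus> \<one>" "\<ominus> \<one> \<unlhd> \<one>" using val_total[of "\<one>" "\<ominus> \<one>"] by auto
qed

lemma val_minus [simp]:
  assumes "x \<in> carrier R" "y \<in> carrier R"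
  shows "\<ominus> x \<unlhd> y \<longleftrightarrow> x \<unlhd> y" "y \<unlhd> \<ominus> x \<longleftrightarrow> y \<unlhd> x"
proof -
  have "x \<unlhd> \<ominus> x" "\<ominus> x \<unlhd> x"
    using assms val_mult[OF val_minus_one(1), of x] val_mult[OF val_minus_one(2), of x]
    by (auto simp: l_minus)
  then show "\<ominus> x \<unlhd> y \<longleftrightarrow> x \<unlhd> y" "y \<unlhd> \<ominus> x \<longleftrightarrow> y \<unlhd> x"
    using assms val_trans[of x "\<ominus> x" y] val_trans[of "\<ominus> x" x y] val_trans[of y x "\<ominus> x"]
      val_trans[of y "\<ominus> x" x] by auto
qed

lemma val_diff: "z \<unlhd> x \<Longrightarrow> z \<unlhd> y \<Longrightarrow> x \<in> carrier R \<Longrightarrow> y \<in> carrier R \<Longrightarrow> z \<in> carrier R \<Longrightarrow> z \<unlhd> x \<ominus> y"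
  unfolding minus_eq by (intro val_add) auto

lemma diff_swap: "x \<in> carrier R \<Longrightarrow> y \<in> carrier R \<Longrightarrow> x \<ominus> y = \<ominus> (y \<ominus> x)"
  by algebra

lemma val_diff_swap:
  assumes "x \<in> carrier R" "y \<in> carrier R" "z \<in> carrier R"
  shows "x \<ominus> y \<unlhd> z \<longleftrightarrow> y \<ominus> x \<unlhd> z" "z \<unlhd> x \<ominus> y \<longleftrightarrow> z \<unlhd> y \<ominus> x"
  using assms by (subst diff_swap; simp)+

lemma val_mult_mono: "x \<unlhd> y \<Longrightarrow> u \<unlhd> w \<Longrightarrow> x \<in> carrier R \<Longrightarrow> y \<in> carrier R \<Longrightarrow> u \<in> carrier R \<Longrightarrow> w \<in> carrier R
    \<Longrightarrow> x \<otimes> u \<unlhd> y \<otimes> w"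
  using val_mult[of x y u] val_mult[of u w y] val_trans[of "x \<otimes> u" "y \<otimes> u" "y \<otimes> w"]
  by (simp add: m_comm)

lemma inv_field: "x \<in> carrier R \<Longrightarrow> x \<noteq> \<zero> \<Longrightarrow> inv x \<in> carrier R"
  "x \<in> carrier R \<Longrightarrow> x \<noteq> \<zero> \<Longrightarrow> x \<otimes> inv x = \<one>" "x \<in> carrier R \<Longrightarrow> x \<noteq> \<zero> \<Longrightarrow> inv x \<otimes> x = \<one>"
  using field_Units by auto

lemma val_cancel:
  assumes "x \<in> carrier R" "y \<in> carrier R" "z \<in> carrier R" "z \<noteq> \<zero>"
  shows "x \<otimes> z \<unlhd> y \<otimes> z \<longleftrightarrow> x \<unlhd> y"
proof
  assume "x \<otimes> z \<unlhd> y \<otimes> z"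
  then have "(x \<otimes> z) \<otimes> inv z \<unlhd> (y \<otimes> z) \<otimes> inv z"
    by (rule val_mult) (use assms inv_field in auto)
  moreover have "(x \<otimes> z) \<otimes> inv z = x" "(y \<otimes> z) \<otimes> inv z = y"
    using assms by (simp_all add: m_assoc inv_field)
  ultimately show "x \<unlhd> y" by simp
qed (use assms val_mult in auto)

lemma val_cancel_left:
  assumes "x \<in> carrier R" "y \<in> carrier R" "z \<in> carrier R" "z \<noteq> \<zero>"
  shows "z \<otimes> x \<unlhd> z \<otimes> y \<longleftrightarrow> x \<unlhd> y"
  using val_cancel[OF assms] assms by (simp add: m_comm)

lemma val_pow_mono: "x \<unlhd> y \<Longrightarrow> x \<in> carrier R \<Longrightarrow> y \<in> carrier R \<Longrightarrow> x [^] (n::nat) \<unlhd> y [^] n"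
  by (induction n) (auto intro: val_mult_mono)

lemma pow_zero: "(n::nat) > 0 \<Longrightarrow> \<zero> [^] n = \<zero>"
  by (induction n) auto

lemma pow_nonzero: "x \<in> carrier R \<Longrightarrow> x \<noteq> \<zero> \<Longrightarrow> x [^] (n::nat) \<noteq> \<zero>"
  by (induction n) (auto dest: integral)

lemma val_pow_iff:
  assumes "x \<in> carrier R" "y \<in> carrier R" "(n::nat) > 0"
  shows "x [^] n \<unlhd> y [^] n \<longleftrightarrow> x \<unlhd> y"
proof
  assume *: "x [^] n \<unlhd> y [^] n"
  show "x \<unlhd> y"
  proof (rule ccontr)
    assume n: "\<not> x \<unlhd> y"
    then have yx: "y \<unlhd> x" "y \<noteq> \<zero>" using assms val_total by auto
    obtain m where m: "n = Suc m" using assms(3) by (cases n) auto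
    have 1: "x [^] m \<otimes> x \<unlhd> y [^] m \<otimes> y" using * m by simp
    have 2: "y [^] m \<otimes> y \<unlhd> x [^] m \<otimes> y" using val_mult val_pow_mono[OF yx(1)] assms by auto
    have "x [^] m \<otimes> x \<unlhd> x [^] m \<otimes> y"
      by (rule val_trans[OF 1 2]) (use assms in auto)
    moreover have "x \<noteq> \<zero>"
      using * yx assms pow_zero[OF assms(3)] pow_nonzero[of y n] val_zero_iff[of "y [^] n"] by auto
    ultimately show False using n assms pow_nonzero by (simp add: val_cancel_left)
  qed
qed (use assms val_pow_mono in auto)

text \<open>By totality, \<open>\<not> x \<unlhd> z\<close> means v(z) < v(x). Strict inequalities
  are written in this negated form throughout.\<close>

lemma val_less_add:
  assumes "\<not> x \<unlhd> z" "\<not> y \<unlhd> z" "x \<in> carrier R" "y \<in> carrier R" "z \<in> carrier R"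
  shows "\<not> x \<oplus> y \<unlhd> z"
  using assms val_total[of x y] val_add[of x x y] val_add[of y x y] val_trans[of x "x \<oplus> y" z]
    val_trans[of y "x \<oplus> y" z] by auto

lemma val_less_diff:
  assumes "\<not> x \<unlhd> z" "\<not> y \<unlhd> z" "x \<in> carrier R" "y \<in> carrier R" "z \<in> carrier R"
  shows "\<not> x \<ominus> y \<unlhd> z"
  unfolding minus_eq by (rule val_less_add) (use assms in auto)

lemma val_add_less:
  assumes "\<not> y \<unlhd> x" "x \<in> carrier R" "y \<in> carrier R"
  shows "x \<oplus> y \<unlhd> x" "x \<unlhd> x \<oplus> y"
proof -
  show "x \<oplus> y \<unlhd> x"
  proof (rule ccontr)
    assume "\<not> ?thesis"
    then have "\<not> (x \<oplus> y) \<ominus> y \<unlhd> x" using assms by (intro val_less_diff) auto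
    moreover have "(x \<oplus> y) \<ominus> y = x" using assms by algebra
    ultimately show False using assms by simp
  qed
  show "x \<unlhd> x \<oplus> y" using assms val_total[of x y] by (intro val_add) auto
qed

lemma sec_eq_zero_iff [simp]: "x \<in> carrier R \<Longrightarrow> \<rho> x = \<zero> \<longleftrightarrow> x = \<zero>"
  using sec_eq_iff[of x \<zero>] by (cases "x = \<zero>") (auto simp: minus_eq)

lemma sec_val:
  assumes "x \<in> carrier R"
  shows "\<rho> x \<unlhd> x" "x \<unlhd> \<rho> x"
proof -
  have "\<rho> x \<unlhd> x \<and> x \<unlhd> \<rho> x"
  proof (cases "x = \<zero>")
    case False
    then have n: "\<not> x \<ominus> \<rho> x \<unlhd> x" using sec_eq_iff[of x "\<rho> x"] assms by simp
    have "x \<oplus> \<ominus> (x \<ominus> \<rho> x) \<unlhd> x" "x \<unlhd> x \<oplus> \<ominus> (x \<ominus> \<rho> x)"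
      by (rule val_add_less, use n assms in simp_all)+
    moreover have "x \<oplus> \<ominus> (x \<ominus> \<rho> x) = \<rho> x" using assms sec_closed[OF assms] by algebra
    ultimately show ?thesis by simp
  qed simp
  then show "\<rho> x \<unlhd> x" "x \<unlhd> \<rho> x" by auto
qed

lemma val_sec [simp]:
  assumes "x \<in> carrier R" "y \<in> carrier R"
  shows "\<rho> x \<unlhd> y \<longleftrightarrow> x \<unlhd> y" "y \<unlhd> \<rho> x \<longleftrightarrow> y \<unlhd> x"
  using assms sec_val[of x] val_trans[of x "\<rho> x" y] val_trans[of "\<rho> x" x y] val_trans[of y x "\<rho> x"]
    val_trans[of y "\<rho> x" x] by auto

lemma sec_eq_val:
  assumes "\<rho> x = \<rho> y" "x \<in> carrier R" "y \<in> carrier R"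
  shows "x \<unlhd> y" "y \<unlhd> x"
  using assms val_sec[of x y] val_sec[of x x] val_sec[of y x] by (metis sec_closed val_refl val_sec)+

lemma sec_one [simp]: "\<rho> \<one> = \<one>"
proof -
  have "\<rho> \<one> \<otimes> \<rho> \<one> = \<rho> \<one> \<otimes> \<one>" using sec_mult[of \<one> \<one>] by simp
  then show ?thesis using m_lcancel[of "\<rho> \<one>" "\<rho> \<one>" \<one>] by simp
qed

lemma sec_pow: "x \<in> carrier R \<Longrightarrow> \<rho> (x [^] (n::nat)) = \<rho> x [^] n"
  by (induction n) (auto simp: sec_mult)

lemma sec_add_less:
  assumes "\<not> y \<unlhd> x" "x \<in> carrier R" "y \<in> carrier R"
  shows "\<rho> (x \<oplus> y) = \<rho> x"
proof -
  have "x \<noteq> \<zero>" using assms by auto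
  moreover have "x \<ominus> (x \<oplus> y) = \<ominus> y" using assms by algebra
  ultimately show ?thesis using sec_eq_iff[of x "x \<oplus> y"] assms by simp
qed

lemma val_sub_sec: "x \<in> carrier R \<Longrightarrow> x \<noteq> \<zero> \<Longrightarrow> \<not> x \<ominus> \<rho> x \<unlhd> x"
  using sec_eq_iff[of x "\<rho> x"] by simp

text \<open>The sums x + y and \<rho> x + \<rho> y differ by (x - \<rho> x) + (y - \<rho> y), whose
  value exceeds v(x). So \<rho> x + \<rho> y has value above v(x) as well, which
  \<open>sec_add\<close> allows only for 0.\<close>

lemma sec_add_cancel:
  assumes xy: "x \<unlhd> y" "y \<unlhd> x" "x \<in> carrier R" "y \<in> carrier R" and n: "\<not> x \<oplus> y \<unlhd> x"
  shows "\<rho> x \<oplus> \<rho> y = \<zero>"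
proof (rule ccontr)
  assume nz: "\<rho> x \<oplus> \<rho> y \<noteq> \<zero>"
  then have le: "\<rho> x \<oplus> \<rho> y \<unlhd> x" using sec_add xy by blast
  have "x \<noteq> \<zero>" "y \<noteq> \<zero>" using xy n by auto
  then have "\<not> x \<ominus> \<rho> x \<unlhd> x" "\<not> y \<ominus> \<rho> y \<unlhd> x"
    using val_sub_sec[of x] val_sub_sec[of y] xy val_trans[of "y \<ominus> \<rho> y" x y] by auto
  then have "\<not> (x \<ominus> \<rho> x) \<oplus> (y \<ominus> \<rho> y) \<unlhd> x"
    by (rule val_less_add) (use xy in auto)
  with n have "\<not> (x \<oplus> y) \<ominus> ((x \<ominus> \<rho> x) \<oplus> (y \<ominus> \<rho> y)) \<unlhd> x"
    by (rule val_less_diff) (use xy in auto)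
  moreover have "(x \<oplus> y) \<ominus> ((x \<ominus> \<rho> x) \<oplus> (y \<ominus> \<rho> y)) = \<rho> x \<oplus> \<rho> y"
    using xy(3,4) sec_closed[OF xy(3)] sec_closed[OF xy(4)] by algebra
  ultimately show False using le by simp
qed

text \<open>The difference of x + y and \<rho> x + \<rho> y has value above v(x) = v(x + y), so
  \<rho> takes the same value at both; by \<open>sec_add\<close> the second sum is its own
  image.\<close>

lemma sec_add_eq:
  assumes xy: "x \<unlhd> y" "y \<unlhd> x" "x \<in> carrier R" "y \<in> carrier R" and le: "x \<oplus> y \<unlhd> x"
  shows "\<rho> (x \<oplus> y) = \<rho> x \<oplus> \<rho> y"
proof (cases "x = \<zero>")
  case True
  then show ?thesis using xy by simp
next
  case False
  then have "y \<noteq> \<zero>" using xy by auto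
  then have "\<not> x \<ominus> \<rho> x \<unlhd> x" "\<not> y \<ominus> \<rho> y \<unlhd> x"
    using False val_sub_sec[of x] val_sub_sec[of y] xy val_trans[of "y \<ominus> \<rho> y" x y] by auto
  then have n: "\<not> (x \<ominus> \<rho> x) \<oplus> (y \<ominus> \<rho> y) \<unlhd> x"
    by (rule val_less_add) (use xy in auto)
  have nz: "x \<oplus> y \<noteq> \<zero>" using le xy False by auto
  have "(x \<oplus> y) \<ominus> (\<rho> x \<oplus> \<rho> y) = (x \<ominus> \<rho> x) \<oplus> (y \<ominus> \<rho> y)"
    using xy(3,4) sec_closed[OF xy(3)] sec_closed[OF xy(4)] by algebra
  moreover have "\<not> (x \<ominus> \<rho> x) \<oplus> (y \<ominus> \<rho> y) \<unlhd> x \<oplus> y"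
    using n le xy val_trans[of "(x \<ominus> \<rho> x) \<oplus> (y \<ominus> \<rho> y)" "x \<oplus> y" x] by auto
  ultimately have eq: "\<rho> (x \<oplus> y) = \<rho> (\<rho> x \<oplus> \<rho> y)"
    using sec_eq_iff[of "x \<oplus> y" "\<rho> x \<oplus> \<rho> y"] xy nz by simp
  then have "\<rho> x \<oplus> \<rho> y \<noteq> \<zero>" using nz xy by auto
  then show ?thesis using eq sec_add[OF xy(3,4,1,2)] by simp
qed

lemma sec_minus [simp]: assumes "x \<in> carrier R" shows "\<rho> (\<ominus> x) = \<ominus> \<rho> x"
proof (cases "x = \<zero>")
  case False
  then have "\<rho> x \<oplus> \<rho> (\<ominus> x) = \<zero>" using assms by (intro sec_add_cancel) (auto simp: r_neg)
  then have "\<ominus> \<rho> x = \<rho> (\<ominus> x)" using assms by (intro minus_equality) (auto simp: a_comm)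
  then show ?thesis by simp
qed auto

text \<open>\<open>lead d\<close> is, up to the factor \<open>\<rho> d\<close>, the residue map applied to \<open>u / d\<close>; this is why it is
  additive on the elements \<open>u\<close> with \<open>v(u) \<ge> v(d)\<close>.\<close>

definition lead :: "'a \<Rightarrow> 'a \<Rightarrow> 'a" where
  "lead d u = (if u \<unlhd> d then \<rho> u else \<zero>)"

lemma lead_add:
  assumes "d \<unlhd> u" "d \<unlhd> w" and cl: "d \<in> carrier R" "u \<in> carrier R" "w \<in> carrier R"
  shows "lead d (u \<oplus> w) = lead d u \<oplus> lead d w"
proof -
  consider "u \<unlhd> d" "w \<unlhd> d" | "u \<unlhd> d" "\<not> w \<unlhd> d" | "\<not> u \<unlhd> d" "w \<unlhd> d" | "\<not> u \<unlhd> d" "\<not> w \<unlhd> d" by blast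
  then show ?thesis
  proof cases
    case 1
    then have eq: "u \<unlhd> w" "w \<unlhd> u" using assms val_trans[of u d w] val_trans[of w d u] by auto
    have iff: "u \<oplus> w \<unlhd> d \<longleftrightarrow> u \<oplus> w \<unlhd> u"
      using 1 assms val_trans[of "u \<oplus> w" d u] val_trans[of "u \<oplus> w" u d] by auto
    show ?thesis
      using sec_add_eq[OF eq] sec_add_cancel[OF eq] cl 1 unfolding lead_def iff by auto
  next
    case 2
    then have n: "\<not> w \<unlhd> u" using cl val_trans[of w u d] by auto
    then have "u \<oplus> w \<unlhd> d" using val_add_less[OF n] 2 cl val_trans[of "u \<oplus> w" u d] by auto
    then show ?thesis using sec_add_less[OF n] 2 cl by (simp add: lead_def)
  next
    case 3
    then have n: "\<not> u \<unlhd> w" using cl val_trans[of u w d] by auto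
    then have "w \<oplus> u \<unlhd> d" using val_add_less[OF n] 3 cl val_trans[of "w \<oplus> u" w d] by auto
    then show ?thesis using sec_add_less[OF n] 3 cl by (simp add: lead_def a_comm)
  next
    case 4
    then show ?thesis using val_less_add[of u d w] cl by (simp add: lead_def)
  qed
qed

text \<open>The list \<open>q\<close> is the initial form of \<open>p\<close> at x: it keeps \<rho>
  of those coefficients whose terms attain v(d). The Horner recursion passes from d to d / x for the
  tail, and \<open>lead_add\<close> joins the constant term.\<close>

lemma lead_peval:
  assumes "length q = length p" "set p \<subseteq> carrier R" "d \<in> carrier R" "d \<noteq> \<zero>" "x \<in> carrier R" "x \<noteq> \<zero>"
    and "\<And>i. i < length p \<Longrightarrow> d \<unlhd> p ! i \<otimes> x [^] i"
    and "\<And>i. i < length p \<Longrightarrow> q ! i = (if p ! i \<otimes> x [^] i \<unlhd> d then \<rho> (p ! i) else \<zero>)"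
  shows "d \<unlhd> peval R p x \<and> lead d (peval R p x) = peval R q (\<rho> x)"
  using assms
proof (induction q p arbitrary: d rule: list_induct2)
  case Nil
  then show ?case by (simp add: lead_def)
next
  case (Cons b q a p)
  define e where "e = d \<otimes> inv x"
  define u where "u = peval R p x"
  have e: "e \<in> carrier R" "e \<otimes> x = d" using Cons.prems(1-5) inv_field[of x] by (auto simp: e_def m_assoc)
  then have e0: "e \<noteq> \<zero>" using Cons.prems(1-5) by auto
  have cl: "a \<in> carrier R" "u \<in> carrier R" using Cons.prems(1-5) by (auto simp: u_def)
  have pc: "p ! i \<in> carrier R" if "i < length p" for i using that Cons.prems(1-5) nth_mem[of i p] by auto
  have *: "(a # p) ! Suc i \<otimes> x [^] Suc i = (p ! i \<otimes> x [^] i) \<otimes> x" if "i < length p" for i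
    using pc[OF that] Cons.prems(1-5) by (simp add: m_assoc)
  have IH: "e \<unlhd> u \<and> lead e u = peval R q (\<rho> x)"
    unfolding u_def
  proof (rule Cons.IH)
    fix i assume i: "i < length p"
    have "e \<otimes> x \<unlhd> (p ! i \<otimes> x [^] i) \<otimes> x" using Cons.prems(6)[of "Suc i"] *[OF i] i e by simp
    then show "e \<unlhd> p ! i \<otimes> x [^] i"
      using val_cancel[of e "p ! i \<otimes> x [^] i" x] e pc[OF i] Cons.prems(4,5) by simp
    have "(p ! i \<otimes> x [^] i) \<otimes> x \<unlhd> e \<otimes> x \<longleftrightarrow> p ! i \<otimes> x [^] i \<unlhd> e"
      using val_cancel[of "p ! i \<otimes> x [^] i" e x] e pc[OF i] Cons.prems(4,5) by simp
    then show "q ! i = (if p ! i \<otimes> x [^] i \<unlhd> e then \<rho> (p ! i) else \<zero>)"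
      using Cons.prems(7)[of "Suc i"] *[OF i] i e by simp
  qed (use Cons.prems(1-5) e e0 in auto)
  have le: "u \<otimes> x \<unlhd> d \<longleftrightarrow> u \<unlhd> e" "d \<unlhd> u \<otimes> x"
    using val_cancel[of u e x] val_cancel[of e u x] IH e cl Cons.prems(1-5) by auto
  then have l: "lead d (x \<otimes> u) = \<rho> x \<otimes> lead e u"
    using cl Cons.prems(1-5) by (simp add: lead_def m_comm[of x] sec_mult) (simp add: m_comm)
  have da: "d \<unlhd> a" "b = lead d a" using Cons.prems(6,7)[of 0] cl by (auto simp: lead_def)
  have "lead d (a \<oplus> x \<otimes> u) = lead d a \<oplus> lead d (x \<otimes> u)"
    by (rule lead_add) (use da le cl Cons.prems(1-5) in \<open>auto simp: m_comm\<close>)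
  moreover have "d \<unlhd> a \<oplus> x \<otimes> u" by (rule val_add) (use da le cl Cons.prems(1-5) in \<open>auto simp: m_comm\<close>)
  ultimately show ?case using da IH l by (simp add: u_def)
qed

text \<open>The leading part of the value 0 is 0, because d is nonzero.\<close>

lemma peval_sec_root:
  assumes "length q = length p" "set p \<subseteq> carrier R" "d \<in> carrier R" "d \<noteq> \<zero>" "x \<in> carrier R" "x \<noteq> \<zero>"
    and "\<And>i. i < length p \<Longrightarrow> d \<unlhd> p ! i \<otimes> x [^] i"
    and "\<And>i. i < length p \<Longrightarrow> q ! i = (if p ! i \<otimes> x [^] i \<unlhd> d then \<rho> (p ! i) else \<zero>)"
    and "peval R p x = \<zero>"
  shows "peval R q (\<rho> x) = \<zero>"
  using lead_peval[OF assms(1-8)] assms(3,4,9) by (auto simp: lead_def)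

text \<open>The lemmas \<open>far_roots\<close> and \<open>near_root\<close> read off from the coefficients whether a polynomial has a root \<open>z\<close> with
  \<open>v(z) > v(d)\<close>; they replace the Newton polygon.\<close>

lemma far_roots:
  assumes "set p \<subseteq> carrier R" "p \<noteq> []" "last p \<noteq> \<zero>" "d \<in> carrier R"
    and root: "\<And>p. set p \<subseteq> carrier R \<Longrightarrow> length p \<ge> 2 \<Longrightarrow> last p \<noteq> \<zero> \<Longrightarrow> \<exists>x \<in> carrier R. peval R p x = \<zero>"
    and far: "\<And>y. y \<in> carrier R \<Longrightarrow> peval R p y = \<zero> \<Longrightarrow> y \<unlhd> d"
    and "j < length p"
  shows "p ! 0 \<unlhd> p ! j \<otimes> d [^] j"
  using assms(1-3) far assms(7)
proof (induction "length p" arbitrary: p j)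
  case (Suc n)
  have p0: "p ! 0 \<in> carrier R" using Suc.prems(1,2) nth_mem[of 0 p] by auto
  show ?case
  proof (cases "j = 0")
    case True
    then show ?thesis using p0 by simp
  next
    case False
    then obtain i where i: "j = Suc i" "i < length p - 1" using Suc.prems(5) by (cases j) auto
    then have len: "length p \<ge> 2" by simp
    then obtain z where z: "z \<in> carrier R" "peval R p z = \<zero>" using root Suc.prems by blast
    have zd: "z \<unlhd> d" using Suc.prems(4) z by blast
    define q where "q = synth R z p"
    have q: "set q \<subseteq> carrier R" "length q = n" "q \<noteq> []" "last q = last p"
    proof -
      show "set q \<subseteq> carrier R" using Suc.prems z by (simp add: q_def carrier_synth)
      show "length q = n" using Suc.hyps(2) by (simp add: q_def)
      then show "q \<noteq> []" using Suc.hyps(2) len by auto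
      show "last q = last p" using last_synth[OF len] Suc.prems z by (simp add: q_def)
    qed
    have qc: "k < n \<Longrightarrow> q ! k \<in> carrier R" for k using q nth_mem[of k q] by auto
    have n: "n = length p - 1" "n > 0" using Suc.hyps(2) len by auto
    have IH: "q ! 0 \<unlhd> q ! k \<otimes> d [^] k" if "k < n" for k
    proof (rule Suc.hyps(1))
      fix y assume y: "y \<in> carrier R" "peval R q y = \<zero>"
      then have "peval R p y = \<zero>" using peval_synth[of p y z] Suc.prems z by (simp add: q_def)
      then show "y \<unlhd> d" using Suc.prems(4) y by blast
    qed (use q Suc.prems that in auto)
    \<comment> \<open>Every root of \<open>p\<close>, in particular z, has value at most v(d). So
      the inductive bound for \<open>q\<close> carries over to \<open>p\<close> when a factor z is
      traded for d, and the ultrametric inequality combines the two contributions to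
      \<open>p ! j\<close>.\<close>
    have hd: "p ! 0 = \<ominus> (z \<otimes> q ! 0)" using hd_synth[of p z] Suc.prems z len by (simp add: q_def)
    have t1: "z \<otimes> q ! 0 \<unlhd> q ! i \<otimes> d [^] Suc i"
    proof -
      have "z \<otimes> q ! 0 \<unlhd> d \<otimes> (q ! i \<otimes> d [^] i)"
        by (rule val_mult_mono[OF zd IH]) (use i n z qc assms(4) in auto)
      moreover have "d \<otimes> (q ! i \<otimes> d [^] i) = q ! i \<otimes> d [^] Suc i"
        using i n z qc assms(4) by (simp add: m_ac)
      ultimately show ?thesis by simp
    qed
    have t2: "z \<otimes> q ! 0 \<unlhd> z \<otimes> (q ! Suc i \<otimes> d [^] Suc i)" if "Suc i < n"
      by (rule val_mult_mono[OF _ IH]) (use that z qc n assms(4) in auto)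
    have "p ! j = q ! i \<ominus> (if Suc i < n then z \<otimes> q ! Suc i else \<zero>)"
      using nth_synth[of p z i] Suc.prems z i n by (simp add: q_def)
    then have "p ! j \<otimes> d [^] j = q ! i \<otimes> d [^] Suc i \<ominus> (if Suc i < n then z \<otimes> (q ! Suc i \<otimes> d [^] Suc i) else \<zero>)"
      using i n qc z assms(4)
      by (auto simp: minus_eq l_distr l_minus m_assoc simp del: nat_pow_Suc)
    moreover have "z \<otimes> q ! 0 \<unlhd> \<dots>"
      by (rule val_diff) (use t1 t2 i n qc z assms(4) in auto)
    ultimately show ?thesis using hd qc n z i assms(4) Suc.prems(1,5) by auto
  qed
qed auto

text \<open>The factor \<open>c\<close> absorbs one power of x for each coefficient that the
  induction peels off.\<close>

lemma val_less_peval: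
  assumes "set p \<subseteq> carrier R" "d \<in> carrier R" "d \<noteq> \<zero>" "x \<in> carrier R"
    and "\<And>i. i < length p \<Longrightarrow> \<not> c \<otimes> (p ! i \<otimes> x [^] i) \<unlhd> d" and "c \<in> carrier R"
  shows "\<not> c \<otimes> peval R p x \<unlhd> d"
  using assms
proof (induction p arbitrary: c)
  case (Cons a p)
  have "\<not> (c \<otimes> x) \<otimes> peval R p x \<unlhd> d"
  proof (rule Cons.IH)
    fix i assume i: "i < length p"
    then have "p ! i \<in> carrier R" using Cons.prems(1) nth_mem[of i p] by auto
    then have "c \<otimes> ((a # p) ! Suc i \<otimes> x [^] Suc i) = (c \<otimes> x) \<otimes> (p ! i \<otimes> x [^] i)"
      using Cons.prems by (simp add: m_ac)
    then show "\<not> (c \<otimes> x) \<otimes> (p ! i \<otimes> x [^] i) \<unlhd> d" using Cons.prems(5)[of "Suc i"] i by simp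
  qed (use Cons.prems(1-4,6) in auto)
  moreover have "\<not> c \<otimes> a \<unlhd> d" using Cons.prems(5)[of 0] Cons.prems(1) by simp
  moreover have "c \<otimes> peval R (a # p) x = c \<otimes> a \<oplus> (c \<otimes> x) \<otimes> peval R p x"
    using Cons.prems by (simp add: r_distr m_assoc)
  moreover have "\<not> c \<otimes> a \<oplus> (c \<otimes> x) \<otimes> peval R p x \<unlhd> d" if "\<not> c \<otimes> a \<unlhd> d" "\<not> (c \<otimes> x) \<otimes> peval R p x \<unlhd> d"
    by (rule val_less_add[OF that]) (use Cons.prems(1-4,6) in auto)
  ultimately show ?case by simp
qed auto

lemma near_root:
  assumes p: "set p \<subseteq> carrier R" "p \<noteq> []" and z: "z \<in> carrier R" "peval R p z = \<zero>"
    and d: "d \<in> carrier R" "\<not> z \<unlhd> d" and le: "\<And>j. j < length p \<Longrightarrow> p ! 0 \<unlhd> p ! j \<otimes> d [^] j"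
  shows "p ! 0 = \<zero>"
proof (rule ccontr)
  assume nz: "p ! 0 \<noteq> \<zero>"
  obtain a q where pq: "p = a # q" using p by (cases p) auto
  have cl: "a \<in> carrier R" "set q \<subseteq> carrier R" "a \<noteq> \<zero>" using p nz pq by auto
  have dz: "d \<unlhd> z" "d \<noteq> \<zero>" using d z val_total by auto
  \<comment> \<open>Since v(z) > v(d), a nonzero term of positive degree has strictly larger value
    at z than at d, hence value above that of \<open>p ! 0\<close>. The constant term would then
    determine the value of the sum, which is 0.\<close>
  have "\<not> z \<otimes> peval R q z \<unlhd> a"
  proof (rule val_less_peval)
    fix i assume i: "i < length q"
    then have qi: "q ! i \<in> carrier R" using cl nth_mem[of i q] by auto
    show "\<not> z \<otimes> (q ! i \<otimes> z [^] i) \<unlhd> a"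
    proof
      assume *: "z \<otimes> (q ! i \<otimes> z [^] i) \<unlhd> a"
      have 1: "a \<unlhd> q ! i \<otimes> d [^] Suc i" using le[of "Suc i"] i by (simp add: pq)
      have 2: "z \<otimes> (q ! i \<otimes> z [^] i) \<unlhd> q ! i \<otimes> d [^] Suc i"
        by (rule val_trans[OF * 1]) (use cl qi z d in auto)
      have q0: "q ! i \<noteq> \<zero>" using * cl z by auto
      have "q ! i \<otimes> z [^] Suc i \<unlhd> q ! i \<otimes> d [^] Suc i"
        using 2 qi z by (simp add: m_ac)
      then have "z [^] Suc i \<unlhd> d [^] Suc i" using q0 qi z d by (simp add: val_cancel_left del: nat_pow_Suc)
      then show False using d z val_pow_iff[of z d "Suc i"] by simp
    qed
  qed (use cl z in auto)
  then have "\<rho> (a \<oplus> z \<otimes> peval R q z) = \<rho> a" using cl z by (intro sec_add_less) auto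
  moreover have "a \<oplus> z \<otimes> peval R q z = \<zero>" using z pq by simp
  ultimately have "\<rho> a = \<zero>" by simp
  then show False using cl by simp
qed

end

section \<open>Partial isomorphisms\<close>

text \<open>The number of linear factors is recorded because it bounds the exponents of the
  monomials that have to be compared later, and thereby the degree up to which \<open>G\<close> must
  contain roots.\<close>

inductive linprod :: "('a, 'm) ring_scheme \<Rightarrow> 'a set \<Rightarrow> 'a \<Rightarrow> 'a \<Rightarrow> nat \<Rightarrow> bool" for R (structure) and G z where
  const: "c \<in> G \<Longrightarrow> linprod R G z c 0"
| factor: "linprod R G z u k \<Longrightarrow> a \<in> G \<Longrightarrow> linprod R G z ((z \<ominus> a) \<otimes> u) (Suc k)"

locale sectioned_pair =
  R: sectioned_field R le1 sec1 + S: sectioned_field S le2 sec2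
  for R :: "('a, 'm) ring_scheme" (structure) and le1 (infix \<open>\<unlhd>\<^sub>1\<close> 50) and sec1 (\<open>\<rho>\<^sub>1\<close>)
    and S :: "('b, 'n) ring_scheme" (structure) and le2 (infix \<open>\<unlhd>\<^sub>2\<close> 50) and sec2 (\<open>\<rho>\<^sub>2\<close>) +
  assumes R_root: "\<And>p. set p \<subseteq> carrier R \<Longrightarrow> length p \<ge> 2 \<Longrightarrow> last p \<noteq> \<zero> \<Longrightarrow>
      \<exists>x \<in> carrier R. peval R p x = \<zero>"
    and S_root: "\<And>p. set p \<subseteq> carrier S \<Longrightarrow> length p \<ge> 2 \<Longrightarrow> last p \<noteq> \<zero>\<^bsub>S\<^esub> \<Longrightarrow>
      \<exists>x \<in> carrier S. peval S p x = \<zero>\<^bsub>S\<^esub>"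
begin

abbreviation P where "P \<equiv> RDirProd R S"

lemma prod_simps [simp]:
  "carrier P = carrier R \<times> carrier S" "\<zero>\<^bsub>P\<^esub> = (\<zero>, \<zero>\<^bsub>S\<^esub>)" "\<one>\<^bsub>P\<^esub> = (\<one>, \<one>\<^bsub>S\<^esub>)"
  "(a, b) \<oplus>\<^bsub>P\<^esub> (c, d) = (a \<oplus> c, b \<oplus>\<^bsub>S\<^esub> d)" "(a, b) \<otimes>\<^bsub>P\<^esub> (c, d) = (a \<otimes> c, b \<otimes>\<^bsub>S\<^esub> d)"
  by (simp_all add: RDirProd_def DirProd_def monoid.defs)

lemma prod_fst_snd [simp]:
  "fst (u \<oplus>\<^bsub>P\<^esub> w) = fst u \<oplus> fst w" "snd (u \<oplus>\<^bsub>P\<^esub> w) = snd u \<oplus>\<^bsub>S\<^esub> snd w"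
  "fst (u \<otimes>\<^bsub>P\<^esub> w) = fst u \<otimes> fst w" "snd (u \<otimes>\<^bsub>P\<^esub> w) = snd u \<otimes>\<^bsub>S\<^esub> snd w"
  by (cases u; cases w; simp)+

sublocale P: cring P
proof (rule cring.intro)
  show "ring P" by (rule RDirProd_ring) (rule R.ring_axioms S.ring_axioms)+
  show "Group.comm_monoid P"
    by (rule monoid.monoid_comm_monoidI[OF ring.is_monoid[OF \<open>ring P\<close>]])
      (auto simp: R.m_comm S.m_comm)
qed

lemma prod_minus [simp]:
  assumes "a \<in> carrier R" "b \<in> carrier S"
  shows "\<ominus>\<^bsub>P\<^esub> (a, b) = (\<ominus> a, \<ominus>\<^bsub>S\<^esub> b)"
  by (rule P.minus_equality) (use assms R.l_neg S.l_neg in auto)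

lemma prod_diff [simp]:
  assumes "a \<in> carrier R" "b \<in> carrier S" "c \<in> carrier R" "d \<in> carrier S"
  shows "(a, b) \<ominus>\<^bsub>P\<^esub> (c, d) = (a \<ominus> c, b \<ominus>\<^bsub>S\<^esub> d)"
  using assms by (simp add: P.minus_eq R.minus_eq S.minus_eq)

text \<open>A list of pairs over \<open>G\<close> is a polynomial together with its image, so a
  computation in the product ring treats both sides at once.\<close>

lemma prod_peval: "peval P p z = (peval R (map fst p) (fst z), peval S (map snd p) (snd z))"
  by (induction p) (auto simp: prod_eq_iff)

text \<open>The last condition makes \<open>G\<close> the graph of an injective function, as \<open>a = 0\<close> iff \<open>v(0) \<le> v(a)\<close>.\<close>

definition partial_iso :: "('a \<times> 'b) set \<Rightarrow> bool" where
  "partial_iso G \<longleftrightarrow> subring G P \<and> (\<forall>(a, b) \<in> G. (\<rho>\<^sub>1 a, \<rho>\<^sub>2 b) \<in> G) \<and>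
     (\<forall>(a, b) \<in> G. \<forall>(c, d) \<in> G. a \<unlhd>\<^sub>1 c \<longleftrightarrow> b \<unlhd>\<^sub>2 d)"

text \<open>At most \<open>n\<close> coefficients: degree less than \<open>n\<close>.\<close>

definition closed_upto :: "('a \<times> 'b) set \<Rightarrow> nat \<Rightarrow> bool" where
  "closed_upto G n \<longleftrightarrow> (\<forall>p x. set p \<subseteq> G \<longrightarrow> p \<noteq> [] \<longrightarrow> length p \<le> n \<longrightarrow> fst (last p) \<noteq> \<zero> \<longrightarrow>
     x \<in> carrier R \<longrightarrow> peval R (map fst p) x = \<zero> \<longrightarrow> x \<in> fst ` G)"

context
  fixes G
  assumes iso: "partial_iso G"
begin

lemma G_subring: "subring G P" using iso by (simp add: partial_iso_def)

lemma G_carrier: "(a, b) \<in> G \<Longrightarrow> a \<in> carrier R" "(a, b) \<in> G \<Longrightarrow> b \<in> carrier S"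
  using subringE(1)[OF G_subring] by auto

lemma G_list_carrier: "set p \<subseteq> G \<Longrightarrow> set (map fst p) \<subseteq> carrier R" "set p \<subseteq> G \<Longrightarrow> set (map snd p) \<subseteq> carrier S"
  "set p \<subseteq> G \<Longrightarrow> set p \<subseteq> carrier P"
  using subringE(1)[OF G_subring] by fastforce+

lemma G_ops:
  "(\<zero>, \<zero>\<^bsub>S\<^esub>) \<in> G" "(\<one>, \<one>\<^bsub>S\<^esub>) \<in> G"
  "(a, b) \<in> G \<Longrightarrow> (c, d) \<in> G \<Longrightarrow> (a \<oplus> c, b \<oplus>\<^bsub>S\<^esub> d) \<in> G"
  "(a, b) \<in> G \<Longrightarrow> (c, d) \<in> G \<Longrightarrow> (a \<otimes> c, b \<otimes>\<^bsub>S\<^esub> d) \<in> G"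
  "(a, b) \<in> G \<Longrightarrow> (\<ominus> a, \<ominus>\<^bsub>S\<^esub> b) \<in> G"
  "(a, b) \<in> G \<Longrightarrow> (c, d) \<in> G \<Longrightarrow> (a \<ominus> c, b \<ominus>\<^bsub>S\<^esub> d) \<in> G"
  "(a, b) \<in> G \<Longrightarrow> (a [^] (n::nat), b [^]\<^bsub>S\<^esub> n) \<in> G"
  "(a, b) \<in> G \<Longrightarrow> (\<rho>\<^sub>1 a, \<rho>\<^sub>2 b) \<in> G"
proof -
  show 0: "(\<zero>, \<zero>\<^bsub>S\<^esub>) \<in> G" and 1: "(\<one>, \<one>\<^bsub>S\<^esub>) \<in> G"
    using subringE(2,3)[OF G_subring] by auto
  show add: "(a, b) \<in> G \<Longrightarrow> (c, d) \<in> G \<Longrightarrow> (a \<oplus> c, b \<oplus>\<^bsub>S\<^esub> d) \<in> G" for a b c d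
    using subringE(7)[OF G_subring, of "(a, b)" "(c, d)"] by simp
  show mult: "(a, b) \<in> G \<Longrightarrow> (c, d) \<in> G \<Longrightarrow> (a \<otimes> c, b \<otimes>\<^bsub>S\<^esub> d) \<in> G" for a b c d
    using subringE(6)[OF G_subring, of "(a, b)" "(c, d)"] by simp
  show minus: "(a, b) \<in> G \<Longrightarrow> (\<ominus> a, \<ominus>\<^bsub>S\<^esub> b) \<in> G" for a b
    using subringE(5)[OF G_subring, of "(a, b)"] G_carrier[of a b] by simp
  show "(a, b) \<in> G \<Longrightarrow> (c, d) \<in> G \<Longrightarrow> (a \<ominus> c, b \<ominus>\<^bsub>S\<^esub> d) \<in> G"
    unfolding R.minus_eq S.minus_eq by (intro add minus)
  show "(a, b) \<in> G \<Longrightarrow> (a [^] (n::nat), b [^]\<^bsub>S\<^esub> n) \<in> G"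
    by (induction n) (auto intro: 1 mult)
  show "(a, b) \<in> G \<Longrightarrow> (\<rho>\<^sub>1 a, \<rho>\<^sub>2 b) \<in> G" using iso by (auto simp: partial_iso_def)
qed

lemma G_val: "(a, b) \<in> G \<Longrightarrow> (c, d) \<in> G \<Longrightarrow> a \<unlhd>\<^sub>1 c \<longleftrightarrow> b \<unlhd>\<^sub>2 d"
  using iso by (auto simp: partial_iso_def)

lemma G_zero: "(a, b) \<in> G \<Longrightarrow> a = \<zero> \<longleftrightarrow> b = \<zero>\<^bsub>S\<^esub>"
  using G_val[OF G_ops(1), of a b] G_carrier[of a b] by simp

lemma G_fun:
  assumes "(a, b) \<in> G" "(c, d) \<in> G"
  shows "a = c \<longleftrightarrow> b = d"
  using G_zero[OF G_ops(6)[OF assms]] assms G_carrier by (metis R.r_right_minus_eq S.r_right_minus_eq)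

lemma G_peval: "set p \<subseteq> G \<Longrightarrow> (a, b) \<in> G \<Longrightarrow> (peval R (map fst p) a, peval S (map snd p) b) \<in> G"
  using P.subring_peval[OF G_subring, of p "(a, b)"] by (simp add: prod_peval)

text \<open>A root exists because R is algebraically closed; closedness puts it into the domain of
  \<open>G\<close>, and \<open>G_zero\<close> transports the vanishing to the other side.\<close>

lemma closed_root:
  assumes "closed_upto G n" "set p \<subseteq> G" "length p \<ge> 2" "length p \<le> n" "fst (last p) \<noteq> \<zero>"
  obtains a b where "(a, b) \<in> G" "peval R (map fst p) a = \<zero>" "peval S (map snd p) b = \<zero>\<^bsub>S\<^esub>"
proof -
  have "p \<noteq> []" using assms by auto
  then obtain x where x: "x \<in> carrier R" "peval R (map fst p) x = \<zero>"
    using R_root[of "map fst p"] assms G_list_carrier(1) by (auto simp: last_map)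
  then have "x \<in> fst ` G" using assms \<open>p \<noteq> []\<close> unfolding closed_upto_def by blast
  then obtain b where b: "(x, b) \<in> G" by auto
  then show thesis using that[OF b] x G_zero[OF G_peval[OF assms(2) b]] by simp
qed

text \<open>By \<open>closed_root\<close> a polynomial and its image have corresponding roots;
  synthetic division in the product ring splits them off together and keeps the quotient over
  \<open>G\<close>. Vanishing top coefficients are stripped first.\<close>

lemma linprod_peval:
  assumes "closed_upto G n" "set p \<subseteq> G" "length p \<le> Suc l" "z \<in> carrier P" "Suc l \<le> n"
  shows "\<exists>k \<le> l. linprod P G z (peval P p z) k"
  using assms(2,3,5)
proof (induction "length p" arbitrary: p l rule: less_induct)
  case less
  consider "p = []" | "p \<noteq> []" "fst (last p) = \<zero>" | "length p = 1" | "length p \<ge> 2" "fst (last p) \<noteq> \<zero>"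
    by (cases p; cases "tl p") auto
  then show ?case
  proof cases
    case 1
    then show ?thesis using linprod.const[OF G_ops(1)] by (intro exI[of _ 0]) simp
  next
    case 2
    then have "last p \<in> G" using less.prems(1) by auto
    moreover obtain a b where ab: "last p = (a, b)" by (cases "last p") auto
    ultimately have "(a, b) \<in> G" "a = \<zero>" using 2 by simp_all
    then have "last p = \<zero>\<^bsub>P\<^esub>" using G_zero[of a b] ab by simp
    then have "peval P p z = peval P (butlast p @ [\<zero>\<^bsub>P\<^esub>]) z"
      using append_butlast_last_id[OF 2(1)] by simp
    also have "\<dots> = peval P (butlast p) z"
      using P.peval_pad[of "butlast p" z 1] G_list_carrier(3)[OF less.prems(1)] assms(4)
      by (auto dest!: in_set_butlastD simp del: prod_simps(2))
    finally have "peval P p z = peval P (butlast p) z" .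
    moreover have "\<exists>k \<le> l. linprod P G z (peval P (butlast p) z) k"
      by (rule less.hyps) (use less.prems 2 in \<open>auto dest: in_set_butlastD\<close>)
    ultimately show ?thesis by simp
  next
    case 3
    then obtain c where "p = [c]" by (cases p) auto
    then have "c \<in> G" "peval P p z = c"
      using less.prems assms(4) subringE(1)[OF G_subring] P.r_null[of z] P.r_zero[of c]
      by (auto simp del: prod_simps)
    then show ?thesis using linprod.const[of c G P z] by (intro exI[of _ 0]) simp
  next
    case 4
    obtain a b where ab: "(a, b) \<in> G" "peval R (map fst p) a = \<zero>" "peval S (map snd p) b = \<zero>\<^bsub>S\<^esub>"
      by (rule closed_root[OF assms(1) less.prems(1) 4(1) _ 4(2)]) (use less.prems in auto)
    let ?q = "synth P (a, b) p"
    have q: "set ?q \<subseteq> G" using P.synth_in_lists[OF G_subring less.prems(1) ab(1)] .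
    have abP: "(a, b) \<in> carrier P" using G_carrier[OF ab(1)] by simp
    have "\<exists>k \<le> l - 1. linprod P G z (peval P ?q z) k"
      by (rule less.hyps) (use less.prems 4 q in auto)
    then obtain k where k: "k \<le> l - 1" "linprod P G z (peval P ?q z) k" by blast
    have "peval P p z = (z \<ominus>\<^bsub>P\<^esub> (a, b)) \<otimes>\<^bsub>P\<^esub> peval P ?q z \<oplus>\<^bsub>P\<^esub> peval P p (a, b)"
      by (rule P.peval_synth[OF G_list_carrier(3)[OF less.prems(1)] assms(4) abP])
    moreover have "peval P p (a, b) = \<zero>\<^bsub>P\<^esub>" using ab by (simp add: prod_peval)
    moreover have "peval P ?q z \<in> carrier P"
      using P.peval_closed[OF G_list_carrier(3)[OF q] assms(4)] .
    ultimately have "peval P p z = (z \<ominus>\<^bsub>P\<^esub> (a, b)) \<otimes>\<^bsub>P\<^esub> peval P ?q z"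
      using assms(4) abP by (simp only: P.r_zero P.minus_closed P.m_closed)
    then have "linprod P G z (peval P p z) (Suc k)" using linprod.factor[OF k(2) ab(1)] by simp
    moreover have "Suc k \<le> l" using k(1) less.prems(2) 4(1) by simp
    ultimately show ?thesis by blast
  qed
qed

end

end

section \<open>Fractions of a partial isomorphism\<close>

context field
begin

lemma inv_mult_field:
  assumes "c \<in> carrier R" "c \<noteq> \<zero>" "d \<in> carrier R" "d \<noteq> \<zero>"
  shows "inv (c \<otimes> d) = inv c \<otimes> inv d"
proof (rule comm_inv_char)
  have i: "inv c \<in> carrier R" "inv d \<in> carrier R" "c \<otimes> inv c = \<one>" "d \<otimes> inv d = \<one>"
    using assms field_Units by auto
  have "c \<otimes> d \<otimes> (inv c \<otimes> inv d) = (c \<otimes> inv c) \<otimes> (d \<otimes> inv d)" using assms i(1,2) by (simp add: m_ac)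
  then show "c \<otimes> d \<otimes> (inv c \<otimes> inv d) = \<one>" using i by simp
  show "c \<otimes> d \<in> carrier R" "inv c \<otimes> inv d \<in> carrier R" using assms i by auto
qed

lemma frac_arith:
  assumes "a \<in> carrier R" "b \<in> carrier R" "c \<in> carrier R" "c \<noteq> \<zero>" "d \<in> carrier R" "d \<noteq> \<zero>"
  shows "a \<otimes> inv c \<otimes> (b \<otimes> inv d) = a \<otimes> b \<otimes> inv (c \<otimes> d)"
    "a \<otimes> inv c \<oplus> b \<otimes> inv d = (a \<otimes> d \<oplus> b \<otimes> c) \<otimes> inv (c \<otimes> d)"
    "a \<otimes> inv c \<otimes> (c \<otimes> d) = a \<otimes> d"
proof -
  have i: "inv c \<in> carrier R" "inv d \<in> carrier R" "c \<otimes> inv c = \<one>" "d \<otimes> inv d = \<one>"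
    using assms field_Units by auto
  show "a \<otimes> inv c \<otimes> (b \<otimes> inv d) = a \<otimes> b \<otimes> inv (c \<otimes> d)"
    using assms i(1,2) by (simp add: inv_mult_field m_ac)
  have "(a \<otimes> d \<oplus> b \<otimes> c) \<otimes> (inv c \<otimes> inv d) = a \<otimes> inv c \<otimes> (d \<otimes> inv d) \<oplus> b \<otimes> inv d \<otimes> (c \<otimes> inv c)"
    using assms i(1,2) by (subst l_distr) (auto simp: m_ac)
  then show "a \<otimes> inv c \<oplus> b \<otimes> inv d = (a \<otimes> d \<oplus> b \<otimes> c) \<otimes> inv (c \<otimes> d)"
    using assms i by (simp add: inv_mult_field)
  have "a \<otimes> inv c \<otimes> (c \<otimes> d) = a \<otimes> d \<otimes> (c \<otimes> inv c)" using assms i(1,2) by (simp add: m_ac)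
  then show "a \<otimes> inv c \<otimes> (c \<otimes> d) = a \<otimes> d" using assms i by simp
qed

end

lemma (in sectioned_field) sec_inv:
  assumes "c \<in> carrier R" "c \<noteq> \<zero>"
  shows "\<rho> (inv c) = inv (\<rho> c)"
proof -
  have "\<rho> (inv c) \<otimes> \<rho> c = \<one>"
    using assms inv_field by (simp flip: sec_mult)
  then show ?thesis using assms inv_field by (intro comm_inv_char[symmetric]) (auto simp: m_comm)
qed

lemma (in sectioned_field) val_frac:
  assumes "a \<in> carrier R" "b \<in> carrier R" "c \<in> carrier R" "c \<noteq> \<zero>" "d \<in> carrier R" "d \<noteq> \<zero>"
  shows "a \<otimes> inv c \<unlhd> b \<otimes> inv d \<longleftrightarrow> a \<otimes> d \<unlhd> b \<otimes> c"
proof -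
  have "a \<otimes> inv c \<otimes> (c \<otimes> d) \<unlhd> b \<otimes> inv d \<otimes> (c \<otimes> d) \<longleftrightarrow> a \<otimes> inv c \<unlhd> b \<otimes> inv d"
    using assms inv_field integral[of c d] by (intro val_cancel) auto
  then show ?thesis using frac_arith(3)[of a b c d] frac_arith(3)[of b a d c] assms by (simp add: m_comm[of c d])
qed

context sectioned_pair
begin

definition fractions :: "('a \<times> 'b) set \<Rightarrow> ('a \<times> 'b) set" where
  "fractions G = {(a \<otimes> inv c, b \<otimes>\<^bsub>S\<^esub> inv\<^bsub>S\<^esub> d) | a b c d. (a, b) \<in> G \<and> (c, d) \<in> G \<and> c \<noteq> \<zero>}"

context
  fixes G
  assumes iso: "partial_iso G"
begin

lemma fractionsI: "(a, b) \<in> G \<Longrightarrow> (c, d) \<in> G \<Longrightarrow> c \<noteq> \<zero> \<Longrightarrow>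
    u = a \<otimes> inv c \<Longrightarrow> w = b \<otimes>\<^bsub>S\<^esub> inv\<^bsub>S\<^esub> d \<Longrightarrow> (u, w) \<in> fractions G"
  unfolding fractions_def by blast

lemma fractionsE:
  assumes "(u, w) \<in> fractions G"
  obtains a b c d where "(a, b) \<in> G" "(c, d) \<in> G" "c \<noteq> \<zero>" "d \<noteq> \<zero>\<^bsub>S\<^esub>" "u = a \<otimes> inv c" "w = b \<otimes>\<^bsub>S\<^esub> inv\<^bsub>S\<^esub> d"
    "a \<in> carrier R" "b \<in> carrier S" "c \<in> carrier R" "d \<in> carrier S"
  using assms G_zero[OF iso] G_carrier[OF iso] unfolding fractions_def by blast

lemma fractions_incl: "G \<subseteq> fractions G"
proof
  fix g assume g: "g \<in> G"
  obtain a b where ab: "g = (a, b)" by (cases g)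
  then show "g \<in> fractions G"
    using fractionsI[OF _ G_ops(2)[OF iso], of a b a b] g G_carrier[OF iso, of a b] by simp
qed

lemma fractions_inverse:
  assumes "(u, w) \<in> fractions G" "u \<noteq> \<zero>"
  shows "(inv u, inv\<^bsub>S\<^esub> w) \<in> fractions G"
proof -
  obtain a b c d where f: "(a, b) \<in> G" "(c, d) \<in> G" "c \<noteq> \<zero>" "d \<noteq> \<zero>\<^bsub>S\<^esub>" "u = a \<otimes> inv c" "w = b \<otimes>\<^bsub>S\<^esub> inv\<^bsub>S\<^esub> d"
    "a \<in> carrier R" "b \<in> carrier S" "c \<in> carrier R" "d \<in> carrier S"
    using fractionsE[OF assms(1)] .
  have a: "a \<noteq> \<zero>" using assms f R.inv_field by auto
  then have b: "b \<noteq> \<zero>\<^bsub>S\<^esub>" using G_zero[OF iso f(1)] by simp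
  have ia: "inv a \<noteq> \<zero>" using R.inv_field(2)[of a] f a by auto
  have ib: "inv\<^bsub>S\<^esub> b \<noteq> \<zero>\<^bsub>S\<^esub>" using S.inv_field(2)[of b] f b by auto
  have "a \<otimes> inv c \<otimes> (c \<otimes> inv a) = \<one>" "b \<otimes>\<^bsub>S\<^esub> inv\<^bsub>S\<^esub> d \<otimes>\<^bsub>S\<^esub> (d \<otimes>\<^bsub>S\<^esub> inv\<^bsub>S\<^esub> b) = \<one>\<^bsub>S\<^esub>"
    using R.frac_arith(3)[of a "inv a" c "inv a"] S.frac_arith(3)[of b "inv\<^bsub>S\<^esub> b" d "inv\<^bsub>S\<^esub> b"]
      f a b ia ib R.inv_field S.inv_field by auto
  then have "inv u = c \<otimes> inv a" "inv\<^bsub>S\<^esub> w = d \<otimes>\<^bsub>S\<^esub> inv\<^bsub>S\<^esub> b"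
    unfolding f by (auto intro!: R.comm_inv_char S.comm_inv_char simp: f a b R.inv_field S.inv_field)
  then show ?thesis using fractionsI[OF f(2,1) a] by blast
qed

text \<open>Since \<rho> is multiplicative and v(a/c) \<le> v(b/d) is equivalent to v(a d) \<le> v(b
  c), everything about fractions reduces to \<open>G\<close>. Consequently the domain of a maximal
  partial isomorphism is a field.\<close>

lemma fractions_iso: "partial_iso (fractions G)"
  unfolding partial_iso_def
proof (intro conjI)
  show "subring (fractions G) P"
  proof (rule P.subringI)
    show "fractions G \<subseteq> carrier P"
      using R.inv_field S.inv_field by (auto elim!: fractionsE)
    show "\<one>\<^bsub>P\<^esub> \<in> fractions G" using fractions_incl G_ops(2)[OF iso] by auto
    fix g g' assume "g \<in> fractions G" "g' \<in> fractions G"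
    then obtain u w u' w' where g: "g = (u, w)" "g' = (u', w')" and
      uw: "(u, w) \<in> fractions G" "(u', w') \<in> fractions G" by (cases g; cases g') auto
    obtain a b c d where f: "(a, b) \<in> G" "(c, d) \<in> G" "c \<noteq> \<zero>" "d \<noteq> \<zero>\<^bsub>S\<^esub>" "u = a \<otimes> inv c" "w = b \<otimes>\<^bsub>S\<^esub> inv\<^bsub>S\<^esub> d"
      "a \<in> carrier R" "b \<in> carrier S" "c \<in> carrier R" "d \<in> carrier S"
      using fractionsE[OF uw(1)] .
    obtain a' b' c' d' where f': "(a', b') \<in> G" "(c', d') \<in> G" "c' \<noteq> \<zero>" "d' \<noteq> \<zero>\<^bsub>S\<^esub>"
      "u' = a' \<otimes> inv c'" "w' = b' \<otimes>\<^bsub>S\<^esub> inv\<^bsub>S\<^esub> d'"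
      "a' \<in> carrier R" "b' \<in> carrier S" "c' \<in> carrier R" "d' \<in> carrier S"
      using fractionsE[OF uw(2)] .
    have cc: "c \<otimes> c' \<noteq> \<zero>" using R.integral f f' by blast
    show "\<ominus>\<^bsub>P\<^esub> g \<in> fractions G"
      unfolding g using f R.inv_field S.inv_field
      by (auto intro!: fractionsI[OF G_ops(5)[OF iso f(1)] f(2,3)] simp: R.l_minus S.l_minus)
    show "g \<otimes>\<^bsub>P\<^esub> g' \<in> fractions G"
      unfolding g prod_simps using f f'
      by (intro fractionsI[OF G_ops(4)[OF iso f(1) f'(1)] G_ops(4)[OF iso f(2) f'(2)] cc])
        (simp_all add: R.frac_arith S.frac_arith)
    show "g \<oplus>\<^bsub>P\<^esub> g' \<in> fractions G"
      unfolding g prod_simps using f f'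
      by (intro fractionsI[OF G_ops(3)[OF iso G_ops(4)[OF iso f(1) f'(2)] G_ops(4)[OF iso f'(1) f(2)]]
            G_ops(4)[OF iso f(2) f'(2)] cc])
        (simp_all add: R.frac_arith S.frac_arith)
  qed
  show "\<forall>(u, w) \<in> fractions G. (\<rho>\<^sub>1 u, \<rho>\<^sub>2 w) \<in> fractions G"
  proof clarify
    fix u w assume "(u, w) \<in> fractions G"
    then obtain a b c d where f: "(a, b) \<in> G" "(c, d) \<in> G" "c \<noteq> \<zero>" "d \<noteq> \<zero>\<^bsub>S\<^esub>" "u = a \<otimes> inv c" "w = b \<otimes>\<^bsub>S\<^esub> inv\<^bsub>S\<^esub> d"
      "a \<in> carrier R" "b \<in> carrier S" "c \<in> carrier R" "d \<in> carrier S"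
      by (rule fractionsE)
    show "(\<rho>\<^sub>1 u, \<rho>\<^sub>2 w) \<in> fractions G"
      by (rule fractionsI[OF G_ops(8)[OF iso f(1)] G_ops(8)[OF iso f(2)]])
        (use f R.inv_field S.inv_field in \<open>auto simp: R.sec_mult S.sec_mult R.sec_inv S.sec_inv\<close>)
  qed
  show "\<forall>(u, w) \<in> fractions G. \<forall>(u', w') \<in> fractions G. u \<unlhd>\<^sub>1 u' \<longleftrightarrow> w \<unlhd>\<^sub>2 w'"
  proof clarify
    fix u w u' w' assume uw: "(u, w) \<in> fractions G" "(u', w') \<in> fractions G"
    obtain a b c d where f: "(a, b) \<in> G" "(c, d) \<in> G" "c \<noteq> \<zero>" "d \<noteq> \<zero>\<^bsub>S\<^esub>" "u = a \<otimes> inv c" "w = b \<otimes>\<^bsub>S\<^esub> inv\<^bsub>S\<^esub> d"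
      "a \<in> carrier R" "b \<in> carrier S" "c \<in> carrier R" "d \<in> carrier S"
      using fractionsE[OF uw(1)] .
    obtain a' b' c' d' where f': "(a', b') \<in> G" "(c', d') \<in> G" "c' \<noteq> \<zero>" "d' \<noteq> \<zero>\<^bsub>S\<^esub>"
      "u' = a' \<otimes> inv c'" "w' = b' \<otimes>\<^bsub>S\<^esub> inv\<^bsub>S\<^esub> d'"
      "a' \<in> carrier R" "b' \<in> carrier S" "c' \<in> carrier R" "d' \<in> carrier S"
      using fractionsE[OF uw(2)] .
    have "a \<otimes> c' \<unlhd>\<^sub>1 a' \<otimes> c \<longleftrightarrow> b \<otimes>\<^bsub>S\<^esub> d' \<unlhd>\<^sub>2 b' \<otimes>\<^bsub>S\<^esub> d"
      by (intro G_val[OF iso] G_ops(4)[OF iso] f f')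
    then show "u \<unlhd>\<^sub>1 u' \<longleftrightarrow> w \<unlhd>\<^sub>2 w'" using f f' by (simp add: R.val_frac S.val_frac)
  qed
qed

text \<open>An element of \<open>G[z]\<close> factors into linear terms over \<open>G\<close>. So \<open>G[z]\<close> is a partial isomorphism as
  soon as the valuation and \<open>\<rho>\<close> of the terms \<open>z - a\<close> are determined by \<open>G\<close>; this happens in two cases.\<close>

lemma adjoin_immediate:
  assumes z: "x \<in> carrier R" "y \<in> carrier S"
    and lin: "\<And>u. u \<in> adjoin P G (x, y) \<Longrightarrow> \<exists>k. linprod P G (x, y) u k"
    and sec: "\<And>a b. (a, b) \<in> G \<Longrightarrow> (\<rho>\<^sub>1 (x \<ominus> a), \<rho>\<^sub>2 (y \<ominus>\<^bsub>S\<^esub> b)) \<in> G"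
  shows "partial_iso (adjoin P G (x, y))"
proof -
  have sub: "adjoin P G (x, y) \<subseteq> carrier R \<times> carrier S" "G \<subseteq> adjoin P G (x, y)"
    using P.adjoin_subset[OF G_subring[OF iso]] P.adjoin_incl[OF G_subring[OF iso]] z by auto
  \<comment> \<open>Multiplicativity puts \<rho> of every product of linear terms into
    \<open>G\<close>.\<close>
  have *: "fst u \<in> carrier R \<and> snd u \<in> carrier S \<and> (\<rho>\<^sub>1 (fst u), \<rho>\<^sub>2 (snd u)) \<in> G"
    if "linprod P G (x, y) u k" for u k
    using that
  proof induction
    case (const c)
    then show ?case using G_ops(8)[OF iso, of "fst c" "snd c"] G_carrier[OF iso, of "fst c" "snd c"] by simp
  next
    case (factor u k a)
    obtain a1 a2 where a: "a = (a1, a2)" by (cases a)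
    then have ac: "a1 \<in> carrier R" "a2 \<in> carrier S" using G_carrier[OF iso] factor by auto
    have "(\<rho>\<^sub>1 (x \<ominus> a1) \<otimes> \<rho>\<^sub>1 (fst u), \<rho>\<^sub>2 (y \<ominus>\<^bsub>S\<^esub> a2) \<otimes>\<^bsub>S\<^esub> \<rho>\<^sub>2 (snd u)) \<in> G"
      using factor a by (intro G_ops(4)[OF iso] sec) auto
    then show ?case using factor ac z by (simp add: a R.sec_mult S.sec_mult)
  qed
  have G: "(\<rho>\<^sub>1 u, \<rho>\<^sub>2 w) \<in> G" if "(u, w) \<in> adjoin P G (x, y)" for u w
    using lin[OF that] * by fastforce
  show ?thesis
    unfolding partial_iso_def
  proof (intro conjI)
    show "subring (adjoin P G (x, y)) P" using z by (intro P.adjoin_subring G_subring[OF iso]) auto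
    show "\<forall>(u, w) \<in> adjoin P G (x, y). (\<rho>\<^sub>1 u, \<rho>\<^sub>2 w) \<in> adjoin P G (x, y)" using G sub by auto
    show "\<forall>(a, b) \<in> adjoin P G (x, y). \<forall>(c, d) \<in> adjoin P G (x, y). a \<unlhd>\<^sub>1 c \<longleftrightarrow> b \<unlhd>\<^sub>2 d"
    proof safe
      fix a b c d assume ac: "(a, b) \<in> adjoin P G (x, y)" "(c, d) \<in> adjoin P G (x, y)"
      then have cl: "a \<in> carrier R" "c \<in> carrier R" "b \<in> carrier S" "d \<in> carrier S" using sub by auto
      \<comment> \<open>An element and its \<rho>-image have the same value, so it suffices to
        compare the images.\<close>
      have "\<rho>\<^sub>1 a \<unlhd>\<^sub>1 \<rho>\<^sub>1 c \<longleftrightarrow> \<rho>\<^sub>2 b \<unlhd>\<^sub>2 \<rho>\<^sub>2 d" by (rule G_val[OF iso G[OF ac(1)] G[OF ac(2)]])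
      then have "a \<unlhd>\<^sub>1 c \<longleftrightarrow> b \<unlhd>\<^sub>2 d" using cl by simp
      then show "a \<unlhd>\<^sub>1 c \<Longrightarrow> b \<unlhd>\<^sub>2 d" "b \<unlhd>\<^sub>2 d \<Longrightarrow> a \<unlhd>\<^sub>1 c" by auto
    qed
  qed
qed

text \<open>The list encodes h X^j - e together with its image. For nonzero h its roots are the j-th
  roots of e/h, the source of divisibility in the value group of \<open>G\<close>.\<close>

lemma binomial_list:
  assumes "(e, f) \<in> G" "(h, k) \<in> G" "j > 0"
  defines "p \<equiv> (\<ominus> e, \<ominus>\<^bsub>S\<^esub> f) # replicate (j - 1) (\<zero>, \<zero>\<^bsub>S\<^esub>) @ [(h, k)]"
  shows "set p \<subseteq> G" "length p = Suc j" "last p = (h, k)"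
    "\<And>x. x \<in> carrier R \<Longrightarrow> peval R (map fst p) x = h \<otimes> x [^] j \<ominus> e"
    "\<And>x. x \<in> carrier S \<Longrightarrow> peval S (map snd p) x = k \<otimes>\<^bsub>S\<^esub> x [^]\<^bsub>S\<^esub> j \<ominus>\<^bsub>S\<^esub> f"
proof -
  show "set p \<subseteq> G" using assms G_ops(1,5)[OF iso] by (auto simp: p_def)
  show "length p = Suc j" "last p = (h, k)" using assms by (auto simp: p_def)
  have cl: "e \<in> carrier R" "h \<in> carrier R" "f \<in> carrier S" "k \<in> carrier S"
    using assms G_carrier[OF iso] by auto
  obtain i where j: "j = Suc i" using assms(3) by (cases j) auto
  have "peval R (replicate i \<zero> @ [h]) x = h \<otimes> x [^] i" if "x \<in> carrier R" for x
    using R.peval_append[of "replicate i \<zero>" h x] cl that by (auto simp: set_replicate_conv_if)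
  then show "peval R (map fst p) x = h \<otimes> x [^] j \<ominus> e" if "x \<in> carrier R" for x
    using cl that by (simp add: p_def j R.minus_eq R.m_ac R.a_comm)
  have "peval S (replicate i \<zero>\<^bsub>S\<^esub> @ [k]) x = k \<otimes>\<^bsub>S\<^esub> x [^]\<^bsub>S\<^esub> i" if "x \<in> carrier S" for x
    using S.peval_append[of "replicate i \<zero>\<^bsub>S\<^esub>" k x] cl that by (auto simp: set_replicate_conv_if)
  then show "peval S (map snd p) x = k \<otimes>\<^bsub>S\<^esub> x [^]\<^bsub>S\<^esub> j \<ominus>\<^bsub>S\<^esub> f" if "x \<in> carrier S" for x
    using cl that by (simp add: p_def j S.minus_eq S.m_ac S.a_comm)
qed

section \<open>Adjoining an element fixed by \<rho>\<close>

context
  fixes r s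
  assumes r: "r \<in> carrier R" "\<rho>\<^sub>1 r = r" "r \<notin> fst ` G" and s: "s \<in> carrier S" "\<rho>\<^sub>2 s = s" "s \<notin> snd ` G"
    and cut: "\<And>a b. (a, b) \<in> G \<Longrightarrow> (r \<unlhd>\<^sub>1 a \<longleftrightarrow> s \<unlhd>\<^sub>2 b) \<and> (a \<unlhd>\<^sub>1 r \<longleftrightarrow> b \<unlhd>\<^sub>2 s)"
begin

lemma rs_nonzero: "r \<noteq> \<zero>" "s \<noteq> \<zero>\<^bsub>S\<^esub>"
  using G_ops(1)[OF iso] r s by force+

text \<open>For nonzero h and positive j, the polynomial h X^j - e has a root t in the domain of
  \<open>G\<close>. Then e = h t^j, and comparing e with h r^j amounts to comparing t with r, where
  \<open>cut\<close> applies.\<close>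

lemma cut_pow:
  assumes "(e, f) \<in> G" "(h, k) \<in> G" "closed_upto G (Suc j)"
  shows "(e \<unlhd>\<^sub>1 h \<otimes> r [^] j \<longleftrightarrow> f \<unlhd>\<^sub>2 k \<otimes>\<^bsub>S\<^esub> s [^]\<^bsub>S\<^esub> j) \<and>
    (h \<otimes> r [^] j \<unlhd>\<^sub>1 e \<longleftrightarrow> k \<otimes>\<^bsub>S\<^esub> s [^]\<^bsub>S\<^esub> j \<unlhd>\<^sub>2 f)"
proof -
  have cl: "e \<in> carrier R" "h \<in> carrier R" "f \<in> carrier S" "k \<in> carrier S"
    using assms G_carrier[OF iso] by auto
  consider "h = \<zero>" | "j = 0" | "h \<noteq> \<zero>" "j > 0" by auto
  then show ?thesis
  proof cases
    case 1
    then have "k = \<zero>\<^bsub>S\<^esub>" using G_zero[OF iso assms(2)] by simp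
    then show ?thesis using 1 G_zero[OF iso assms(1)] r s cl by auto
  next
    case 2
    then show ?thesis using G_val[OF iso assms(1,2)] G_val[OF iso assms(2,1)] cl by simp
  next
    case 3
    then have k: "k \<noteq> \<zero>\<^bsub>S\<^esub>" using G_zero[OF iso assms(2)] by simp
    note p = binomial_list[OF assms(1,2) 3(2)]
    obtain t t' where t: "(t, t') \<in> G" "h \<otimes> t [^] j \<ominus> e = \<zero>" "k \<otimes>\<^bsub>S\<^esub> t' [^]\<^bsub>S\<^esub> j \<ominus>\<^bsub>S\<^esub> f = \<zero>\<^bsub>S\<^esub>"
      by (rule closed_root[OF iso assms(3) p(1)])
        (use p(2,3) 3 p(4,5) G_carrier[OF iso] in auto)
    have tc: "t \<in> carrier R" "t' \<in> carrier S" using G_carrier[OF iso t(1)] by auto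
    have e: "e = h \<otimes> t [^] j" "f = k \<otimes>\<^bsub>S\<^esub> t' [^]\<^bsub>S\<^esub> j" using t tc cl by auto
    show ?thesis
      unfolding e using cut[OF t(1)] cl tc r s 3 k
      by (simp add: R.val_cancel_left S.val_cancel_left R.val_pow_iff S.val_pow_iff)
  qed
qed

text \<open>Cancelling the smaller power of r leaves a constant to be compared with a
  monomial.\<close>

lemma cut_monomial:
  assumes "(e, f) \<in> G" "(h, k) \<in> G" "closed_upto G (Suc l)" "m \<le> l" "n \<le> l"
  shows "e \<otimes> r [^] m \<unlhd>\<^sub>1 h \<otimes> r [^] n \<longleftrightarrow> f \<otimes>\<^bsub>S\<^esub> s [^]\<^bsub>S\<^esub> m \<unlhd>\<^sub>2 k \<otimes>\<^bsub>S\<^esub> s [^]\<^bsub>S\<^esub> n"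
proof -
  have cl: "e \<in> carrier R" "h \<in> carrier R" "f \<in> carrier S" "k \<in> carrier S"
    using assms G_carrier[OF iso] by auto
  have closed: "closed_upto G (Suc j)" if "j \<le> l" for j
    using assms(3) that unfolding closed_upto_def by (meson Suc_le_mono le_trans)
  show ?thesis
  proof (cases "m \<le> n")
    case True
    then obtain j where n: "n = m + j" using le_Suc_ex by blast
    have "h \<otimes> r [^] n = (h \<otimes> r [^] j) \<otimes> r [^] m" "k \<otimes>\<^bsub>S\<^esub> s [^]\<^bsub>S\<^esub> n = (k \<otimes>\<^bsub>S\<^esub> s [^]\<^bsub>S\<^esub> j) \<otimes>\<^bsub>S\<^esub> s [^]\<^bsub>S\<^esub> m"
      using cl r s by (simp_all add: n R.nat_pow_mult[symmetric] S.nat_pow_mult[symmetric] R.m_ac S.m_ac)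
    then show ?thesis
      using cut_pow[OF assms(1,2) closed[of j]] n assms(5) cl r s rs_nonzero
      by (simp add: R.val_cancel S.val_cancel R.pow_nonzero S.pow_nonzero)
  next
    case False
    then obtain j where m: "m = n + j" using le_Suc_ex[of n m] by auto
    have "e \<otimes> r [^] m = (e \<otimes> r [^] j) \<otimes> r [^] n" "f \<otimes>\<^bsub>S\<^esub> s [^]\<^bsub>S\<^esub> m = (f \<otimes>\<^bsub>S\<^esub> s [^]\<^bsub>S\<^esub> j) \<otimes>\<^bsub>S\<^esub> s [^]\<^bsub>S\<^esub> n"
      using cl r s by (simp_all add: m R.nat_pow_mult[symmetric] S.nat_pow_mult[symmetric] R.m_ac S.m_ac)
    then show ?thesis
      using cut_pow[OF assms(2,1) closed[of j]] m assms(4) cl r s rs_nonzero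
      by (simp add: R.val_cancel S.val_cancel R.pow_nonzero S.pow_nonzero)
  qed
qed

text \<open>If v(r) and v(a) differ, the one of smaller value determines r - a up to terms of higher
  value. If they agree, r = \<rho>(r) differs from \<rho>(a), as only the latter lies in the domain
  of \<open>G\<close>; so the leading parts do not cancel and \<rho>(r - a) = r - \<rho>(a).\<close>

lemma sec_linear:
  assumes "(a, b) \<in> G"
  shows "\<exists>(e, f) \<in> G. \<exists>m \<le> (1::nat). r \<ominus> a \<unlhd>\<^sub>1 e \<otimes> r [^] m \<and> e \<otimes> r [^] m \<unlhd>\<^sub>1 r \<ominus> a \<and>
      s \<ominus>\<^bsub>S\<^esub> b \<unlhd>\<^sub>2 f \<otimes>\<^bsub>S\<^esub> s [^]\<^bsub>S\<^esub> m \<and> f \<otimes>\<^bsub>S\<^esub> s [^]\<^bsub>S\<^esub> m \<unlhd>\<^sub>2 s \<ominus>\<^bsub>S\<^esub> b"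
    and "(\<rho>\<^sub>1 (r \<ominus> a), \<rho>\<^sub>2 (s \<ominus>\<^bsub>S\<^esub> b)) \<in> adjoin P G (r, (s::'b))"
proof -
  have cl: "a \<in> carrier R" "b \<in> carrier S" using G_carrier[OF iso assms] by auto
  have sub: "subring (adjoin P G (r, s)) P" "G \<subseteq> adjoin P G (r, s)" "(r, s) \<in> adjoin P G (r, s)"
    using P.adjoin_subring P.adjoin_incl P.adjoin_mem G_subring[OF iso] r s by auto
  have "(\<exists>(e, f) \<in> G. \<exists>m \<le> (1::nat). r \<ominus> a \<unlhd>\<^sub>1 e \<otimes> r [^] m \<and> e \<otimes> r [^] m \<unlhd>\<^sub>1 r \<ominus> a \<and>
      s \<ominus>\<^bsub>S\<^esub> b \<unlhd>\<^sub>2 f \<otimes>\<^bsub>S\<^esub> s [^]\<^bsub>S\<^esub> m \<and> f \<otimes>\<^bsub>S\<^esub> s [^]\<^bsub>S\<^esub> m \<unlhd>\<^sub>2 s \<ominus>\<^bsub>S\<^esub> b) \<and>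
    (\<rho>\<^sub>1 (r \<ominus> a), \<rho>\<^sub>2 (s \<ominus>\<^bsub>S\<^esub> b)) \<in> adjoin P G (r, s)" (is "?A \<and> ?B")
  proof -
    consider "\<not> a \<unlhd>\<^sub>1 r" | "\<not> r \<unlhd>\<^sub>1 a" | "a \<unlhd>\<^sub>1 r" "r \<unlhd>\<^sub>1 a" by blast
    then show ?thesis
    proof cases
      case 1
      then have 2: "\<not> b \<unlhd>\<^sub>2 s" using cut[OF assms] by simp
      have "r \<ominus> a \<unlhd>\<^sub>1 r" "r \<unlhd>\<^sub>1 r \<ominus> a" "\<rho>\<^sub>1 (r \<ominus> a) = r"
        using R.val_add_less[of "\<ominus> a" r] R.sec_add_less[of "\<ominus> a" r] 1 cl r by (simp_all add: R.minus_eq)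
      moreover have "s \<ominus>\<^bsub>S\<^esub> b \<unlhd>\<^sub>2 s" "s \<unlhd>\<^sub>2 s \<ominus>\<^bsub>S\<^esub> b" "\<rho>\<^sub>2 (s \<ominus>\<^bsub>S\<^esub> b) = s"
        using S.val_add_less[of "\<ominus>\<^bsub>S\<^esub> b" s] S.sec_add_less[of "\<ominus>\<^bsub>S\<^esub> b" s] 2 cl s by (simp_all add: S.minus_eq)
      ultimately show ?thesis
        using sub(3) r s by (auto intro!: bexI[OF _ G_ops(2)[OF iso]] exI[of _ "1::nat"])
    next
      case 2
      then have 3: "\<not> s \<unlhd>\<^sub>2 b" using cut[OF assms] by simp
      have "r \<ominus> a \<unlhd>\<^sub>1 a" "a \<unlhd>\<^sub>1 r \<ominus> a" "\<rho>\<^sub>1 (r \<ominus> a) = \<ominus> \<rho>\<^sub>1 a"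
        using R.val_add_less[of r "\<ominus> a"] R.sec_add_less[of r "\<ominus> a"] 2 cl r
        by (simp_all add: R.minus_eq R.a_comm)
      moreover have "s \<ominus>\<^bsub>S\<^esub> b \<unlhd>\<^sub>2 b" "b \<unlhd>\<^sub>2 s \<ominus>\<^bsub>S\<^esub> b" "\<rho>\<^sub>2 (s \<ominus>\<^bsub>S\<^esub> b) = \<ominus>\<^bsub>S\<^esub> \<rho>\<^sub>2 b"
        using S.val_add_less[of s "\<ominus>\<^bsub>S\<^esub> b"] S.sec_add_less[of s "\<ominus>\<^bsub>S\<^esub> b"] 3 cl s
        by (simp_all add: S.minus_eq S.a_comm)
      moreover have "(\<ominus> \<rho>\<^sub>1 a, \<ominus>\<^bsub>S\<^esub> \<rho>\<^sub>2 b) \<in> G" using assms by (intro G_ops[OF iso])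
      ultimately show ?thesis
        using sub(2) cl by (auto intro!: bexI[OF _ assms] exI[of _ "0::nat"])
    next
      case 3
      then have 4: "b \<unlhd>\<^sub>2 s" "s \<unlhd>\<^sub>2 b" using cut[OF assms] by auto
      have G: "(\<rho>\<^sub>1 a, \<rho>\<^sub>2 b) \<in> G" using assms by (intro G_ops[OF iso])
      have ne: "\<rho>\<^sub>1 r \<noteq> \<rho>\<^sub>1 a" "\<rho>\<^sub>2 s \<noteq> \<rho>\<^sub>2 b" using G r s by force+
      then have 5: "r \<ominus> a \<unlhd>\<^sub>1 r" "s \<ominus>\<^bsub>S\<^esub> b \<unlhd>\<^sub>2 s"
        using R.sec_eq_iff[of r a] S.sec_eq_iff[of s b] r s cl rs_nonzero by auto
      have 6: "r \<unlhd>\<^sub>1 r \<ominus> a" "s \<unlhd>\<^sub>2 s \<ominus>\<^bsub>S\<^esub> b" using 3 4 r s cl by (auto intro!: R.val_diff S.val_diff)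
      have "\<rho>\<^sub>1 (r \<ominus> a) = r \<ominus> \<rho>\<^sub>1 a" "\<rho>\<^sub>2 (s \<ominus>\<^bsub>S\<^esub> b) = s \<ominus>\<^bsub>S\<^esub> \<rho>\<^sub>2 b"
        using R.sec_add_eq[of r "\<ominus> a"] S.sec_add_eq[of s "\<ominus>\<^bsub>S\<^esub> b"] 3 4 5 cl r s
        by (simp_all add: R.minus_eq S.minus_eq)
      moreover have "(r, s) \<ominus>\<^bsub>P\<^esub> (\<rho>\<^sub>1 a, \<rho>\<^sub>2 b) \<in> adjoin P G (r, s)"
        unfolding P.minus_eq using subringE(5,7)[OF sub(1)] sub(2,3) G by blast
      ultimately show ?thesis
        using 5 6 r s cl by (auto intro!: bexI[OF _ G_ops(2)[OF iso]] exI[of _ "1::nat"])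
    qed
  qed
  then show ?A ?B by blast+
qed

text \<open>The value of a product need not be one of \<open>G\<close>, so a monomial e r^m of the
  same value is carried along. For \<rho> it is enough that it is multiplicative and maps linear
  terms into the adjoined ring.\<close>

lemma sec_linprod:
  assumes "linprod P G (r, s) u k"
  shows "(\<rho>\<^sub>1 (fst u), \<rho>\<^sub>2 (snd u)) \<in> adjoin P G (r, s) \<and> fst u \<in> carrier R \<and> snd u \<in> carrier S \<and>
    (\<exists>(e, f) \<in> G. \<exists>m \<le> k. fst u \<unlhd>\<^sub>1 e \<otimes> r [^] m \<and> e \<otimes> r [^] m \<unlhd>\<^sub>1 fst u \<and>
      snd u \<unlhd>\<^sub>2 f \<otimes>\<^bsub>S\<^esub> s [^]\<^bsub>S\<^esub> m \<and> f \<otimes>\<^bsub>S\<^esub> s [^]\<^bsub>S\<^esub> m \<unlhd>\<^sub>2 snd u)"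
  using assms
proof induction
  case (const c)
  obtain a b where c: "c = (a, b)" by (cases c)
  then show ?case
    using const G_ops(8)[OF iso, of a b] G_carrier[OF iso, of a b] P.adjoin_incl[OF G_subring[OF iso], of "(r, s)"] r s
    by (auto intro!: bexI[of _ "(a, b)"])
next
  case (factor u k c)
  obtain a b where c: "c = (a, b)" by (cases c)
  have ab: "(a, b) \<in> G" "a \<in> carrier R" "b \<in> carrier S" using factor c G_carrier[OF iso] by auto
  obtain e f m where 1: "(e, f) \<in> G" "m \<le> (1::nat)" "r \<ominus> a \<unlhd>\<^sub>1 e \<otimes> r [^] m" "e \<otimes> r [^] m \<unlhd>\<^sub>1 r \<ominus> a"
      "s \<ominus>\<^bsub>S\<^esub> b \<unlhd>\<^sub>2 f \<otimes>\<^bsub>S\<^esub> s [^]\<^bsub>S\<^esub> m" "f \<otimes>\<^bsub>S\<^esub> s [^]\<^bsub>S\<^esub> m \<unlhd>\<^sub>2 s \<ominus>\<^bsub>S\<^esub> b"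
    using sec_linear(1)[OF ab(1)] by blast
  obtain h i n where 2: "(h, i) \<in> G" "n \<le> k" "fst u \<unlhd>\<^sub>1 h \<otimes> r [^] n" "h \<otimes> r [^] n \<unlhd>\<^sub>1 fst u"
      "snd u \<unlhd>\<^sub>2 i \<otimes>\<^bsub>S\<^esub> s [^]\<^bsub>S\<^esub> n" "i \<otimes>\<^bsub>S\<^esub> s [^]\<^bsub>S\<^esub> n \<unlhd>\<^sub>2 snd u"
    using factor.IH by blast
  have cl: "e \<in> carrier R" "h \<in> carrier R" "f \<in> carrier S" "i \<in> carrier S" "fst u \<in> carrier R" "snd u \<in> carrier S"
    using 1(1) 2(1) G_carrier[OF iso] factor.IH by auto
  have eq: "(e \<otimes> r [^] m) \<otimes> (h \<otimes> r [^] n) = (e \<otimes> h) \<otimes> r [^] (m + n)"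
    "(f \<otimes>\<^bsub>S\<^esub> s [^]\<^bsub>S\<^esub> m) \<otimes>\<^bsub>S\<^esub> (i \<otimes>\<^bsub>S\<^esub> s [^]\<^bsub>S\<^esub> n) = (f \<otimes>\<^bsub>S\<^esub> i) \<otimes>\<^bsub>S\<^esub> s [^]\<^bsub>S\<^esub> (m + n)"
    using cl r s by (simp_all add: R.nat_pow_mult[symmetric] S.nat_pow_mult[symmetric] R.m_ac S.m_ac)
  have "(r \<ominus> a) \<otimes> fst u \<unlhd>\<^sub>1 (e \<otimes> r [^] m) \<otimes> (h \<otimes> r [^] n)" "(e \<otimes> r [^] m) \<otimes> (h \<otimes> r [^] n) \<unlhd>\<^sub>1 (r \<ominus> a) \<otimes> fst u"
    "(s \<ominus>\<^bsub>S\<^esub> b) \<otimes>\<^bsub>S\<^esub> snd u \<unlhd>\<^sub>2 (f \<otimes>\<^bsub>S\<^esub> s [^]\<^bsub>S\<^esub> m) \<otimes>\<^bsub>S\<^esub> (i \<otimes>\<^bsub>S\<^esub> s [^]\<^bsub>S\<^esub> n)"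
    "(f \<otimes>\<^bsub>S\<^esub> s [^]\<^bsub>S\<^esub> m) \<otimes>\<^bsub>S\<^esub> (i \<otimes>\<^bsub>S\<^esub> s [^]\<^bsub>S\<^esub> n) \<unlhd>\<^sub>2 (s \<ominus>\<^bsub>S\<^esub> b) \<otimes>\<^bsub>S\<^esub> snd u"
    using 1 2 cl r s ab by (auto intro!: R.val_mult_mono S.val_mult_mono)
  moreover have "(e \<otimes> h, f \<otimes>\<^bsub>S\<^esub> i) \<in> G" using 1 2 by (intro G_ops[OF iso])
  moreover have "m + n \<le> Suc k" using 1 2 by simp
  moreover have "(\<rho>\<^sub>1 (r \<ominus> a), \<rho>\<^sub>2 (s \<ominus>\<^bsub>S\<^esub> b)) \<otimes>\<^bsub>P\<^esub> (\<rho>\<^sub>1 (fst u), \<rho>\<^sub>2 (snd u)) \<in> adjoin P G (r, s)"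
    using factor.IH sec_linear(2)[OF ab(1)] r s by (intro P.adjoin_mult G_subring[OF iso]) auto
  ultimately show ?case
    unfolding eq using ab r s cl
    by (auto simp: c R.sec_mult S.sec_mult intro!: bexI[of _ "(e \<otimes> h, f \<otimes>\<^bsub>S\<^esub> i)"] exI[of _ "m + n"])
qed

lemma adjoin_sec:
  assumes lin: "\<And>u. u \<in> adjoin P G (r, s) \<Longrightarrow> \<exists>k. closed_upto G (Suc k) \<and> linprod P G (r, s) u k"
  shows "partial_iso (adjoin P G (r, s))"
  unfolding partial_iso_def
proof (intro conjI)
  show "subring (adjoin P G (r, s)) P" using r s by (intro P.adjoin_subring G_subring[OF iso]) auto
  show "\<forall>(u, w) \<in> adjoin P G (r, s). (\<rho>\<^sub>1 u, \<rho>\<^sub>2 w) \<in> adjoin P G (r, s)"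
    using lin sec_linprod by fastforce
  show "\<forall>(a, b) \<in> adjoin P G (r, s). \<forall>(c, d) \<in> adjoin P G (r, s). a \<unlhd>\<^sub>1 c \<longleftrightarrow> b \<unlhd>\<^sub>2 d"
  proof (clarify)
    fix a b c d assume "(a, b) \<in> adjoin P G (r, s)" "(c, d) \<in> adjoin P G (r, s)"
    then obtain k l where kl: "closed_upto G (Suc k)" "linprod P G (r, s) (a, b) k"
        "closed_upto G (Suc l)" "linprod P G (r, s) (c, d) l" using lin by blast
    obtain e f m where 1: "(e, f) \<in> G" "m \<le> k" "a \<unlhd>\<^sub>1 e \<otimes> r [^] m" "e \<otimes> r [^] m \<unlhd>\<^sub>1 a"
        "b \<unlhd>\<^sub>2 f \<otimes>\<^bsub>S\<^esub> s [^]\<^bsub>S\<^esub> m" "f \<otimes>\<^bsub>S\<^esub> s [^]\<^bsub>S\<^esub> m \<unlhd>\<^sub>2 b" "a \<in> carrier R" "b \<in> carrier S"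
      using sec_linprod[OF kl(2)] by auto
    obtain h i n where 2: "(h, i) \<in> G" "n \<le> l" "c \<unlhd>\<^sub>1 h \<otimes> r [^] n" "h \<otimes> r [^] n \<unlhd>\<^sub>1 c"
        "d \<unlhd>\<^sub>2 i \<otimes>\<^bsub>S\<^esub> s [^]\<^bsub>S\<^esub> n" "i \<otimes>\<^bsub>S\<^esub> s [^]\<^bsub>S\<^esub> n \<unlhd>\<^sub>2 d" "c \<in> carrier R" "d \<in> carrier S"
      using sec_linprod[OF kl(4)] by auto
    have cl: "e \<in> carrier R" "h \<in> carrier R" "f \<in> carrier S" "i \<in> carrier S"
      using 1(1) 2(1) G_carrier[OF iso] by auto
    have "closed_upto G (Suc (max k l))" using kl by (simp add: max_def)
    then have "e \<otimes> r [^] m \<unlhd>\<^sub>1 h \<otimes> r [^] n \<longleftrightarrow> f \<otimes>\<^bsub>S\<^esub> s [^]\<^bsub>S\<^esub> m \<unlhd>\<^sub>2 i \<otimes>\<^bsub>S\<^esub> s [^]\<^bsub>S\<^esub> n"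
      by (rule cut_monomial[OF 1(1) 2(1)]) (use 1 2 in auto)
    moreover have "a \<unlhd>\<^sub>1 c \<longleftrightarrow> e \<otimes> r [^] m \<unlhd>\<^sub>1 h \<otimes> r [^] n"
      using R.val_trans 1 2 cl r by (meson R.m_closed R.nat_pow_closed)
    moreover have "b \<unlhd>\<^sub>2 d \<longleftrightarrow> f \<otimes>\<^bsub>S\<^esub> s [^]\<^bsub>S\<^esub> m \<unlhd>\<^sub>2 i \<otimes>\<^bsub>S\<^esub> s [^]\<^bsub>S\<^esub> n"
      using S.val_trans 1 2 cl s by (meson S.m_closed S.nat_pow_closed)
    ultimately show "a \<unlhd>\<^sub>1 c \<longleftrightarrow> b \<unlhd>\<^sub>2 d" by simp
  qed
qed

end

end

end

section \<open>Elements without a best approximation\<close>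

context sectioned_pair
begin

context
  fixes G
  assumes iso: "partial_iso G"
begin

lemma G_dom: "a \<in> fst ` G \<Longrightarrow> a \<in> carrier R"
  using G_carrier[OF iso] by auto

text \<open>The differences x - a and b - a differ by x - b, which has larger value than x -
  a.\<close>

lemma sec_closer:
  assumes "x \<in> carrier R" "a \<in> carrier R" "b \<in> carrier R" "\<not> x \<ominus> b \<unlhd>\<^sub>1 x \<ominus> a"
  shows "\<rho>\<^sub>1 (x \<ominus> a) = \<rho>\<^sub>1 (b \<ominus> a)" "x \<ominus> a \<unlhd>\<^sub>1 b \<ominus> a" "b \<ominus> a \<unlhd>\<^sub>1 x \<ominus> a"
proof -
  have "x \<ominus> a \<noteq> \<zero>" using assms by (metis R.minus_closed R.val_zero)
  moreover have "(x \<ominus> a) \<ominus> (b \<ominus> a) = x \<ominus> b" using assms(1-3) by algebra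
  ultimately show eq: "\<rho>\<^sub>1 (x \<ominus> a) = \<rho>\<^sub>1 (b \<ominus> a)"
    using R.sec_eq_iff[of "x \<ominus> a" "b \<ominus> a"] assms by simp
  show "x \<ominus> a \<unlhd>\<^sub>1 b \<ominus> a" "b \<ominus> a \<unlhd>\<^sub>1 x \<ominus> a" using R.sec_eq_val[OF eq] assms by auto
qed

context
  fixes x
  assumes x: "x \<in> carrier R"
    and imm: "\<And>a. a \<in> fst ` G \<Longrightarrow> \<exists>b \<in> fst ` G. \<not> x \<ominus> b \<unlhd>\<^sub>1 x \<ominus> a"
begin

text \<open>By \<open>imm\<close> the linearly ordered values v(x - a), for a in the domain of
  \<open>G\<close>, have no largest element.\<close>

lemma closer:
  assumes "finite A" "A \<subseteq> fst ` G"
  shows "\<exists>b \<in> fst ` G. \<forall>a \<in> A. \<not> x \<ominus> b \<unlhd>\<^sub>1 x \<ominus> a"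
  using assms
proof (induction A)
  case empty
  then show ?case using G_ops(1)[OF iso] by force
next
  case (insert a A)
  then obtain b where b: "b \<in> fst ` G" "\<forall>c \<in> A. \<not> x \<ominus> b \<unlhd>\<^sub>1 x \<ominus> c" by auto
  show ?case
  proof (cases "x \<ominus> b \<unlhd>\<^sub>1 x \<ominus> a")
    case True
    obtain b' where b': "b' \<in> fst ` G" "\<not> x \<ominus> b' \<unlhd>\<^sub>1 x \<ominus> a" using imm[of a] insert.prems by auto
    have "\<not> x \<ominus> b' \<unlhd>\<^sub>1 x \<ominus> c" if c: "c \<in> A" for c
    proof
      assume *: "x \<ominus> b' \<unlhd>\<^sub>1 x \<ominus> c"
      have cl: "a \<in> carrier R" "b \<in> carrier R" "b' \<in> carrier R" "c \<in> carrier R"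
        using insert.prems b(1) b'(1) c by (auto intro!: G_dom simp: subset_iff simp del: image_iff)
      then have "x \<ominus> c \<unlhd>\<^sub>1 x \<ominus> b" using b(2) c x R.val_total[of "x \<ominus> b" "x \<ominus> c"] by auto
      then have "x \<ominus> c \<unlhd>\<^sub>1 x \<ominus> a" using True cl x R.val_trans[of "x \<ominus> c" "x \<ominus> b" "x \<ominus> a"] by auto
      then show False using * b'(2) cl x R.val_trans[of "x \<ominus> b'" "x \<ominus> c" "x \<ominus> a"] by auto
    qed
    then show ?thesis using b' by auto
  next
    case False
    then show ?thesis using b by auto
  qed
qed

lemma sec_in_range:
  assumes "(a, a') \<in> G"
  obtains b b' where "(b, b') \<in> G" "\<rho>\<^sub>1 (x \<ominus> a) = \<rho>\<^sub>1 (b \<ominus> a)" "(\<rho>\<^sub>1 (b \<ominus> a), \<rho>\<^sub>2 (b' \<ominus>\<^bsub>S\<^esub> a')) \<in> G"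
proof -
  obtain b b' where b: "(b, b') \<in> G" "\<not> x \<ominus> b \<unlhd>\<^sub>1 x \<ominus> a" using imm[of a] assms by force
  show thesis
    using that[OF b(1) sec_closer(1)[OF x _ _ b(2)]] G_ops(6,8)[OF iso] assms b G_carrier[OF iso] by metis
qed

text \<open>Otherwise each of the finitely many roots y of the image of \<open>p\<close> fails at
  some point of \<open>G\<close>. For a in the domain close enough to x and a suitable d, these
  roots are far from the image of a: v(y - a') \<le> v(d'), whereas v(x - a) > v(d).
  \<open>far_roots\<close> turns the first fact into inequalities between the coefficients of the
  polynomial shifted by a', \<open>G\<close> transports them to R, and there
  \<open>near_root\<close> makes the constant term vanish; back in S this annihilates the leading
  coefficient.\<close>

lemma immediate_algebraic:
  assumes p: "set p \<subseteq> G" "length p \<ge> 2" "fst (last p) \<noteq> \<zero>" "peval R (map fst p) x = \<zero>"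
  shows "\<exists>y \<in> carrier S. peval S (map snd p) y = \<zero>\<^bsub>S\<^esub> \<and>
    (\<forall>(a, b) \<in> G. (\<rho>\<^sub>1 (x \<ominus> a), \<rho>\<^sub>2 (y \<ominus>\<^bsub>S\<^esub> b)) \<in> G)"
proof (rule ccontr)
  assume neg: "\<not> ?thesis"
  have pne: "p \<noteq> []" using p by auto
  have lastG: "(fst (last p), snd (last p)) \<in> G" using pne p(1) by auto
  then have snd_last: "snd (last p) \<noteq> \<zero>\<^bsub>S\<^esub>" using G_zero[OF iso lastG] p(3) by simp
  define Y where "Y = {y \<in> carrier S. peval S (map snd p) y = \<zero>\<^bsub>S\<^esub>}"
  have finY: "finite Y"
    unfolding Y_def using G_list_carrier[OF iso p(1)] pne snd_last by (intro S.finite_roots_peval) (auto simp: last_map)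
  have "\<forall>y \<in> Y. \<exists>g \<in> G. (\<rho>\<^sub>1 (x \<ominus> fst g), \<rho>\<^sub>2 (y \<ominus>\<^bsub>S\<^esub> snd g)) \<notin> G"
    using neg unfolding Y_def by fastforce
  then obtain g where g: "\<And>y. y \<in> Y \<Longrightarrow> g y \<in> G"
    "\<And>y. y \<in> Y \<Longrightarrow> (\<rho>\<^sub>1 (x \<ominus> fst (g y)), \<rho>\<^sub>2 (y \<ominus>\<^bsub>S\<^esub> snd (g y))) \<notin> G" by metis
  define A where "A = fst ` g ` Y"
  have A: "finite A" "A \<subseteq> fst ` G" using finY g(1) by (auto simp: A_def)
  \<comment> \<open>The element b is nearer to x than every point of failure, and a is nearer still.
    So v(x - c) < v(x - b) = v(d) < v(x - a) for each such point c.\<close>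
  obtain b where b: "b \<in> fst ` G" "\<forall>a \<in> A. \<not> x \<ominus> b \<unlhd>\<^sub>1 x \<ominus> a" using closer[OF A] by blast
  obtain a where a: "a \<in> fst ` G" "\<forall>c \<in> insert b A. \<not> x \<ominus> a \<unlhd>\<^sub>1 x \<ominus> c" using closer[of "insert b A"] A b by auto
  obtain a' b' where ab: "(a, a') \<in> G" "(b, b') \<in> G" using a b by auto
  define d where "d = a \<ominus> b"
  define d' where "d' = a' \<ominus>\<^bsub>S\<^esub> b'"
  have dG: "(d, d') \<in> G" unfolding d_def d'_def by (intro G_ops(6)[OF iso] ab)
  have cl: "a \<in> carrier R" "b \<in> carrier R" "d \<in> carrier R" "a' \<in> carrier S" "d' \<in> carrier S"
    using G_carrier[OF iso] ab dG by auto
  have d: "x \<ominus> b \<unlhd>\<^sub>1 d" "d \<unlhd>\<^sub>1 x \<ominus> b"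
    using sec_closer[of x b a] x cl a by (auto simp: d_def)
  have xa: "\<not> x \<ominus> a \<unlhd>\<^sub>1 d"
    using a(2) d cl x R.val_trans[of "x \<ominus> a" d "x \<ominus> b"] by auto
  then have d0: "d \<noteq> \<zero>" using x cl by auto
  then have d'0: "d' \<noteq> \<zero>\<^bsub>S\<^esub>" using G_zero[OF iso dG] by simp
  \<comment> \<open>At the point (c, c') where y fails, \<rho>(y - c') differs from \<rho>(a' - c').
    Hence v(a' - y) \<le> v(a' - c') \<le> v(d').\<close>
  have root_far: "y \<ominus>\<^bsub>S\<^esub> a' \<unlhd>\<^sub>2 d'" if y: "y \<in> Y" for y
  proof -
    obtain c c' where c: "g y = (c, c')" by (cases "g y")
    then have cG: "(c, c') \<in> G" "c \<in> A" using g(1)[OF y] y by (auto simp: A_def image_iff intro: bexI[of _ y])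
    have cc: "c \<in> carrier R" "c' \<in> carrier S" "y \<in> carrier S" using cG(1) G_carrier[OF iso] y by (auto simp: Y_def)
    note s = sec_closer[of x c a, OF x cc(1) cl(1)]
    have n: "\<not> x \<ominus> a \<unlhd>\<^sub>1 x \<ominus> c" using a(2) cG(2) by auto
    have ac: "(a \<ominus> c, a' \<ominus>\<^bsub>S\<^esub> c') \<in> G" by (intro G_ops(6)[OF iso] ab cG)
    have "x \<ominus> c \<unlhd>\<^sub>1 x \<ominus> b" using b(2) cG(2) x cc cl R.val_total[of "x \<ominus> b" "x \<ominus> c"] by auto
    then have "a \<ominus> c \<unlhd>\<^sub>1 d"
      using s(3)[OF n] d(1) cl x cc R.val_trans[of "a \<ominus> c" "x \<ominus> c" "x \<ominus> b"] R.val_trans[of "a \<ominus> c" "x \<ominus> b" d] by auto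
    then have le: "a' \<ominus>\<^bsub>S\<^esub> c' \<unlhd>\<^sub>2 d'" using G_val[OF iso ac dG] by simp
    have "x \<ominus> c \<noteq> \<zero>" using n x cl cc by (metis R.minus_closed R.val_zero)
    then have "a \<ominus> c \<noteq> \<zero>" using s(2)[OF n] s(1)[OF n] x cc cl by (metis R.minus_closed R.sec_eq_zero_iff)
    then have nz: "a' \<ominus>\<^bsub>S\<^esub> c' \<noteq> \<zero>\<^bsub>S\<^esub>" using G_zero[OF iso ac] by simp
    have "\<rho>\<^sub>2 (a' \<ominus>\<^bsub>S\<^esub> c') \<noteq> \<rho>\<^sub>2 (y \<ominus>\<^bsub>S\<^esub> c')"
      using g(2)[OF y] G_ops(8)[OF iso ac] s(1)[OF n] c by auto
    then have "(a' \<ominus>\<^bsub>S\<^esub> c') \<ominus>\<^bsub>S\<^esub> (y \<ominus>\<^bsub>S\<^esub> c') \<unlhd>\<^sub>2 a' \<ominus>\<^bsub>S\<^esub> c'"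
      using S.sec_eq_iff[of "a' \<ominus>\<^bsub>S\<^esub> c'" "y \<ominus>\<^bsub>S\<^esub> c'"] nz cc cl by auto
    moreover have "(a' \<ominus>\<^bsub>S\<^esub> c') \<ominus>\<^bsub>S\<^esub> (y \<ominus>\<^bsub>S\<^esub> c') = a' \<ominus>\<^bsub>S\<^esub> y" using cc cl by algebra
    ultimately have "a' \<ominus>\<^bsub>S\<^esub> y \<unlhd>\<^sub>2 d'" using le cc cl S.val_trans[of "a' \<ominus>\<^bsub>S\<^esub> y" "a' \<ominus>\<^bsub>S\<^esub> c'" d'] by simp
    then show ?thesis using S.val_diff_swap cc cl by simp
  qed
  obtain q where q: "set q \<subseteq> G" "length q = length p" "p \<noteq> [] \<Longrightarrow> last q = last p"
    and qe: "\<And>z. z \<in> carrier P \<Longrightarrow> peval P q z = peval P p (z \<oplus>\<^bsub>P\<^esub> (a, a'))"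
    by (rule P.peval_shift[OF G_subring[OF iso] ab(1) p(1)]) blast
  \<comment> \<open>The other component of the argument is a dummy: only one coordinate of the
    identity in the product ring is read off.\<close>
  have qR: "peval R (map fst q) z = peval R (map fst p) (z \<oplus> a)" if "z \<in> carrier R" for z
    using qe[of "(z, \<zero>\<^bsub>S\<^esub>)"] that by (simp add: prod_peval)
  have qS: "peval S (map snd q) z = peval S (map snd p) (z \<oplus>\<^bsub>S\<^esub> a')" if "z \<in> carrier S" for z
    using qe[of "(\<zero>, z)"] that by (simp add: prod_peval)
  have qne: "q \<noteq> []" using q pne by auto
  note qc = G_list_carrier[OF iso q(1)]
  have val: "map snd q ! 0 \<unlhd>\<^sub>2 map snd q ! j \<otimes>\<^bsub>S\<^esub> d' [^]\<^bsub>S\<^esub> j" if "j < length (map snd q)" for j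
  proof (rule S.far_roots[OF qc(2) _ _ cl(5) S_root _ that])
    fix y assume y: "y \<in> carrier S" "peval S (map snd q) y = \<zero>\<^bsub>S\<^esub>"
    then have "y \<oplus>\<^bsub>S\<^esub> a' \<in> Y" using qS cl by (simp add: Y_def)
    moreover have "(y \<oplus>\<^bsub>S\<^esub> a') \<ominus>\<^bsub>S\<^esub> a' = y" using y cl by algebra
    ultimately show "y \<unlhd>\<^sub>2 d'" using root_far by metis
  qed (use qne q pne snd_last in \<open>auto simp: last_map\<close>)
  have qi: "(fst (q ! i), snd (q ! i)) \<in> G" if "i < length q" for i using q(1) nth_mem[OF that] by auto
  have "map fst q ! 0 = \<zero>"
  proof (rule R.near_root[OF qc(1) _ _ _ cl(3) xa])
    show "peval R (map fst q) (x \<ominus> a) = \<zero>"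
    proof -
      have "(x \<ominus> a) \<oplus> a = x" using x cl by algebra
      then show ?thesis using qR[of "x \<ominus> a"] p(4) x cl by simp
    qed
    fix j assume j: "j < length (map fst q)"
    have "(fst (q ! j) \<otimes> d [^] j, snd (q ! j) \<otimes>\<^bsub>S\<^esub> d' [^]\<^bsub>S\<^esub> j) \<in> G"
      using j by (intro G_ops(4,7)[OF iso] qi dG) auto
    moreover have "0 < length q" using qne by simp
    ultimately show "map fst q ! 0 \<unlhd>\<^sub>1 map fst q ! j \<otimes> d [^] j"
      using val[of j] j G_val[OF iso qi[of 0]] by auto
  qed (use qne x cl in auto)
  then have q0: "snd (q ! 0) = \<zero>\<^bsub>S\<^esub>" using G_zero[OF iso qi[of 0]] qne by simp
  define n where "n = length q - 1"
  have n: "n < length q" using qne by (simp add: n_def)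
  have qn: "snd (q ! n) \<in> carrier S" using qi[OF n] G_carrier[OF iso] by blast
  \<comment> \<open>With constant term 0, the bound from \<open>far_roots\<close> says that the top
    term at d' has infinite value.\<close>
  have "\<zero>\<^bsub>S\<^esub> \<unlhd>\<^sub>2 snd (q ! n) \<otimes>\<^bsub>S\<^esub> d' [^]\<^bsub>S\<^esub> n" using val[of n] q0 n qne by simp
  then have "snd (q ! n) \<otimes>\<^bsub>S\<^esub> d' [^]\<^bsub>S\<^esub> n = \<zero>\<^bsub>S\<^esub>" using qn cl by simp
  then have "snd (q ! n) = \<zero>\<^bsub>S\<^esub>"
    using S.integral[of "snd (q ! n)" "d' [^]\<^bsub>S\<^esub> n"] S.pow_nonzero[OF cl(5) d'0] qn cl by auto
  then show False using snd_last q(3)[OF pne] qne by (simp add: n_def last_conv_nth)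
qed

end

end

end

section \<open>Equality of values, and Newton polygons with one edge\<close>

context sectioned_field
begin

definition veq :: "'a \<Rightarrow> 'a \<Rightarrow> bool"  (infix \<open>\<approx>\<close> 50) where
  "x \<approx> y \<longleftrightarrow> x \<unlhd> y \<and> y \<unlhd> x"

lemma veq_refl: "x \<in> carrier R \<Longrightarrow> x \<approx> x"
  by (simp add: veq_def)

lemma veq_sym: "x \<approx> y \<Longrightarrow> y \<approx> x"
  by (simp add: veq_def)

lemma veq_trans: "x \<approx> y \<Longrightarrow> y \<approx> z \<Longrightarrow> x \<in> carrier R \<Longrightarrow> y \<in> carrier R \<Longrightarrow> z \<in> carrier R \<Longrightarrow> x \<approx> z"
  unfolding veq_def using val_trans by blast

lemma veq_mult: "x \<approx> y \<Longrightarrow> u \<approx> w \<Longrightarrow> x \<in> carrier R \<Longrightarrow> y \<in> carrier R \<Longrightarrow> u \<in> carrier R \<Longrightarrow> w \<in> carrier R \<Longrightarrow>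
    x \<otimes> u \<approx> y \<otimes> w"
  unfolding veq_def by (auto intro: val_mult_mono)

lemma veq_pow: "x \<approx> y \<Longrightarrow> x \<in> carrier R \<Longrightarrow> y \<in> carrier R \<Longrightarrow> x [^] (n::nat) \<approx> y [^] n"
  unfolding veq_def by (auto intro: val_pow_mono)

lemma veq_cancel: "x \<otimes> z \<approx> y \<otimes> z \<Longrightarrow> x \<in> carrier R \<Longrightarrow> y \<in> carrier R \<Longrightarrow> z \<in> carrier R \<Longrightarrow> z \<noteq> \<zero> \<Longrightarrow> x \<approx> y"
  unfolding veq_def by (simp add: val_cancel)

lemma veq_left: "x \<approx> y \<Longrightarrow> x \<in> carrier R \<Longrightarrow> y \<in> carrier R \<Longrightarrow> z \<in> carrier R \<Longrightarrow> x \<unlhd> z \<longleftrightarrow> y \<unlhd> z"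
  and veq_right: "x \<approx> y \<Longrightarrow> x \<in> carrier R \<Longrightarrow> y \<in> carrier R \<Longrightarrow> z \<in> carrier R \<Longrightarrow> z \<unlhd> x \<longleftrightarrow> z \<unlhd> y"
  unfolding veq_def using val_trans by blast+

lemma val_min:
  assumes "finite A" "A \<noteq> {}" "A \<subseteq> carrier R"
  shows "\<exists>m \<in> A. \<forall>a \<in> A. m \<unlhd> a"
  using assms
proof (induction rule: finite_ne_induct)
  case (insert x F)
  then obtain m where m: "m \<in> F" "\<forall>a \<in> F. m \<unlhd> a" by auto
  then have "x \<unlhd> m \<or> m \<unlhd> x" "x \<in> carrier R" "m \<in> carrier R" using insert.prems val_total by auto
  moreover have "x \<unlhd> a" if "x \<unlhd> m" "a \<in> F" for a
    using val_trans[of x m a] that m insert.prems by auto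
  ultimately show ?case using m by auto
qed auto

lemma val_max:
  assumes "finite A" "A \<noteq> {}" "A \<subseteq> carrier R"
  shows "\<exists>m \<in> A. \<forall>a \<in> A. a \<unlhd> m"
  using assms
proof (induction rule: finite_ne_induct)
  case (insert x F)
  then obtain m where m: "m \<in> F" "\<forall>a \<in> F. a \<unlhd> m" by auto
  then have "x \<unlhd> m \<or> m \<unlhd> x" "x \<in> carrier R" "m \<in> carrier R" using insert.prems val_total by auto
  moreover have "a \<unlhd> x" if "m \<unlhd> x" "a \<in> F" for a
    using val_trans[of a m x] that m insert.prems by auto
  ultimately show ?case using m by auto
qed auto

text \<open>The assumption \<open>line\<close> says that the Newton polygon of \<open>b\<close> has a single edge.\<close>

lemma straight_root:
  assumes b: "set b \<subseteq> carrier R" "length b = Suc n" "n > 0" "b ! 0 \<noteq> \<zero>" "b ! n \<noteq> \<zero>"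
    and fixed: "\<And>i. i \<le> n \<Longrightarrow> \<rho> (b ! i) = b ! i"
    and line: "\<And>i. i \<le> n \<Longrightarrow> b ! i \<noteq> \<zero> \<Longrightarrow> (b ! i) [^] n \<approx> (b ! 0) [^] (n - i) \<otimes> (b ! n) [^] i"
    and s: "s \<in> carrier R" "peval R b s = \<zero>"
  shows "b ! 0 \<approx> b ! n \<otimes> s [^] n" "peval R b (\<rho> s) = \<zero>"
proof -
  have bc: "b ! i \<in> carrier R" if "i \<le> n" for i using that b nth_mem[of i b] by auto
  have s0: "s \<noteq> \<zero>"
  proof
    assume "s = \<zero>"
    moreover obtain c b' where "b = c # b'" using b(2) by (cases b) auto
    ultimately have "b ! 0 = \<zero>" using s b by auto
    then show False using b by simp
  qed
  define A where "A = b ! 0"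
  define B where "B = b ! n \<otimes> s [^] n"
  define T where "T i = b ! i \<otimes> s [^] i" for i
  have cl: "A \<in> carrier R" "B \<in> carrier R" "\<And>i. i \<le> n \<Longrightarrow> T i \<in> carrier R"
    using bc s by (auto simp: A_def B_def T_def)
  have A0: "A \<noteq> \<zero>" using b by (simp add: A_def)
  have B0: "B \<noteq> \<zero>"
    using integral[of "b ! n" "s [^] n"] pow_nonzero[OF s(1) s0] bc s b by (auto simp: B_def)
  \<comment> \<open>Multiplying \<open>line\<close> by s^(i n) places the values of the nonzero
    terms of b(s) on the segment between those of the two end terms.\<close>
  have T: "T i [^] n \<approx> A [^] (n - i) \<otimes> B [^] i" if i: "i \<le> n" "b ! i \<noteq> \<zero>" for i
  proof -
    have "(b ! i) [^] n \<otimes> s [^] (i * n) \<approx> (b ! 0) [^] (n - i) \<otimes> (b ! n) [^] i \<otimes> s [^] (i * n)"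
      using i bc s by (intro veq_mult line veq_refl) auto
    moreover have "(b ! i) [^] n \<otimes> s [^] (i * n) = T i [^] n"
      using i bc s by (simp add: T_def nat_pow_distrib nat_pow_pow)
    moreover have "(b ! 0) [^] (n - i) \<otimes> (b ! n) [^] i \<otimes> s [^] (i * n) = A [^] (n - i) \<otimes> B [^] i"
      using i bc s by (simp add: A_def B_def nat_pow_distrib nat_pow_pow m_assoc mult.commute)
    ultimately show ?thesis by simp
  qed
  \<comment> \<open>The least value on a segment is attained at an end, so v(e) is a lower bound for
    the values of all terms.\<close>
  define e where "e = (if A \<unlhd> B then A else B)"
  have e: "e \<unlhd> A" "e \<unlhd> B" "e \<in> carrier R" "e \<noteq> \<zero>"
    using val_total[OF cl(1,2)] cl A0 B0 by (auto simp: e_def)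
  have pow_split: "u [^] (n - i) \<otimes> u [^] i = u [^] n" if "i \<le> n" "u \<in> carrier R" for u i
    using that by (simp add: nat_pow_mult)
  have eT: "e \<unlhd> T i" if i: "i \<le> n" for i
  proof (cases "b ! i = \<zero>")
    case True
    then show ?thesis using e s by (simp add: T_def)
  next
    case False
    have "e [^] (n - i) \<otimes> e [^] i \<unlhd> A [^] (n - i) \<otimes> B [^] i"
      using e cl by (intro val_mult_mono val_pow_mono) auto
    then have "e [^] n \<unlhd> T i [^] n"
      using T[OF i False] pow_split[OF i e(3)] veq_right[OF T[OF i False], of "e [^] n"] cl e i by simp
    then show ?thesis using val_pow_iff e cl i b by simp
  qed
  define q where "q = map (\<lambda>i. if T i \<unlhd> e then b ! i else \<zero>) [0..<Suc n]"
  have q: "length q = length b" "\<And>i. i < length b \<Longrightarrow> q ! i = (if b ! i \<otimes> s [^] i \<unlhd> e then \<rho> (b ! i) else \<zero>)"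
    using b fixed by (auto simp: q_def T_def simp del: upt_Suc)
  have root: "peval R q (\<rho> s) = \<zero>"
    by (rule peval_sec_root[OF q(1) b(1) e(3,4) s(1) s0 _ q(2) s(2)]) (use eT b in \<open>auto simp: T_def\<close>)
  \<comment> \<open>If the end terms had different values, the initial form at s would be a single
    monomial, which cannot vanish at the nonzero \<rho>(s). \<open>BA\<close> is the same argument
    from the other end.\<close>
  have AB: "B \<unlhd> A"
  proof (rule ccontr)
    assume n: "\<not> B \<unlhd> A"
    then have eA: "e = A" using val_total[OF cl(1,2)] by (auto simp: e_def)
    have "q ! i = \<zero>" if i: "i \<le> n" "i > 0" for i
    proof (rule ccontr)
      assume "q ! i \<noteq> \<zero>"
      then have *: "T i \<unlhd> A" "b ! i \<noteq> \<zero>" using i eA by (auto simp: q_def simp del: upt_Suc split: if_splits)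
      then have "T i [^] n \<unlhd> A [^] n" using cl i by (intro val_pow_mono) auto
      then have "A [^] (n - i) \<otimes> B [^] i \<unlhd> A [^] (n - i) \<otimes> A [^] i"
        using veq_left[OF T[OF i(1) *(2)], of "A [^] n"] cl i by (simp add: pow_split)
      then have "B \<unlhd> A" using cl A0 i by (simp add: val_cancel_left pow_nonzero val_pow_iff)
      then show False using n by simp
    qed
    moreover have "q ! 0 = A" using eA cl by (simp add: q_def T_def A_def[symmetric] nth_append del: upt_Suc)
    ultimately have "q = A # replicate n \<zero>"
      using q(1) b(2) by (intro nth_equalityI) (auto simp: nth_Cons' less_Suc_eq_le)
    then show False using root A0 cl s by simp
  qed
  have BA: "A \<unlhd> B"
  proof (rule ccontr)
    assume n: "\<not> A \<unlhd> B"
    then have eB: "e = B" by (simp add: e_def)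
    have "q ! i = \<zero>" if i: "i < n" for i
    proof (rule ccontr)
      assume "q ! i \<noteq> \<zero>"
      then have *: "T i \<unlhd> B" "b ! i \<noteq> \<zero>" using i eB by (auto simp: q_def simp del: upt_Suc split: if_splits)
      then have "T i [^] n \<unlhd> B [^] n" using cl i by (intro val_pow_mono) auto
      then have "A [^] (n - i) \<otimes> B [^] i \<unlhd> B [^] (n - i) \<otimes> B [^] i"
        using veq_left[OF T[OF _ *(2)], of "B [^] n"] cl i by (simp add: pow_split)
      then have "A \<unlhd> B" using cl B0 i by (simp add: val_cancel pow_nonzero val_pow_iff)
      then show False using n by simp
    qed
    moreover have "q ! n = b ! n" using eB cl by (simp add: q_def T_def B_def[symmetric] del: upt_Suc)
    ultimately have "q = replicate n \<zero> @ [b ! n]"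
      using q(1) b(2) by (intro nth_equalityI) (auto simp: nth_append less_Suc_eq)
    then have "peval R q (\<rho> s) = b ! n \<otimes> \<rho> s [^] n"
      using peval_append[of "replicate n \<zero>" "b ! n" "\<rho> s"] bc s by (auto simp: set_replicate_conv_if)
    then have "b ! n = \<zero> \<or> \<rho> s [^] n = \<zero>" using root integral[of "b ! n" "\<rho> s [^] n"] bc s by simp
    then show False using pow_nonzero[of "\<rho> s" n] s s0 b by simp
  qed
  show "b ! 0 \<approx> b ! n \<otimes> s [^] n" using AB BA by (simp add: veq_def A_def B_def)
  \<comment> \<open>As the end terms have equal value, every nonzero term has this least value, so
    the initial form is all of \<open>b\<close>.\<close>
  have e': "A \<unlhd> e" "B \<unlhd> e" using AB BA cl by (auto simp: e_def)
  have "q ! i = b ! i" if i: "i \<le> n" for i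
  proof (cases "b ! i = \<zero>")
    case True
    then show ?thesis using i by (simp add: q_def del: upt_Suc)
  next
    case False
    have "A [^] (n - i) \<otimes> B [^] i \<unlhd> e [^] (n - i) \<otimes> e [^] i"
      using e' e cl by (intro val_mult_mono val_pow_mono) auto
    then have "T i [^] n \<unlhd> e [^] n"
      using veq_left[OF T[OF i False], of "e [^] n"] cl e i by (simp add: pow_split)
    then have "T i \<unlhd> e" using val_pow_iff e cl i b by simp
    then show ?thesis using i by (simp add: q_def del: upt_Suc)
  qed
  then have "q = b" using q(1) b(2) by (intro nth_equalityI) auto
  then show "peval R b (\<rho> s) = \<zero>" using root by simp
qed

end

section \<open>Algebraic elements with a best approximation\<close>

context sectioned_pair
begin

context
  fixes G
  assumes iso: "partial_iso G"
begin

lemma closed_upto_mono: "closed_upto G n \<Longrightarrow> m \<le> n \<Longrightarrow> closed_upto G m"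
  unfolding closed_upto_def by (meson le_trans)

text \<open>If \<rho>(x - a) were in the domain, a + \<rho>(x - a) would approximate x strictly
  better than a does.\<close>

lemma best_approximation:
  assumes x: "x \<in> carrier R" "x \<notin> fst ` G" and a: "a \<in> fst ` G"
    and best: "\<And>b. b \<in> fst ` G \<Longrightarrow> x \<ominus> b \<unlhd>\<^sub>1 x \<ominus> a"
  shows "\<rho>\<^sub>1 (x \<ominus> a) \<notin> fst ` G"
proof
  assume "\<rho>\<^sub>1 (x \<ominus> a) \<in> fst ` G"
  then obtain b c where bc: "(\<rho>\<^sub>1 (x \<ominus> a), b) \<in> G" "(a, c) \<in> G" using a by auto
  have ac: "a \<in> carrier R" using G_carrier[OF iso bc(2)] by simp
  have "(a \<oplus> \<rho>\<^sub>1 (x \<ominus> a), c \<oplus>\<^bsub>S\<^esub> b) \<in> G" by (intro G_ops(3)[OF iso] bc)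
  then have "x \<ominus> (a \<oplus> \<rho>\<^sub>1 (x \<ominus> a)) \<unlhd>\<^sub>1 x \<ominus> a" by (intro best) force
  moreover have "x \<ominus> (a \<oplus> \<rho>\<^sub>1 (x \<ominus> a)) = (x \<ominus> a) \<ominus> \<rho>\<^sub>1 (x \<ominus> a)"
    using x(1) ac R.sec_closed[OF R.minus_closed[OF x(1) ac]] by algebra
  moreover have "x \<ominus> a \<noteq> \<zero>" using x ac a by auto
  ultimately show False using R.val_sub_sec[of "x \<ominus> a"] x ac by simp
qed

text \<open>Zero top coefficients are peeled off one by one; a nonzero one would put r into the
  domain by closedness.\<close>

lemma no_small_polynomial:
  assumes "closed_upto G n" "r \<in> carrier R" "r \<notin> fst ` G"
    and "set q \<subseteq> G" "length q \<le> n" "peval R (map fst q) r = \<zero>"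
  shows "\<forall>g \<in> set q. fst g = \<zero>"
  using assms(4-6)
proof (induction q rule: rev_induct)
  case (snoc g q)
  have g: "fst g = \<zero>"
  proof (rule ccontr)
    assume "fst g \<noteq> \<zero>"
    then have "r \<in> fst ` G"
      using assms(1,2) snoc.prems unfolding closed_upto_def by (metis last_snoc snoc_eq_iff_butlast)
    then show False using assms(3) by blast
  qed
  have "set (map fst q) \<subseteq> carrier R" using snoc.prems by (intro G_list_carrier[OF iso]) auto
  then have "peval R (map fst q) r = \<zero>"
    using snoc.prems(3) g R.peval_append[of "map fst q" \<zero> r] assms(2) by simp
  then show ?case using snoc g by simp
qed simp

text \<open>The list \<open>q\<close> is the initial form of \<open>p\<close> at x, and r =
  \<rho>(x) is a root of it. Closedness below degree n makes its end coefficients nonzero, and all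
  its nonzero terms at r have the same value; so its Newton polygon is a single edge. This concerns
  only values of coefficients, hence \<open>G\<close> carries it over, and
  \<open>straight_root\<close> produces s. The end terms determine n v(r) and thus the cut of
  v(r).\<close>

lemma sec_algebraic:
  assumes p: "set p \<subseteq> G" "length p = Suc n" "fst (last p) \<noteq> \<zero>" "peval R (map fst p) x = \<zero>"
    and x: "x \<in> carrier R" "\<rho>\<^sub>1 x \<notin> fst ` G" and closed: "closed_upto G n"
  shows "\<exists>q s. set q \<subseteq> G \<and> length q = Suc n \<and> fst (last q) \<noteq> \<zero> \<and> peval R (map fst q) (\<rho>\<^sub>1 x) = \<zero> \<and>
    s \<in> carrier S \<and> \<rho>\<^sub>2 s = s \<and> s \<notin> snd ` G \<and> peval S (map snd q) s = \<zero>\<^bsub>S\<^esub> \<and>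
    (\<forall>(a, b) \<in> G. (\<rho>\<^sub>1 x \<unlhd>\<^sub>1 a \<longleftrightarrow> s \<unlhd>\<^sub>2 b) \<and> (a \<unlhd>\<^sub>1 \<rho>\<^sub>1 x \<longleftrightarrow> b \<unlhd>\<^sub>2 s))"
proof -
  define r where "r = \<rho>\<^sub>1 x"
  have r: "r \<in> carrier R" "\<rho>\<^sub>1 r = r" "r \<notin> fst ` G" using x by (auto simp: r_def)
  have x0: "x \<noteq> \<zero>" using x(2) G_ops(1)[OF iso] by force
  then have r0: "r \<noteq> \<zero>" using x by (simp add: r_def)
  define t where "t i = fst (p ! i) \<otimes> x [^] i" for i
  have pG: "(fst (p ! i), snd (p ! i)) \<in> G" if "i \<le> n" for i using that p nth_mem[of i p] by auto
  have pc: "fst (p ! i) \<in> carrier R" if "i \<le> n" for i using G_carrier[OF iso pG[OF that]] by simp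
  have tc: "t i \<in> carrier R" if "i \<le> n" for i using pc[OF that] x by (simp add: t_def)
  obtain i0 where i0: "i0 \<le> n" "\<And>i. i \<le> n \<Longrightarrow> t i0 \<unlhd>\<^sub>1 t i"
    using R.val_min[of "t ` {..n}"] tc by auto
  define d where "d = t i0"
  have d: "d \<in> carrier R" using tc i0 by (simp add: d_def)
  have "last p = p ! n" using p(2) by (cases p rule: rev_cases) (auto simp: nth_append)
  then have tn: "t n \<noteq> \<zero>" using R.integral[of "fst (p ! n)" "x [^] n"] R.pow_nonzero[OF x(1) x0] p(3) pc x by (auto simp: t_def)
  have d0: "d \<noteq> \<zero>"
  proof
    assume "d = \<zero>"
    then have "\<zero> \<unlhd>\<^sub>1 t n" using i0(2)[of n] by (simp add: d_def)
    then show False using tn tc by simp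
  qed
  define q where "q = map (\<lambda>i. if t i \<unlhd>\<^sub>1 d then (\<rho>\<^sub>1 (fst (p ! i)), \<rho>\<^sub>2 (snd (p ! i))) else (\<zero>, \<zero>\<^bsub>S\<^esub>)) [0..<Suc n]"
  have len: "length q = Suc n" by (simp add: q_def)
  have qi: "q ! i = (if t i \<unlhd>\<^sub>1 d then (\<rho>\<^sub>1 (fst (p ! i)), \<rho>\<^sub>2 (snd (p ! i))) else (\<zero>, \<zero>\<^bsub>S\<^esub>))" if "i \<le> n" for i
    using that by (simp add: q_def del: upt_Suc)
  have qG': "q ! i \<in> G" if "i \<le> n" for i
    using qi[OF that] G_ops(8)[OF iso pG[OF that]] G_ops(1)[OF iso] by simp
  then have qG: "set q \<subseteq> G" using len by (metis in_set_conv_nth less_Suc_eq_le subsetI)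
  have qc: "fst (q ! i) \<in> carrier R" "snd (q ! i) \<in> carrier S" if "i \<le> n" for i
    using G_carrier[OF iso, of "fst (q ! i)" "snd (q ! i)"] qG'[OF that] by auto
  have q_root: "peval R (map fst q) r = \<zero>"
    unfolding r_def
  proof (rule R.peval_sec_root[OF _ G_list_carrier(1)[OF iso p(1)] d d0 x(1) x0 _ _ p(4)])
    fix i assume "i < length (map fst p)"
    then have i: "i \<le> n" using p by simp
    show "d \<unlhd>\<^sub>1 map fst p ! i \<otimes> x [^] i" using i0(2)[OF i] i p by (simp add: d_def t_def)
    show "map fst q ! i = (if map fst p ! i \<otimes> x [^] i \<unlhd>\<^sub>1 d then \<rho>\<^sub>1 (map fst p ! i) else \<zero>)"
      using i p len qi[OF i] by (simp add: t_def)
  qed (use p len in simp)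
  have q_val: "R.veq (fst (q ! i) \<otimes> r [^] i) d" if i: "i \<le> n" "fst (q ! i) \<noteq> \<zero>" for i
  proof -
    have *: "t i \<unlhd>\<^sub>1 d" "fst (q ! i) = \<rho>\<^sub>1 (fst (p ! i))" using i qi[OF i(1)] by (auto split: if_splits)
    then have "fst (q ! i) \<otimes> r [^] i = \<rho>\<^sub>1 (t i)" using pc[OF i(1)] x by (simp add: t_def r_def R.sec_mult R.sec_pow)
    then show ?thesis using * i0(2)[OF i(1)] tc[OF i(1)] d by (simp add: R.veq_def d_def)
  qed
  have q_i0: "fst (q ! i0) \<noteq> \<zero>"
    using qi[OF i0(1)] d d0 pc[OF i0(1)] x by (auto simp: d_def t_def)
  have q_fixed: "\<rho>\<^sub>1 (fst (q ! i)) = fst (q ! i)" "\<rho>\<^sub>2 (snd (q ! i)) = snd (q ! i)" if "i \<le> n" for i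
    using qi[OF that] G_carrier[OF iso pG[OF that]] by auto
  have qne: "q \<noteq> []" using len by auto
  have last_q: "last q = q ! n" using len by (cases q rule: rev_cases) (auto simp: nth_append)
  \<comment> \<open>Without its top term \<open>q\<close> has only n coefficients, so that vanishing
    at r would force all of them to be zero; but the one at \<open>i0\<close> is not.\<close>
  have q_last: "fst (last q) \<noteq> \<zero>"
  proof
    assume z: "fst (last q) = \<zero>"
    obtain q1 g where qq: "q = q1 @ [g]" using qne by (cases q rule: rev_cases) auto
    have bl: "set q1 \<subseteq> G" "length q1 = n" using qG len qq by auto
    have bc: "set (map fst q1) \<subseteq> carrier R" by (rule G_list_carrier(1)[OF iso bl(1)])
    have "map fst q = map fst q1 @ [\<zero>]" using z qq by simp
    then have "peval R (map fst q1) r = \<zero>"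
      using q_root R.peval_append[OF bc, of \<zero> r] R.peval_closed[OF bc r(1)] r by simp
    then have "\<forall>g \<in> set q1. fst g = \<zero>"
      using no_small_polynomial[OF closed r(1,3) bl(1)] bl(2) by simp
    then have "\<forall>g \<in> set q. fst g = \<zero>" using z qq by auto
    then show False using q_i0 i0(1) len nth_mem[of i0 q] by auto
  qed
  have q_hd: "fst (q ! 0) \<noteq> \<zero>"
  proof
    assume z: "fst (q ! 0) = \<zero>"
    obtain g q' where q': "q = g # q'" using qne by (cases q) auto
    have "set (map fst q') \<subseteq> carrier R" using qG q' by (intro G_list_carrier[OF iso]) auto
    then have "peval R (map fst q') r = \<zero>"
      using q_root z q' r r0 R.integral[of r "peval R (map fst q') r"] by auto
    then have "\<forall>g \<in> set q'. fst g = \<zero>"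
      using no_small_polynomial[OF closed r(1,3), of q'] qG len q' by auto
    then have "\<forall>g \<in> set q. fst g = \<zero>" using z q' by simp
    then show False using q_last qne by simp
  qed
  have npos: "n > 0"
  proof (rule ccontr)
    assume "\<not> n > 0"
    then obtain g where "q = [g]" using len by (cases q) auto
    then show False using q_root q_hd r qc[of 0] by simp
  qed
  \<comment> \<open>Multiplied by r^(i n), both sides become products of n terms of \<open>q\<close>
    at r and thus have the value of d^n.\<close>
  have line: "R.veq (fst (q ! i) [^] n) (fst (q ! 0) [^] (n - i) \<otimes> fst (q ! n) [^] i)"
    if i: "i \<le> n" "fst (q ! i) \<noteq> \<zero>" for i
  proof (rule R.veq_cancel)
    have c: "fst (q ! 0) \<in> carrier R" "fst (q ! n) \<in> carrier R" "fst (q ! i) \<in> carrier R" using qc i by auto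
    have dn: "d [^] (n - i) \<otimes> d [^] i = d [^] n" using d i by (simp add: R.nat_pow_mult)
    have 1: "R.veq ((fst (q ! i) \<otimes> r [^] i) [^] n) (d [^] n)"
      by (rule R.veq_pow[OF q_val[OF i]]) (use c r d in auto)
    have 2: "R.veq (fst (q ! 0) [^] (n - i) \<otimes> (fst (q ! n) \<otimes> r [^] n) [^] i) (d [^] n)"
      unfolding dn[symmetric]
      by (intro R.veq_mult R.veq_pow) (use q_val[of 0] q_val[of n] q_hd q_last last_q c r d in auto)
    have "R.veq ((fst (q ! i) \<otimes> r [^] i) [^] n) (fst (q ! 0) [^] (n - i) \<otimes> (fst (q ! n) \<otimes> r [^] n) [^] i)"
      by (rule R.veq_trans[OF 1 R.veq_sym[OF 2]]) (use c r d in auto)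
    moreover have "(fst (q ! i) \<otimes> r [^] i) [^] n = fst (q ! i) [^] n \<otimes> r [^] (i * n)"
      using c r by (simp add: R.nat_pow_distrib R.nat_pow_pow)
    moreover have "fst (q ! 0) [^] (n - i) \<otimes> (fst (q ! n) \<otimes> r [^] n) [^] i =
        fst (q ! 0) [^] (n - i) \<otimes> fst (q ! n) [^] i \<otimes> r [^] (i * n)"
      using c r by (simp add: R.nat_pow_distrib R.nat_pow_pow R.m_assoc mult.commute)
    ultimately show "R.veq (fst (q ! i) [^] n \<otimes> r [^] (i * n))
        (fst (q ! 0) [^] (n - i) \<otimes> fst (q ! n) [^] i \<otimes> r [^] (i * n))" by simp
  qed (use qc i r r0 R.pow_nonzero in auto)
  have qGi: "(fst (q ! i), snd (q ! i)) \<in> G" if "i \<le> n" for i using qG'[OF that] by simp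
  have zero_iff: "fst (q ! i) = \<zero> \<longleftrightarrow> snd (q ! i) = \<zero>\<^bsub>S\<^esub>" if "i \<le> n" for i
    by (rule G_zero[OF iso qGi[OF that]])
  have line': "S.veq (snd (q ! i) [^]\<^bsub>S\<^esub> n) (snd (q ! 0) [^]\<^bsub>S\<^esub> (n - i) \<otimes>\<^bsub>S\<^esub> snd (q ! n) [^]\<^bsub>S\<^esub> i)"
    if i: "i \<le> n" "snd (q ! i) \<noteq> \<zero>\<^bsub>S\<^esub>" for i
  proof -
    have G1: "(fst (q ! i) [^] n, snd (q ! i) [^]\<^bsub>S\<^esub> n) \<in> G" by (intro G_ops(7)[OF iso] qGi i)
    have G2: "(fst (q ! 0) [^] (n - i) \<otimes> fst (q ! n) [^] i, snd (q ! 0) [^]\<^bsub>S\<^esub> (n - i) \<otimes>\<^bsub>S\<^esub> snd (q ! n) [^]\<^bsub>S\<^esub> i) \<in> G"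
      by (intro G_ops(4,7)[OF iso] qGi) auto
    show ?thesis
      using line[OF i(1)] zero_iff[OF i(1)] i(2) G_val[OF iso G1 G2] G_val[OF iso G2 G1]
      by (simp add: R.veq_def S.veq_def)
  qed
  define b where "b = map snd q"
  have b: "set b \<subseteq> carrier S" "length b = Suc n" "b ! 0 \<noteq> \<zero>\<^bsub>S\<^esub>" "b ! n \<noteq> \<zero>\<^bsub>S\<^esub>" "\<And>i. i \<le> n \<Longrightarrow> b ! i = snd (q ! i)"
    using G_list_carrier(2)[OF iso qG] len zero_iff[of 0] zero_iff[of n] q_hd q_last last_q by (auto simp: b_def)
  have "last b = b ! n" using b(2) by (cases b rule: rev_cases) (auto simp: nth_append)
  then obtain s0 where s0: "s0 \<in> carrier S" "peval S b s0 = \<zero>\<^bsub>S\<^esub>"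
    using S_root[of b] b npos by auto
  have straight: "S.veq (b ! 0) (b ! n \<otimes>\<^bsub>S\<^esub> s0 [^]\<^bsub>S\<^esub> n)" "peval S b (\<rho>\<^sub>2 s0) = \<zero>\<^bsub>S\<^esub>"
    by (rule S.straight_root[OF b(1,2) npos b(3,4) _ _ s0], use b(5) q_fixed line' in simp_all)+
  define s where "s = \<rho>\<^sub>2 s0"
  have s: "s \<in> carrier S" "\<rho>\<^sub>2 s = s" "peval S (map snd q) s = \<zero>\<^bsub>S\<^esub>"
    using s0 straight(2) by (auto simp: s_def b_def)
  \<comment> \<open>A preimage a of s would be a root of \<open>q\<close> different from r.
    Splitting off X - a leaves a polynomial with n coefficients that vanishes at r although its top
    coefficient is still nonzero.\<close>
  have sn: "s \<notin> snd ` G"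
  proof
    assume "s \<in> snd ` G"
    then obtain a where a: "(a, s) \<in> G" by auto
    have ac: "a \<in> carrier R" "a \<noteq> r" using G_carrier[OF iso a] a r by force+
    have aP: "(a, s) \<in> carrier P" using ac s by simp
    have pa: "peval R (map fst q) a = \<zero>" using G_peval[OF iso qG a] s(3) G_zero[OF iso] by simp
    let ?q = "synth P (a, s) q"
    have q2: "set ?q \<subseteq> G" by (rule P.synth_in_lists[OF G_subring[OF iso] qG a])
    have "peval P q (r, \<zero>\<^bsub>S\<^esub>) = ((r, \<zero>\<^bsub>S\<^esub>) \<ominus>\<^bsub>P\<^esub> (a, s)) \<otimes>\<^bsub>P\<^esub> peval P ?q (r, \<zero>\<^bsub>S\<^esub>) \<oplus>\<^bsub>P\<^esub> peval P q (a, s)"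
      by (rule P.peval_synth[OF G_list_carrier(3)[OF iso qG] _ aP]) (use r in simp)
    then have "(r \<ominus> a) \<otimes> peval R (map fst ?q) r = \<zero>"
      using q_root pa ac r s G_list_carrier(1)[OF iso q2] by (simp add: prod_peval)
    then have "peval R (map fst ?q) r = \<zero>"
      using R.integral[of "r \<ominus> a" "peval R (map fst ?q) r"] R.r_right_minus_eq[of r a] ac r G_list_carrier(1)[OF iso q2] by auto
    then have "\<forall>g \<in> set ?q. fst g = \<zero>"
      using no_small_polynomial[OF closed r(1,3) q2] len by simp
    moreover have "last ?q = last q"
      using P.last_synth[OF _ G_list_carrier(3)[OF iso qG] aP] len npos by simp
    moreover have "?q \<noteq> []" using len npos length_synth[of P "(a, s)" q] by (metis diff_Suc_1 length_0_conv less_numeral_extra(3))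
    ultimately show False using q_last by (metis last_in_set)
  qed
  have eqR: "R.veq (fst (q ! 0)) (fst (q ! n) \<otimes> r [^] n)"
    using R.veq_trans[OF q_val[of 0, simplified] R.veq_sym[OF q_val[of n]]] q_hd q_last last_q qc[of 0] qc[of n] r d by simp
  have eqS: "S.veq (snd (q ! 0)) (snd (q ! n) \<otimes>\<^bsub>S\<^esub> s [^]\<^bsub>S\<^esub> n)"
  proof -
    have "S.veq (b ! n \<otimes>\<^bsub>S\<^esub> s0 [^]\<^bsub>S\<^esub> n) (b ! n \<otimes>\<^bsub>S\<^esub> s [^]\<^bsub>S\<^esub> n)"
      using qc[of n] b(5)[of n] s s0 by (intro S.veq_mult S.veq_pow S.veq_refl) (auto simp: S.veq_def s_def)
    then show ?thesis using S.veq_trans[OF straight(1)] qc[of 0] qc[of n] b(5) s s0 by simp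
  qed
  \<comment> \<open>By \<open>eqR\<close> the value of \<open>q ! n\<close> times r^n is that of
    \<open>q ! 0\<close>. So comparing r with a means comparing \<open>q ! 0\<close> with
    \<open>q ! n\<close> times a^n, which takes place inside \<open>G\<close>; likewise for
    s.\<close>
  have cut: "(r \<unlhd>\<^sub>1 a \<longleftrightarrow> s \<unlhd>\<^sub>2 a') \<and> (a \<unlhd>\<^sub>1 r \<longleftrightarrow> a' \<unlhd>\<^sub>2 s)" if a: "(a, a') \<in> G" for a a'
  proof -
    have ac: "a \<in> carrier R" "a' \<in> carrier S" using G_carrier[OF iso a] by auto
    have c: "fst (q ! 0) \<in> carrier R" "snd (q ! 0) \<in> carrier S" "fst (q ! n) \<in> carrier R" "snd (q ! n) \<in> carrier S"
      "fst (q ! n) \<noteq> \<zero>" "snd (q ! n) \<noteq> \<zero>\<^bsub>S\<^esub>" using qc b(4,5) q_last last_q by auto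
    have 1: "r \<unlhd>\<^sub>1 a \<longleftrightarrow> fst (q ! n) \<otimes> r [^] n \<unlhd>\<^sub>1 fst (q ! n) \<otimes> a [^] n"
      "a \<unlhd>\<^sub>1 r \<longleftrightarrow> fst (q ! n) \<otimes> a [^] n \<unlhd>\<^sub>1 fst (q ! n) \<otimes> r [^] n"
      using c ac r npos by (simp_all add: R.val_cancel_left R.val_pow_iff)
    have 2: "s \<unlhd>\<^sub>2 a' \<longleftrightarrow> snd (q ! n) \<otimes>\<^bsub>S\<^esub> s [^]\<^bsub>S\<^esub> n \<unlhd>\<^sub>2 snd (q ! n) \<otimes>\<^bsub>S\<^esub> a' [^]\<^bsub>S\<^esub> n"
      "a' \<unlhd>\<^sub>2 s \<longleftrightarrow> snd (q ! n) \<otimes>\<^bsub>S\<^esub> a' [^]\<^bsub>S\<^esub> n \<unlhd>\<^sub>2 snd (q ! n) \<otimes>\<^bsub>S\<^esub> s [^]\<^bsub>S\<^esub> n"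
      using c ac s npos by (simp_all add: S.val_cancel_left S.val_pow_iff)
    have G: "(fst (q ! n) \<otimes> a [^] n, snd (q ! n) \<otimes>\<^bsub>S\<^esub> a' [^]\<^bsub>S\<^esub> n) \<in> G"
      by (intro G_ops(4,7)[OF iso] qGi a) auto
    have 3: "fst (q ! 0) \<unlhd>\<^sub>1 fst (q ! n) \<otimes> a [^] n \<longleftrightarrow> snd (q ! 0) \<unlhd>\<^sub>2 snd (q ! n) \<otimes>\<^bsub>S\<^esub> a' [^]\<^bsub>S\<^esub> n"
      "fst (q ! n) \<otimes> a [^] n \<unlhd>\<^sub>1 fst (q ! 0) \<longleftrightarrow> snd (q ! n) \<otimes>\<^bsub>S\<^esub> a' [^]\<^bsub>S\<^esub> n \<unlhd>\<^sub>2 snd (q ! 0)"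
      using G_val[OF iso qGi[of 0] G] G_val[OF iso G qGi[of 0]] by simp_all
    show ?thesis
      unfolding 1 2 using 3 R.veq_left[OF eqR] R.veq_right[OF eqR] S.veq_left[OF eqS] S.veq_right[OF eqS] c ac r s
      by simp
  qed
  show ?thesis
    using qG len q_last q_root s sn cut unfolding r_def by blast
qed

end

end

text \<open>The first kind describes an immediate transcendental element, the second one an element \<open>\<rho> y\<close> by
  its cut in the value group.\<close>

definition basic_conditions :: "('b, 'n) ring_scheme \<Rightarrow> ('b \<Rightarrow> 'b \<Rightarrow> bool) \<Rightarrow> ('b \<Rightarrow> 'b) \<Rightarrow> ('b \<Rightarrow> bool) set" where
  "basic_conditions S vle sec =
     {\<lambda>y. sec (y \<ominus>\<^bsub>S\<^esub> a) = b | a b. a \<in> carrier S \<and> b \<in> carrier S} \<union>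
     {\<lambda>y. sec y = y \<and> y \<noteq> a \<and> (vle y a \<longleftrightarrow> p) \<and> (vle a y \<longleftrightarrow> q) | a p q. a \<in> carrier S}"

text \<open>The last two assumptions serve finite satisfiability: infinitely many residues leave an
  element of a given value outside any finite set, and a nontrivial valuation reaches beyond any
  finite set of values of nonzero elements.\<close>

locale saturated_pair = sectioned_pair R le1 sec1 S le2 sec2
  for R :: "('a, 'm) ring_scheme" (structure) and le1 (infix \<open>\<unlhd>\<^sub>1\<close> 50) and sec1 (\<open>\<rho>\<^sub>1\<close>)
    and S :: "('b, 'n) ring_scheme" (structure) and le2 (infix \<open>\<unlhd>\<^sub>2\<close> 50) and sec2 (\<open>\<rho>\<^sub>2\<close>) +
  assumes saturated: "\<And>\<P>. countable \<P> \<Longrightarrow> \<P> \<subseteq> basic_conditions S le2 sec2 \<Longrightarrow>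
      (\<And>F. finite F \<Longrightarrow> F \<subseteq> \<P> \<Longrightarrow> \<exists>y \<in> carrier S. \<forall>\<phi> \<in> F. \<phi> y) \<Longrightarrow> \<exists>y \<in> carrier S. \<forall>\<phi> \<in> \<P>. \<phi> y"
    and residue_infinite: "infinite {k \<in> carrier S. \<rho>\<^sub>2 k = k \<and> k \<unlhd>\<^sub>2 \<one>\<^bsub>S\<^esub> \<and> \<one>\<^bsub>S\<^esub> \<unlhd>\<^sub>2 k}"
    and nontrivial: "\<exists>c \<in> carrier S. c \<noteq> \<zero>\<^bsub>S\<^esub> \<and> \<not> c \<unlhd>\<^sub>2 \<one>\<^bsub>S\<^esub>"

section \<open>Saturation and proper extensions\<close>

context saturated_pair
begin

context
  fixes G
  assumes iso: "partial_iso G" and countable: "countable G"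
begin

text \<open>Finitely many of the conditions are satisfied by the image of an element b of the domain
  that is closer to x than the points a concerned, since then \<rho>(x - a) = \<rho>(b - a).\<close>

lemma immediate_transcendental:
  assumes x: "x \<in> carrier R" and imm: "\<And>a. a \<in> fst ` G \<Longrightarrow> \<exists>b \<in> fst ` G. \<not> x \<ominus> b \<unlhd>\<^sub>1 x \<ominus> a"
  shows "\<exists>y \<in> carrier S. \<forall>(a, b) \<in> G. (\<rho>\<^sub>1 (x \<ominus> a), \<rho>\<^sub>2 (y \<ominus>\<^bsub>S\<^esub> b)) \<in> G"
proof -
  \<comment> \<open>A member ((a, a'), (c, c')) of \<open>H\<close> records that \<rho>(x - a) = c;
    the condition imposed on y is the corresponding equation \<rho>(y - a') = c'.\<close>
  define H where "H = {h \<in> G \<times> G. \<rho>\<^sub>1 (x \<ominus> fst (fst h)) = fst (snd h)}"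
  define \<phi> where "\<phi> h = (\<lambda>y. \<rho>\<^sub>2 (y \<ominus>\<^bsub>S\<^esub> snd (fst h)) = snd (snd h))" for h :: "('a \<times> 'b) \<times> ('a \<times> 'b)"
  have cl: "snd (fst h) \<in> carrier S" "snd (snd h) \<in> carrier S" "fst (fst h) \<in> carrier R" if "h \<in> H" for h
    using that G_carrier[OF iso, of "fst (fst h)" "snd (fst h)"] G_carrier[OF iso, of "fst (snd h)" "snd (snd h)"]
    by (auto simp: H_def)
  have "\<exists>y \<in> carrier S. \<forall>f \<in> \<phi> ` H. f y"
  proof (rule saturated)
    have "countable (G \<times> G)" by (rule countable_SIGMA) (use countable in auto)
    then have "countable H" by (rule countable_subset[rotated]) (auto simp: H_def)
    then show "countable (\<phi> ` H)" by simp
    show "\<phi> ` H \<subseteq> basic_conditions S le2 sec2"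
      using cl unfolding \<phi>_def basic_conditions_def by blast
    fix F assume "finite F" "F \<subseteq> \<phi> ` H"
    then obtain H0 where H0: "H0 \<subseteq> H" "finite H0" "F = \<phi> ` H0" by (meson finite_subset_image)
    have "(\<lambda>h. fst (fst h)) ` H0 \<subseteq> fst ` G" using H0(1) by (force simp: H_def)
    then obtain b where b: "b \<in> fst ` G" "\<forall>h \<in> H0. \<not> x \<ominus> b \<unlhd>\<^sub>1 x \<ominus> fst (fst h)"
      using closer[OF iso x imm, of "(\<lambda>h. fst (fst h)) ` H0"] H0(2) by auto
    obtain b' where bG: "(b, b') \<in> G" using b(1) by auto
    have "\<phi> h b'" if h: "h \<in> H0" for h
    proof -
      obtain a a' c c' where h': "h = ((a, a'), (c, c'))" by (metis surj_pair)
      then have hG: "(a, a') \<in> G" "(c, c') \<in> G" "\<rho>\<^sub>1 (x \<ominus> a) = c" using h H0(1) by (auto simp: H_def)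
      have "\<rho>\<^sub>1 (x \<ominus> a) = \<rho>\<^sub>1 (b \<ominus> a)"
        using sec_closer(1)[OF iso x, of a b] b(2) h h' G_carrier[OF iso] hG(1) bG by force
      then have "(c, \<rho>\<^sub>2 (b' \<ominus>\<^bsub>S\<^esub> a')) \<in> G" using G_ops(6,8)[OF iso] bG hG by metis
      then show ?thesis using G_fun[OF iso, of c "\<rho>\<^sub>2 (b' \<ominus>\<^bsub>S\<^esub> a')" c c'] hG(2) by (simp add: \<phi>_def h')
    qed
    then show "\<exists>y \<in> carrier S. \<forall>f \<in> F. f y" using G_carrier[OF iso bG] H0(3) by blast
  qed
  then obtain y where y: "y \<in> carrier S" "\<And>h. h \<in> H \<Longrightarrow> \<phi> h y" by auto
  have "(\<rho>\<^sub>1 (x \<ominus> a), \<rho>\<^sub>2 (y \<ominus>\<^bsub>S\<^esub> a')) \<in> G" if a: "(a, a') \<in> G" for a a'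
  proof -
    obtain b b' where b: "(b, b') \<in> G" "\<rho>\<^sub>1 (x \<ominus> a) = \<rho>\<^sub>1 (b \<ominus> a)" "(\<rho>\<^sub>1 (b \<ominus> a), \<rho>\<^sub>2 (b' \<ominus>\<^bsub>S\<^esub> a')) \<in> G"
      by (rule sec_in_range[OF iso x imm a])
    then have "((a, a'), (\<rho>\<^sub>1 (x \<ominus> a), \<rho>\<^sub>2 (b' \<ominus>\<^bsub>S\<^esub> a'))) \<in> H" using a by (simp add: H_def)
    from y(2)[OF this] show ?thesis using b by (simp add: \<phi>_def)
  qed
  then show ?thesis using y(1) by blast
qed

text \<open>The value of y has to lie strictly between those of the images of the nearest elements l
  and u on the two sides of r. A square root of l u has the mean of their values; if one side is
  missing, an element of positive value shifts the remaining bound.\<close>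

lemma between:
  assumes closed: "\<And>n. closed_upto G n" and r: "r \<in> carrier R" "r \<noteq> \<zero>"
    and A: "finite A" "A \<subseteq> G" and ne: "\<And>a. a \<in> A \<Longrightarrow> \<not> (fst a \<unlhd>\<^sub>1 r \<and> r \<unlhd>\<^sub>1 fst a)"
  shows "\<exists>y \<in> carrier S. \<forall>(a, b) \<in> A. (y \<unlhd>\<^sub>2 b \<longleftrightarrow> r \<unlhd>\<^sub>1 a) \<and> (b \<unlhd>\<^sub>2 y \<longleftrightarrow> a \<unlhd>\<^sub>1 r)"
proof -
  define L where "L = {a \<in> fst ` A. a \<unlhd>\<^sub>1 r}"
  \<comment> \<open>Including 0, of infinite value, makes \<open>U\<close> nonempty; if its least
    value is that of 0, there is no finite upper bound.\<close>
  define U where "U = insert \<zero> {a \<in> fst ` A. r \<unlhd>\<^sub>1 a}"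
  have LU: "finite L" "finite U" "L \<subseteq> fst ` G" "U \<subseteq> fst ` G" "L \<subseteq> carrier R" "U \<subseteq> carrier R"
    using A G_dom[OF iso] G_ops(1)[OF iso] by (force simp: L_def U_def)+
  have r_less: "\<not> r \<unlhd>\<^sub>1 a" if "a \<in> L" for a using that ne by (auto simp: L_def)
  have r_gr: "\<not> a \<unlhd>\<^sub>1 r" if "a \<in> U" for a using that ne r by (auto simp: U_def)
  obtain u where u: "u \<in> U" "\<And>a. a \<in> U \<Longrightarrow> u \<unlhd>\<^sub>1 a" 
    using R.val_min[OF LU(2) _ LU(6)] unfolding U_def by blast
  obtain u' where uG: "(u, u') \<in> G" using u(1) LU by auto
  have uc: "u \<in> carrier R" "u' \<in> carrier S" using G_carrier[OF iso uG] by auto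
  obtain c where c: "c \<in> carrier S" "c \<noteq> \<zero>\<^bsub>S\<^esub>" "\<not> c \<unlhd>\<^sub>2 \<one>\<^bsub>S\<^esub>" using nontrivial by blast
  have enough: ?thesis if y: "y \<in> carrier S" "\<not> u' \<unlhd>\<^sub>2 y" "\<And>a b. a \<in> L \<Longrightarrow> (a, b) \<in> G \<Longrightarrow> \<not> y \<unlhd>\<^sub>2 b" for y
  proof -
    have "(y \<unlhd>\<^sub>2 b \<longleftrightarrow> r \<unlhd>\<^sub>1 a) \<and> (b \<unlhd>\<^sub>2 y \<longleftrightarrow> a \<unlhd>\<^sub>1 r)" if ab: "(a, b) \<in> A" for a b
    proof -
      have G: "(a, b) \<in> G" using A ab by blast
      have cl: "a \<in> carrier R" "b \<in> carrier S" using G_carrier[OF iso G] by auto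
      consider "a \<in> L" "a \<unlhd>\<^sub>1 r" | "a \<in> U" "r \<unlhd>\<^sub>1 a"
        using R.val_total[OF r(1) cl(1)] ab by (force simp: L_def U_def)
      then show ?thesis
      proof cases
        case 1
        then show ?thesis using y(3)[OF 1(1) G] r_less[OF 1(1)] S.val_total[OF y(1) cl(2)] by auto
      next
        case 2
        have ub: "u' \<unlhd>\<^sub>2 b" using G_val[OF iso uG G] u(2)[OF 2(1)] by simp
        then have "\<not> b \<unlhd>\<^sub>2 y" using y(2) S.val_trans[of u' b y] uc cl y(1) by blast
        then show ?thesis using 2 r_gr S.val_total[OF y(1) cl(2)] by auto
      qed
    qed
    then show ?thesis using y(1) by blast
  qed
  show ?thesis
  proof (cases "L = {}")
    case True
    show ?thesis
    proof (cases "u' = \<zero>\<^bsub>S\<^esub>")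
      case u0: True
      show ?thesis by (rule enough[of "\<one>\<^bsub>S\<^esub>"]) (use u0 True in auto)
    next
      case False
      define y where "y = u' \<otimes>\<^bsub>S\<^esub> inv\<^bsub>S\<^esub> c"
      have y: "y \<in> carrier S" "y \<otimes>\<^bsub>S\<^esub> c = u'" using uc c S.inv_field by (auto simp: y_def S.m_assoc)
      then have y0: "y \<noteq> \<zero>\<^bsub>S\<^esub>" using False c by auto
      have "\<not> u' \<unlhd>\<^sub>2 y" using S.val_cancel_left[of c "\<one>\<^bsub>S\<^esub>" y] y y0 c by simp
      then show ?thesis using enough[of y] y True by simp
    qed
  next
    case False
    then obtain l where l: "l \<in> L" "\<And>a. a \<in> L \<Longrightarrow> a \<unlhd>\<^sub>1 l" using R.val_max[of L] LU by auto
    obtain l' where lG: "(l, l') \<in> G" using l(1) LU by auto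
    have lc: "l \<in> carrier R" "l' \<in> carrier S" using G_carrier[OF iso lG] by auto
    have l0: "l \<noteq> \<zero>" using r_less[OF l(1)] r by auto
    then have l'0: "l' \<noteq> \<zero>\<^bsub>S\<^esub>" using G_zero[OF iso lG] by simp
    have lower: "\<not> y \<unlhd>\<^sub>2 b" if y: "y \<in> carrier S" "\<not> y \<unlhd>\<^sub>2 l'" and a: "a \<in> L" "(a, b) \<in> G" for y a b
    proof -
      have "b \<unlhd>\<^sub>2 l'" using G_val[OF iso a(2) lG] l(2)[OF a(1)] by simp
      then show ?thesis using y S.val_trans[of y b l'] G_carrier[OF iso a(2)] lc by blast
    qed
    show ?thesis
    proof (cases "u = \<zero>")
      case True
      then have u'0: "u' = \<zero>\<^bsub>S\<^esub>" using G_zero[OF iso uG] by simp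
      define y where "y = l' \<otimes>\<^bsub>S\<^esub> c"
      have y: "y \<in> carrier S" "y \<noteq> \<zero>\<^bsub>S\<^esub>" using lc c l'0 S.integral[of l' c] by (auto simp: y_def)
      have yl: "\<not> y \<unlhd>\<^sub>2 l'" using S.val_cancel_left[of c "\<one>\<^bsub>S\<^esub>" l'] lc c l'0 by (simp add: y_def)
      show ?thesis by (rule enough[OF y(1) _ lower[OF y(1) yl]]) (use y u'0 in auto)
    next
      case u0: False
      then have u'0: "u' \<noteq> \<zero>\<^bsub>S\<^esub>" using G_zero[OF iso uG] by simp
      have ul: "\<not> u \<unlhd>\<^sub>1 l"
        using r_gr[OF u(1)] l(1) R.val_trans[of u l r] uc lc r by (auto simp: L_def)
      then have u'l': "\<not> u' \<unlhd>\<^sub>2 l'" using G_val[OF iso uG lG] by simp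
      have lu: "(l \<otimes> u, l' \<otimes>\<^bsub>S\<^esub> u') \<in> G" by (intro G_ops(4)[OF iso] lG uG)
      note p = binomial_list[OF iso lu G_ops(2)[OF iso], of 2]
      obtain t t' where t: "(t, t') \<in> G" "\<one>\<^bsub>S\<^esub> \<otimes>\<^bsub>S\<^esub> t' [^]\<^bsub>S\<^esub> (2::nat) \<ominus>\<^bsub>S\<^esub> l' \<otimes>\<^bsub>S\<^esub> u' = \<zero>\<^bsub>S\<^esub>"
        by (rule closed_root[OF iso closed[of 3] p(1)]) (use p(2,3,5) G_carrier[OF iso] in auto)
      have tc: "t' \<in> carrier S" using G_carrier[OF iso t(1)] by auto
      have tt: "t' \<otimes>\<^bsub>S\<^esub> t' = l' \<otimes>\<^bsub>S\<^esub> u'" using t(2) tc lc uc by (simp add: numeral_2_eq_2)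
      have ut: "\<not> u' \<unlhd>\<^sub>2 t'"
      proof
        assume *: "u' \<unlhd>\<^sub>2 t'"
        then have "u' \<otimes>\<^bsub>S\<^esub> u' \<unlhd>\<^sub>2 t' \<otimes>\<^bsub>S\<^esub> t'" using uc tc by (intro S.val_mult_mono) auto
        then show False using u'l' u'0 uc lc by (simp add: tt S.val_cancel)
      qed
      have tl: "\<not> t' \<unlhd>\<^sub>2 l'"
      proof
        assume *: "t' \<unlhd>\<^sub>2 l'"
        then have "t' \<otimes>\<^bsub>S\<^esub> t' \<unlhd>\<^sub>2 l' \<otimes>\<^bsub>S\<^esub> l'" using lc tc by (intro S.val_mult_mono) auto
        then show False using u'l' l'0 uc lc by (simp add: tt S.val_cancel_left)
      qed
      show ?thesis by (rule enough[OF tc ut lower[OF tc tl]])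
    qed
  qed
qed

text \<open>If v(r) is the value of some b in the domain, then \<rho>(b') times any representative
  of a nonzero residue has the right cut, and infinitely many residues allow it to avoid a finite
  set. Otherwise \<open>between\<close> gives the cut, and the \<rho>-image of its witness differs
  from the finitely many parameters already in value.\<close>

lemma sec_transcendental:
  assumes closed: "\<And>n. closed_upto G n" and r: "r \<in> carrier R" "\<rho>\<^sub>1 r = r" "r \<notin> fst ` G"
  shows "\<exists>s. s \<in> carrier S \<and> \<rho>\<^sub>2 s = s \<and> s \<notin> snd ` G \<and>
    (\<forall>(a, b) \<in> G. (r \<unlhd>\<^sub>1 a \<longleftrightarrow> s \<unlhd>\<^sub>2 b) \<and> (a \<unlhd>\<^sub>1 r \<longleftrightarrow> b \<unlhd>\<^sub>2 s))"
proof -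
  have r0: "r \<noteq> \<zero>" using r G_ops(1)[OF iso] by force
  define \<phi> where "\<phi> g = (\<lambda>y. \<rho>\<^sub>2 y = y \<and> y \<noteq> snd g \<and> (y \<unlhd>\<^sub>2 snd g \<longleftrightarrow> r \<unlhd>\<^sub>1 fst g) \<and> (snd g \<unlhd>\<^sub>2 y \<longleftrightarrow> fst g \<unlhd>\<^sub>1 r))"
    for g :: "'a \<times> 'b"
  have cl: "fst g \<in> carrier R" "snd g \<in> carrier S" if "g \<in> G" for g
    using that G_carrier[OF iso, of "fst g" "snd g"] by auto
  have "\<exists>y \<in> carrier S. \<forall>f \<in> \<phi> ` G. f y"
  proof (rule saturated)
    show "countable (\<phi> ` G)" using countable by simp
    show "\<phi> ` G \<subseteq> basic_conditions S le2 sec2"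
      using cl unfolding \<phi>_def basic_conditions_def by blast
    fix F assume "finite F" "F \<subseteq> \<phi> ` G"
    then obtain A where A: "A \<subseteq> G" "finite A" "F = \<phi> ` A" by (meson finite_subset_image)
    have "\<exists>y \<in> carrier S. \<forall>g \<in> A. \<phi> g y"
    proof (cases "\<exists>(b, b') \<in> G. b \<unlhd>\<^sub>1 r \<and> r \<unlhd>\<^sub>1 b")
      case True
      then obtain b b' where b: "(b, b') \<in> G" "R.veq r b" by (auto simp: R.veq_def)
      have bc: "b \<in> carrier R" "b' \<in> carrier S" using G_carrier[OF iso b(1)] by auto
      have "b \<noteq> \<zero>" using b(2) r0 r(1) by (auto simp: R.veq_def)
      then have b'0: "b' \<noteq> \<zero>\<^bsub>S\<^esub>" using G_zero[OF iso b(1)] by simp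
      let ?K = "{k \<in> carrier S. \<rho>\<^sub>2 k = k \<and> k \<unlhd>\<^sub>2 \<one>\<^bsub>S\<^esub> \<and> \<one>\<^bsub>S\<^esub> \<unlhd>\<^sub>2 k}"
      have "inj_on (\<lambda>k. \<rho>\<^sub>2 b' \<otimes>\<^bsub>S\<^esub> k) ?K"
        using bc b'0 by (auto intro!: inj_onI simp: S.m_lcancel)
      then have "infinite ((\<lambda>k. \<rho>\<^sub>2 b' \<otimes>\<^bsub>S\<^esub> k) ` ?K)" using residue_infinite by (simp add: finite_image_iff)
      then obtain y where y: "y \<in> (\<lambda>k. \<rho>\<^sub>2 b' \<otimes>\<^bsub>S\<^esub> k) ` ?K" "y \<notin> snd ` A"
        using A(2) by (meson finite_imageI finite_subset subsetI)
      then obtain k where k: "y = \<rho>\<^sub>2 b' \<otimes>\<^bsub>S\<^esub> k" "k \<in> carrier S" "\<rho>\<^sub>2 k = k" "S.veq k \<one>\<^bsub>S\<^esub>" by (auto simp: S.veq_def)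
      have yc: "y \<in> carrier S" "\<rho>\<^sub>2 y = y" using k bc by (auto simp: S.sec_mult)
      have "S.veq (\<rho>\<^sub>2 b' \<otimes>\<^bsub>S\<^esub> k) (b' \<otimes>\<^bsub>S\<^esub> \<one>\<^bsub>S\<^esub>)"
        using k bc by (intro S.veq_mult) (auto simp: S.veq_def)
      then have yb: "S.veq y b'" using k bc by simp
      have "\<phi> g y" if g: "g \<in> A" for g
      proof -
        obtain a a' where a: "g = (a, a')" by (cases g)
        then have aG: "(a, a') \<in> G" using g A by auto
        have ac: "a \<in> carrier R" "a' \<in> carrier S" using G_carrier[OF iso aG] by auto
        have "y \<noteq> a'" using y(2) g a by force
        then show ?thesis
          using G_val[OF iso aG b(1)] G_val[OF iso b(1) aG] S.veq_left[OF yb] S.veq_right[OF yb]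
            R.veq_left[OF b(2)] R.veq_right[OF b(2)] ac bc yc r by (simp add: \<phi>_def a)
      qed
      then show ?thesis using yc by blast
    next
      case False
      then have ne: "\<not> (fst a \<unlhd>\<^sub>1 r \<and> r \<unlhd>\<^sub>1 fst a)" if "a \<in> G" for a using that by force
      obtain y where y: "y \<in> carrier S" "\<forall>(a, b) \<in> A. (y \<unlhd>\<^sub>2 b \<longleftrightarrow> r \<unlhd>\<^sub>1 a) \<and> (b \<unlhd>\<^sub>2 y \<longleftrightarrow> a \<unlhd>\<^sub>1 r)"
        using between[OF closed r(1) r0 A(2,1)] ne A(1) by blast
      have "\<phi> g (\<rho>\<^sub>2 y)" if g: "g \<in> A" for g
      proof -
        have val: "y \<unlhd>\<^sub>2 snd g \<longleftrightarrow> r \<unlhd>\<^sub>1 fst g" "snd g \<unlhd>\<^sub>2 y \<longleftrightarrow> fst g \<unlhd>\<^sub>1 r" using y(2) g by auto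
        have gc: "snd g \<in> carrier S" using cl g A(1) by blast
        then have "\<rho>\<^sub>2 y \<noteq> snd g"
          using val ne[of g] g A(1) y(1) S.val_sec[of y "snd g"] by (metis S.val_refl subsetD)
        then show ?thesis using val gc y(1) by (simp add: \<phi>_def)
      qed
      then show ?thesis using y(1) S.sec_closed by blast
    qed
    then show "\<exists>y \<in> carrier S. \<forall>f \<in> F. f y" using A(3) by blast
  qed
  then obtain s where s: "s \<in> carrier S" "\<And>g. g \<in> G \<Longrightarrow> \<phi> g s" by auto
  have "\<rho>\<^sub>2 s = s" using s(2)[OF G_ops(1)[OF iso]] by (simp add: \<phi>_def)
  moreover have "s \<notin> snd ` G" using s(2) by (force simp: \<phi>_def)
  moreover have "(r \<unlhd>\<^sub>1 a \<longleftrightarrow> s \<unlhd>\<^sub>2 b) \<and> (a \<unlhd>\<^sub>1 r \<longleftrightarrow> b \<unlhd>\<^sub>2 s)" if "(a, b) \<in> G" for a b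
    using s(2)[OF that] by (simp add: \<phi>_def)
  ultimately show ?thesis using s(1) by blast
qed

lemma proper_extension:
  assumes inverse: "\<And>a b. (a, b) \<in> G \<Longrightarrow> a \<noteq> \<zero> \<Longrightarrow> (inv a, inv\<^bsub>S\<^esub> b) \<in> G"
    and ne: "fst ` G \<noteq> carrier R"
  shows "\<exists>G'. partial_iso G' \<and> G \<subset> G'"
proof -
  have dom: "fst ` G \<subseteq> carrier R" using G_dom[OF iso] by blast
  have strict: "\<exists>G'. partial_iso G' \<and> G \<subset> G'"
    if "x \<in> carrier R" "y \<in> carrier S" "x \<notin> fst ` G" "partial_iso (adjoin P G (x, y))" for x y
  proof -
    have "G \<subseteq> adjoin P G (x, y)" "(x, y) \<in> adjoin P G (x, y)" "(x, y) \<notin> G"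
      using P.adjoin_incl P.adjoin_mem G_subring[OF iso] that by force+
    then show ?thesis using that(4) by blast
  qed
  show ?thesis
  proof (cases "\<forall>n. closed_upto G n")
    case True
    obtain x where x: "x \<in> carrier R" "x \<notin> fst ` G" using ne dom by blast
    \<comment> \<open>Here every nonzero polynomial over the domain splits, so any representation of
      u will do.\<close>
    have lin: "\<exists>k. closed_upto G (Suc k) \<and> linprod P G (x, y) u k"
      if "u \<in> adjoin P G (x, y)" "x \<in> carrier R" "y \<in> carrier S" for u x y
    proof -
      obtain p where p: "set p \<subseteq> G" "u = peval P p (x, y)" using \<open>u \<in> adjoin P G (x, y)\<close> by (auto simp: adjoin_def)
      then show ?thesis using linprod_peval[OF iso _ p(1), of "Suc (length p)" "length p" "(x, y)"] True that by auto
    qed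
    show ?thesis
    proof (cases "\<forall>a \<in> fst ` G. \<exists>b \<in> fst ` G. \<not> x \<ominus> b \<unlhd>\<^sub>1 x \<ominus> a")
      case imm: True
      then obtain y where y: "y \<in> carrier S" "\<And>a b. (a, b) \<in> G \<Longrightarrow> (\<rho>\<^sub>1 (x \<ominus> a), \<rho>\<^sub>2 (y \<ominus>\<^bsub>S\<^esub> b)) \<in> G"
        using immediate_transcendental[OF x(1)] by blast
      show ?thesis
        by (rule strict[OF x(1) y(1) x(2)], rule adjoin_immediate[OF iso x(1) y(1) _ y(2)])
          (use lin x y in blast)+
    next
      case False
      then obtain a where a: "a \<in> fst ` G" "\<And>b. b \<in> fst ` G \<Longrightarrow> x \<ominus> b \<unlhd>\<^sub>1 x \<ominus> a" by blast
      have r: "\<rho>\<^sub>1 (x \<ominus> a) \<in> carrier R" "\<rho>\<^sub>1 (\<rho>\<^sub>1 (x \<ominus> a)) = \<rho>\<^sub>1 (x \<ominus> a)" "\<rho>\<^sub>1 (x \<ominus> a) \<notin> fst ` G"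
        using best_approximation[OF iso x a] x a dom by auto
      then obtain s where s: "s \<in> carrier S" "\<rho>\<^sub>2 s = s" "s \<notin> snd ` G"
        "\<And>a' b. (a', b) \<in> G \<Longrightarrow> (\<rho>\<^sub>1 (x \<ominus> a) \<unlhd>\<^sub>1 a' \<longleftrightarrow> s \<unlhd>\<^sub>2 b) \<and> (a' \<unlhd>\<^sub>1 \<rho>\<^sub>1 (x \<ominus> a) \<longleftrightarrow> b \<unlhd>\<^sub>2 s)"
        using sec_transcendental[of "\<rho>\<^sub>1 (x \<ominus> a)"] True by blast
      show ?thesis
        by (rule strict[OF r(1) s(1) r(3)], rule adjoin_sec[OF iso r s]) (use lin r s in blast)+
    qed
  next
    case False
    \<comment> \<open>\<open>N\<close> counts coefficients, so the least degree over the domain of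
      an element outside it is \<open>N\<close> - 1.\<close>
    define N where "N = (LEAST n. \<not> closed_upto G n)"
    have N: "\<not> closed_upto G N" unfolding N_def by (rule LeastI_ex) (use False in blast)
    have least: "closed_upto G n" if "n < N" for n using not_less_Least[of n] that unfolding N_def by blast
    obtain p x where p: "set p \<subseteq> G" "p \<noteq> []" "length p \<le> N" "fst (last p) \<noteq> \<zero>" "peval R (map fst p) x = \<zero>"
      and x: "x \<in> carrier R" "x \<notin> fst ` G" using N unfolding closed_upto_def by blast
    obtain n where n: "length p = Suc n" using p(2) by (cases p) auto
    have closed: "closed_upto G n" using least[of n] p(3) n by simp
    have npos: "n > 0"
    proof (rule ccontr)
      assume "\<not> n > 0"
      then obtain g where g: "p = [g]" using n by (cases p) auto
      moreover have "fst g \<in> carrier R" using G_carrier[OF iso, of "fst g" "snd g"] g p by auto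
      ultimately show False using p x by simp
    qed
    then obtain l where l: "n = Suc l" by (cases n) auto
    \<comment> \<open>The polynomial is made monic by an inverse in \<open>G\<close>. Every element
      of the adjoined ring is then given by n coefficients, that is, by degree less than n, where
      \<open>linprod_peval\<close> applies.\<close>
    have lin: "\<exists>k. closed_upto G (Suc k) \<and> linprod P G (x, y) u k"
      if q: "set q \<subseteq> G" "length q = Suc n" "fst (last q) \<noteq> \<zero>" "peval R (map fst q) x = \<zero>"
        "peval S (map snd q) y = \<zero>\<^bsub>S\<^esub>" and xy: "x \<in> carrier R" "y \<in> carrier S" and u: "u \<in> adjoin P G (x, y)"
      for q x y u
    proof -
      have qne: "q \<noteq> []" using q by auto
      define g where "g = last q"
      have gG: "(fst g, snd g) \<in> G" using q(1) qne by (auto simp: g_def)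
      then have gc: "fst g \<in> carrier R" "snd g \<in> carrier S" using G_carrier[OF iso gG] by auto
      have g0: "fst g \<noteq> \<zero>" "snd g \<noteq> \<zero>\<^bsub>S\<^esub>" using q(3) G_zero[OF iso gG] by (auto simp: g_def)
      define i where "i = (inv (fst g), inv\<^bsub>S\<^esub> (snd g))"
      have i: "i \<in> G" "i \<in> carrier P" "i \<otimes>\<^bsub>P\<^esub> g = \<one>\<^bsub>P\<^esub>"
        using inverse[OF gG g0(1)] gc g0 R.inv_field S.inv_field by (auto simp: i_def prod_eq_iff)
      define Q where "Q = map ((\<otimes>\<^bsub>P\<^esub>) i) (butlast q)"
      have "map ((\<otimes>\<^bsub>P\<^esub>) i) q = Q @ [\<one>\<^bsub>P\<^esub>]"
        using append_butlast_last_id[OF qne] i(3) unfolding Q_def g_def by (metis list.simps(8,9) map_append)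
      moreover have "peval P (map ((\<otimes>\<^bsub>P\<^esub>) i) q) (x, y) = i \<otimes>\<^bsub>P\<^esub> peval P q (x, y)"
        using P.peval_smult[OF G_list_carrier(3)[OF iso q(1)] _ i(2)] xy by simp
      moreover have "i \<otimes>\<^bsub>P\<^esub> peval P q (x, y) = \<zero>\<^bsub>P\<^esub>"
        using q(4,5) i(2) P.r_null[OF i(2)] by (simp add: prod_peval)
      ultimately have root: "peval P (Q @ [\<one>\<^bsub>P\<^esub>]) (x, y) = \<zero>\<^bsub>P\<^esub>" by simp
      have Q: "set Q \<subseteq> G" "length Q = n"
        using q(1,2) i(1) by (auto simp: Q_def dest!: in_set_butlastD intro!: subringE(6)[OF G_subring[OF iso]])
      obtain w where w: "set w \<subseteq> G" "length w = n" "peval P w (x, y) = u"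
        using P.adjoin_algebraic[OF G_subring[OF iso] _ Q(1) _ root u] Q(2) npos xy by auto
      then show ?thesis
        using linprod_peval[OF iso closed w(1), of l "(x, y)"] xy l closed
        by (metis Suc_le_mono closed_upto_mono[OF iso] order_refl mem_Times_iff fst_conv snd_conv prod_simps(1))
    qed
    show ?thesis
    proof (cases "\<forall>a \<in> fst ` G. \<exists>b \<in> fst ` G. \<not> x \<ominus> b \<unlhd>\<^sub>1 x \<ominus> a")
      case imm: True
      then obtain y where y: "y \<in> carrier S" "peval S (map snd p) y = \<zero>\<^bsub>S\<^esub>"
        "\<And>a b. (a, b) \<in> G \<Longrightarrow> (\<rho>\<^sub>1 (x \<ominus> a), \<rho>\<^sub>2 (y \<ominus>\<^bsub>S\<^esub> b)) \<in> G"
        using immediate_algebraic[OF iso x(1) _ p(1) _ p(4,5)] n npos by force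
      show ?thesis
        by (rule strict[OF x(1) y(1) x(2)], rule adjoin_immediate[OF iso x(1) y(1) _ y(3)])
          (use lin[OF p(1) n p(4,5) y(2) x(1) y(1)] in blast)+
    next
      case False
      then obtain a where a: "a \<in> fst ` G" "\<And>b. b \<in> fst ` G \<Longrightarrow> x \<ominus> b \<unlhd>\<^sub>1 x \<ominus> a" by blast
      obtain a' where aG: "(a, a') \<in> G" using a(1) by auto
      have ac: "a \<in> carrier R" "a' \<in> carrier S" using G_carrier[OF iso aG] by auto
      have r: "\<rho>\<^sub>1 (x \<ominus> a) \<in> carrier R" "\<rho>\<^sub>1 (\<rho>\<^sub>1 (x \<ominus> a)) = \<rho>\<^sub>1 (x \<ominus> a)" "\<rho>\<^sub>1 (x \<ominus> a) \<notin> fst ` G"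
        using best_approximation[OF iso x a] x ac by auto
      \<comment> \<open>The shift has the root x - a, so its initial form at x - a has the root r =
        \<rho>(x - a).\<close>
      obtain p' where p': "set p' \<subseteq> G" "length p' = length p" "p \<noteq> [] \<Longrightarrow> last p' = last p"
        and pe: "\<And>z. z \<in> carrier P \<Longrightarrow> peval P p' z = peval P p (z \<oplus>\<^bsub>P\<^esub> (a, a'))"
        by (rule P.peval_shift[OF G_subring[OF iso] aG p(1)]) blast
      have "(x \<ominus> a) \<oplus> a = x" using x ac by algebra
      then have root: "peval R (map fst p') (x \<ominus> a) = \<zero>"
        using pe[of "(x \<ominus> a, \<zero>\<^bsub>S\<^esub>)"] p(5) x ac by (simp add: prod_peval)
      have p2: "length p' = Suc n" "fst (last p') \<noteq> \<zero>" using p' p n by auto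
      obtain q s where q: "set q \<subseteq> G" "length q = Suc n" "fst (last q) \<noteq> \<zero>" "peval R (map fst q) (\<rho>\<^sub>1 (x \<ominus> a)) = \<zero>"
        "peval S (map snd q) s = \<zero>\<^bsub>S\<^esub>" and s': "s \<in> carrier S" "\<rho>\<^sub>2 s = s" "s \<notin> snd ` G"
        "\<forall>(a', b) \<in> G. (\<rho>\<^sub>1 (x \<ominus> a) \<unlhd>\<^sub>1 a' \<longleftrightarrow> s \<unlhd>\<^sub>2 b) \<and> (a' \<unlhd>\<^sub>1 \<rho>\<^sub>1 (x \<ominus> a) \<longleftrightarrow> b \<unlhd>\<^sub>2 s)"
        using sec_algebraic[OF iso p'(1) p2 root R.minus_closed[OF x(1) ac(1)] r(3) closed] by blast
      have s: "s \<in> carrier S" "\<rho>\<^sub>2 s = s" "s \<notin> snd ` G"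
        "\<And>a' b. (a', b) \<in> G \<Longrightarrow> (\<rho>\<^sub>1 (x \<ominus> a) \<unlhd>\<^sub>1 a' \<longleftrightarrow> s \<unlhd>\<^sub>2 b) \<and> (a' \<unlhd>\<^sub>1 \<rho>\<^sub>1 (x \<ominus> a) \<longleftrightarrow> b \<unlhd>\<^sub>2 s)"
        using s' by auto
      show ?thesis
        by (rule strict[OF r(1) s(1) r(3)], rule adjoin_sec[OF iso r s])
          (use lin[OF q r(1) s(1)] in blast)+
    qed
  qed
qed

end

section \<open>Maximal partial isomorphisms\<close>

lemma partial_iso_Union:
  assumes "\<C> \<noteq> {}" "\<And>G. G \<in> \<C> \<Longrightarrow> partial_iso G" "\<And>G H. G \<in> \<C> \<Longrightarrow> H \<in> \<C> \<Longrightarrow> G \<subseteq> H \<or> H \<subseteq> G"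
  shows "partial_iso (\<Union>\<C>)"
proof -
  note sub = assms(2)[unfolded partial_iso_def, THEN conjunct1]
  have common: "\<exists>H \<in> \<C>. g \<in> H \<and> h \<in> H" if "g \<in> \<Union>\<C>" "h \<in> \<Union>\<C>" for g h
    using that assms(3) by blast
  show ?thesis
    unfolding partial_iso_def
  proof (intro conjI)
    show "subring (\<Union>\<C>) P"
    proof (rule P.subringI)
      show "\<Union>\<C> \<subseteq> carrier P" using subringE(1)[OF sub] by blast
      show "\<one>\<^bsub>P\<^esub> \<in> \<Union>\<C>" using subringE(3)[OF sub] assms(1) by blast
      show "\<ominus>\<^bsub>P\<^esub> g \<in> \<Union>\<C>" if "g \<in> \<Union>\<C>" for g using subringE(5)[OF sub] that by blast
      show "g \<otimes>\<^bsub>P\<^esub> h \<in> \<Union>\<C>" if gh: "g \<in> \<Union>\<C>" "h \<in> \<Union>\<C>" for g h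
        using common[OF gh] subringE(6)[OF sub] by blast
      show "g \<oplus>\<^bsub>P\<^esub> h \<in> \<Union>\<C>" if gh: "g \<in> \<Union>\<C>" "h \<in> \<Union>\<C>" for g h
        using common[OF gh] subringE(7)[OF sub] by blast
    qed
    show "\<forall>(a, b) \<in> \<Union>\<C>. (\<rho>\<^sub>1 a, \<rho>\<^sub>2 b) \<in> \<Union>\<C>" using G_ops(8)[OF assms(2)] by blast
    show "\<forall>(a, b) \<in> \<Union>\<C>. \<forall>(c, d) \<in> \<Union>\<C>. a \<unlhd>\<^sub>1 c \<longleftrightarrow> b \<unlhd>\<^sub>2 d"
    proof clarify
      fix a b c d H H' assume "(a, b) \<in> H" "H \<in> \<C>" "(c, d) \<in> H'" "H' \<in> \<C>"
      then obtain H'' where "H'' \<in> \<C>" "(a, b) \<in> H''" "(c, d) \<in> H''" using common by blast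
      then show "a \<unlhd>\<^sub>1 c \<longleftrightarrow> b \<unlhd>\<^sub>2 d" using G_val[OF assms(2)] by blast
    qed
  qed
qed

text \<open>A partial isomorphism is the graph of a function on its domain. Countability of R thus
  keeps even the maximal ones provided by Zorn's lemma within reach of saturation.\<close>

lemma partial_iso_countable:
  assumes "countable (carrier R)" "partial_iso G"
  shows "countable G"
proof -
  have "inj_on fst G" using G_fun[OF assms(2)] by (auto simp: inj_on_def)
  moreover have "countable (fst ` G)"
    using G_dom[OF assms(2)] by (intro countable_subset[OF _ assms(1)]) blast
  ultimately show ?thesis using countable_image_inj_on by blast
qed

theorem embedding:
  assumes countable: "countable (carrier R)" and iso: "partial_iso G"
  shows "\<exists>G'. partial_iso G' \<and> G \<subseteq> G' \<and> fst ` G' = carrier R"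
proof -
  define Z where "Z = {H. partial_iso H \<and> G \<subseteq> H}"
  have "\<exists>M\<in>Z. \<forall>Y\<in>Z. M \<subseteq> Y \<longrightarrow> Y = M"
  proof (rule subset_Zorn_nonempty)
    show "Z \<noteq> {}" using iso by (auto simp: Z_def)
    fix \<C> assume c: "\<C> \<noteq> {}" "subset.chain Z \<C>"
    then have "partial_iso (\<Union>\<C>)"
      by (intro partial_iso_Union) (auto simp: subset_chain_def Z_def)
    moreover have "G \<subseteq> \<Union>\<C>" using c unfolding subset_chain_def Z_def by blast
    ultimately show "\<Union>\<C> \<in> Z" by (simp add: Z_def)
  qed
  then obtain M where M: "partial_iso M" "G \<subseteq> M" "\<And>Y. partial_iso Y \<Longrightarrow> M \<subseteq> Y \<Longrightarrow> Y = M"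
    unfolding Z_def by (metis (mono_tags, lifting) mem_Collect_eq order_trans)
  have fr: "fractions M = M" using M(3)[OF fractions_iso[OF M(1)] fractions_incl[OF M(1)]] .
  have "fst ` M = carrier R"
  proof (rule ccontr)
    assume ne: "fst ` M \<noteq> carrier R"
    have "\<exists>G'. partial_iso G' \<and> M \<subset> G'"
      by (rule proper_extension[OF M(1) partial_iso_countable[OF countable M(1)] _ ne])
        (use fractions_inverse[OF M(1)] fr in auto)
    then show False using M(3) by blast
  qed
  then show ?thesis using M by blast
qed

end

section \<open>Ultraproducts\<close>

text \<open>Filters are ordered so that smaller ones contain more sets; a minimal proper filter
  below \<open>sequentially\<close> is therefore a free ultrafilter.\<close>

lemma free_ultrafilter_exists:
  "\<exists>U :: nat filter. U \<le> sequentially \<and> U \<noteq> bot \<and> (\<forall>P. eventually P U \<or> eventually (\<lambda>i. \<not> P i) U)"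
proof -
  define A where "A = {F :: nat filter. F \<le> sequentially \<and> F \<noteq> bot}"
  have "\<exists>m\<in>A. \<forall>a\<in>A. m \<ge> a \<longrightarrow> a = m"
  proof (rule predicate_Zorn)
    show "partial_order_on A (relation_of (\<ge>) A)"
      by (auto simp: partial_order_on_def preorder_on_def refl_on_def relation_of_def trans_def antisym_def)
    fix C assume "C \<in> Chains (relation_of (\<ge>) A)"
    then have C: "C \<subseteq> A" "\<And>F G. F \<in> C \<Longrightarrow> G \<in> C \<Longrightarrow> F \<le> G \<or> G \<le> F"
      by (auto simp: Chains_def relation_of_def)
    show "\<exists>u\<in>A. \<forall>a\<in>C. a \<ge> u"
    proof (cases "C = {}")
      case True
      then show ?thesis by (auto simp: A_def intro!: exI[of _ sequentially])
    next
      case False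
      have "eventually (\<lambda>_. False) (Inf C) \<longleftrightarrow> (\<exists>b\<in>C. eventually (\<lambda>_. False) b)"
        by (rule eventually_Inf_base[OF False]) (use C(2) in force)
      then have "Inf C \<noteq> bot" using C(1) by (auto simp: A_def trivial_limit_def)
      moreover have "Inf C \<le> sequentially" using False C(1) by (force simp: A_def intro: Inf_lower2)
      ultimately show ?thesis by (auto simp: A_def intro: Inf_lower)
    qed
  qed
  then obtain U where U: "U \<in> A" "\<And>F. F \<in> A \<Longrightarrow> F \<le> U \<Longrightarrow> F = U" by auto
  have "eventually P U \<or> eventually (\<lambda>i. \<not> P i) U" for P
  proof (rule disjCI)
    assume n: "\<not> eventually (\<lambda>i. \<not> P i) U"
    \<comment> \<open>As the complement of P is not in \<open>U\<close>, adjoining P keeps the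
      filter proper; minimality then puts P into \<open>U\<close>.\<close>
    let ?F = "inf U (principal {i. P i})"
    have "?F \<noteq> bot" using n by (simp add: trivial_limit_def eventually_inf_principal)
    moreover have "?F \<le> sequentially" using U(1) by (auto simp: A_def intro: le_infI1)
    ultimately have "?F = U" using U(2)[of ?F] by (simp add: A_def)
    moreover have "eventually P ?F" by (simp add: eventually_inf_principal)
    ultimately show "eventually P U" by simp
  qed
  then show ?thesis using U(1) by (auto simp: A_def)
qed

text \<open>The elements of an ultraproduct are chosen representatives instead of classes, so that it is a
  structure on functions with pointwise operations.\<close>

definition rep :: "'i filter \<Rightarrow> ('i \<Rightarrow> 'a) \<Rightarrow> 'i \<Rightarrow> 'a" where
  "rep U f = (SOME g. eventually (\<lambda>i. g i = f i) U)"

lemma eventually_rep: "eventually (\<lambda>i. rep U f i = f i) U"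
  unfolding rep_def by (rule someI[of _ f]) simp

lemma rep_eq_iff: "rep U f = rep U g \<longleftrightarrow> eventually (\<lambda>i. f i = g i) U"
proof
  assume *: "rep U f = rep U g"
  show "eventually (\<lambda>i. f i = g i) U"
    using eventually_rep[of U f] eventually_rep[of U g] unfolding * by eventually_elim simp
next
  assume *: "eventually (\<lambda>i. f i = g i) U"
  have "eventually (\<lambda>i. h i = f i) U \<longleftrightarrow> eventually (\<lambda>i. h i = g i) U" for h
    by (rule eventually_subst) (use * in eventually_elim, simp)
  then show "rep U f = rep U g" unfolding rep_def by simp
qed

definition ultraproduct :: "'i filter \<Rightarrow> ('i \<Rightarrow> ('v, 'r) struct) \<Rightarrow> ('i \<Rightarrow> 'v, 'i \<Rightarrow> 'r) struct" where
  "ultraproduct U M =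
     \<lparr>VF = rep U ` {f. \<forall>i. f i \<in> VF (M i)}, v_zero = rep U (\<lambda>i. v_zero (M i)), v_one = rep U (\<lambda>i. v_one (M i)),
      v_add = (\<lambda>x y. rep U (\<lambda>i. v_add (M i) (x i) (y i))), v_neg = (\<lambda>x. rep U (\<lambda>i. v_neg (M i) (x i))),
      v_mul = (\<lambda>x y. rep U (\<lambda>i. v_mul (M i) (x i) (y i))),
      RV0 = rep U ` {f. \<forall>i. f i \<in> RV0 (M i)}, r_zero = rep U (\<lambda>i. r_zero (M i)),
      r_one = rep U (\<lambda>i. r_one (M i)), r_inf = rep U (\<lambda>i. r_inf (M i)),
      r_add = (\<lambda>x y. rep U (\<lambda>i. r_add (M i) (x i) (y i))), r_neg = (\<lambda>x. rep U (\<lambda>i. r_neg (M i) (x i))),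
      r_mul = (\<lambda>x y. rep U (\<lambda>i. r_mul (M i) (x i) (y i))),
      r_Kx = (\<lambda>x. eventually (\<lambda>i. r_Kx (M i) (x i)) U),
      r_le = (\<lambda>x y. eventually (\<lambda>i. r_le (M i) (x i) (y i)) U),
      s_rv = (\<lambda>x. rep U (\<lambda>i. s_rv (M i) (x i))), s_sn = (\<lambda>x. rep U (\<lambda>i. s_sn (M i) (x i)))\<rparr>"

lemma rep_lift1: "rep U (\<lambda>i. h i (rep U f i)) = rep U (\<lambda>i. h i (f i))"
  unfolding rep_eq_iff using eventually_rep[of U f] by eventually_elim simp

lemma rep_lift2: "rep U (\<lambda>i. h i (rep U f i) (rep U g i)) = rep U (\<lambda>i. h i (f i) (g i))"
  unfolding rep_eq_iff using eventually_rep[of U f] eventually_rep[of U g] by eventually_elim simp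

lemma rep_pred1: "eventually (\<lambda>i. h i (rep U f i)) U \<longleftrightarrow> eventually (\<lambda>i. h i (f i)) U"
  by (rule eventually_subst) (use eventually_rep[of U f] in eventually_elim, simp)

lemma rep_pred2: "eventually (\<lambda>i. h i (rep U f i) (rep U g i)) U \<longleftrightarrow> eventually (\<lambda>i. h i (f i) (g i)) U"
  by (rule eventually_subst) (use eventually_rep[of U f] eventually_rep[of U g] in eventually_elim, simp)

lemma ultraproduct_ops [simp]:
  "VF (ultraproduct U M) = rep U ` {f. \<forall>i. f i \<in> VF (M i)}"
  "RV0 (ultraproduct U M) = rep U ` {f. \<forall>i. f i \<in> RV0 (M i)}"
  "v_zero (ultraproduct U M) = rep U (\<lambda>i. v_zero (M i))"
  "v_one (ultraproduct U M) = rep U (\<lambda>i. v_one (M i))"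
  "v_add (ultraproduct U M) (rep U x) (rep U y) = rep U (\<lambda>i. v_add (M i) (x i) (y i))"
  "v_neg (ultraproduct U M) (rep U x) = rep U (\<lambda>i. v_neg (M i) (x i))"
  "v_mul (ultraproduct U M) (rep U x) (rep U y) = rep U (\<lambda>i. v_mul (M i) (x i) (y i))"
  "r_zero (ultraproduct U M) = rep U (\<lambda>i. r_zero (M i))"
  "r_one (ultraproduct U M) = rep U (\<lambda>i. r_one (M i))"
  "r_inf (ultraproduct U M) = rep U (\<lambda>i. r_inf (M i))"
  "r_add (ultraproduct U M) (rep U s) (rep U t) = rep U (\<lambda>i. r_add (M i) (s i) (t i))"
  "r_neg (ultraproduct U M) (rep U s) = rep U (\<lambda>i. r_neg (M i) (s i))"
  "r_mul (ultraproduct U M) (rep U s) (rep U t) = rep U (\<lambda>i. r_mul (M i) (s i) (t i))"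
  "r_Kx (ultraproduct U M) (rep U s) \<longleftrightarrow> eventually (\<lambda>i. r_Kx (M i) (s i)) U"
  "r_le (ultraproduct U M) (rep U s) (rep U t) \<longleftrightarrow> eventually (\<lambda>i. r_le (M i) (s i) (t i)) U"
  "s_rv (ultraproduct U M) (rep U x) = rep U (\<lambda>i. s_rv (M i) (x i))"
  "s_sn (ultraproduct U M) (rep U s) = rep U (\<lambda>i. s_sn (M i) (s i))"
  unfolding ultraproduct_def struct.simps by (rule refl rep_lift1 rep_lift2 rep_pred1 rep_pred2)+

lemma ultraproduct_eval:
  "veval (ultraproduct U M) (\<lambda>j. rep U (E j)) (\<lambda>j. rep U (F j)) t = rep U (\<lambda>i. veval (M i) (\<lambda>j. E j i) (\<lambda>j. F j i) t)"
  "reval (ultraproduct U M) (\<lambda>j. rep U (E j)) (\<lambda>j. rep U (F j)) u = rep U (\<lambda>i. reval (M i) (\<lambda>j. E j i) (\<lambda>j. F j i) u)"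
  by (induction t and u) simp_all

lemma rep_fun_upd: "(\<lambda>j. rep U (E j))(n := rep U g) = (\<lambda>j. rep U ((E(n := g)) j))"
  by auto

lemma fun_upd_at: "(\<lambda>j. (E(n := g)) j i) = (\<lambda>j. E j i)(n := g i)"
  by auto

theorem los:
  assumes U: "U \<noteq> bot" "\<And>P. eventually P U \<or> eventually (\<lambda>i. \<not> P i) U"
    and M: "\<And>i. is_structure (M i)"
    and "\<And>i j. E j i \<in> VF (M i)" "\<And>i j. F j i \<in> RV0 (M i)"
  shows "sat (ultraproduct U M) (\<lambda>j. rep U (E j)) (\<lambda>j. rep U (F j)) \<phi> \<longleftrightarrow>
    eventually (\<lambda>i. sat (M i) (\<lambda>j. E j i) (\<lambda>j. F j i) \<phi>) U"
  using assms(4,5)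
proof (induction \<phi> arbitrary: E F)
  case (InKx t)
  show ?case
    by (simp add: ultraproduct_eval)
next
  case (RLe s t)
  show ?case
    by (simp add: ultraproduct_eval)
next
  case (FNot \<phi>)
  have "\<not> eventually P U \<longleftrightarrow> eventually (\<lambda>i. \<not> P i) U" for P
  proof
    assume n: "eventually (\<lambda>i. \<not> P i) U"
    show "\<not> eventually P U"
    proof
      assume "eventually P U"
      with n have "eventually (\<lambda>i. False) U" by eventually_elim simp
      then show False using U(1) by (simp add: trivial_limit_def)
    qed
  qed (use U(2) in blast)
  then show ?case using FNot by simp
next
  case (VEx n \<phi>)
  have IH: "sat (ultraproduct U M) ((\<lambda>j. rep U (E j))(n := rep U g)) (\<lambda>j. rep U (F j)) \<phi> \<longleftrightarrow>
      eventually (\<lambda>i. sat (M i) ((\<lambda>j. E j i)(n := g i)) (\<lambda>j. F j i) \<phi>) U" if "\<And>i. g i \<in> VF (M i)" for g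
    unfolding rep_fun_upd fun_upd_at[symmetric] by (rule VEx.IH) (use VEx.prems that in auto)
  show ?case
  proof
    assume "sat (ultraproduct U M) (\<lambda>j. rep U (E j)) (\<lambda>j. rep U (F j)) (VEx n \<phi>)"
    then obtain g where g: "\<And>i. g i \<in> VF (M i)"
      "sat (ultraproduct U M) ((\<lambda>j. rep U (E j))(n := rep U g)) (\<lambda>j. rep U (F j)) \<phi>"
      by auto
    then have "eventually (\<lambda>i. sat (M i) ((\<lambda>j. E j i)(n := g i)) (\<lambda>j. F j i) \<phi>) U" using IH by blast
    then show "eventually (\<lambda>i. sat (M i) (\<lambda>j. E j i) (\<lambda>j. F j i) (VEx n \<phi>)) U"
      by eventually_elim (use g(1) in auto)
  next
    assume ev: "eventually (\<lambda>i. sat (M i) (\<lambda>j. E j i) (\<lambda>j. F j i) (VEx n \<phi>)) U"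
    \<comment> \<open>At indices without a witness an arbitrary element of the carrier is taken, so
      that the choice function lies in the product.\<close>
    have "\<exists>a. a \<in> VF (M i) \<and> (sat (M i) (\<lambda>j. E j i) (\<lambda>j. F j i) (VEx n \<phi>) \<longrightarrow>
        sat (M i) ((\<lambda>j. E j i)(n := a)) (\<lambda>j. F j i) \<phi>)" for i
    proof (cases "sat (M i) (\<lambda>j. E j i) (\<lambda>j. F j i) (VEx n \<phi>)")
      case True
      then show ?thesis by auto
    next
      case False
      then show ?thesis using M[of i] unfolding is_structure_def by blast
    qed
    then obtain g where g: "\<And>i. g i \<in> VF (M i)"
      "\<And>i. sat (M i) (\<lambda>j. E j i) (\<lambda>j. F j i) (VEx n \<phi>) \<Longrightarrow> sat (M i) ((\<lambda>j. E j i)(n := g i)) (\<lambda>j. F j i) \<phi>"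
      by metis
    have "eventually (\<lambda>i. sat (M i) ((\<lambda>j. E j i)(n := g i)) (\<lambda>j. F j i) \<phi>) U"
      using ev by eventually_elim (rule g(2))
    then have "sat (ultraproduct U M) ((\<lambda>j. rep U (E j))(n := rep U g)) (\<lambda>j. rep U (F j)) \<phi>" using IH g(1) by blast
    moreover have "rep U g \<in> VF (ultraproduct U M)" using g(1) by auto
    ultimately show "sat (ultraproduct U M) (\<lambda>j. rep U (E j)) (\<lambda>j. rep U (F j)) (VEx n \<phi>)" by auto
  qed
next
  case (REx n \<phi>)
  have IH: "sat (ultraproduct U M) (\<lambda>j. rep U (E j)) ((\<lambda>j. rep U (F j))(n := rep U g)) \<phi> \<longleftrightarrow>
      eventually (\<lambda>i. sat (M i) (\<lambda>j. E j i) ((\<lambda>j. F j i)(n := g i)) \<phi>) U" if "\<And>i. g i \<in> RV0 (M i)" for g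
    unfolding rep_fun_upd fun_upd_at[symmetric] by (rule REx.IH) (use REx.prems that in auto)
  show ?case
  proof
    assume "sat (ultraproduct U M) (\<lambda>j. rep U (E j)) (\<lambda>j. rep U (F j)) (REx n \<phi>)"
    then obtain g where g: "\<And>i. g i \<in> RV0 (M i)"
      "sat (ultraproduct U M) (\<lambda>j. rep U (E j)) ((\<lambda>j. rep U (F j))(n := rep U g)) \<phi>"
      by auto
    then have "eventually (\<lambda>i. sat (M i) (\<lambda>j. E j i) ((\<lambda>j. F j i)(n := g i)) \<phi>) U" using IH by blast
    then show "eventually (\<lambda>i. sat (M i) (\<lambda>j. E j i) (\<lambda>j. F j i) (REx n \<phi>)) U"
      by eventually_elim (use g(1) in auto)
  next
    assume ev: "eventually (\<lambda>i. sat (M i) (\<lambda>j. E j i) (\<lambda>j. F j i) (REx n \<phi>)) U"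
    have "\<exists>a. a \<in> RV0 (M i) \<and> (sat (M i) (\<lambda>j. E j i) (\<lambda>j. F j i) (REx n \<phi>) \<longrightarrow>
        sat (M i) (\<lambda>j. E j i) ((\<lambda>j. F j i)(n := a)) \<phi>)" for i
    proof (cases "sat (M i) (\<lambda>j. E j i) (\<lambda>j. F j i) (REx n \<phi>)")
      case True
      then show ?thesis by auto
    next
      case False
      then show ?thesis using M[of i] unfolding is_structure_def by blast
    qed
    then obtain g where g: "\<And>i. g i \<in> RV0 (M i)"
      "\<And>i. sat (M i) (\<lambda>j. E j i) (\<lambda>j. F j i) (REx n \<phi>) \<Longrightarrow> sat (M i) (\<lambda>j. E j i) ((\<lambda>j. F j i)(n := g i)) \<phi>"
      by metis
    have "eventually (\<lambda>i. sat (M i) (\<lambda>j. E j i) ((\<lambda>j. F j i)(n := g i)) \<phi>) U"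
      using ev by eventually_elim (rule g(2))
    then have "sat (ultraproduct U M) (\<lambda>j. rep U (E j)) ((\<lambda>j. rep U (F j))(n := rep U g)) \<phi>" using IH g(1) by blast
    moreover have "rep U g \<in> RV0 (ultraproduct U M)" using g(1) by auto
    ultimately show "sat (ultraproduct U M) (\<lambda>j. rep U (E j)) (\<lambda>j. rep U (F j)) (REx n \<phi>)" by auto
  qed
qed (simp_all only: sat.simps ultraproduct_eval rep_eq_iff eventually_conj_iff)

lemma ultraproduct_structure:
  assumes M: "\<And>i. is_structure (M i)"
  shows "is_structure (ultraproduct U M)"
proof -
  have V: "rep U (\<lambda>i. h i) \<in> rep U ` {f. \<forall>i. f i \<in> VF (M i)}" if "\<And>i. h i \<in> VF (M i)" for h
    using that by blast
  have R: "rep U (\<lambda>i. h i) \<in> rep U ` {f. \<forall>i. f i \<in> RV0 (M i)}" if "\<And>i. h i \<in> RV0 (M i)" for h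
    using that by blast
  note m = M[unfolded is_structure_def]
  show ?thesis
    unfolding is_structure_def by (auto intro!: V R) (use m in blast)+
qed

lemma assignment_rep:
  fixes e f :: "nat \<Rightarrow> _"
  assumes "range e \<subseteq> VF (ultraproduct U M)" "range f \<subseteq> RV0 (ultraproduct U M)"
  obtains E F where "\<And>i j. E j i \<in> VF (M i)" "\<And>i j. F j i \<in> RV0 (M i)" "e = (\<lambda>j. rep U (E j))" "f = (\<lambda>j. rep U (F j))"
proof -
  have "e j \<in> rep U ` {g. \<forall>i. g i \<in> VF (M i)}" "f j \<in> rep U ` {g. \<forall>i. g i \<in> RV0 (M i)}" for j
    using assms unfolding ultraproduct_ops by blast+
  then have "\<forall>j. \<exists>g. (\<forall>i. g i \<in> VF (M i)) \<and> e j = rep U g" "\<forall>j. \<exists>g. (\<forall>i. g i \<in> RV0 (M i)) \<and> f j = rep U g"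
    by blast+
  then obtain E F where "\<And>j. (\<forall>i. E j i \<in> VF (M i)) \<and> e j = rep U (E j)" "\<And>j. (\<forall>i. F j i \<in> RV0 (M i)) \<and> f j = rep U (F j)"
    by metis
  then show thesis by (intro that[of E F]) auto
qed

lemma ultraproduct_model:
  assumes U: "U \<noteq> bot" "\<And>P. eventually P U \<or> eventually (\<lambda>i. \<not> P i) U" and M: "\<And>i. is_model (M i) T"
  shows "is_model (ultraproduct U M) T"
  unfolding is_model_def
proof (intro conjI ballI)
  have str: "is_structure (M i)" for i using M by (simp add: is_model_def)
  then show "is_structure (ultraproduct U M)" by (rule ultraproduct_structure)
  fix \<sigma> assume \<sigma>: "\<sigma> \<in> T"
  show "holds (ultraproduct U M) \<sigma>"
    unfolding holds_def
  proof (intro allI impI)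
    fix e f :: "nat \<Rightarrow> _" assume "range e \<subseteq> VF (ultraproduct U M)" "range f \<subseteq> RV0 (ultraproduct U M)"
    then obtain E F where EF: "\<And>i j. E j i \<in> VF (M i)" "\<And>i j. F j i \<in> RV0 (M i)"
      "e = (\<lambda>j. rep U (E j))" "f = (\<lambda>j. rep U (F j))" by (rule assignment_rep) blast
    have "sat (M i) (\<lambda>j. E j i) (\<lambda>j. F j i) \<sigma>" for i
    proof -
      have "range (\<lambda>j. E j i) \<subseteq> VF (M i)" "range (\<lambda>j. F j i) \<subseteq> RV0 (M i)" using EF(1,2) by auto
      then show ?thesis using M[of i] \<sigma> unfolding is_model_def holds_def by blast
    qed
    then show "sat (ultraproduct U M) e f \<sigma>" unfolding EF(3,4) los[OF U str EF(1,2)] by simp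
  qed
qed

text \<open>Variable 0 is to realise the type, while the assignment of the remaining variables
  supplies countably many parameters. Only types of VF-elements are considered, as RV is reached
  through \<open>sn\<close>.\<close>

definition saturated_struct :: "('v, 'r) struct \<Rightarrow> bool" where
  "saturated_struct N \<longleftrightarrow> (\<forall>e f \<Phi>. range e \<subseteq> VF N \<longrightarrow> range f \<subseteq> RV0 N \<longrightarrow>
     (\<forall>K. \<exists>x\<in>VF N. \<forall>k<K. sat N (e(0 := x)) f (\<Phi> k)) \<longrightarrow> (\<exists>x\<in>VF N. \<forall>k::nat. sat N (e(0 := x)) f (\<Phi> k)))"

text \<open>A diagonal argument: at index i the element \<open>g i\<close> satisfies as many of the
  first formulas as can be satisfied together there, but at most i of them. Formula k is among these
  at almost all indices.\<close>

lemma ultraproduct_saturated: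
  assumes U: "U \<le> sequentially" "U \<noteq> bot" "\<And>P. eventually P U \<or> eventually (\<lambda>i. \<not> P i) U"
    and M: "\<And>i. is_structure (M i)"
  shows "saturated_struct (ultraproduct U M)"
  unfolding saturated_struct_def
proof (intro allI impI)
  fix e f :: "nat \<Rightarrow> _" and \<Phi> :: "nat \<Rightarrow> form"
  let ?N = "ultraproduct U M"
  assume ef: "range e \<subseteq> VF ?N" "range f \<subseteq> RV0 ?N" and fin: "\<forall>K. \<exists>x\<in>VF ?N. \<forall>k<K. sat ?N (e(0 := x)) f (\<Phi> k)"
  from ef obtain E F where EF: "\<And>i j. E j i \<in> VF (M i)" "\<And>i j. F j i \<in> RV0 (M i)"
      "e = (\<lambda>j. rep U (E j))" "f = (\<lambda>j. rep U (F j))" by (rule assignment_rep) blast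
  have los': "sat ?N (e(0 := rep U g)) f \<phi> \<longleftrightarrow>
      eventually (\<lambda>i. sat (M i) ((\<lambda>j. E j i)(0 := g i)) (\<lambda>j. F j i) \<phi>) U" if "\<And>i. g i \<in> VF (M i)" for g \<phi>
    unfolding EF(3,4) rep_fun_upd fun_upd_at[symmetric] by (rule los[OF U(2,3) M]) (use EF that in auto)
  define Q where "Q K i \<longleftrightarrow> (\<exists>a\<in>VF (M i). \<forall>k<K. sat (M i) ((\<lambda>j. E j i)(0 := a)) (\<lambda>j. F j i) (\<Phi> k))" for K i
  have Q: "eventually (Q K) U" for K
  proof -
    obtain x where x: "x \<in> VF ?N" "\<forall>k<K. sat ?N (e(0 := x)) f (\<Phi> k)" using fin by blast
    then obtain g where g: "\<And>i. g i \<in> VF (M i)" "x = rep U g" by auto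
    have "\<forall>k\<in>{..<K}. eventually (\<lambda>i. sat (M i) ((\<lambda>j. E j i)(0 := g i)) (\<lambda>j. F j i) (\<Phi> k)) U"
      using x(2) los'[OF g(1)] g(2) by auto
    then have "eventually (\<lambda>i. \<forall>k\<in>{..<K}. sat (M i) ((\<lambda>j. E j i)(0 := g i)) (\<lambda>j. F j i) (\<Phi> k)) U"
      by (subst eventually_ball_finite_distrib) auto
    then show ?thesis by eventually_elim (use g(1) in \<open>auto simp: Q_def\<close>)
  qed
  have Q0: "Q 0 i" for i using EF(1)[of 0 i] by (auto simp: Q_def)
  \<comment> \<open>The bound i guarantees a maximum and does no harm, because \<open>U\<close>
    contains all final segments.\<close>
  define N where "N i = (GREATEST K. K \<le> i \<and> Q K i)" for i
  have N: "Q (N i) i" "K \<le> i \<Longrightarrow> Q K i \<Longrightarrow> K \<le> N i" for i K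
  proof -
    have "N i \<le> i \<and> Q (N i) i" unfolding N_def by (rule GreatestI_nat[of _ 0 i]) (use Q0 in auto)
    then show "Q (N i) i" by simp
    show "K \<le> i \<Longrightarrow> Q K i \<Longrightarrow> K \<le> N i" unfolding N_def by (rule Greatest_le_nat[of _ _ i]) auto
  qed
  obtain g where g: "\<And>i. g i \<in> VF (M i)" "\<And>i k. k < N i \<Longrightarrow> sat (M i) ((\<lambda>j. E j i)(0 := g i)) (\<lambda>j. F j i) (\<Phi> k)"
    using N(1) unfolding Q_def by metis
  have "sat ?N (e(0 := rep U g)) f (\<Phi> k)" for k
  proof -
    have "eventually (\<lambda>i. Suc k \<le> i) U" using U(1) eventually_ge_at_top[of "Suc k"] by (auto simp: le_filter_def)
    with Q[of "Suc k"] have "eventually (\<lambda>i. sat (M i) ((\<lambda>j. E j i)(0 := g i)) (\<lambda>j. F j i) (\<Phi> k)) U"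
    proof eventually_elim
      case (elim i)
      then have "Suc k \<le> N i" using N(2) by blast
      then show ?case using g(2) by simp
    qed
    then show ?thesis using los'[OF g(1)] by simp
  qed
  moreover have "rep U g \<in> VF ?N" using g(1) by auto
  ultimately show "\<exists>x\<in>VF ?N. \<forall>k. sat ?N (e(0 := x)) f (\<Phi> k)" by blast
qed

section \<open>Models of the theory as sectioned fields\<close>

lemma (in algebraically_closed) peval_root:
  assumes p: "set p \<subseteq> carrier L" "length p \<ge> 2" "last p \<noteq> \<zero>"
  shows "\<exists>x\<in>carrier L. peval L p x = \<zero>"
proof -
  define n where "n = length p - 1"
  define l where "l = last p"
  have ne: "p \<noteq> []" using p by auto
  have l: "l \<in> carrier L" "l \<noteq> \<zero>" using p ne by (auto simp: l_def)
  then have il: "inv l \<in> carrier L" "inv l \<otimes> l = \<one>" "l \<otimes> inv l = \<one>" using field_Units by auto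
  \<comment> \<open>The list is divided by its last entry and reversed, as \<open>horner\<close>
    reads the coefficients of a monic polynomial from the top.\<close>
  define c where "c i = (if i < n then inv l \<otimes> p ! (n - 1 - i) else \<zero>)" for i
  have c: "c i \<in> carrier L" for i
  proof (cases "i < n")
    case True
    then have "n - 1 - i < length p" by (simp add: n_def)
    then have "p ! (n - 1 - i) \<in> carrier L" using p(1) nth_mem by blast
    then show ?thesis using il(1) by (simp add: c_def)
  qed (simp add: c_def)
  have horner: "horner L \<one> x c k = peval L (rev (\<one> # map c [0..<k])) x" if "x \<in> carrier L" for x k
  proof (induction k)
    case (Suc k)
    have "set (rev (\<one> # map c [0..<k])) \<subseteq> carrier L" using c by auto
    then have "peval L (rev (\<one> # map c [0..<k])) x \<in> carrier L" using that by (rule peval_closed)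
    then show ?case using Suc that c by (simp add: a_comm m_comm)
  qed (use that in simp)
  have "algebraically_closed L" by unfold_locales
  moreover have "n \<ge> 1" using p(2) by (simp add: n_def)
  ultimately obtain x where x: "x \<in> carrier L" "horner L \<one> x c n = \<zero>"
    using c unfolding algebraically_closed_iff_horner by blast
  have "rev (\<one> # map c [0..<n]) = map ((\<otimes>) (inv l)) p"
  proof (rule nth_equalityI)
    show "length (rev (\<one> # map c [0..<n])) = length (map ((\<otimes>) (inv l)) p)" using ne by (simp add: n_def)
    fix i assume "i < length (rev (\<one> # map c [0..<n]))"
    then have i: "i \<le> n" by simp
    show "rev (\<one> # map c [0..<n]) ! i = map ((\<otimes>) (inv l)) p ! i"
    proof (cases "i = n")
      case True
      then show ?thesis using ne il by (simp add: nth_append n_def l_def last_conv_nth)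
    next
      case False
      then have "n - Suc i < n" "n - Suc (n - Suc i) = i" "i < n" "i < length p" using i by (auto simp: n_def)
      then show ?thesis by (simp add: nth_append rev_nth c_def)
    qed
  qed
  then have "inv l \<otimes> peval L p x = \<zero>"
    using x horner[OF x(1), of n] peval_smult[OF p(1) x(1) il(1)] by simp
  then have "peval L p x = \<zero>" using integral[of "inv l" "peval L p x"] il l p(1) x(1) by auto
  then show ?thesis using x by blast
qed

text \<open>In a field of finite order q, the polynomial X^q - X + 1 takes the value 1 everywhere.
  Here m = q - 1, and \<open>p\<close> is 1 + X (X^m - 1).\<close>

lemma (in algebraically_closed) infinite_carrier: "infinite (carrier L)"
proof
  assume fin: "finite (carrier L)"
  define m where "m = order L - 1"
  have "{\<zero>, \<one>} \<subseteq> carrier L" by simp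
  then have "card {\<zero>, \<one>} \<le> card (carrier L)" by (rule card_mono[OF fin])
  then have m: "m > 0" by (simp add: m_def order_def)
  define p where "p = \<one> # \<ominus> \<one> # replicate (m - 1) \<zero> @ [\<one>]"
  have "set p \<subseteq> carrier L" "length p \<ge> 2" "last p \<noteq> \<zero>" by (auto simp: p_def)
  then obtain x where x: "x \<in> carrier L" "peval L p x = \<zero>" using peval_root by blast
  have "peval L (replicate (m - 1) \<zero> @ [\<one>]) x = x [^] (m - 1)"
    using peval_append[of "replicate (m - 1) \<zero>" \<one> x] x by (auto simp: set_replicate_conv_if)
  moreover have "x \<otimes> x [^] (m - 1) = x [^] m"
    using m x nat_pow_Suc2[of x "m - 1"] by simp
  ultimately have val: "peval L p x = \<one> \<oplus> x \<otimes> (\<ominus> \<one> \<oplus> x [^] m)" by (simp add: p_def)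
  have "x \<otimes> (\<ominus> \<one> \<oplus> x [^] m) = \<zero>"
  proof (cases "x = \<zero>")
    case False
    interpret mg: group "Multiplicative_Group.mult_of L" by (rule field_mult_group)
    have "x [^]\<^bsub>Multiplicative_Group.mult_of L\<^esub> order (Multiplicative_Group.mult_of L) = \<one>\<^bsub>Multiplicative_Group.mult_of L\<^esub>"
      using x False by (intro mg.pow_order_eq_1) auto
    then have "x [^] m = \<one>" using order_mult_of[OF fin] by (simp add: m_def Multiplicative_Group.nat_pow_mult_of)
    then show ?thesis using x by (simp add: l_neg)
  qed (use x in simp)
  then show False using x(2) val by simp
qed

definition vle :: "('v, 'r) struct \<Rightarrow> 'v \<Rightarrow> 'v \<Rightarrow> bool" where
  "vle M x y \<longleftrightarrow> r_le M (s_rv M x) (s_rv M y)"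

definition rho :: "('v, 'r) struct \<Rightarrow> 'v \<Rightarrow> 'v" where
  "rho M x = s_sn M (s_rv M x)"

text \<open>The default values are included because terms may leave the intended domains of the
  operations, and \<open>eval_related\<close> has to compare their values there too.\<close>

locale ACVF_dag_model = pre_ACVF +
  assumes total: "\<And>s t. s \<in> RV M \<Longrightarrow> t \<in> RV M \<Longrightarrow> r_le M s t \<or> r_le M t s"
    and nontriv: "\<exists>t\<in>RVx M. t \<notin> Kx M"
    and r_neg: "\<And>t. t \<in> insert (r_zero M) (Kx M) \<Longrightarrow> r_neg M t = \<ominus>\<^bsub>K_ring M\<^esub> t"
    and inf_mult': "\<And>t. t \<in> RV0 M \<Longrightarrow> r_mul M (r_inf M) t = r_inf M"
    and zero_mult: "\<And>t. t \<in> RV0 M \<Longrightarrow> t \<noteq> r_inf M \<Longrightarrow> r_mul M t (r_zero M) = r_zero M \<and> r_mul M (r_zero M) t = r_zero M"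
    and add_default: "\<And>s t. s \<in> RV0 M \<Longrightarrow> t \<in> RV0 M \<Longrightarrow>
      \<not> (s \<in> insert (r_zero M) (Kx M) \<and> t \<in> insert (r_zero M) (Kx M)) \<Longrightarrow> r_add M s t = r_zero M"
    and neg_default: "\<And>t. t \<in> RV0 M \<Longrightarrow> t \<notin> insert (r_zero M) (Kx M) \<Longrightarrow> r_neg M t = r_zero M"
    and le_zero: "\<And>t. t \<in> RV0 M \<Longrightarrow> \<not> r_le M t (r_zero M) \<and> \<not> r_le M (r_zero M) t"
    and residue_hom: "residue M \<in> ring_hom ((VF_ring M)\<lparr>carrier := val_ring M\<rparr>) (K_ring M)"
    and sn_hom: "s_sn M \<in> hom (RVx_group M) (VFx_group M)"
    and sn_inf: "s_sn M (r_inf M) = v_zero M"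
    and rv_sn: "\<And>t. t \<in> RV M \<Longrightarrow> s_rv M (s_sn M t) = t"
    and sn_subfield: "subfield (insert (v_zero M) (s_sn M ` Kx M)) (VF_ring M)"
    and sn_zero: "s_sn M (r_zero M) = v_zero M"

lemma is_model_ACVF_dag_model:
  assumes "is_model M ACVF_dag"
  shows "ACVF_dag_model M"
proof -
  have str: "is_structure M" and A: "is_ACVF M" and S: "is_section M"
    using assms by (simp_all add: is_model_ACVF_dag_iff)
  have K: "carrier (K_ring M) = insert (r_zero M) (Kx M)" by (simp add: K_ring_def)
  note A = A[unfolded is_ACVF_def]
  have a1: "algebraically_closed (VF_ring M)"
    using A by (elim conjE)
  have a2: "\<forall>x\<in>VF M. v_neg M x = \<ominus>\<^bsub>VF_ring M\<^esub> x"
    using A by (elim conjE)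
  have a3: "comm_group (RVx_group M)"
    using A by (elim conjE)
  have a4: "r_zero M \<noteq> r_inf M"
    using A by (elim conjE)
  have a5: "\<forall>t\<in>carrier (K_ring M). r_mul M t (r_zero M) = r_zero M \<and> r_mul M (r_zero M) t = r_zero M"
    using A by (elim conjE)
  have a6: "\<forall>t\<in>RV0 M. r_mul M t (r_inf M) = r_inf M \<and> r_mul M (r_inf M) t = r_inf M"
    using A by (elim conjE)
  have a7: "algebraically_closed (K_ring M)"
    using A by (elim conjE)
  have a8: "\<forall>t\<in>carrier (K_ring M). r_neg M t = \<ominus>\<^bsub>K_ring M\<^esub> t"
    using A by (elim conjE)
  have a9: "\<forall>t\<in>RV M. r_le M t t \<and> r_le M t (r_inf M)"
    using A by (elim conjE)
  have a10: "\<forall>r\<in>RV M. \<forall>s\<in>RV M. \<forall>t\<in>RV M. r_le M r s \<longrightarrow> r_le M s t \<longrightarrow> r_le M r t"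
    using A by (elim conjE)
  have a11: "Kx M = {t \<in> RV M. r_le M t (r_one M) \<and> r_le M (r_one M) t}"
    using A by (elim conjE)
  have a12: "\<forall>s\<in>RV M. \<forall>t\<in>RV M. r_le M s t \<longrightarrow> r_le M t s \<longrightarrow> (\<exists>k\<in>Kx M. s = r_mul M k t)"
    using A by (elim conjE)
  have a13: "\<forall>s\<in>RV M. \<forall>t\<in>RV M. r_le M s t \<or> r_le M t s"
    using A by (elim conjE)
  have a14: "\<forall>r\<in>RVx M. \<forall>s\<in>RVx M. \<forall>t\<in>RVx M. r_le M r s \<longrightarrow> r_le M (r_mul M r t) (r_mul M s t)"
    using A by (elim conjE)
  have a15: "\<exists>t\<in>RVx M. t \<notin> Kx M"
    using A by (elim conjE)
  have a16: "\<forall>s\<in>RV0 M. \<forall>t\<in>RV0 M. \<not> (s \<in> carrier (K_ring M) \<and> t \<in> carrier (K_ring M)) \<longrightarrow> r_add M s t = r_zero M"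
    using A by (elim conjE)
  have a17: "\<forall>t\<in>RV0 M - carrier (K_ring M). r_neg M t = r_zero M"
    using A by (elim conjE)
  have a18: "\<forall>t\<in>RVx M - Kx M. r_mul M t (r_zero M) = r_zero M \<and> r_mul M (r_zero M) t = r_zero M"
    using A by (elim conjE)
  have a19: "\<forall>t\<in>RV0 M. \<not> r_le M t (r_zero M) \<and> \<not> r_le M (r_zero M) t"
    using A by (elim conjE)
  have a20: "s_rv M (v_zero M) = r_inf M"
    using A by (elim conjE)
  have a21: "s_rv M \<in> hom (VFx_group M) (RVx_group M)"
    using A by (elim conjE)
  have a23: "\<forall>x\<in>VF M. \<forall>y\<in>VF M. r_le M (s_rv M x) (s_rv M (v_add M x y)) \<or> r_le M (s_rv M y) (s_rv M (v_add M x y))"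
    using A by (elim conjE)
  have a24: "residue M \<in> ring_hom ((VF_ring M)\<lparr>carrier := val_ring M\<rparr>) (K_ring M)"
    using A by (elim conjE)
  note S = S[unfolded is_section_def]
  have "pre_ACVF M"
  proof (rule pre_ACVF.intro)
    show "\<exists>k\<in>Kx M. s = r_mul M k t" if "s \<in> RV M" "t \<in> RV M" "r_le M s t" "r_le M t s" for s t
      using a12 that by blast
    show "r_le M r t" if "r \<in> RV M" "s \<in> RV M" "t \<in> RV M" "r_le M r s" "r_le M s t" for r s t
      using a10 that by blast
    show "r_le M (r_mul M r t) (r_mul M s t)" if "r \<in> RVx M" "s \<in> RVx M" "t \<in> RVx M" "r_le M r s" for r s t
      using a14 that by blast
    show "r_le M (s_rv M x) (s_rv M (v_add M x y)) \<or> r_le M (s_rv M y) (s_rv M (v_add M x y))"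
      if "x \<in> VF M" "y \<in> VF M" for x y using a23 that by blast
  qed (use str a1 a2 a3 a4 a6 a7 a9 a11 a20 a21 in simp_all)
  moreover have "ACVF_dag_model_axioms M"
  proof (rule ACVF_dag_model_axioms.intro)
    show "r_mul M t (r_zero M) = r_zero M \<and> r_mul M (r_zero M) t = r_zero M"
      if "t \<in> RV0 M" "t \<noteq> r_inf M" for t
    proof (cases "t \<in> insert (r_zero M) (Kx M)")
      case True
      then show ?thesis using a5 K by blast
    next
      case False
      then have "t \<in> RVx M - Kx M" using that by (auto simp: RVx_def)
      then show ?thesis using a18 by blast
    qed
    show "r_neg M t = r_zero M" if "t \<in> RV0 M" "t \<notin> insert (r_zero M) (Kx M)" for t
      using a17 that unfolding K by blast
    show "r_add M s t = r_zero M" if "s \<in> RV0 M" "t \<in> RV0 M"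
      "\<not> (s \<in> insert (r_zero M) (Kx M) \<and> t \<in> insert (r_zero M) (Kx M))" for s t
      using a16 that unfolding K by blast
    show "r_le M s t \<or> r_le M t s" if "s \<in> RV M" "t \<in> RV M" for s t using a13 that by blast
    show "\<exists>t\<in>RVx M. t \<notin> Kx M" by (rule a15)
    show "r_neg M t = \<ominus>\<^bsub>K_ring M\<^esub> t" if "t \<in> insert (r_zero M) (Kx M)" for t
      using a8 that unfolding K by blast
  qed (use a6 a19 a24 S in auto)
  ultimately show ?thesis by (rule ACVF_dag_model.intro)
qed

section \<open>Valuation, residue map and section in a model\<close>

context ACVF_dag_model
begin

lemma RVx_RV0: "t \<in> RVx M \<Longrightarrow> t \<in> RV0 M" and RV_RV0: "t \<in> RV M \<Longrightarrow> t \<in> RV0 M" and Kx_RV0: "t \<in> Kx M \<Longrightarrow> t \<in> RV0 M"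
  by (auto simp: RVx_def RV_def Kx_def)

lemma sn_VF: "t \<in> RV0 M \<Longrightarrow> s_sn M t \<in> VF M"
  using struct by (simp add: is_structure_def)

lemma sn_mult: "s \<in> RVx M \<Longrightarrow> t \<in> RVx M \<Longrightarrow> s_sn M (r_mul M s t) = v_mul M (s_sn M s) (s_sn M t)"
  using sn_hom by (auto simp: hom_def VFx_group_def)

lemma sn_nonzero: "t \<in> RVx M \<Longrightarrow> s_sn M t \<noteq> v_zero M"
  using sn_hom by (auto simp: hom_def VFx_group_def)

lemma sn_one: "s_sn M (r_one M) = v_one M"
proof -
  have 1: "r_one M \<in> RVx M" using RVx.one_closed by simp
  have "v_mul M (s_sn M (r_one M)) (s_sn M (r_one M)) = v_mul M (s_sn M (r_one M)) (v_one M)"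
    using sn_mult[OF 1 1] RVx.l_one[of "r_one M"] 1 sn_VF[OF RVx_RV0[OF 1]] VF.r_one[of "s_sn M (r_one M)"] by simp
  then show ?thesis
    using VF.m_lcancel[of "s_sn M (r_one M)" "s_sn M (r_one M)" "v_one M"] sn_nonzero[OF 1] sn_VF[OF RVx_RV0[OF 1]]
    by simp
qed

lemma rho_closed: "x \<in> VF M \<Longrightarrow> rho M x \<in> VF M"
  unfolding rho_def using rv_RV[of x] sn_VF[OF RV_RV0] by blast

lemma rv_rho: "x \<in> VF M \<Longrightarrow> s_rv M (rho M x) = s_rv M x"
  unfolding rho_def by (rule rv_sn[OF rv_RV])

lemma rho_eq_iff: "x \<in> VF M \<Longrightarrow> y \<in> VF M \<Longrightarrow> rho M x = rho M y \<longleftrightarrow> s_rv M x = s_rv M y"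
  using rv_rho by (metis rho_def)

lemma rho_zero: "rho M (v_zero M) = v_zero M"
  by (simp add: rho_def rv_zero sn_inf)

lemma inf_le: "t \<in> RV M \<Longrightarrow> r_le M (r_inf M) t \<Longrightarrow> t = r_inf M"
  using antisym[of t "r_inf M"] inf_RV le_inf[of t] inf_mult Kx_RV0 by metis

lemma rv_inf_iff: "x \<in> VF M \<Longrightarrow> s_rv M x = r_inf M \<longleftrightarrow> x = v_zero M"
  using rv_RVx[of x] rv_zero by (auto simp: RVx_def)

lemma vle_zero: "x \<in> VF M \<Longrightarrow> vle M x (v_zero M)"
  unfolding vle_def rv_zero by (rule le_inf[OF rv_RV])

lemma zero_vle: "vle M (v_zero M) x \<Longrightarrow> x \<in> VF M \<Longrightarrow> x = v_zero M"
  unfolding vle_def rv_zero using inf_le[OF rv_RV] rv_inf_iff by blast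

lemma vle_mult:
  assumes "vle M x y" "x \<in> VF M" "y \<in> VF M" "z \<in> VF M"
  shows "vle M (v_mul M x z) (v_mul M y z)"
proof (cases "x = v_zero M \<or> y = v_zero M \<or> z = v_zero M")
  case True
  then have "v_mul M y z = v_zero M" using assms zero_vle[of y] by auto
  then show ?thesis using assms vle_zero[of "v_mul M x z"] by simp
next
  case False
  then show ?thesis using assms compat rv_RVx by (simp add: vle_def rv_mult)
qed

lemma rho_mult: "x \<in> VF M \<Longrightarrow> y \<in> VF M \<Longrightarrow> rho M (v_mul M x y) = v_mul M (rho M x) (rho M y)"
  using rho_zero rho_closed[of x] rho_closed[of y] sn_mult[OF rv_RVx rv_RVx, of x y] rv_mult[of x y]
  by (cases "x = v_zero M"; cases "y = v_zero M") (auto simp: rho_def)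

lemma residue_arith:
  assumes "x \<in> val_ring M" "y \<in> val_ring M"
  shows "residue M (v_add M x y) = r_add M (residue M x) (residue M y)"
  using residue_hom assms by (auto simp: ring_hom_def)

lemma one_val_ring: "v_one M \<in> val_ring M" "residue M (v_one M) = r_one M"
  using residue_hom rv_one le_refl[OF le_one_RV] by (auto simp: ring_hom_def val_ring_def)

lemma neg_VF: "x \<in> VF M \<Longrightarrow> v_neg M x \<in> VF M"
  using struct by (simp add: is_structure_def)

text \<open>The square of t = rv(-1) is 1. In a total order compatible with multiplication this
  gives 1 \<le> t, and -x is the product of -1 and x.\<close>

lemma neg_val_ring:
  assumes x: "x \<in> val_ring M"
  shows "v_neg M x \<in> val_ring M"
proof (cases "x = v_zero M")
  case True
  then show ?thesis using x v_neg[of x] VF.minus_zero by (simp add: val_ring_def)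
next
  case False
  have xV: "x \<in> VF M" "r_le M (r_one M) (s_rv M x)" using x by (auto simp: val_ring_def)
  define m where "m = v_neg M (v_one M)"
  have m: "m \<in> VF M" using neg_VF by (simp add: m_def)
  have mx: "v_mul M m x = v_neg M x"
    using VF.l_minus[of "v_one M" x] VF.l_one[of x] xV v_neg[of x] v_neg[of "v_one M"] by (simp add: m_def)
  have mm: "v_mul M m m = v_one M"
    using VF.l_minus[of "v_one M" m] VF.l_one[of m] VF.minus_minus[of "v_one M"] m v_neg[of "v_one M"] by (simp add: m_def)
  then have m0: "m \<noteq> v_zero M" using m by auto
  define t where "t = s_rv M m"
  have t: "t \<in> RVx M" "r_mul M t t = r_one M"
    using rv_RVx[OF m m0] rv_mult[OF m m0 m m0] mm rv_one by (simp_all add: t_def)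
  have one: "r_one M \<in> RVx M" using RVx.one_closed by simp
  have "r_le M (r_one M) t"
    using total[OF RVx_RV[OF t(1)] le_one_RV] compat[OF t(1) one t(1)] t RVx.l_one[of t] by auto
  moreover have "r_le M (r_mul M (r_one M) t) (r_mul M (s_rv M x) t)"
    using compat[OF one rv_RVx[OF xV(1) False] t(1) xV(2)] .
  moreover have "r_mul M (s_rv M x) t = s_rv M (v_neg M x)"
    using rv_mult[OF m m0 xV(1) False] RVx.m_comm[of t "s_rv M x"] t(1) rv_RVx[OF xV(1) False] mx by (simp add: t_def)
  ultimately have "r_le M (r_one M) (s_rv M (v_neg M x))"
    using le_trans[OF le_one_RV RVx_RV[OF t(1)] rv_RV[OF neg_VF[OF xV(1)]]] RVx.l_one[of t] t(1) by simp
  then show ?thesis using neg_VF[OF xV(1)] by (simp add: val_ring_def)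
qed

lemma Kx_iff: "x \<in> VF M \<Longrightarrow> r_Kx M (s_rv M x) \<longleftrightarrow> r_le M (s_rv M x) (r_one M) \<and> r_le M (r_one M) (s_rv M x)"
  using Kx rv_RV[of x] RV_RV0[OF rv_RV[of x]] by (auto simp: Kx_def)

lemma residue_zero_iff: "x \<in> VF M \<Longrightarrow> residue M x = r_zero M \<longleftrightarrow> \<not> r_Kx M (s_rv M x)"
  using residue_Kx[of x] Kx by (auto simp: residue_def RV_def)

text \<open>Additivity of the residue map identifies the kernel of rv with the elements 1 - w for w
  in the maximal ideal.\<close>

lemma rv_eq_one_iff:
  assumes u: "u \<in> VF M"
  shows "s_rv M u = r_one M \<longleftrightarrow> \<not> vle M (v_add M (v_one M) (v_neg M u)) (v_one M)"
proof -
  define w where "w = v_add M (v_one M) (v_neg M u)"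
  have w: "w \<in> VF M" using neg_VF[OF u] by (simp add: w_def)
  have w': "w = \<one>\<^bsub>VF_ring M\<^esub> \<ominus>\<^bsub>VF_ring M\<^esub> u" using u v_neg by (simp add: w_def a_minus_def)
  have uc: "u \<in> carrier (VF_ring M)" using u by simp
  have "u \<oplus>\<^bsub>VF_ring M\<^esub> w = \<one>\<^bsub>VF_ring M\<^esub>" "u = \<one>\<^bsub>VF_ring M\<^esub> \<ominus>\<^bsub>VF_ring M\<^esub> w"
    unfolding w' using uc by algebra+
  then have uw: "v_add M u w = v_one M" "u = v_add M (v_one M) (v_neg M w)"
    using w v_neg by (simp_all add: a_minus_def)
  show ?thesis
    unfolding w_def[symmetric]
  proof
    assume 1: "s_rv M u = r_one M"
    then have uv: "u \<in> val_ring M" "residue M u = r_one M"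
      using u le_refl[OF le_one_RV] one_Kx by (auto simp: val_ring_def residue_def Kx_def)
    then have wv: "w \<in> val_ring M" unfolding w_def using val_ring_add one_val_ring(1) neg_val_ring by blast
    have "r_add M (r_one M) (residue M w) = r_one M"
      using residue_arith[OF uv(1) wv] uv(2) uw(1) one_val_ring(2) by simp
    then have "residue M w = r_zero M"
      using K.add.l_cancel_one'[of "r_one M" "residue M w"] residue_in_K[OF wv] one_Kx by auto
    then show "\<not> vle M w (v_one M)"
      using residue_zero_iff[OF w] Kx_iff[OF w] wv by (auto simp: vle_def rv_one val_ring_def)
  next
    assume n: "\<not> vle M w (v_one M)"
    then have "r_le M (r_one M) (s_rv M w)"
      using total[OF le_one_RV rv_RV[OF w]] by (auto simp: vle_def rv_one)
    then have wv: "w \<in> val_ring M" using w by (simp add: val_ring_def)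
    have w0: "residue M w = r_zero M" using n residue_zero_iff[OF w] Kx_iff[OF w] by (auto simp: vle_def rv_one)
    have uv: "u \<in> val_ring M"
      by (subst uw(2)) (intro val_ring_add one_val_ring(1) neg_val_ring wv)
    have "residue M u = r_one M"
      using residue_arith[OF uv wv] uw(1) one_val_ring(2) w0 residue_in_K[OF uv] K.r_zero[of "residue M u"] by simp
    moreover have "r_one M \<noteq> r_zero M" using K.one_not_zero by simp
    ultimately show "s_rv M u = r_one M" by (simp add: residue_def split: if_splits)
  qed
qed

lemma vle_cancel:
  assumes "x \<in> VF M" "y \<in> VF M" "z \<in> VF M" "z \<noteq> v_zero M"
  shows "vle M (v_mul M x z) (v_mul M y z) \<longleftrightarrow> vle M x y"
proof
  obtain z' where z': "z' \<in> VF M" "v_mul M z z' = v_one M"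
    using VF.field_Units assms(3,4) unfolding Units_def by auto
  assume "vle M (v_mul M x z) (v_mul M y z)"
  then have "vle M (v_mul M (v_mul M x z) z') (v_mul M (v_mul M y z) z')"
    by (rule vle_mult) (use assms z' in auto)
  then show "vle M x y"
    using VF.m_assoc[of x z z'] VF.m_assoc[of y z z'] VF.r_one[of x] VF.r_one[of y] assms z' by simp
qed (use assms vle_mult in auto)

text \<open>Division by x reduces this to u = y/x and \<open>rv_eq_one_iff\<close>.\<close>

lemma rv_eq_iff:
  assumes "x \<in> VF M" "y \<in> VF M" "x \<noteq> v_zero M"
  shows "s_rv M x = s_rv M y \<longleftrightarrow> \<not> vle M (v_add M x (v_neg M y)) x"
proof -
  obtain x' where x': "x' \<in> VF M" "v_mul M x' x = v_one M"
    using VF.field_Units assms(1,3) unfolding Units_def by auto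
  define u where "u = v_mul M y x'"
  have u: "u \<in> VF M" "v_mul M u x = y"
    using assms x' VF.m_assoc[of y x' x] VF.r_one[of y] by (simp_all add: u_def)
  define w where "w = v_add M (v_one M) (v_neg M u)"
  have w: "w \<in> VF M" using neg_VF[OF u(1)] by (simp add: w_def)
  have "v_mul M w x = v_add M x (v_neg M y)"
    using VF.l_distr[of "v_one M" "v_neg M u" x] VF.l_minus[of u x] VF.l_one[of x] u assms v_neg neg_VF[OF u(1)]
    by (simp add: w_def)
  then have "vle M (v_add M x (v_neg M y)) x \<longleftrightarrow> vle M w (v_one M)"
    using vle_cancel[of w "v_one M" x] VF.l_one[of x] w assms by simp
  then have "\<not> vle M (v_add M x (v_neg M y)) x \<longleftrightarrow> s_rv M u = r_one M"
    using rv_eq_one_iff[OF u(1)] by (simp add: w_def)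
  also have "\<dots> \<longleftrightarrow> s_rv M x = s_rv M y"
  proof (cases "y = v_zero M")
    case True
    then have "u = v_zero M" using x' by (simp add: u_def)
    then show ?thesis using rv_inf_iff[OF assms(1)] assms True rv_zero RVx.one_closed by (auto simp: RVx_def)
  next
    case False
    then have u0: "u \<noteq> v_zero M" using u assms by auto
    have m: "s_rv M y = r_mul M (s_rv M u) (s_rv M x)" using rv_mult[OF u(1) u0 assms(1,3)] u(2) by simp
    have "s_rv M u = r_one M \<longleftrightarrow> r_mul M (s_rv M u) (s_rv M x) = s_rv M x"
      using RVx.r_cancel_one[of "s_rv M x" "s_rv M u"] rv_RVx[OF u(1) u0] rv_RVx[OF assms(1,3)] by simp
    then show ?thesis using m by auto
  qed
  finally show ?thesis by blast
qed

lemma sn_sum: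
  assumes "k \<in> Kx M" "l \<in> Kx M"
  shows "v_add M (s_sn M k) (s_sn M l) = v_zero M \<or> (\<exists>u\<in>Kx M. v_add M (s_sn M k) (s_sn M l) = s_sn M u)"
proof -
  have "subring (insert (v_zero M) (s_sn M ` Kx M)) (VF_ring M)"
    by (intro subcring.axioms subdomain.axioms subfield.axioms sn_subfield)
  then show ?thesis using subringE(7)[of _ "VF_ring M" "s_sn M k" "s_sn M l"] assms by auto
qed

text \<open>As x and y have the same value, rv(x) = k rv(y) with k in \<open>Kx\<close>. So the sum
  is sn(k) + sn(1), an element of the field sn(K), multiplied by sn(rv(y)).\<close>

lemma rho_sum:
  assumes xy: "x \<in> VF M" "y \<in> VF M" "vle M x y" "vle M y x"
  defines "s \<equiv> v_add M (rho M x) (rho M y)"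
  shows "s = v_zero M \<or> rho M s = s \<and> vle M s x"
proof (cases "y = v_zero M")
  case True
  then have "x = v_zero M" using zero_vle xy by blast
  then show ?thesis using True rho_zero VF.r_zero[of "v_zero M"] by (simp add: s_def)
next
  case False
  then have x0: "x \<noteq> v_zero M" using zero_vle[of y] xy by blast
  define t where "t = s_rv M y"
  have t: "t \<in> RVx M" "s_rv M x \<in> RVx M" using rv_RVx xy False x0 by (auto simp: t_def)
  obtain k where k: "k \<in> Kx M" "s_rv M x = r_mul M k t"
    using antisym[OF rv_RV[OF xy(1)] rv_RV[OF xy(2)]] xy(3,4) by (auto simp: vle_def t_def)
  have kx: "k \<in> RVx M" "r_one M \<in> RVx M" using k(1) Kx_RVx RVx.one_closed by auto
  have snk: "s_sn M k \<in> VF M" "s_sn M t \<in> VF M" "s_sn M (r_one M) \<in> VF M" using sn_VF[OF RVx_RV0] kx t by auto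
  have "s_sn M (r_mul M k t) = v_mul M (s_sn M k) (s_sn M t)" "s_sn M t = v_mul M (s_sn M (r_one M)) (s_sn M t)"
    using sn_mult kx t snk sn_one VF.l_one[of "s_sn M t"] by simp_all
  then have s: "s = v_mul M (v_add M (s_sn M k) (s_sn M (r_one M))) (s_sn M t)"
    using VF.l_distr[of "s_sn M k" "s_sn M (r_one M)" "s_sn M t"] snk k by (simp add: s_def rho_def t_def[symmetric])
  from sn_sum[OF k(1) one_Kx] show ?thesis
  proof
    assume "v_add M (s_sn M k) (s_sn M (r_one M)) = v_zero M"
    then show ?thesis using s snk by simp
  next
    assume "\<exists>u\<in>Kx M. v_add M (s_sn M k) (s_sn M (r_one M)) = s_sn M u"
    then obtain u where u: "u \<in> Kx M" "v_add M (s_sn M k) (s_sn M (r_one M)) = s_sn M u" by blast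
    have ux: "u \<in> RVx M" using u(1) Kx_RVx by blast
    have ut: "r_mul M u t \<in> RVx M" using RVx.m_closed[of u t] ux t by simp
    have s': "s = s_sn M (r_mul M u t)" using s u(2) sn_mult[OF ux t(1)] by simp
    have rvs: "s_rv M s = r_mul M u t" using s' rv_sn[OF RVx_RV[OF ut]] by simp
    have "r_le M u (r_one M)" using u(1) Kx by auto
    then have "r_le M (r_mul M u t) t" using compat[OF ux kx(2) t(1)] RVx.l_one[of t] t by simp
    moreover have "r_le M t (s_rv M x)" using xy(4) by (simp add: vle_def t_def)
    ultimately have "vle M s x"
      unfolding vle_def rvs by (intro le_trans[OF RVx_RV[OF ut] RVx_RV[OF t(1)] RVx_RV[OF t(2)]])
    moreover have "rho M s = s" unfolding rho_def rvs by (rule s'[symmetric])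
    ultimately show ?thesis by blast
  qed
qed

text \<open>Two axioms carry the content: \<open>sec_eq_iff\<close> says that the kernel of rv is 1
  plus the maximal ideal and comes from \<open>rv_eq_iff\<close>; \<open>sec_add\<close> reflects
  that sn(K) is a field and comes from \<open>rho_sum\<close>.\<close>

lemma VF_sectioned_field: "sectioned_field (VF_ring M) (vle M) (rho M)"
proof (rule sectioned_field.intro)
  show "field (VF_ring M)" by (rule VF.field_axioms)
  show "sectioned_field_axioms (VF_ring M) (vle M) (rho M)"
  proof (rule sectioned_field_axioms.intro)
    fix x y z
    show "x \<in> carrier (VF_ring M) \<Longrightarrow> y \<in> carrier (VF_ring M) \<Longrightarrow> vle M x y \<or> vle M y x"
      unfolding vle_def using total rv_RV by simp
    show "vle M x y \<Longrightarrow> vle M y z \<Longrightarrow> x \<in> carrier (VF_ring M) \<Longrightarrow> y \<in> carrier (VF_ring M) \<Longrightarrow>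
        z \<in> carrier (VF_ring M) \<Longrightarrow> vle M x z"
      unfolding vle_def using le_trans[OF rv_RV rv_RV rv_RV, of x y z] by simp
    show "vle M z (x \<oplus>\<^bsub>VF_ring M\<^esub> y)"
      if "vle M z x" "vle M z y" "x \<in> carrier (VF_ring M)" "y \<in> carrier (VF_ring M)" "z \<in> carrier (VF_ring M)"
    proof -
      have "r_le M (s_rv M x) (s_rv M (v_add M x y)) \<or> r_le M (s_rv M y) (s_rv M (v_add M x y))"
        using ultrametric that by simp
      then show ?thesis
        using le_trans[of "s_rv M z" "s_rv M x" "s_rv M (v_add M x y)"]
          le_trans[of "s_rv M z" "s_rv M y" "s_rv M (v_add M x y)"] rv_RV that by (auto simp: vle_def)
    qed
    show "x \<in> carrier (VF_ring M) \<Longrightarrow> y \<in> carrier (VF_ring M) \<Longrightarrow> x \<noteq> \<zero>\<^bsub>VF_ring M\<^esub> \<Longrightarrow>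
        rho M x = rho M y \<longleftrightarrow> \<not> vle M (x \<ominus>\<^bsub>VF_ring M\<^esub> y) x"
      using rv_eq_iff[of x y] rho_eq_iff[of x y] v_neg[of y] by (simp add: a_minus_def)
    show "x \<in> carrier (VF_ring M) \<Longrightarrow> y \<in> carrier (VF_ring M) \<Longrightarrow> vle M x y \<Longrightarrow> vle M y x \<Longrightarrow>
        rho M x \<oplus>\<^bsub>VF_ring M\<^esub> rho M y = \<zero>\<^bsub>VF_ring M\<^esub> \<or>
        rho M (rho M x \<oplus>\<^bsub>VF_ring M\<^esub> rho M y) = rho M x \<oplus>\<^bsub>VF_ring M\<^esub> rho M y \<and>
        vle M (rho M x \<oplus>\<^bsub>VF_ring M\<^esub> rho M y) x"
      using rho_sum[of x y] by simp
  qed (use vle_mult vle_zero zero_vle rho_closed rho_mult rv_rho rho_zero in \<open>auto simp: rho_def\<close>)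
qed

lemma residue_field_infinite:
  "infinite {k \<in> VF M. rho M k = k \<and> vle M k (v_one M) \<and> vle M (v_one M) k}"
proof -
  have "infinite (Kx M)" using K.infinite_carrier by simp
  moreover have "inj_on (s_sn M) (Kx M)"
    using rv_sn[OF RVx_RV[OF subsetD[OF Kx_RVx]]] by (metis inj_onI)
  ultimately have "infinite (s_sn M ` Kx M)" by (simp add: finite_image_iff)
  moreover have "s_sn M ` Kx M \<subseteq> {k \<in> VF M. rho M k = k \<and> vle M k (v_one M) \<and> vle M (v_one M) k}"
  proof clarify
    fix k assume k: "k \<in> Kx M"
    then have "s_rv M (s_sn M k) = k" using rv_sn RVx_RV Kx_RVx by blast
    then show "s_sn M k \<in> VF M \<and> rho M (s_sn M k) = s_sn M k \<and> vle M (s_sn M k) (v_one M) \<and> vle M (v_one M) (s_sn M k)"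
      using k Kx sn_VF[OF Kx_RV0[OF k]] by (simp add: rho_def vle_def rv_one)
  qed
  ultimately show ?thesis using finite_subset by blast
qed

text \<open>If an element outside \<open>Kx\<close> has negative value, its inverse has positive
  value.\<close>

lemma nontrivial_valuation: "\<exists>c\<in>VF M. c \<noteq> v_zero M \<and> \<not> vle M c (v_one M)"
proof -
  obtain t where t: "t \<in> RVx M" "t \<notin> Kx M" using nontriv by blast
  have one: "r_one M \<in> RVx M" using RVx.one_closed by simp
  have "\<exists>s\<in>RVx M. \<not> r_le M s (r_one M)"
  proof (cases "r_le M t (r_one M)")
    case True
    then have n: "\<not> r_le M (r_one M) t" using t Kx RVx_RV[OF t(1)] by blast
    obtain s where s: "s \<in> RVx M" "r_mul M s t = r_one M" using RVx.l_inv_ex[of t] t by auto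
    have "\<not> r_le M s (r_one M)"
      using compat[OF s(1) one t(1)] n s(2) RVx.l_one[of t] t(1) by auto
    then show ?thesis using s by blast
  qed (use t in blast)
  then obtain s where s: "s \<in> RVx M" "\<not> r_le M s (r_one M)" by blast
  then show ?thesis
    using sn_nonzero[OF s(1)] sn_VF[OF RVx_RV0[OF s(1)]] rv_sn[OF RVx_RV[OF s(1)]]
    by (intro bexI[of _ "s_sn M s"]) (auto simp: vle_def rv_one)
qed

end

section \<open>Back and forth\<close>

text \<open>In contrast to \<open>partial_iso\<close>, only the first condition depends on the carriers; so nothing else
  changes when \<open>M\<close> is replaced by an elementary substructure.\<close>

definition piso :: "('v, 'r) struct \<Rightarrow> ('w, 's) struct \<Rightarrow> ('v \<times> 'w) set \<Rightarrow> bool" where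
  "piso M N G \<longleftrightarrow> G \<subseteq> VF M \<times> VF N \<and> (v_zero M, v_zero N) \<in> G \<and> (v_one M, v_one N) \<in> G \<and>
     (\<forall>(a, b)\<in>G. (v_neg M a, v_neg N b) \<in> G \<and> (rho M a, rho N b) \<in> G \<and>
       (\<forall>(c, d)\<in>G. (v_add M a c, v_add N b d) \<in> G \<and> (v_mul M a c, v_mul N b d) \<in> G \<and>
         (vle M a c \<longleftrightarrow> vle N b d)))"

lemma piso_D:
  assumes "piso M N G" "(a, b) \<in> G"
  shows "a \<in> VF M" "b \<in> VF N" "(v_neg M a, v_neg N b) \<in> G" "(rho M a, rho N b) \<in> G"
    "(c, d) \<in> G \<Longrightarrow> (v_add M a c, v_add N b d) \<in> G" "(c, d) \<in> G \<Longrightarrow> (v_mul M a c, v_mul N b d) \<in> G"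
    "(c, d) \<in> G \<Longrightarrow> vle M a c \<longleftrightarrow> vle N b d"
  using assms unfolding piso_def by blast+

lemma piso_converse: "piso M N G \<Longrightarrow> piso N M (G\<inverse>)"
  unfolding piso_def by blast

lemma countable_converse:
  assumes "countable r"
  shows "countable (r\<inverse>)"
proof -
  have "r\<inverse> = prod.swap ` r" by force
  then show ?thesis using assms by simp
qed

lemma model_sectioned_pair:
  assumes "is_model M ACVF_dag" "is_model N ACVF_dag"
  shows "sectioned_pair (VF_ring M) (vle M) (rho M) (VF_ring N) (vle N) (rho N)"
proof -
  interpret M: ACVF_dag_model M by (rule is_model_ACVF_dag_model[OF assms(1)])
  interpret N: ACVF_dag_model N by (rule is_model_ACVF_dag_model[OF assms(2)])
  show ?thesis
    by (intro sectioned_pair.intro sectioned_pair_axioms.intro M.VF_sectioned_field N.VF_sectioned_field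
        M.VF.peval_root N.VF.peval_root)
qed

lemma piso_iff_partial_iso:
  assumes "is_model M ACVF_dag" "is_model N ACVF_dag"
  shows "piso M N G \<longleftrightarrow>
    sectioned_pair.partial_iso (VF_ring M) (vle M) (rho M) (VF_ring N) (vle N) (rho N) G"
proof -
  interpret M: ACVF_dag_model M by (rule is_model_ACVF_dag_model[OF assms(1)])
  interpret N: ACVF_dag_model N by (rule is_model_ACVF_dag_model[OF assms(2)])
  interpret sectioned_pair "VF_ring M" "vle M" "rho M" "VF_ring N" "vle N" "rho N"
    by (rule model_sectioned_pair[OF assms])
  show ?thesis
  proof
    assume p: "piso M N G"
    have "subring G P"
    proof (rule P.subringI)
      show "G \<subseteq> carrier P" "\<one>\<^bsub>P\<^esub> \<in> G" using p by (auto simp: piso_def)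
      fix g h assume "g \<in> G" "h \<in> G"
      then obtain a b c d where gh: "g = (a, b)" "h = (c, d)" "(a, b) \<in> G" "(c, d) \<in> G" by (cases g; cases h) auto
      show "\<ominus>\<^bsub>P\<^esub> g \<in> G" using piso_D[OF p gh(3)] gh M.v_neg N.v_neg by simp
      show "g \<otimes>\<^bsub>P\<^esub> h \<in> G" "g \<oplus>\<^bsub>P\<^esub> h \<in> G" using piso_D(5,6)[OF p gh(3,4)] gh by simp_all
    qed
    moreover have "\<forall>(a, b)\<in>G. (rho M a, rho N b) \<in> G" "\<forall>(a, b)\<in>G. \<forall>(c, d)\<in>G. vle M a c \<longleftrightarrow> vle N b d"
      using p unfolding piso_def by blast+
    ultimately show "partial_iso G" unfolding partial_iso_def by blast
  next
    assume p: "partial_iso G"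
    note ops = G_ops[OF p]
    show "piso M N G"
      unfolding piso_def
    proof (intro conjI)
      show "G \<subseteq> VF M \<times> VF N" using G_carrier[OF p] by auto
      show "(v_zero M, v_zero N) \<in> G" "(v_one M, v_one N) \<in> G" using ops(1,2) by simp_all
      have neg: "(v_neg M a, v_neg N b) \<in> G" if "(a, b) \<in> G" for a b
        using ops(5)[OF that] M.v_neg N.v_neg G_carrier[OF p that] by simp
      have op: "(v_add M a c, v_add N b d) \<in> G" "(v_mul M a c, v_mul N b d) \<in> G"
        if "(a, b) \<in> G" "(c, d) \<in> G" for a b c d
        using ops(3,4)[OF that] by simp_all
      show "\<forall>(a, b)\<in>G. (v_neg M a, v_neg N b) \<in> G \<and> (rho M a, rho N b) \<in> G \<and>
        (\<forall>(c, d)\<in>G. (v_add M a c, v_add N b d) \<in> G \<and> (v_mul M a c, v_mul N b d) \<in> G \<and> (vle M a c \<longleftrightarrow> vle N b d))"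
      proof clarify
        fix a b assume ab: "(a, b) \<in> G"
        show "(v_neg M a, v_neg N b) \<in> G \<and> (rho M a, rho N b) \<in> G \<and>
          (\<forall>(c, d)\<in>G. (v_add M a c, v_add N b d) \<in> G \<and> (v_mul M a c, v_mul N b d) \<in> G \<and> (vle M a c \<longleftrightarrow> vle N b d))"
          using neg[OF ab] ops(8)[OF ab] op[OF ab] G_val[OF p ab] by auto
      qed
    qed
  qed
qed

text \<open>Each basic condition is a formula about variable 0. Condition k has its own variables 2k
  + 1 and 2k + 2 for parameters, so a single assignment serves all conditions at once.\<close>

lemma model_saturated_pair:
  assumes M: "is_model M ACVF_dag" and N: "is_model N ACVF_dag" and sat: "saturated_struct N"
  shows "saturated_pair (VF_ring M) (vle M) (rho M) (VF_ring N) (vle N) (rho N)"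
proof -
  interpret M: ACVF_dag_model M by (rule is_model_ACVF_dag_model[OF M])
  interpret N: ACVF_dag_model N by (rule is_model_ACVF_dag_model[OF N])
  interpret sectioned_pair "VF_ring M" "vle M" "rho M" "VF_ring N" "vle N" "rho N"
    by (rule model_sectioned_pair[OF M N])
  have str: "v_zero N \<in> VF N" "r_zero N \<in> RV0 N" using N.struct by (auto simp: is_structure_def)
  show ?thesis
  proof (rule saturated_pair.intro[OF sectioned_pair_axioms saturated_pair_axioms.intro])
    fix \<P> assume cnt: "countable \<P>" and basic: "\<P> \<subseteq> basic_conditions (VF_ring N) (vle N) (rho N)"
      and fin: "\<And>F. finite F \<Longrightarrow> F \<subseteq> \<P> \<Longrightarrow> \<exists>y\<in>carrier (VF_ring N). \<forall>\<phi>\<in>F. \<phi> y"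
    show "\<exists>y\<in>carrier (VF_ring N). \<forall>\<phi>\<in>\<P>. \<phi> y"
    proof (cases "\<P> = {}")
      case True
      then show ?thesis by (intro bexI[of _ "v_zero N"]) simp_all
    next
      case False
      define \<psi> where "\<psi> = from_nat_into \<P>"
      have \<psi>: "range \<psi> = \<P>" using range_from_nat_into[OF False cnt] by (simp add: \<psi>_def)
      have "\<exists>a b \<Phi>. a \<in> VF N \<and> b \<in> VF N \<and> (\<forall>e f y. e (2 * k + 1) = a \<longrightarrow> e (2 * k + 2) = b \<longrightarrow> y \<in> VF N \<longrightarrow>
          (sat N (e(0 := y)) f \<Phi> \<longleftrightarrow> \<psi> k y))" for k
      proof -
        have "\<psi> k \<in> basic_conditions (VF_ring N) (vle N) (rho N)" using \<psi> basic by blast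
        then consider (1) a b where "a \<in> VF N" "b \<in> VF N" "\<psi> k = (\<lambda>y. rho N (y \<ominus>\<^bsub>VF_ring N\<^esub> a) = b)"
          | (2) a p q where "a \<in> VF N" "\<psi> k = (\<lambda>y. rho N y = y \<and> y \<noteq> a \<and> (vle N y a \<longleftrightarrow> p) \<and> (vle N a y \<longleftrightarrow> q))"
          unfolding basic_conditions_def by auto
        then show ?thesis
        proof cases
          case 1
          let ?\<Phi> = "Sn (Rv (VAdd (VVar 0) (VNeg (VVar (2 * k + 1))))) \<doteq>\<^sub>v VVar (2 * k + 2)"
          have "sat N (e(0 := y)) f ?\<Phi> \<longleftrightarrow> \<psi> k y" if "e (2 * k + 1) = a" "e (2 * k + 2) = b" "y \<in> VF N" for e f y
            using that 1 N.v_neg by (simp add: rho_def a_minus_def)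
          then show ?thesis using 1(1,2) by blast
        next
          case 2
          let ?x = "VVar 0" and ?a = "VVar (2 * k + 1)"
          \<comment> \<open>Here \<open>p\<close> and \<open>q\<close> are truth values; they decide
            whether the atomic formula or its negation is taken.\<close>
          define lit where "lit p \<phi> = (if p then \<phi> else \<^bold>\<not> \<phi>)" for p \<phi>
          have lit: "sat N e f (lit p \<phi>) \<longleftrightarrow> (sat N e f \<phi> \<longleftrightarrow> p)" for e f p \<phi> by (auto simp: lit_def)
          let ?\<Phi> = "Sn (Rv ?x) \<doteq>\<^sub>v ?x \<^bold>\<and> \<^bold>\<not> ?x \<doteq>\<^sub>v ?a \<^bold>\<and> lit p (Rv ?x \<preceq>\<^sub>r Rv ?a) \<^bold>\<and> lit q (Rv ?a \<preceq>\<^sub>r Rv ?x)"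
          have "sat N (e(0 := y)) f ?\<Phi> \<longleftrightarrow> \<psi> k y" if "e (2 * k + 1) = a" for e f y
            using that 2 by (simp add: rho_def vle_def lit)
          then show ?thesis using 2(1) by blast
        qed
      qed
      then obtain a b \<Phi> where ab: "\<And>k. a k \<in> VF N" "\<And>k. b k \<in> VF N" and
        \<Phi>: "\<And>k e f y. e (2 * k + 1) = a k \<Longrightarrow> e (2 * k + 2) = b k \<Longrightarrow> y \<in> VF N \<Longrightarrow> sat N (e(0 := y)) f (\<Phi> k) \<longleftrightarrow> \<psi> k y"
        by metis
      define e where "e i = (if i = 0 then v_zero N else if odd i then a (i div 2) else b (i div 2 - 1))" for i
      have e: "e (2 * k + 1) = a k" "e (2 * k + 2) = b k" for k by (simp_all add: e_def)
      have range: "range e \<subseteq> VF N" "range (\<lambda>_. r_zero N) \<subseteq> RV0 N" using ab str by (auto simp: e_def)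
      have sat_iff: "sat N (e(0 := y)) (\<lambda>_. r_zero N) (\<Phi> k) \<longleftrightarrow> \<psi> k y" if "y \<in> VF N" for y k
        by (rule \<Phi>[OF e that])
      have "\<exists>x\<in>VF N. \<forall>k<K. sat N (e(0 := x)) (\<lambda>_. r_zero N) (\<Phi> k)" for K
      proof -
        have "\<exists>y\<in>carrier (VF_ring N). \<forall>\<phi>\<in>\<psi> ` {..<K}. \<phi> y" by (rule fin) (use \<psi> in auto)
        then show ?thesis using sat_iff by auto
      qed
      then have "\<exists>x\<in>VF N. \<forall>k. sat N (e(0 := x)) (\<lambda>_. r_zero N) (\<Phi> k)"
        using sat range unfolding saturated_struct_def by blast
      then obtain y where "y \<in> VF N" "\<And>k. \<psi> k y" using sat_iff by blast
      then show ?thesis unfolding \<psi>[symmetric] by auto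
    qed
  qed (use N.residue_field_infinite N.nontrivial_valuation in simp_all)
qed

text \<open>A countable elementary substructure of \<open>M\<close> that contains c and the domain
  of \<open>G\<close> is again a model. By \<open>embedding\<close> it is mapped as a whole, so c
  receives an image while the new graph stays countable.\<close>

lemma forth:
  assumes M: "is_model M ACVF_dag" and N: "is_model N ACVF_dag" and sat: "saturated_struct N"
    and G: "piso M N G" "countable G" and c: "c \<in> VF M"
  shows "\<exists>G'. piso M N G' \<and> countable G' \<and> G \<subseteq> G' \<and> (\<exists>d. (c, d) \<in> G')"
proof -
  have str: "is_structure M" using M by (simp add: is_model_def)
  have A0: "insert c (fst ` G) \<subseteq> VF M" "countable (insert c (fst ` G))"
    using G c unfolding piso_def by auto
  obtain A B where AB: "insert c (fst ` G) \<subseteq> A" "countable A" "A \<subseteq> VF M" "B \<subseteq> RV0 M"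
    and str': "is_structure (M\<lparr>VF := A, RV0 := B\<rparr>)"
    and el: "\<And>e f \<phi>. range e \<subseteq> A \<Longrightarrow> range f \<subseteq> B \<Longrightarrow> sat (M\<lparr>VF := A, RV0 := B\<rparr>) e f \<phi> = sat M e f \<phi>"
    by (rule countable_elementary_substructure[OF str A0 empty_subsetI countable_empty]) (rule that)
  let ?M = "M\<lparr>VF := A, RV0 := B\<rparr>"
  have M': "is_model ?M ACVF_dag"
    unfolding is_model_def holds_def
  proof (intro conjI ballI allI impI)
    fix \<sigma> and e f :: "nat \<Rightarrow> _" assume \<sigma>: "\<sigma> \<in> ACVF_dag" and "range e \<subseteq> VF ?M" "range f \<subseteq> RV0 ?M"
    then have ef: "range e \<subseteq> A" "range f \<subseteq> B" by simp_all
    then have "range e \<subseteq> VF M" "range f \<subseteq> RV0 M" using AB(3,4) by blast+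
    then have "sat M e f \<sigma>" using M \<sigma> unfolding is_model_def holds_def by blast
    then show "sat ?M e f \<sigma>" using el[OF ef] by simp
  qed (rule str')
  have same: "vle ?M = vle M" "rho ?M = rho M" by (simp_all add: vle_def rho_def fun_eq_iff)
  have sub: "piso ?M N H \<longleftrightarrow> piso M N H" if "fst ` H \<subseteq> A" for H
  proof -
    have "H \<subseteq> A \<times> VF N \<longleftrightarrow> H \<subseteq> VF M \<times> VF N" using that AB(3) by force
    then show ?thesis by (simp add: piso_def same)
  qed
  interpret saturated_pair "VF_ring ?M" "vle ?M" "rho ?M" "VF_ring N" "vle N" "rho N"
    by (rule model_saturated_pair[OF M' N sat])
  have "piso ?M N G" using sub[of G] AB(1) G(1) by simp
  then have "partial_iso G" using piso_iff_partial_iso[OF M' N] by simp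
  moreover have car: "carrier (VF_ring ?M) = A" by (simp add: VF_ring_def)
  ultimately obtain G' where G': "partial_iso G'" "G \<subseteq> G'" "fst ` G' = A"
    using embedding[of G] AB(2) by auto
  have "countable G'" using partial_iso_countable[OF _ G'(1)] car AB(2) by simp
  moreover have "piso M N G'" using piso_iff_partial_iso[OF M' N] G'(1,3) sub[of G'] by simp
  moreover have "c \<in> fst ` G'" using G'(3) AB(1) by simp
  ultimately show ?thesis using G'(2) by force
qed

text \<open>The relation between the RV-sorts that a partial isomorphism induces through the sections;
  the section does not distinguish \<open>0\<close> from \<open>\<infinity>\<close>.\<close>

definition rel_RV :: "('v, 'r) struct \<Rightarrow> ('w, 's) struct \<Rightarrow> ('v \<times> 'w) set \<Rightarrow> 'r \<Rightarrow> 's \<Rightarrow> bool" where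
  "rel_RV M N G s t \<longleftrightarrow> s \<in> RV0 M \<and> t \<in> RV0 N \<and> (s = r_zero M \<longleftrightarrow> t = r_zero N) \<and> (s_sn M s, s_sn N t) \<in> G"

lemma rel_RV_converse: "rel_RV M N G s t \<Longrightarrow> rel_RV N M (G\<inverse>) t s"
  by (auto simp: rel_RV_def)

section \<open>Recovering the RV-sort from VF\<close>

context ACVF_dag_model
begin

lemma sn_eq_zero_iff: "t \<in> RV0 M \<Longrightarrow> s_sn M t = v_zero M \<longleftrightarrow> t = r_zero M \<or> t = r_inf M"
  using sn_nonzero[of t] sn_zero sn_inf by (auto simp: RVx_def)

lemma zero_RV0: "r_zero M \<in> RV0 M" and inf_RV0: "r_inf M \<in> RV0 M"
  using struct by (auto simp: is_structure_def)

lemma RV_iff: "t \<in> RV M \<longleftrightarrow> t \<in> RV0 M \<and> t \<noteq> r_zero M"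
  by (auto simp: RV_def)

lemma le_iff_vle: "s \<in> RV M \<Longrightarrow> t \<in> RV M \<Longrightarrow> r_le M s t \<longleftrightarrow> vle M (s_sn M s) (s_sn M t)"
  by (simp add: vle_def rv_sn)

lemma Kx_iff_vle: "t \<in> RV0 M \<Longrightarrow> r_Kx M t \<longleftrightarrow> t \<noteq> r_zero M \<and> vle M (s_sn M t) (v_one M) \<and> vle M (v_one M) (s_sn M t)"
proof -
  assume t: "t \<in> RV0 M"
  have "r_Kx M t \<longleftrightarrow> t \<in> Kx M" using t by (simp add: Kx_def)
  also have "\<dots> \<longleftrightarrow> t \<in> RV M \<and> r_le M t (r_one M) \<and> r_le M (r_one M) t" using Kx by blast
  also have "\<dots> \<longleftrightarrow> t \<noteq> r_zero M \<and> vle M (s_sn M t) (v_one M) \<and> vle M (v_one M) (s_sn M t)"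
    using t le_iff_vle[of t "r_one M"] le_iff_vle[of "r_one M" t] le_one_RV sn_one by (auto simp: RV_iff)
  finally show ?thesis .
qed

lemma sn_inject: "s \<in> RV M \<Longrightarrow> t \<in> RV M \<Longrightarrow> s_sn M s = s_sn M t \<longleftrightarrow> s = t"
  using rv_sn by metis

text \<open>Both 0 and \<infinity> are sent to 0, which makes \<open>sn\<close> multiplicative on
  the whole sort. The second part separates these two possible values of a product, where
  \<infinity> absorbs 0.\<close>

lemma sn_mul:
  assumes "s \<in> RV0 M" "t \<in> RV0 M"
  shows "s_sn M (r_mul M s t) = v_mul M (s_sn M s) (s_sn M t)"
    "r_mul M s t = r_zero M \<longleftrightarrow> s = r_zero M \<and> t \<noteq> r_inf M \<or> t = r_zero M \<and> s \<noteq> r_inf M"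
proof -
  consider "s = r_inf M" | "t = r_inf M" | "s \<noteq> r_inf M" "t \<noteq> r_inf M" "s = r_zero M \<or> t = r_zero M"
    | "s \<in> RVx M" "t \<in> RVx M" using assms by (auto simp: RVx_def)
  then have "s_sn M (r_mul M s t) = v_mul M (s_sn M s) (s_sn M t) \<and>
    (r_mul M s t = r_zero M \<longleftrightarrow> s = r_zero M \<and> t \<noteq> r_inf M \<or> t = r_zero M \<and> s \<noteq> r_inf M)"
  proof cases
    case 1
    then show ?thesis using assms inf_mult'[of t] sn_inf sn_VF[of t] zero_inf by auto
  next
    case 2
    then show ?thesis using assms inf_mult[of s] sn_inf sn_VF[of s] zero_inf by auto
  next
    case 3
    then show ?thesis using assms zero_mult[of s] zero_mult[of t] sn_zero sn_VF by auto
  next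
    case 4
    then show ?thesis using sn_mult[of s t] RVx.m_closed[of s t] by (auto simp: RVx_def)
  qed
  then show "s_sn M (r_mul M s t) = v_mul M (s_sn M s) (s_sn M t)"
    "r_mul M s t = r_zero M \<longleftrightarrow> s = r_zero M \<and> t \<noteq> r_inf M \<or> t = r_zero M \<and> s \<noteq> r_inf M" by blast+
qed

lemma sn_residue:
  assumes k: "k \<in> insert (r_zero M) (Kx M)"
  shows "s_sn M k \<in> val_ring M" "residue M (s_sn M k) = k" "rho M (s_sn M k) = s_sn M k"
proof -
  have "s_sn M k \<in> val_ring M \<and> residue M (s_sn M k) = k \<and> rho M (s_sn M k) = s_sn M k"
  proof (cases "k = r_zero M")
    case True
    then show ?thesis
      using sn_zero rho_zero rv_zero le_inf[OF le_one_RV] inf_notin by (simp add: val_ring_def residue_def)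
  next
    case False
    then have k': "k \<in> Kx M" using k by simp
    then have rv: "s_rv M (s_sn M k) = k" using rv_sn RVx_RV Kx_RVx by blast
    then show ?thesis using k' Kx sn_VF[OF Kx_RV0[OF k']] by (auto simp: val_ring_def residue_def rho_def Kx_def)
  qed
  then show "s_sn M k \<in> val_ring M" "residue M (s_sn M k) = k" "rho M (s_sn M k) = s_sn M k" by auto
qed

text \<open>The image of K is closed under sums; additivity of the residue map, a left inverse of
  \<open>sn\<close> on K, identifies the preimage of the sum.\<close>

lemma sn_K_sum:
  assumes "k \<in> insert (r_zero M) (Kx M)" "l \<in> insert (r_zero M) (Kx M)"
  shows "s_sn M (r_add M k l) = v_add M (s_sn M k) (s_sn M l)"
proof -
  have sum: "\<exists>u\<in>insert (r_zero M) (Kx M). v_add M (s_sn M k) (s_sn M l) = s_sn M u"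
  proof (cases "k = r_zero M \<or> l = r_zero M")
    case True
    then show ?thesis using assms sn_zero VF.l_zero[of "s_sn M l"] VF.r_zero[of "s_sn M k"] sn_residue(1)
      by (auto simp: val_ring_def)
  next
    case False
    then show ?thesis using sn_sum[of k l] assms sn_zero by auto
  qed
  then obtain u where u: "u \<in> insert (r_zero M) (Kx M)" "v_add M (s_sn M k) (s_sn M l) = s_sn M u" by blast
  then have "u = r_add M k l"
    using residue_arith[OF sn_residue(1)[OF assms(1)] sn_residue(1)[OF assms(2)]] sn_residue(2) assms by metis
  then show ?thesis using u by simp
qed

lemma sn_K_neg:
  assumes "k \<in> insert (r_zero M) (Kx M)"
  shows "s_sn M (r_neg M k) = v_neg M (s_sn M k)"
proof -
  have n: "r_neg M k \<in> insert (r_zero M) (Kx M)" "r_add M k (r_neg M k) = r_zero M"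
    using assms r_neg[OF assms] K.a_inv_closed[of k] K.r_neg[of k] by simp_all
  have V: "s_sn M k \<in> VF M" "s_sn M (r_neg M k) \<in> VF M" using sn_residue(1) assms n by (auto simp: val_ring_def)
  have "v_add M (s_sn M k) (s_sn M (r_neg M k)) = v_zero M"
    using sn_K_sum[OF assms n(1)] n(2) sn_zero by simp
  then have "v_add M (s_sn M (r_neg M k)) (s_sn M k) = v_zero M" using VF.a_comm V by simp
  then show ?thesis using VF.minus_equality[of "s_sn M (r_neg M k)" "s_sn M k"] V v_neg by simp
qed

end

locale ACVF_dag_pair = M: ACVF_dag_model M + N: ACVF_dag_model N
  for M :: "('v, 'r) struct" and N :: "('w, 's) struct" +
  fixes G
  assumes G: "piso M N G"
begin

lemma G_zero_iff: "(a, b) \<in> G \<Longrightarrow> a = v_zero M \<longleftrightarrow> b = v_zero N"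
  using piso_D(7)[OF G, of "v_zero M" "v_zero N" a b] piso_D(1,2)[OF G, of a b] G M.zero_vle N.zero_vle
    M.vle_zero[of "v_zero M"] N.vle_zero[of "v_zero N"] by (auto simp: piso_def)

lemma G_eq_iff:
  assumes "(a, b) \<in> G" "(c, d) \<in> G"
  shows "a = c \<longleftrightarrow> b = d"
proof -
  have cl: "a \<in> VF M" "c \<in> VF M" "b \<in> VF N" "d \<in> VF N" using piso_D(1,2)[OF G] assms by auto
  have "(v_add M a (v_neg M c), v_add N b (v_neg N d)) \<in> G" using piso_D[OF G] assms by blast
  from G_zero_iff[OF this] show ?thesis
    using M.VF.r_right_minus_eq[of a c] N.VF.r_right_minus_eq[of b d] cl M.v_neg[of c] N.v_neg[of d]
    by (simp add: a_minus_def)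
qed

lemma rel_inf: assumes "rel_RV M N G s t" shows "s = r_inf M \<longleftrightarrow> t = r_inf N"
  using assms G_zero_iff[of "s_sn M s" "s_sn N t"] M.sn_eq_zero_iff[of s] N.sn_eq_zero_iff[of t] M.zero_inf N.zero_inf
  by (auto simp: rel_RV_def)

lemma rel_eq_iff:
  assumes "rel_RV M N G s t" "rel_RV M N G s' t'"
  shows "s = s' \<longleftrightarrow> t = t'"
proof (cases "s = r_zero M \<or> s' = r_zero M")
  case True
  then show ?thesis using assms by (auto simp: rel_RV_def)
next
  case False
  then have "s \<in> RV M" "s' \<in> RV M" "t \<in> RV N" "t' \<in> RV N"
    using assms by (auto simp: rel_RV_def M.RV_iff N.RV_iff)
  then show ?thesis
    using G_eq_iff[of "s_sn M s" "s_sn N t" "s_sn M s'" "s_sn N t'"] assms M.sn_inject N.sn_inject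
    by (auto simp: rel_RV_def)
qed

lemma rel_le_iff:
  assumes "rel_RV M N G s t" "rel_RV M N G s' t'"
  shows "r_le M s s' \<longleftrightarrow> r_le N t t'"
proof (cases "s = r_zero M \<or> s' = r_zero M")
  case True
  then show ?thesis using assms M.le_zero N.le_zero by (auto simp: rel_RV_def)
next
  case False
  then have "s \<in> RV M" "s' \<in> RV M" "t \<in> RV N" "t' \<in> RV N"
    using assms by (auto simp: rel_RV_def M.RV_iff N.RV_iff)
  then show ?thesis
    using piso_D(7)[OF G, of "s_sn M s" "s_sn N t" "s_sn M s'" "s_sn N t'"] assms M.le_iff_vle N.le_iff_vle
    by (auto simp: rel_RV_def)
qed

lemma rel_Kx_iff: assumes "rel_RV M N G s t" shows "r_Kx M s \<longleftrightarrow> r_Kx N t"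
proof -
  have st: "s \<in> RV0 M" "t \<in> RV0 N" "s = r_zero M \<longleftrightarrow> t = r_zero N" "(s_sn M s, s_sn N t) \<in> G"
    using assms by (auto simp: rel_RV_def)
  have one: "(v_one M, v_one N) \<in> G" using G by (simp add: piso_def)
  show ?thesis
    using M.Kx_iff_vle[OF st(1)] N.Kx_iff_vle[OF st(2)] st(3) piso_D(7)[OF G st(4) one] piso_D(7)[OF G one st(4)] by blast
qed

lemma rel_K_iff: "rel_RV M N G s t \<Longrightarrow> s \<in> insert (r_zero M) (Kx M) \<longleftrightarrow> t \<in> insert (r_zero N) (Kx N)"
  using rel_Kx_iff[of s t] by (auto simp: rel_RV_def Kx_def)

lemma rel_rv: assumes "(a, b) \<in> G" shows "rel_RV M N G (s_rv M a) (s_rv N b)"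
  using M.rv_RV[of a] N.rv_RV[of b] piso_D[OF G assms] by (auto simp: rel_RV_def M.RV_iff N.RV_iff rho_def)

lemma K_sn_zero: "t \<in> insert (r_zero N) (Kx N) \<Longrightarrow> s_sn N t = v_zero N \<longleftrightarrow> t = r_zero N"
  "s \<in> insert (r_zero M) (Kx M) \<Longrightarrow> s_sn M s = v_zero M \<longleftrightarrow> s = r_zero M"
  using M.sn_nonzero N.sn_nonzero M.Kx_RVx N.Kx_RVx M.sn_zero N.sn_zero by blast+

lemma rel_zero: "rel_RV M N G (r_zero M) (r_zero N)"
  using G M.zero_RV0 N.zero_RV0 by (simp add: rel_RV_def M.sn_zero N.sn_zero piso_def)

lemma rel_K:
  assumes "s \<in> insert (r_zero M) (Kx M)" "t \<in> insert (r_zero N) (Kx N)" "(s_sn M s, s_sn N t) \<in> G"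
  shows "rel_RV M N G s t"
  using assms G_zero_iff[OF assms(3)] K_sn_zero(1)[of t] K_sn_zero(2)[of s] M.zero_RV0 N.zero_RV0 by (auto simp: rel_RV_def Kx_def)

text \<open>For sums and negatives in the RV-sort, membership in K is preserved and decides between
  the field operation and the default value. For products, being 0 has to be followed separately, as
  \<open>sn\<close> does not see it.\<close>

lemma eval_related:
  assumes e: "\<And>i. (e i, e' i) \<in> G" and f: "\<And>i. rel_RV M N G (f i) (f' i)"
  shows "(veval M e f t, veval N e' f' t) \<in> G" "rel_RV M N G (reval M e f u) (reval N e' f' u)"
proof (induction t and u)
  case (VAdd t1 t2)
  then show ?case using piso_D(5)[OF G] by simp
next
  case (VNeg t)
  then show ?case using piso_D(3)[OF G] by simp
next
  case (VMul t1 t2)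
  then show ?case using piso_D(6)[OF G] by simp
next
  case (Sn u)
  then show ?case by (simp add: rel_RV_def)
next
  case RZero
  then show ?case using rel_zero by simp
next
  case ROne
  then show ?case
    using G M.RVx.one_closed N.RVx.one_closed M.sn_one N.sn_one by (auto simp: rel_RV_def RVx_def piso_def)
next
  case RInf
  then show ?case
    using G M.inf_RV0 N.inf_RV0 M.sn_inf N.sn_inf M.zero_inf N.zero_inf by (auto simp: rel_RV_def piso_def)
next
  case (RAdd u1 u2)
  define s1 and s2 and t1 and t2 where d: "s1 = reval M e f u1" "s2 = reval M e f u2" "t1 = reval N e' f' u1" "t2 = reval N e' f' u2"
  have r: "rel_RV M N G s1 t1" "rel_RV M N G s2 t2" using RAdd by (simp_all add: d)
  then have RV0: "s1 \<in> RV0 M" "s2 \<in> RV0 M" "t1 \<in> RV0 N" "t2 \<in> RV0 N" by (auto simp: rel_RV_def)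
  have "rel_RV M N G (r_add M s1 s2) (r_add N t1 t2)"
  proof (cases "s1 \<in> insert (r_zero M) (Kx M) \<and> s2 \<in> insert (r_zero M) (Kx M)")
    case True
    then have K: "t1 \<in> insert (r_zero N) (Kx N)" "t2 \<in> insert (r_zero N) (Kx N)" using rel_K_iff r by blast+
    show ?thesis
    proof (rule rel_K)
      show "r_add M s1 s2 \<in> insert (r_zero M) (Kx M)" "r_add N t1 t2 \<in> insert (r_zero N) (Kx N)"
        using M.K.a_closed[of s1 s2] N.K.a_closed[of t1 t2] True K by simp_all
      show "(s_sn M (r_add M s1 s2), s_sn N (r_add N t1 t2)) \<in> G"
        using True K r piso_D(5)[OF G] by (simp add: M.sn_K_sum N.sn_K_sum rel_RV_def)
    qed
  next
    case False
    then have "\<not> (t1 \<in> insert (r_zero N) (Kx N) \<and> t2 \<in> insert (r_zero N) (Kx N))" using rel_K_iff r by blast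
    then show ?thesis using M.add_default[OF RV0(1,2) False] N.add_default[OF RV0(3,4)] rel_zero by simp
  qed
  then show ?case by (simp add: d)
next
  case (RNeg u)
  define s and t where d: "s = reval M e f u" "t = reval N e' f' u"
  have r: "rel_RV M N G s t" using RNeg by (simp add: d)
  then have RV0: "s \<in> RV0 M" "t \<in> RV0 N" by (auto simp: rel_RV_def)
  have "rel_RV M N G (r_neg M s) (r_neg N t)"
  proof (cases "s \<in> insert (r_zero M) (Kx M)")
    case True
    then have K: "t \<in> insert (r_zero N) (Kx N)" using rel_K_iff r by blast
    show ?thesis
    proof (rule rel_K)
      show "r_neg M s \<in> insert (r_zero M) (Kx M)" "r_neg N t \<in> insert (r_zero N) (Kx N)"
        using M.K.a_inv_closed[of s] N.K.a_inv_closed[of t] True K M.r_neg[of s] N.r_neg[of t] by simp_all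
      show "(s_sn M (r_neg M s), s_sn N (r_neg N t)) \<in> G"
        using True K r piso_D(3)[OF G] by (simp add: M.sn_K_neg N.sn_K_neg rel_RV_def)
    qed
  next
    case False
    then have "t \<notin> insert (r_zero N) (Kx N)" using rel_K_iff r by blast
    then show ?thesis using M.neg_default[OF RV0(1) False] N.neg_default[OF RV0(2)] rel_zero by simp
  qed
  then show ?case by (simp add: d)
next
  case (RMul u1 u2)
  define s1 and s2 and t1 and t2 where d: "s1 = reval M e f u1" "s2 = reval M e f u2" "t1 = reval N e' f' u1" "t2 = reval N e' f' u2"
  have r: "rel_RV M N G s1 t1" "rel_RV M N G s2 t2" using RMul by (simp_all add: d)
  then have RV0: "s1 \<in> RV0 M" "s2 \<in> RV0 M" "t1 \<in> RV0 N" "t2 \<in> RV0 N" by (auto simp: rel_RV_def)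
  have "r_mul M s1 s2 \<in> RV0 M" "r_mul N t1 t2 \<in> RV0 N"
    using RV0 M.struct N.struct by (simp_all add: is_structure_def)
  moreover have "r_mul M s1 s2 = r_zero M \<longleftrightarrow> r_mul N t1 t2 = r_zero N"
    unfolding M.sn_mul(2)[OF RV0(1,2)] N.sn_mul(2)[OF RV0(3,4)] using rel_inf r by (auto simp: rel_RV_def)
  moreover have "(s_sn M (r_mul M s1 s2), s_sn N (r_mul N t1 t2)) \<in> G"
    unfolding M.sn_mul(1)[OF RV0(1,2)] N.sn_mul(1)[OF RV0(3,4)] using r piso_D(6)[OF G] by (auto simp: rel_RV_def)
  ultimately show ?case by (simp add: d rel_RV_def)
next
  case (Rv t)
  then show ?case using rel_rv by simp
qed (use e f G in \<open>auto simp: piso_def\<close>)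

end

text \<open>The element sn(s) is given an image d, and rv(d) becomes the image of s. Only s = 0 is
  not recovered from sn(s) by rv; it is paired with 0.\<close>

lemma forth_RV:
  assumes M: "is_model M ACVF_dag" and N: "is_model N ACVF_dag" and sat: "saturated_struct N"
    and G: "piso M N G" "countable G" and s: "s \<in> RV0 M"
  shows "\<exists>G'. piso M N G' \<and> countable G' \<and> G \<subseteq> G' \<and> (\<exists>t. rel_RV M N G' s t)"
proof -
  interpret M: ACVF_dag_model M by (rule is_model_ACVF_dag_model[OF M])
  interpret N: ACVF_dag_model N by (rule is_model_ACVF_dag_model[OF N])
  obtain G' d where G': "piso M N G'" "countable G'" "G \<subseteq> G'" "(s_sn M s, d) \<in> G'"
    using forth[OF M N sat G M.sn_VF[OF s]] by blast
  interpret P: ACVF_dag_pair M N G' by unfold_locales (rule G'(1))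
  show ?thesis
  proof (cases "s = r_zero M")
    case True
    then show ?thesis using G' P.rel_zero by blast
  next
    case False
    then have "s_rv M (s_sn M s) = s" using s M.rv_sn M.RV_iff by blast
    then have "rel_RV M N G' s (s_rv N d)" using P.rel_rv[OF G'(4)] by simp
    then show ?thesis using G' by blast
  qed
qed

text \<open>A witness in \<open>N\<close> is brought back by a forth step for the converse graph,
  which is why both structures are saturated. The graph is generalised in the induction, since every
  quantifier enlarges it.\<close>

theorem back_and_forth:
  assumes M: "is_model M ACVF_dag" "saturated_struct M" and N: "is_model N ACVF_dag" "saturated_struct N"
    and "piso M N G" "countable G" "\<And>i. (e i, e' i) \<in> G" "\<And>i. rel_RV M N G (f i) (f' i)"
  shows "sat M e f \<phi> \<longleftrightarrow> sat N e' f' \<phi>"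
  using assms(5-)
proof (induction \<phi> arbitrary: G e e' f f')
  case (VEx n \<phi>)
  have mono: "rel_RV M N G s t \<Longrightarrow> G \<subseteq> G' \<Longrightarrow> rel_RV M N G' s t" for G' s t by (auto simp: rel_RV_def)
  have IH: "sat M (e(n := c)) f \<phi> \<longleftrightarrow> sat N (e'(n := d)) f' \<phi>"
    if "piso M N G'" "countable G'" "G \<subseteq> G'" "(c, d) \<in> G'" for G' c d
    by (rule VEx.IH[OF that(1,2)]) (use that VEx.prems mono in auto)
  have 1: "\<exists>d\<in>VF N. sat N (e'(n := d)) f' \<phi>" if c: "c \<in> VF M" "sat M (e(n := c)) f \<phi>" for c
  proof -
    obtain H d where H: "piso M N H" "countable H" "G \<subseteq> H" "(c, d) \<in> H"
      using forth[OF M(1) N VEx.prems(1,2) c(1)] by blast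
    then show ?thesis using IH[OF H] c(2) piso_D(2)[OF H(1,4)] by blast
  qed
  have 2: "\<exists>c\<in>VF M. sat M (e(n := c)) f \<phi>" if d: "d \<in> VF N" "sat N (e'(n := d)) f' \<phi>" for d
  proof -
    obtain H c where H: "piso N M H" "countable H" "G\<inverse> \<subseteq> H" "(d, c) \<in> H"
      using forth[OF N(1) M piso_converse[OF VEx.prems(1)] countable_converse[OF VEx.prems(2)] d(1)] by blast
    have H': "piso M N (H\<inverse>)" "countable (H\<inverse>)" "G \<subseteq> H\<inverse>" "(c, d) \<in> H\<inverse>"
      using piso_converse[OF H(1)] countable_converse[OF H(2)] H(3,4) by auto
    then show ?thesis using IH[OF H'] d(2) piso_D(1)[OF H'(1,4)] by blast
  qed
  show ?case using 1 2 by auto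
next
  case (REx n \<phi>)
  have mono: "rel_RV M N G s t \<Longrightarrow> G \<subseteq> G' \<Longrightarrow> rel_RV M N G' s t" for G' s t by (auto simp: rel_RV_def)
  have IH: "sat M e (f(n := s)) \<phi> \<longleftrightarrow> sat N e' (f'(n := t)) \<phi>"
    if "piso M N G'" "countable G'" "G \<subseteq> G'" "rel_RV M N G' s t" for G' s t
    by (rule REx.IH[OF that(1,2)]) (use that REx.prems mono in auto)
  have 1: "\<exists>t\<in>RV0 N. sat N e' (f'(n := t)) \<phi>" if s: "s \<in> RV0 M" "sat M e (f(n := s)) \<phi>" for s
  proof -
    obtain H t where H: "piso M N H" "countable H" "G \<subseteq> H" "rel_RV M N H s t"
      using forth_RV[OF M(1) N REx.prems(1,2) s(1)] by blast
    then show ?thesis using IH[OF H] s(2) by (auto simp: rel_RV_def)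
  qed
  have 2: "\<exists>s\<in>RV0 M. sat M e (f(n := s)) \<phi>" if t: "t \<in> RV0 N" "sat N e' (f'(n := t)) \<phi>" for t
  proof -
    obtain H s where H: "piso N M H" "countable H" "G\<inverse> \<subseteq> H" "rel_RV N M H t s"
      using forth_RV[OF N(1) M piso_converse[OF REx.prems(1)] countable_converse[OF REx.prems(2)] t(1)] by blast
    have H': "piso M N (H\<inverse>)" "countable (H\<inverse>)" "G \<subseteq> H\<inverse>" "rel_RV M N (H\<inverse>) s t"
      using piso_converse[OF H(1)] rel_RV_converse[OF H(4)] countable_converse[OF H(2)] H(3) by auto
    then show ?thesis using IH[OF H'] t(2) by (auto simp: rel_RV_def)
  qed
  show ?case using 1 2 by auto
next
  case (VEq s t)
  interpret ACVF_dag_pair M N G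
    by (intro ACVF_dag_pair.intro ACVF_dag_pair_axioms.intro is_model_ACVF_dag_model M N VEq.prems)
  show ?case using G_eq_iff eval_related[of e e' f f'] VEq.prems by simp
next
  case (REq s t)
  interpret ACVF_dag_pair M N G
    by (intro ACVF_dag_pair.intro ACVF_dag_pair_axioms.intro is_model_ACVF_dag_model M N REq.prems)
  show ?case using rel_eq_iff eval_related[of e e' f f'] REq.prems by simp
next
  case (InKx t)
  interpret ACVF_dag_pair M N G
    by (intro ACVF_dag_pair.intro ACVF_dag_pair_axioms.intro is_model_ACVF_dag_model M N InKx.prems)
  show ?case using rel_Kx_iff eval_related[of e e' f f'] InKx.prems by simp
next
  case (RLe s t)
  interpret ACVF_dag_pair M N G
    by (intro ACVF_dag_pair.intro ACVF_dag_pair_axioms.intro is_model_ACVF_dag_model M N RLe.prems)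
  show ?case using rel_le_iff eval_related[of e e' f f'] RLe.prems by simp
next
  case (FNot \<phi>)
  then show ?case by simp
next
  case (FAnd \<phi> \<psi>)
  have "sat M e f \<phi> \<longleftrightarrow> sat N e' f' \<phi>" "sat M e f \<psi> \<longleftrightarrow> sat N e' f' \<psi>"
    by (rule FAnd.IH[OF FAnd.prems]; assumption)+
  then show ?case by simp
qed

section \<open>Quantifier elimination\<close>

text \<open>The set \<open>C\<close> is split according to the truth of each formula in
  \<open>L\<close>; on a part where all of them are constant, so is \<open>\<phi>\<close>.\<close>

lemma boolean_combination:
  fixes C :: "(('v, 'r) struct \<times> (nat \<Rightarrow> 'v) \<times> (nat \<Rightarrow> 'r)) set"
  assumes "\<And>\<theta>. \<theta> \<in> set L \<Longrightarrow> qfree \<theta> \<and> fvV \<theta> \<subseteq> V \<and> fvR \<theta> \<subseteq> W"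
    and "\<And>M e f M' e' f'. (M, e, f) \<in> C \<Longrightarrow> (M', e', f') \<in> C \<Longrightarrow>
      (\<forall>\<theta>\<in>set L. sat M e f \<theta> \<longleftrightarrow> sat M' e' f' \<theta>) \<Longrightarrow> sat M e f \<phi> \<Longrightarrow> sat M' e' f' \<phi>"
  shows "\<exists>\<psi>. qfree \<psi> \<and> fvV \<psi> \<subseteq> V \<and> fvR \<psi> \<subseteq> W \<and> (\<forall>(M, e, f)\<in>C. sat M e f \<phi> \<longleftrightarrow> sat M e f \<psi>)"
  using assms
proof (induction L arbitrary: C)
  case Nil
  show ?case
  proof (cases "\<exists>(M, e, f)\<in>C. sat M e f \<phi>")
    case True
    then obtain M e f where C: "(M, e, f) \<in> C" "sat M e f \<phi>" by blast
    have "sat M' e' f' \<phi>" if "(M', e', f') \<in> C" for M' e' f'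
      by (rule Nil.prems(2)[OF C(1) that _ C(2)]) simp
    then show ?thesis by (intro exI[of _ "VZero \<doteq>\<^sub>v VZero"]) auto
  next
    case False
    then show ?thesis by (intro exI[of _ "\<^bold>\<not> VZero \<doteq>\<^sub>v VZero"]) auto
  qed
next
  case (Cons \<theta> L)
  let ?C = "\<lambda>b. {(M, e, f) \<in> C. sat M e f \<theta> \<longleftrightarrow> b}"
  have ex: "\<exists>\<psi>. qfree \<psi> \<and> fvV \<psi> \<subseteq> V \<and> fvR \<psi> \<subseteq> W \<and> (\<forall>(M, e, f)\<in>?C b. sat M e f \<phi> \<longleftrightarrow> sat M e f \<psi>)" for b
  proof (rule Cons.IH)
    fix M e f M' e' f'
    assume "(M, e, f) \<in> ?C b" "(M', e', f') \<in> ?C b" "\<forall>\<theta>\<in>set L. sat M e f \<theta> \<longleftrightarrow> sat M' e' f' \<theta>" "sat M e f \<phi>"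
    then show "sat M' e' f' \<phi>" using Cons.prems(2)[of M e f M' e' f'] by auto
  qed (use Cons.prems(1) in auto)
  obtain \<psi> where \<psi>: "qfree \<psi>" "fvV \<psi> \<subseteq> V" "fvR \<psi> \<subseteq> W" "\<forall>(M, e, f)\<in>?C True. sat M e f \<phi> \<longleftrightarrow> sat M e f \<psi>"
    using ex[of True] by (elim exE conjE)
  obtain \<psi>' where \<psi>': "qfree \<psi>'" "fvV \<psi>' \<subseteq> V" "fvR \<psi>' \<subseteq> W" "\<forall>(M, e, f)\<in>?C False. sat M e f \<phi> \<longleftrightarrow> sat M e f \<psi>'"
    using ex[of False] by (elim exE conjE)
  let ?\<chi> = "(\<theta> \<^bold>\<longrightarrow> \<psi>) \<^bold>\<and> (\<^bold>\<not> \<theta> \<^bold>\<longrightarrow> \<psi>')"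
  have "sat M e f \<phi> \<longleftrightarrow> sat M e f ?\<chi>" if "(M, e, f) \<in> C" for M e f
    using \<psi>(4) \<psi>'(4) that by (cases "sat M e f \<theta>") auto
  moreover have "qfree ?\<chi>" "fvV ?\<chi> \<subseteq> V" "fvR ?\<chi> \<subseteq> W"
    using \<psi>(1-3) \<psi>'(1-3) Cons.prems(1)[of \<theta>] by auto
  ultimately show ?case by blast
qed

text \<open>The pairs of values of terms in the free variables of \<open>\<phi>\<close> form a
  partial isomorphism: term formation gives closure, and agreement on
  \<open>Rv t \<preceq>\<^sub>r Rv s\<close> preserves the valuation.\<close>

lemma qfree_equivalent:
  assumes M: "is_model M ACVF_dag" "saturated_struct M" and N: "is_model N ACVF_dag" "saturated_struct N"
    and ef: "range e \<subseteq> VF M" "range f \<subseteq> RV0 M" "range e' \<subseteq> VF N" "range f' \<subseteq> RV0 N"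
    and agree: "\<And>\<theta>. qfree \<theta> \<Longrightarrow> fvV \<theta> \<subseteq> fvV \<phi> \<Longrightarrow> fvR \<theta> \<subseteq> fvR \<phi> \<Longrightarrow> sat M e f \<theta> \<longleftrightarrow> sat N e' f' \<theta>"
  shows "sat M e f \<phi> \<longleftrightarrow> sat N e' f' \<phi>"
proof -
  interpret M: ACVF_dag_model M by (rule is_model_ACVF_dag_model[OF M(1)])
  interpret N: ACVF_dag_model N by (rule is_model_ACVF_dag_model[OF N(1)])
  define T where "T = {t. vvars_v t \<subseteq> fvV \<phi> \<and> rvars_v t \<subseteq> fvR \<phi>}"
  define G where "G = (\<lambda>t. (veval M e f t, veval N e' f' t)) ` T"
  have GI: "(veval M e f t, veval N e' f' t) \<in> G" if "vvars_v t \<subseteq> fvV \<phi>" "rvars_v t \<subseteq> fvR \<phi>" for t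
    using that by (auto simp: G_def T_def)
  note in_M = eval_in[OF M.struct ef(1,2)] and in_N = eval_in[OF N.struct ef(3,4)]
  have piso: "piso M N G"
    unfolding piso_def
  proof (intro conjI)
    show "G \<subseteq> VF M \<times> VF N" using in_M(1) in_N(1) by (auto simp: G_def)
    show "(v_zero M, v_zero N) \<in> G" "(v_one M, v_one N) \<in> G" using GI[of VZero] GI[of VOne] by simp_all
    show "\<forall>(a, b)\<in>G. (v_neg M a, v_neg N b) \<in> G \<and> (rho M a, rho N b) \<in> G \<and>
       (\<forall>(c, d)\<in>G. (v_add M a c, v_add N b d) \<in> G \<and> (v_mul M a c, v_mul N b d) \<in> G \<and> (vle M a c \<longleftrightarrow> vle N b d))"
    proof clarify
      fix a b assume "(a, b) \<in> G"
      then obtain t where t: "vvars_v t \<subseteq> fvV \<phi>" "rvars_v t \<subseteq> fvR \<phi>" "a = veval M e f t" "b = veval N e' f' t"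
        by (auto simp: G_def T_def)
      have "(v_add M a c, v_add N b d) \<in> G \<and> (v_mul M a c, v_mul N b d) \<in> G \<and> (vle M a c \<longleftrightarrow> vle N b d)"
        if "(c, d) \<in> G" for c d
      proof -
        obtain s where s: "vvars_v s \<subseteq> fvV \<phi>" "rvars_v s \<subseteq> fvR \<phi>" "c = veval M e f s" "d = veval N e' f' s"
          using \<open>(c, d) \<in> G\<close> by (auto simp: G_def T_def)
        show ?thesis
          using GI[of "VAdd t s"] GI[of "VMul t s"] agree[of "Rv t \<preceq>\<^sub>r Rv s"] t s by (simp add: vle_def)
      qed
      then show "(v_neg M a, v_neg N b) \<in> G \<and> (rho M a, rho N b) \<in> G \<and>
         (\<forall>(c, d)\<in>G. (v_add M a c, v_add N b d) \<in> G \<and> (v_mul M a c, v_mul N b d) \<in> G \<and> (vle M a c \<longleftrightarrow> vle N b d))"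
        using GI[of "VNeg t"] GI[of "Sn (Rv t)"] t by (auto simp: rho_def)
    qed
  qed
  interpret P: ACVF_dag_pair M N G by unfold_locales (rule piso)
  \<comment> \<open>\<open>back_and_forth\<close> requires all variables to be related, so those not
    free in \<open>\<phi>\<close> are reset to 0.\<close>
  define e0 where "e0 i = (if i \<in> fvV \<phi> then e i else v_zero M)" for i
  define e0' where "e0' i = (if i \<in> fvV \<phi> then e' i else v_zero N)" for i
  define f0 where "f0 i = (if i \<in> fvR \<phi> then f i else r_zero M)" for i
  define f0' where "f0' i = (if i \<in> fvR \<phi> then f' i else r_zero N)" for i
  have e: "(e0 i, e0' i) \<in> G" for i
    using GI[of "VVar i"] GI[of VZero] by (simp add: e0_def e0'_def)
  \<comment> \<open>Agreement on the equation with \<open>RZero\<close> enters because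
    \<open>sn\<close> does not separate 0 from \<infinity>.\<close>
  have "rel_RV M N G (f i) (f' i)" if "i \<in> fvR \<phi>" for i
    using GI[of "Sn (RVar i)"] agree[of "RVar i \<doteq>\<^sub>r RZero"] in_M(2)[of "RVar i"] in_N(2)[of "RVar i"] that
    by (simp add: rel_RV_def)
  then have f: "rel_RV M N G (f0 i) (f0' i)" for i
    using P.rel_zero by (simp add: f0_def f0'_def)
  have "sat M e f \<phi> \<longleftrightarrow> sat M e0 f0 \<phi>" "sat N e' f' \<phi> \<longleftrightarrow> sat N e0' f0' \<phi>"
    by (rule sat_cong; simp add: e0_def e0'_def f0_def f0'_def)+
  moreover have "sat M e0 f0 \<phi> \<longleftrightarrow> sat N e0' f0' \<phi>"
    by (rule back_and_forth[OF M N piso _ e f]) (simp add: G_def)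
  ultimately show ?thesis by simp
qed

theorem theorem3p14:
  shows "admits_QE ACVF_dag"
  unfolding admits_QE_def
proof (rule allI, rule ccontr)
  fix \<phi>
  assume neg: "\<not> (\<exists>\<psi>. qfree \<psi> \<and> fvV \<psi> \<subseteq> fvV \<phi> \<and> fvR \<psi> \<subseteq> fvR \<phi> \<and> ACVF_dag \<TTurnstile> (\<phi> \<^bold>\<longleftrightarrow> \<psi>))"
  define Q where "Q = {\<theta>. qfree \<theta> \<and> fvV \<theta> \<subseteq> fvV \<phi> \<and> fvR \<theta> \<subseteq> fvR \<phi>}"
  have "(VZero \<doteq>\<^sub>v VZero) \<in> Q" by (simp add: Q_def)
  then have "Q \<noteq> {}" by blast
  define \<theta> where "\<theta> = from_nat_into Q"
  have \<theta>: "range \<theta> = Q" unfolding \<theta>_def by (rule range_from_nat_into[OF \<open>Q \<noteq> {}\<close>]) simp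
  define C where "C = {(M :: (nat, nat) struct, e :: nat \<Rightarrow> nat, f :: nat \<Rightarrow> nat). is_model M ACVF_dag \<and> range e \<subseteq> VF M \<and> range f \<subseteq> RV0 M}"
  \<comment> \<open>Otherwise the first n formulas of the enumeration would determine
    \<open>\<phi>\<close> on \<open>C\<close>, and a Boolean combination of them would be equivalent
    to it.\<close>
  have "\<exists>M e f N e' f'. (M, e, f) \<in> C \<and> (N, e', f') \<in> C \<and>
    (\<forall>k<n. sat M e f (\<theta> k) \<longleftrightarrow> sat N e' f' (\<theta> k)) \<and> sat M e f \<phi> \<and> \<not> sat N e' f' \<phi>" for n
  proof (rule ccontr)
    assume none: "\<not> ?thesis"
    have H: "sat N e' f' \<phi>" if "(M, e, f) \<in> C" "(N, e', f') \<in> C"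
      "\<forall>\<chi>\<in>set (map \<theta> [0..<n]). sat M e f \<chi> \<longleftrightarrow> sat N e' f' \<chi>" "sat M e f \<phi>" for M e f N e' f'
    proof -
      have "\<forall>k<n. sat M e f (\<theta> k) \<longleftrightarrow> sat N e' f' (\<theta> k)" using that(3) by simp
      then show ?thesis using none that(1,2,4) by blast
    qed
    have "\<exists>\<psi>. qfree \<psi> \<and> fvV \<psi> \<subseteq> fvV \<phi> \<and> fvR \<psi> \<subseteq> fvR \<phi> \<and> (\<forall>(M, e, f)\<in>C. sat M e f \<phi> \<longleftrightarrow> sat M e f \<psi>)"
    proof (rule boolean_combination)
      fix \<chi> assume "\<chi> \<in> set (map \<theta> [0..<n])"
      then have "\<chi> \<in> Q" using \<theta> by auto
      then show "qfree \<chi> \<and> fvV \<chi> \<subseteq> fvV \<phi> \<and> fvR \<chi> \<subseteq> fvR \<phi>" by (simp add: Q_def)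
    qed (rule H)
    then obtain \<psi> where \<psi>: "qfree \<psi>" "fvV \<psi> \<subseteq> fvV \<phi>" "fvR \<psi> \<subseteq> fvR \<phi>"
      "\<And>M e f. (M, e, f) \<in> C \<Longrightarrow> sat M e f \<phi> \<longleftrightarrow> sat M e f \<psi>" by blast
    have "ACVF_dag \<TTurnstile> (\<phi> \<^bold>\<longleftrightarrow> \<psi>)"
      unfolding entails_def holds_def using \<psi>(4) by (auto simp: C_def)
    then show False using neg \<psi>(1-3) by blast
  qed
  then obtain M e f N e' f' where MN: "\<And>n. (M n, e n, f n) \<in> C" "\<And>n. (N n, e' n, f' n) \<in> C"
    "\<And>n k. k < n \<Longrightarrow> sat (M n) (e n) (f n) (\<theta> k) \<longleftrightarrow> sat (N n) (e' n) (f' n) (\<theta> k)"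
    "\<And>n. sat (M n) (e n) (f n) \<phi>" "\<And>n. \<not> sat (N n) (e' n) (f' n) \<phi>" by metis
  have M: "is_model (M n) ACVF_dag" "is_structure (M n)" "e n j \<in> VF (M n)" "f n j \<in> RV0 (M n)" for n j
    using MN(1)[of n] by (auto simp: C_def is_model_def)
  have N: "is_model (N n) ACVF_dag" "is_structure (N n)" "e' n j \<in> VF (N n)" "f' n j \<in> RV0 (N n)" for n j
    using MN(2)[of n] by (auto simp: C_def is_model_def)
  obtain U :: "nat filter" where U: "U \<le> sequentially" "U \<noteq> bot" "\<And>P. eventually P U \<or> eventually (\<lambda>i. \<not> P i) U"
    using free_ultrafilter_exists by blast
  let ?M = "ultraproduct U M" and ?N = "ultraproduct U N"
  let ?e = "\<lambda>j. rep U (\<lambda>i. e i j)" and ?f = "\<lambda>j. rep U (\<lambda>i. f i j)"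
  let ?e' = "\<lambda>j. rep U (\<lambda>i. e' i j)" and ?f' = "\<lambda>j. rep U (\<lambda>i. f' i j)"
  have sat_M: "sat ?M ?e ?f \<chi> \<longleftrightarrow> eventually (\<lambda>i. sat (M i) (e i) (f i) \<chi>) U" for \<chi>
    using los[OF U(2,3) M(2), where E = "\<lambda>j i. e i j" and F = "\<lambda>j i. f i j" and \<phi> = \<chi>] M(3,4) by simp
  have sat_N: "sat ?N ?e' ?f' \<chi> \<longleftrightarrow> eventually (\<lambda>i. sat (N i) (e' i) (f' i) \<chi>) U" for \<chi>
    using los[OF U(2,3) N(2), where E = "\<lambda>j i. e' i j" and F = "\<lambda>j i. f' i j" and \<phi> = \<chi>] N(3,4) by simp
  have "sat ?M ?e ?f \<phi> \<longleftrightarrow> sat ?N ?e' ?f' \<phi>"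
  proof (rule qfree_equivalent)
    show "is_model ?M ACVF_dag" "is_model ?N ACVF_dag"
      by (rule ultraproduct_model[OF U(2,3)], rule M N)+
    show "saturated_struct ?M" "saturated_struct ?N"
      by (rule ultraproduct_saturated[OF U], rule M N)+
    show "range ?e \<subseteq> VF ?M" "range ?f \<subseteq> RV0 ?M" "range ?e' \<subseteq> VF ?N" "range ?f' \<subseteq> RV0 ?N"
      using M(3,4) N(3,4) by auto
    fix \<chi> assume "qfree \<chi>" "fvV \<chi> \<subseteq> fvV \<phi>" "fvR \<chi> \<subseteq> fvR \<phi>"
    then have "\<chi> \<in> range \<theta>" unfolding \<theta> by (simp add: Q_def)
    then obtain k where k: "\<chi> = \<theta> k" by blast
    \<comment> \<open>The two models agree on formula k at all indices above k, and these form a set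
      in \<open>U\<close> because \<open>U\<close> is free.\<close>
    have "eventually (\<lambda>i. k < i) U" using U(1) eventually_gt_at_top[of k] by (auto simp: le_filter_def)
    then have "eventually (\<lambda>i. sat (M i) (e i) (f i) \<chi> \<longleftrightarrow> sat (N i) (e' i) (f' i) \<chi>) U"
      by eventually_elim (use MN(3) k in simp)
    then show "sat ?M ?e ?f \<chi> \<longleftrightarrow> sat ?N ?e' ?f' \<chi>"
      unfolding sat_M sat_N by (rule eventually_subst)
  qed
  then show False using MN(4,5) U(2) unfolding sat_M sat_N by (simp add: trivial_limit_def)
qed

end
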